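(* Let $(X,Y)$ be the solution on $[0,T]$ of the system $$X_t=x_0+\rho B_t+\sqrt{1-\rho^2}\,W_t+\int_0^t h_1(s,X_s,Y_s)\,ds,\qquad Y_t=y_0+B^H_t+\int_0^t h_2(s,X_s,Y_s)\,ds .$$ Then the joint density $p_T(x,y|x_0,y_0)$ of $(X_T,Y_T)$ under $\mathbb P$ has the representation $$p_T(x,y|x_0,y_0)=\phi(x-x_0,y-y_0)\;\tilde{\mathbb E}_{x,y}\!\left[e^{\int_0^T\tilde h_1(t)\,d\tilde W_t-\frac12\int_0^T\tilde h_1^2(t)\,dt+\int_0^T\tilde h_2(t)\,d\tilde B_t-\frac12\int_0^T\tilde h_2^2(t)\,dt}\right],$$ where $\tilde{\mathbb E}_{x,y}[\cdot]=\tilde{\mathbb E}[\,\cdot\,|X_T=x,Y_T=y]$ is the conditional expectation under $\tilde{\mathbb P}$ (under which $X$ is a Brownian motion and $Y$ a fractional Brownian motion, started at $x_0$ and $y_0$) conditioned on the terminal point $(X_T,Y_T)=(x,y)$, and $\phi$ is the bivariate Gaussian density $$\phi(\xi,\eta)=\frac{1}{2\pi T^{H+\frac12}\sqrt{1-\rho^2\kappa_H^2}}\exp\left\{-\frac{1}{2(1-\rho^2\kappa_H^2)}\left[\left(\frac{\xi}{\sqrt T}\right)^2-2\rho\kappa_H\left(\frac{\xi}{\sqrt T}\right)\left(\frac{\eta}{T^H}\right)+\left(\frac{\eta}{T^H}\right)^2\right]\right\},$$ with $\kappa_H=c_H\,\dfrac{B\left(\frac32-H,\,H+\frac12\right)}{H+\frac12}$,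 $B(\cdot,\cdot)$ in this formula being the Beta function.
   Context: Setting. $H\in(0,1)$, $\rho\in(-1,1)$, $(x_0,y_0)\in\mathbb R^2$, $T\in(0,1)$. On a complete filtered probability space $(\Omega,\mathcal F,\mathbb P,\{\mathcal F_t\})$ satisfying the usual conditions, $B$ and $W$ are independent standard Brownian motions, and $B^H_t=\int_0^tK_H(t,s)\,dB_s$ is the fractional Brownian motion of Hurst exponent $H$ generated by $B$, where for $0<s<t$ $$K_H(t,s)=c_H\left[\left(\tfrac ts\right)^{H-\frac12}(t-s)^{H-\frac12}-(H-\tfrac12)s^{\frac12-H}\int_s^tu^{H-\frac32}(u-s)^{H-\frac12}du\right],\quad c_H=\left[\frac{2H\,\Gamma(\frac32-H)}{\Gamma(2-2H)\,\Gamma(H+\frac12)}\right]^{1/2},$$ and $K_H(t,s)=0$ for $s\ge t$. Standing assumption on the drifts. $h_1,h_2:[0,T]\times\mathbb R^2\to\mathbb R$ are deterministic (Borel measurable) functions such that, for some constant $L>0$: (a) $|h_i(t,x_1,y_1)-h_i(t,x_2,y_2)|\le L(|x_1-x_2|+|y_1-y_2|)$ for $i=1,2$, all $t\in[0,T]$ and all $(x_1,y_1),(x_2,y_2)\in\mathbb R^2$; (b) if $H>\frac12$: $|h_1(t,0,0)|\le L$ for all $t\in[0,T]$, and for some $\gamma\in(H-\frac12,\frac12)$, $|h_2(t,x,y)-h_2(s,x,y)|\le L|t-s|^\gamma$ for all $s,t\in[0,T]$, $(x,y)\in\mathbb R^2$; if $H\le\frac12$: $|h_i(t,0,0)|\le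 L$ for all $t\in[0,T]$, $i=1,2$. The adapted processes $\tilde h_1,\tilde h_2$ (with paths in $L^2([0,T])$) are determined by $$\int_0^tK_H(t,s)\tilde h_2(s)\,ds=\int_0^th_2(s,X_s,Y_s)\,ds,\qquad \rho\,\tilde h_2(t)+\sqrt{1-\rho^2}\,\tilde h_1(t)=h_1(t,X_t,Y_t).$$ $T$ is assumed small enough that the system has a unique solution on $[0,T]$ with continuous paths and Novikov's condition $\mathbb E[\exp\{\frac12\int_0^T(\tilde h_1^2+\tilde h_2^2)\,dt\}]<\infty$ holds. The probability measure $\tilde{\mathbb P}$ is defined by $$\frac{d\tilde{\mathbb P}}{d\mathbb P}=\exp\left\{-\int_0^T\tilde h_1\,dW_t-\frac12\int_0^T\tilde h_1^2\,dt-\int_0^T\tilde h_2\,dB_t-\frac12\int_0^T\tilde h_2^2\,dt\right\},$$ $\tilde{\mathbb E}$ is its expectation, and $\tilde W_t=W_t+\int_0^t\tilde h_1(s)ds$, $\tilde B_t=B_t+\int_0^t\tilde h_2(s)ds$. Densities and conditional expectations given $(X_T,Y_T)=(x,y)$ are, as usual, determined up to Lebesgue-null sets of $(x,y)$. *)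

theory Defs
  imports "HOL-Probability.Probability"
begin

section \<open>Filtrations and Brownian motion on a finite time interval\<close>

text \<open>
  Time runs through \<open>{0..T}\<close>; the values of families \<open>F\<close>, \<open>W\<close>, \<open>X\<close>, ... at other real
  times are never used. Of the measures \<open>F t\<close> only the \<open>\<sigma>\<close>-algebras matter.
\<close>

definition usual_filtration :: "'a measure \<Rightarrow> (real \<Rightarrow> 'a measure) \<Rightarrow> real \<Rightarrow> bool" where
  "usual_filtration M F T \<longleftrightarrow>
     (\<forall>t\<in>{0..T}. subalgebra M (F t)) \<and>
     (\<forall>s t. 0 \<le> s \<and> s \<le> t \<and> t \<le> T \<longrightarrow> sets (F s) \<subseteq> sets (F t)) \<and>
     null_sets M \<subseteq> sets (F 0) \<and>
     (\<forall>t\<in>{0..<T}. sets (F t) = (\<Inter>u\<in>{t<..T}. sets (F u)))"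

definition adapted :: "(real \<Rightarrow> 'a measure) \<Rightarrow> real \<Rightarrow> (real \<Rightarrow> 'a \<Rightarrow> real) \<Rightarrow> bool" where
  "adapted F T X \<longleftrightarrow> (\<forall>t\<in>{0..T}. X t \<in> borel_measurable (F t))"

definition progressively_measurable ::
    "(real \<Rightarrow> 'a measure) \<Rightarrow> real \<Rightarrow> (real \<Rightarrow> 'a \<Rightarrow> real) \<Rightarrow> bool" where
  "progressively_measurable F T f \<longleftrightarrow>
     (\<forall>t\<in>{0..T}. (\<lambda>(s, \<omega>). f s \<omega>) \<in> borel_measurable (restrict_space borel {0..t} \<Otimes>\<^sub>M F t))"

definition continuous_paths :: "'a measure \<Rightarrow> real \<Rightarrow> (real \<Rightarrow> 'a \<Rightarrow> real) \<Rightarrow> bool" where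
  "continuous_paths M T X \<longleftrightarrow> (AE \<omega> in M. continuous_on {0..T} (\<lambda>t. X t \<omega>))"

definition brownian_motion ::
    "'a measure \<Rightarrow> (real \<Rightarrow> 'a measure) \<Rightarrow> real \<Rightarrow> (real \<Rightarrow> 'a \<Rightarrow> real) \<Rightarrow> bool" where
  "brownian_motion M F T W \<longleftrightarrow>
     adapted F T W \<and> continuous_paths M T W \<and> (AE \<omega> in M. W 0 \<omega> = 0) \<and>
     (\<forall>s t. 0 \<le> s \<and> s < t \<and> t \<le> T \<longrightarrow>
        distributed M lborel (\<lambda>\<omega>. W t \<omega> - W s \<omega>) (normal_density 0 (sqrt (t - s))) \<and>
        prob_space.indep_set M (sets (F s))
          (sets (vimage_algebra (space M) (\<lambda>\<omega>. W t \<omega> - W s \<omega>) borel)))"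

definition independent_processes ::
    "'a measure \<Rightarrow> real \<Rightarrow> (real \<Rightarrow> 'a \<Rightarrow> real) \<Rightarrow> (real \<Rightarrow> 'a \<Rightarrow> real) \<Rightarrow> bool" where
  "independent_processes M T B W \<longleftrightarrow>
     prob_space.indep_var M
       (Pi\<^sub>M {0..T} (\<lambda>_. borel)) (\<lambda>\<omega>. \<lambda>t\<in>{0..T}. B t \<omega>)
       (Pi\<^sub>M {0..T} (\<lambda>_. borel)) (\<lambda>\<omega>. \<lambda>t\<in>{0..T}. W t \<omega>)"

section \<open>The Ito integral\<close>

text \<open>
  The data \<open>n\<close>, \<open>\<tau>\<close>, \<open>\<xi>\<close> encode the simple process that equals the bounded,
  \<open>F (\<tau> i)\<close>-measurable random variable \<open>\<xi> i\<close> on \<open>(\<tau> i, \<tau> (i+1)]\<close> for \<open>i < n\<close>.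
  For \<open>T = 0\<close> the only partition is \<open>n = 0\<close>.
\<close>

definition simple_integrand ::
    "(real \<Rightarrow> 'a measure) \<Rightarrow> real \<Rightarrow> nat \<Rightarrow> (nat \<Rightarrow> real) \<Rightarrow> (nat \<Rightarrow> 'a \<Rightarrow> real) \<Rightarrow> bool" where
  "simple_integrand F T n \<tau> \<xi> \<longleftrightarrow>
     \<tau> 0 = 0 \<and> \<tau> n = T \<and> (\<forall>i<n. \<tau> i < \<tau> (Suc i)) \<and>
     (\<forall>i<n. \<xi> i \<in> borel_measurable (F (\<tau> i)) \<and> (\<exists>C. \<forall>\<omega>\<in>space (F (\<tau> i)). \<bar>\<xi> i \<omega>\<bar> \<le> C))"

definition simple_process ::
    "nat \<Rightarrow> (nat \<Rightarrow> real) \<Rightarrow> (nat \<Rightarrow> 'a \<Rightarrow> real) \<Rightarrow> real \<Rightarrow> 'a \<Rightarrow> real" where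
  "simple_process n \<tau> \<xi> t \<omega> = (\<Sum>i<n. \<xi> i \<omega> * indicator {\<tau> i<..\<tau> (Suc i)} t)"

definition simple_ito_integral ::
    "(real \<Rightarrow> 'a \<Rightarrow> real) \<Rightarrow> nat \<Rightarrow> (nat \<Rightarrow> real) \<Rightarrow> (nat \<Rightarrow> 'a \<Rightarrow> real) \<Rightarrow> 'a \<Rightarrow> real" where
  "simple_ito_integral W n \<tau> \<xi> \<omega> = (\<Sum>i<n. \<xi> i \<omega> * (W (\<tau> (Suc i)) \<omega> - W (\<tau> i) \<omega>))"

text \<open>
  \<open>I\<close> is a version of \<open>\<integral>\<^sub>0\<^sup>T f dW\<close>: there are simple processes \<open>\<phi>\<^sub>k\<close> with
  \<open>\<integral>\<^sub>0\<^sup>T (\<phi>\<^sub>k - f)\<^sup>2 dt \<rightarrow> 0\<close> and \<open>\<integral>\<^sub>0\<^sup>T \<phi>\<^sub>k dW \<rightarrow> I\<close>, both in probability. The time integral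
  is an extended nonnegative one, so that it is infinite (and not \<open>0\<close>) on paths that are not
  square integrable.
\<close>

definition has_ito_integral ::
    "'a measure \<Rightarrow> (real \<Rightarrow> 'a measure) \<Rightarrow> (real \<Rightarrow> 'a \<Rightarrow> real) \<Rightarrow> real \<Rightarrow>
     (real \<Rightarrow> 'a \<Rightarrow> real) \<Rightarrow> ('a \<Rightarrow> real) \<Rightarrow> bool" where
  "has_ito_integral M F W T f I \<longleftrightarrow>
     progressively_measurable F T f \<and> I \<in> borel_measurable M \<and>
     (\<exists>n \<tau> \<xi>.
        (\<forall>k. simple_integrand F T (n k) (\<tau> k) (\<xi> k)) \<and>
        (\<forall>\<epsilon>>0. (\<lambda>k. measure M {\<omega> \<in> space M.
            (\<integral>\<^sup>+t\<in>{0..T}. ennreal ((simple_process (n k) (\<tau> k) (\<xi> k) t \<omega> - f t \<omega>)\<^sup>2) \<partial>lborel)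
              > ennreal \<epsilon>}) \<longlonglongrightarrow> 0) \<and>
        (\<forall>\<epsilon>>0. (\<lambda>k. measure M {\<omega> \<in> space M.
            \<bar>simple_ito_integral W (n k) (\<tau> k) (\<xi> k) \<omega> - I \<omega>\<bar> > \<epsilon>}) \<longlonglongrightarrow> 0))"

definition ito_integral ::
    "'a measure \<Rightarrow> (real \<Rightarrow> 'a measure) \<Rightarrow> (real \<Rightarrow> 'a \<Rightarrow> real) \<Rightarrow> real \<Rightarrow>
     (real \<Rightarrow> 'a \<Rightarrow> real) \<Rightarrow> 'a \<Rightarrow> real" where
  "ito_integral M F W T f = (SOME I. has_ito_integral M F W T f I)"

section \<open>Fractional Brownian motion\<close>

definition c_const :: "real \<Rightarrow> real" where
  "c_const H = sqrt (2 * H * Gamma (3/2 - H) / (Gamma (2 - 2 * H) * Gamma (H + 1/2)))"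

definition K_kernel :: "real \<Rightarrow> real \<Rightarrow> real \<Rightarrow> real" where
  "K_kernel H t s =
     (if 0 < s \<and> s < t then
        c_const H *
          ((t / s) powr (H - 1/2) * (t - s) powr (H - 1/2)
           - (H - 1/2) * s powr (1/2 - H) *
             (LBINT u:{s..t}. u powr (H - 3/2) * (u - s) powr (H - 1/2)))
      else 0)"

definition fbm_generated_by ::
    "'a measure \<Rightarrow> (real \<Rightarrow> 'a measure) \<Rightarrow> real \<Rightarrow> real \<Rightarrow>
     (real \<Rightarrow> 'a \<Rightarrow> real) \<Rightarrow> (real \<Rightarrow> 'a \<Rightarrow> real) \<Rightarrow> bool" where
  "fbm_generated_by M F H T B BH \<longleftrightarrow>
     continuous_paths M T BH \<and>
     (\<forall>t\<in>{0..T}. AE \<omega> in M. BH t \<omega> = ito_integral M F B t (\<lambda>s _. K_kernel H t s) \<omega>)"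

definition fractional_brownian_motion ::
    "'a measure \<Rightarrow> (real \<Rightarrow> 'a measure) \<Rightarrow> real \<Rightarrow> real \<Rightarrow> (real \<Rightarrow> 'a \<Rightarrow> real) \<Rightarrow> bool" where
  "fractional_brownian_motion M F H T Y \<longleftrightarrow>
     (\<exists>B. brownian_motion M F T B \<and> fbm_generated_by M F H T B Y)"

section \<open>The system\<close>

definition drift_assumption ::
    "real \<Rightarrow> real \<Rightarrow> (real \<Rightarrow> real \<Rightarrow> real \<Rightarrow> real) \<Rightarrow> (real \<Rightarrow> real \<Rightarrow> real \<Rightarrow> real) \<Rightarrow> bool" where
  "drift_assumption H T h1 h2 \<longleftrightarrow>
     (\<forall>h\<in>{h1, h2}. (\<lambda>(t, x, y). h t x y) \<in> borel_measurable (restrict_space borel ({0..T} \<times> UNIV))) \<and>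
     (\<exists>L>0.
        (\<forall>h\<in>{h1, h2}. \<forall>t\<in>{0..T}. \<forall>x1 y1 x2 y2.
           \<bar>h t x1 y1 - h t x2 y2\<bar> \<le> L * (\<bar>x1 - x2\<bar> + \<bar>y1 - y2\<bar>)) \<and>
        (if H > 1/2 then
           (\<forall>t\<in>{0..T}. \<bar>h1 t 0 0\<bar> \<le> L) \<and>
           (\<exists>\<gamma>. H - 1/2 < \<gamma> \<and> \<gamma> < 1/2 \<and>
              (\<forall>s\<in>{0..T}. \<forall>t\<in>{0..T}. \<forall>x y. \<bar>h2 t x y - h2 s x y\<bar> \<le> L * \<bar>t - s\<bar> powr \<gamma>))
         else (\<forall>h\<in>{h1, h2}. \<forall>t\<in>{0..T}. \<bar>h t 0 0\<bar> \<le> L)))"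

definition sde_solution ::
    "'a measure \<Rightarrow> (real \<Rightarrow> 'a measure) \<Rightarrow> real \<Rightarrow> real \<Rightarrow> real \<Rightarrow> real \<Rightarrow>
     (real \<Rightarrow> real \<Rightarrow> real \<Rightarrow> real) \<Rightarrow> (real \<Rightarrow> real \<Rightarrow> real \<Rightarrow> real) \<Rightarrow>
     (real \<Rightarrow> 'a \<Rightarrow> real) \<Rightarrow> (real \<Rightarrow> 'a \<Rightarrow> real) \<Rightarrow> (real \<Rightarrow> 'a \<Rightarrow> real) \<Rightarrow>
     (real \<Rightarrow> 'a \<Rightarrow> real) \<Rightarrow> (real \<Rightarrow> 'a \<Rightarrow> real) \<Rightarrow> bool" where
  "sde_solution M F T \<rho> x0 y0 h1 h2 B W BH X Y \<longleftrightarrow>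
     adapted F T X \<and> adapted F T Y \<and> continuous_paths M T X \<and> continuous_paths M T Y \<and>
     (AE \<omega> in M. \<forall>t\<in>{0..T}.
        X t \<omega> = x0 + \<rho> * B t \<omega> + sqrt (1 - \<rho>\<^sup>2) * W t \<omega> + (LBINT s:{0..t}. h1 s (X s \<omega>) (Y s \<omega>)) \<and>
        Y t \<omega> = y0 + BH t \<omega> + (LBINT s:{0..t}. h2 s (X s \<omega>) (Y s \<omega>)))"

definition unique_sde_solution ::
    "'a measure \<Rightarrow> (real \<Rightarrow> 'a measure) \<Rightarrow> real \<Rightarrow> real \<Rightarrow> real \<Rightarrow> real \<Rightarrow>
     (real \<Rightarrow> real \<Rightarrow> real \<Rightarrow> real) \<Rightarrow> (real \<Rightarrow> real \<Rightarrow> real \<Rightarrow> real) \<Rightarrow>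
     (real \<Rightarrow> 'a \<Rightarrow> real) \<Rightarrow> (real \<Rightarrow> 'a \<Rightarrow> real) \<Rightarrow> (real \<Rightarrow> 'a \<Rightarrow> real) \<Rightarrow>
     (real \<Rightarrow> 'a \<Rightarrow> real) \<Rightarrow> (real \<Rightarrow> 'a \<Rightarrow> real) \<Rightarrow> bool" where
  "unique_sde_solution M F T \<rho> x0 y0 h1 h2 B W BH X Y \<longleftrightarrow>
     sde_solution M F T \<rho> x0 y0 h1 h2 B W BH X Y \<and>
     (\<forall>X' Y'. sde_solution M F T \<rho> x0 y0 h1 h2 B W BH X' Y' \<longrightarrow>
        (AE \<omega> in M. \<forall>t\<in>{0..T}. X' t \<omega> = X t \<omega> \<and> Y' t \<omega> = Y t \<omega>))"

definition L2_process ::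
    "'a measure \<Rightarrow> (real \<Rightarrow> 'a measure) \<Rightarrow> real \<Rightarrow> (real \<Rightarrow> 'a \<Rightarrow> real) \<Rightarrow> bool" where
  "L2_process M F T f \<longleftrightarrow>
     progressively_measurable F T f \<and>
     (AE \<omega> in M. set_integrable lborel {0..T} (\<lambda>t. (f t \<omega>)\<^sup>2))"

text \<open>
  The equations fix \<open>g1\<close> and \<open>g2\<close> (the processes \<open>h\<^sub>1\<close> and \<open>h\<^sub>2\<close> with a tilde) only up to
  \<open>dt \<otimes> M\<close>-null sets, hence the second one is required for almost every \<open>t\<close>.
\<close>

definition tilde_drifts ::
    "'a measure \<Rightarrow> (real \<Rightarrow> 'a measure) \<Rightarrow> real \<Rightarrow> real \<Rightarrow> real \<Rightarrow>
     (real \<Rightarrow> real \<Rightarrow> real \<Rightarrow> real) \<Rightarrow> (real \<Rightarrow> real \<Rightarrow> real \<Rightarrow> real) \<Rightarrow>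
     (real \<Rightarrow> 'a \<Rightarrow> real) \<Rightarrow> (real \<Rightarrow> 'a \<Rightarrow> real) \<Rightarrow>
     (real \<Rightarrow> 'a \<Rightarrow> real) \<Rightarrow> (real \<Rightarrow> 'a \<Rightarrow> real) \<Rightarrow> bool" where
  "tilde_drifts M F H T \<rho> h1 h2 X Y g1 g2 \<longleftrightarrow>
     L2_process M F T g1 \<and> L2_process M F T g2 \<and>
     (AE \<omega> in M. \<forall>t\<in>{0..T}.
        (LBINT s:{0..t}. K_kernel H t s * g2 s \<omega>) = (LBINT s:{0..t}. h2 s (X s \<omega>) (Y s \<omega>))) \<and>
     (AE \<omega> in M. AE t in lborel. t \<in> {0..T} \<longrightarrow>
        \<rho> * g2 t \<omega> + sqrt (1 - \<rho>\<^sup>2) * g1 t \<omega> = h1 t (X t \<omega>) (Y t \<omega>))"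

definition novikov ::
    "'a measure \<Rightarrow> real \<Rightarrow> (real \<Rightarrow> 'a \<Rightarrow> real) \<Rightarrow> (real \<Rightarrow> 'a \<Rightarrow> real) \<Rightarrow> bool" where
  "novikov M T g1 g2 \<longleftrightarrow>
     integrable M (\<lambda>\<omega>. exp (1/2 * (LBINT t:{0..T}. (g1 t \<omega>)\<^sup>2 + (g2 t \<omega>)\<^sup>2)))"

definition tilde_measure ::
    "'a measure \<Rightarrow> (real \<Rightarrow> 'a measure) \<Rightarrow> real \<Rightarrow> (real \<Rightarrow> 'a \<Rightarrow> real) \<Rightarrow> (real \<Rightarrow> 'a \<Rightarrow> real) \<Rightarrow>
     (real \<Rightarrow> 'a \<Rightarrow> real) \<Rightarrow> (real \<Rightarrow> 'a \<Rightarrow> real) \<Rightarrow> 'a measure" where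
  "tilde_measure M F T B W g1 g2 =
     density M (\<lambda>\<omega>. ennreal (exp
       (- ito_integral M F W T g1 \<omega> - 1/2 * (LBINT t:{0..T}. (g1 t \<omega>)\<^sup>2)
        - ito_integral M F B T g2 \<omega> - 1/2 * (LBINT t:{0..T}. (g2 t \<omega>)\<^sup>2))))"

definition drift_shift ::
    "(real \<Rightarrow> 'a \<Rightarrow> real) \<Rightarrow> (real \<Rightarrow> 'a \<Rightarrow> real) \<Rightarrow> real \<Rightarrow> 'a \<Rightarrow> real" where
  "drift_shift W g t \<omega> = W t \<omega> + (LBINT s:{0..t}. g s \<omega>)"

section \<open>Conditional expectation given the value of a random variable\<close>

text \<open>
  \<open>cond_exp_given P N V Z v\<close> is \<open>E\<^sub>P[Z | V = v]\<close>: the factorisation through \<open>V\<close> of the conditional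
  expectation of \<open>Z\<close> given \<open>\<sigma>(V)\<close>, determined up to null sets of the law of \<open>V\<close>.
\<close>

definition cond_exp_given ::
    "'a measure \<Rightarrow> 'b measure \<Rightarrow> ('a \<Rightarrow> 'b) \<Rightarrow> ('a \<Rightarrow> real) \<Rightarrow> 'b \<Rightarrow> real" where
  "cond_exp_given P N V Z =
     (SOME g. g \<in> borel_measurable N \<and>
        (AE \<omega> in P. real_cond_exp P (vimage_algebra (space P) V N) Z \<omega> = g (V \<omega>)))"

section \<open>The Gaussian density\<close>

definition kappa_const :: "real \<Rightarrow> real" where
  "kappa_const H = c_const H * (Beta (3/2 - H) (H + 1/2) / (H + 1/2))"

definition phi_density :: "real \<Rightarrow> real \<Rightarrow> real \<Rightarrow> real \<Rightarrow> real \<Rightarrow> real" where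
  "phi_density H \<rho> T \<xi> \<eta> =
     1 / (2 * pi * T powr (H + 1/2) * sqrt (1 - \<rho>\<^sup>2 * (kappa_const H)\<^sup>2)) *
     exp (- 1 / (2 * (1 - \<rho>\<^sup>2 * (kappa_const H)\<^sup>2)) *
       ((\<xi> / sqrt T)\<^sup>2
        - 2 * \<rho> * kappa_const H * (\<xi> / sqrt T) * (\<eta> / T powr H)
        + (\<eta> / T powr H)\<^sup>2))"

end

theory Submission
  imports Defs "HOL-Real_Asymp.Real_Asymp"
begin

text \<open>
  Under the measure \<open>Q\<close> with density \<open>exp (- \<integral> ht1 dW - 1/2 \<integral> ht1\<^sup>2 dt - \<integral> ht2 dB - 1/2 \<integral> ht2\<^sup>2 dt)\<close>
  the shifted processes \<open>W + \<integral> ht1\<close> and \<open>B + \<integral> ht2\<close> are independent Brownian motions. In terms of these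
  the system loses its drift: \<open>X - x0\<close> is a combination of the two with coefficients \<open>sqrt (1 - \<rho>\<^sup>2)\<close> and
  \<open>\<rho>\<close>, and \<open>Y - y0\<close> is the fractional Brownian motion generated by \<open>B + \<integral> ht2\<close>, because \<open>ht2\<close> was
  chosen so that its integral against the Volterra kernel reproduces the drift of \<open>Y\<close>. Hence
  \<open>(X T - x0, Y T - y0)\<close> is a centred Gaussian vector under \<open>Q\<close>, with variances \<open>T\<close> and \<open>T powr (2 * H)\<close>
  and covariance \<open>\<rho> * kappa_const H * T powr (H + 1/2)\<close>, which gives the density \<open>\<phi>\<close>. Since
  \<open>dM/dQ\<close> is the reciprocal \<open>Z\<close> of the density above, the law of the terminal point under \<open>M\<close> has, with
  respect to its law under \<open>Q\<close>, the density \<open>E\<^sub>Q[Z | X T = x, Y T = y]\<close>, and the formula follows.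

  The whole Gaussian structure under \<open>Q\<close> is extracted from a single identity (\<open>master_identity\<close>):
  for square integrable deterministic \<open>a\<close> and \<open>b\<close> vanishing before time \<open>s\<close>, the variable
  \<open>\<integral> a (dW + ht1 dt) + \<integral> b (dB + ht2 dt)\<close> is under \<open>Q\<close> independent of \<open>F s\<close> and normal with
  variance \<open>\<integral> a\<^sup>2 + b\<^sup>2\<close>, stated through characteristic functions. It replaces Levy's
  characterisation and Ito's formula. For step integrands it holds by conditioning on one cell after
  the other, where it reduces to a completed square for a pair of standard normal variables
  (\<open>exponential_step\<close>). The general case is a limit; the passage to it needs that the
  discrete densities converge in mean, which is Novikov's criterion (\<open>exponential_limit_one\<close>).

  Two further points are not formal. That \<open>W\<close> and \<open>B\<close>, each a Brownian motion for the common filtration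
  and independent of each other as processes, have increments that are jointly independent of the
  past of the filtration is itself a theorem (\<open>bm_pair_gaussian_step\<close>). And the constant in the
  kernel must be matched with the variance and the covariance (\<open>K_kernel_integrals\<close>): this amounts to two
  integrals of the kernel over \<open>{0..t}\<close> in terms of Beta functions.
\<close>

section \<open>Laws from weighted characteristic functions\<close>

text \<open>
  Levy's uniqueness theorem, applied to the probability measure with density \<open>Y / c\<close>. The weight lets one
  lemma cover both a change of measure and the restriction to an event.
\<close>

lemma weighted_char_determines_law:
  fixes Y U :: "'a => real"
  assumes Y: "integrable M Y" "\<And>x. 0 <= Y x" and [measurable]: "U \<in> borel_measurable M"
    and ch: "\<And>\<theta>. (CLINT x|M. Y x * iexp (\<theta> * U x)) = complex_of_real (c * exp (-(\<theta>\<^sup>2)/2))"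
    and C: "C \<in> sets borel"
  shows "(LINT x|M. Y x * indicator C (U x)) = c * measure std_normal_distribution C"
proof -
  have [measurable]: "Y \<in> borel_measurable M" using Y by auto
  have c: "(LINT x|M. Y x) = c"
  proof -
    have "complex_of_real (LINT x|M. Y x) = complex_of_real c"
      using ch[of 0] by simp
    thus ?thesis using of_real_eq_iff by blast
  qed
  show ?thesis
  proof (cases "c = 0")
    case True
    hence "AE x in M. Y x = 0" using integral_nonneg_eq_0_iff_AE[OF Y(1)] Y(2) c by simp
    hence "(LINT x|M. Y x * indicator C (U x)) = (LINT x|M. 0)"
      using C by (intro integral_cong_AE) auto
    thus ?thesis using True by simp
  next
    case False
    have cpos: "c > 0" using False c Y(2) Bochner_Integration.integral_nonneg[of M Y] by simp
    let ?Q = "density M (\<lambda>x. ennreal (Y x / c))"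
    have "emeasure ?Q (space ?Q) = (\<integral>\<^sup>+ x. ennreal (Y x / c) \<partial>M)"
      by (subst emeasure_density) (auto intro!: nn_integral_cong simp: indicator_def)
    also have "\<dots> = ennreal (LINT x|M. Y x / c)"
      using Y cpos by (intro nn_integral_eq_integral) auto
    also have "\<dots> = 1" using c cpos by simp
    finally interpret Q: prob_space ?Q by (rule prob_spaceI)
    have U: "U \<in> borel_measurable ?Q" by simp
    let ?D = "distr ?Q borel U"
    interpret D: prob_space ?D by (rule Q.prob_space_distr) simp
    interpret RD: real_distribution ?D by (intro real_distribution.intro real_distribution_axioms.intro D.prob_space_axioms) auto
    have "char ?D = char std_normal_distribution"
    proof (rule ext)
      fix t
      have "char ?D t = (CLINT x|?Q. iexp (t * U x))"
        unfolding char_def by (subst integral_distr) auto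
      also have "\<dots> = (CLINT x|M. (Y x / c) *\<^sub>R iexp (t * U x))"
        using cpos Y by (subst integral_density) auto
      also have "\<dots> = (CLINT x|M. (Y x * iexp (t * U x)) / c)"
        by (intro Bochner_Integration.integral_cong refl) (simp add: scaleR_conv_of_real)
      also have "\<dots> = complex_of_real (exp (-(t\<^sup>2)/2))"
        using cpos by (subst integral_divide_zero) (simp only: ch, simp)
      finally show "char ?D t = char std_normal_distribution t"
        by (simp add: char_std_normal_distribution)
    qed
    hence eq: "?D = std_normal_distribution"
      by (intro Levy_uniqueness RD.real_distribution_axioms real_dist_normal_dist)
    have "measure std_normal_distribution C = measure ?D C" by (simp add: eq)
    also have "\<dots> = (LINT x|?D. indicator C x)" using C by simp
    also have "\<dots> = (LINT x|?Q. indicator C (U x))"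
      using C by (subst integral_distr) auto
    also have "\<dots> = (LINT x|M. (Y x / c) *\<^sub>R indicator C (U x))"
      using cpos Y C by (subst integral_density) auto
    also have "\<dots> = (LINT x|M. Y x * indicator C (U x)) / c"
      by (subst integral_divide_zero[symmetric]) (auto intro!: Bochner_Integration.integral_cong)
    finally show ?thesis using cpos by (simp add: field_simps)
  qed
qed

lemma integrable_mult_bounded:
  fixes f :: "'a => 'b::{banach, second_countable_topology, real_normed_algebra}"
  assumes "integrable M f" "g \<in> borel_measurable M" "\<And>x. x \<in> space M ==> norm (g x) <= K"
  shows "integrable M (\<lambda>x. f x * g x)"
proof (rule Bochner_Integration.integrable_bound[where f="\<lambda>x. K *\<^sub>R f x"])
  show "AE x in M. norm (f x * g x) <= norm (K *\<^sub>R f x)"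
  proof (rule AE_I2)
    fix x assume "x \<in> space M"
    hence "norm (f x * g x) <= norm (f x) * K"
      by (meson assms(3) mult_left_mono norm_ge_zero norm_mult_ineq order_trans)
    also have "\<dots> <= norm (K *\<^sub>R f x)" by (simp add: mult.commute mult_mono)
    finally show "norm (f x * g x) <= norm (K *\<^sub>R f x)" .
  qed
qed (use assms in auto)

lemma integrable_real_mult_complex:
  fixes f :: "'a => real"
  assumes "integrable M f" "g \<in> borel_measurable M" "\<And>x. x \<in> space M ==> norm (g x) <= K"
  shows "integrable M (\<lambda>x. complex_of_real (f x) * g x)"
  using assms by (intro integrable_mult_bounded[where K=K]) auto

text \<open>
  The weights \<open>Y * (1 + cos (b * V))\<close> and \<open>Y * (1 + sin (b * V))\<close> are nonnegative, so \<open>weighted_char_determines_law\<close>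
  applies to \<open>U\<close> and gives the characteristic function of \<open>V\<close> on each event \<open>U \<in> C\<close>. A second application, to \<open>V\<close>
  with weight \<open>Y\<close> times the indicator of this event, gives the joint law, and no uniqueness theorem in the
  plane is needed.
\<close>

lemma joint_char_determines_law:
  fixes Y U V :: "'a => real"
  assumes Y: "integrable M Y" "\<And>x. 0 <= Y x"
    and [measurable]: "U \<in> borel_measurable M" "V \<in> borel_measurable M"
    and ch: "\<And>a b. (CLINT x|M. Y x * iexp (a * U x + b * V x)) = complex_of_real (exp (-(a\<^sup>2 + b\<^sup>2)/2))"
  shows "distr (density M (\<lambda>x. ennreal (Y x))) (borel \<Otimes>\<^sub>M borel) (\<lambda>x. (U x, V x))
          = std_normal_distribution \<Otimes>\<^sub>M std_normal_distribution"
proof -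
  let ?N = std_normal_distribution
  interpret N: prob_space ?N using real_dist_normal_dist unfolding real_distribution_def by auto
  have [measurable]: "Y \<in> borel_measurable M" using Y by auto
  have int: "integrable M (\<lambda>x. complex_of_real (Y x) * iexp (a * U x + b * V x))" for a b
    using Y by (intro integrable_real_mult_complex[where K=1]) auto
  have hb: "has_bochner_integral M (\<lambda>x. complex_of_real (Y x) * iexp (a * U x + b * V x)) (complex_of_real (exp (-(a\<^sup>2 + b\<^sup>2)/2)))" for a b
    using int ch by (simp only: has_bochner_integral_iff)
  have cosC: "(LINT x|M. (Y x * (1 + cos (b * V x))) * indicator C (U x))
      = (1 + exp (-(b\<^sup>2)/2)) * measure ?N C" if C: "C \<in> sets borel" for b C
  proof (rule weighted_char_determines_law[OF _ _ _ _ C])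
    show "integrable M (\<lambda>x. Y x * (1 + cos (b * V x)))"
      using Y abs_cos_le_one by (intro integrable_mult_bounded[where K=2]) (auto intro: order_trans[OF abs_triangle_ineq])
    show "0 <= Y x * (1 + cos (b * V x))" for x
      using Y(2)[of x] cos_ge_minus_one[of "b * V x"] by (intro mult_nonneg_nonneg) linarith+
    fix a
    have *: "complex_of_real (Y x * (1 + cos (b * V x))) * iexp (a * U x)
       = Y x * iexp (a * U x + 0 * V x) + (1/2) * (Y x * iexp (a * U x + b * V x)) + (1/2) * (Y x * iexp (a * U x + (-b) * V x))" for x
      by (simp add: cos_of_real cos_exp_eq exp_add exp_minus[symmetric] algebra_simps flip: cos_of_real)
         (simp add: mult_exp_exp)
    show "(CLINT x|M. complex_of_real (Y x * (1 + cos (b * V x))) * iexp (a * U x)) =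
         complex_of_real ((1 + exp (- (b\<^sup>2) / 2)) * exp (-(a\<^sup>2)/2))"
      unfolding * using has_bochner_integral_integral_eq[OF has_bochner_integral_add[OF has_bochner_integral_add[OF hb[of a 0]
        has_bochner_integral_mult_right[OF hb[of a b], of "1/2"]] has_bochner_integral_mult_right[OF hb[of a "-b"], of "1/2"]]]
      by (simp add: exp_add[symmetric] add_divide_distrib diff_divide_distrib algebra_simps flip: of_real_mult of_real_add)
  qed simp
  have sinC: "(LINT x|M. (Y x * (1 + sin (b * V x))) * indicator C (U x))
      = 1 * measure ?N C" if C: "C \<in> sets borel" for b C
  proof (rule weighted_char_determines_law[OF _ _ _ _ C])
    show "integrable M (\<lambda>x. Y x * (1 + sin (b * V x)))"
      using Y abs_sin_le_one by (intro integrable_mult_bounded[where K=2]) (auto intro: order_trans[OF abs_triangle_ineq])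
    show "0 <= Y x * (1 + sin (b * V x))" for x
      using Y(2)[of x] sin_ge_minus_one[of "b * V x"] by (intro mult_nonneg_nonneg) linarith+
    fix a
    have *: "complex_of_real (Y x * (1 + sin (b * V x))) * iexp (a * U x)
       = Y x * iexp (a * U x + 0 * V x) + (1/(2*\<i>)) * (Y x * iexp (a * U x + b * V x)) - (1/(2*\<i>)) * (Y x * iexp (a * U x + (-b) * V x))" for x
      by (simp add: sin_exp_eq exp_add exp_minus[symmetric] field_simps flip: sin_of_real)
         (simp add: mult_exp_exp)?
    show "(CLINT x|M. complex_of_real (Y x * (1 + sin (b * V x))) * iexp (a * U x)) =
         complex_of_real (1 * exp (-(a\<^sup>2)/2))"
      unfolding * using has_bochner_integral_integral_eq[OF has_bochner_integral_diff[OF has_bochner_integral_add[OF hb[of a 0]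
        has_bochner_integral_mult_right[OF hb[of a b], of "1/(2*\<i>)"]] has_bochner_integral_mult_right[OF hb[of a "-b"], of "1/(2*\<i>)"]]]
      by simp
  qed simp
  have YC: "integrable M (\<lambda>x. Y x * indicator C (U x))" if "C \<in> sets borel" for C
    using Y that by (intro integrable_mult_bounded[where K=1]) (auto simp: indicator_def)
  have one: "(LINT x|M. Y x * indicator C (U x)) = measure ?N C" if C: "C \<in> sets borel" for C
    using sinC[OF C, of 0] by simp
  have both: "(LINT x|M. (Y x * indicator C (U x)) * indicator D (V x)) = measure ?N C * measure ?N D"
    if C: "C \<in> sets borel" and D: "D \<in> sets borel" for C D
  proof (rule weighted_char_determines_law[OF YC[OF C] _ _ _ D])
    show "0 <= Y x * indicator C (U x)" for x using Y(2) by (auto simp: indicator_def)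
    fix b
    have ic: "integrable M (\<lambda>x. (Y x * indicator C (U x)) * cos (b * V x))"
      using YC[OF C] by (rule integrable_mult_bounded[where K=1]) auto
    have isn: "integrable M (\<lambda>x. (Y x * indicator C (U x)) * sin (b * V x))"
      using YC[OF C] by (rule integrable_mult_bounded[where K=1]) auto
    have c: "(LINT x|M. (Y x * indicator C (U x)) * cos (b * V x)) = exp (-(b\<^sup>2)/2) * measure ?N C"
    proof -
      have "(LINT x|M. (Y x * (1 + cos (b * V x))) * indicator C (U x)) =
        (LINT x|M. Y x * indicator C (U x) + (Y x * indicator C (U x)) * cos (b * V x))"
        by (intro Bochner_Integration.integral_cong refl) (simp add: algebra_simps)
      also have "\<dots> = measure ?N C + (LINT x|M. (Y x * indicator C (U x)) * cos (b * V x))"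
        using ic YC[OF C] one[OF C] by simp
      finally show ?thesis using cosC[OF C, of b] by (simp add: algebra_simps)
    qed
    have s: "(LINT x|M. (Y x * indicator C (U x)) * sin (b * V x)) = 0"
    proof -
      have "(LINT x|M. (Y x * (1 + sin (b * V x))) * indicator C (U x)) =
        (LINT x|M. Y x * indicator C (U x) + (Y x * indicator C (U x)) * sin (b * V x))"
        by (intro Bochner_Integration.integral_cong refl) (simp add: algebra_simps)
      also have "\<dots> = measure ?N C + (LINT x|M. (Y x * indicator C (U x)) * sin (b * V x))"
        using isn YC[OF C] one[OF C] by simp
      finally show ?thesis using sinC[OF C, of b] by (simp add: algebra_simps)
    qed
    have "(CLINT x|M. complex_of_real (Y x * indicator C (U x)) * iexp (b * V x)) =
      (CLINT x|M. complex_of_real ((Y x * indicator C (U x)) * cos (b * V x)) + \<i> * complex_of_real ((Y x * indicator C (U x)) * sin (b * V x)))"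
      by (intro Bochner_Integration.integral_cong refl) (simp add: exp_Euler cos_of_real sin_of_real algebra_simps flip: cos_of_real sin_of_real)
    also have "\<dots> = complex_of_real (LINT x|M. (Y x * indicator C (U x)) * cos (b * V x)) + \<i> * complex_of_real (LINT x|M. (Y x * indicator C (U x)) * sin (b * V x))"
      using ic isn by (subst Bochner_Integration.integral_add) (auto simp del: of_real_mult)
    also have "\<dots> = complex_of_real (measure ?N C * exp (-(b\<^sup>2)/2))"
      unfolding c s by simp
    finally show "(CLINT x|M. complex_of_real (Y x * indicator C (U x)) * iexp (b * V x)) = complex_of_real (measure ?N C * exp (-(b\<^sup>2)/2))" .
  qed simp
  show ?thesis
  proof (rule pair_measure_eqI[symmetric])
    fix C D assume "C \<in> sets ?N" "D \<in> sets ?N"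
    hence [measurable]: "C \<in> sets borel" "D \<in> sets borel" by simp_all
    have "emeasure (distr (density M (\<lambda>x. ennreal (Y x))) (borel \<Otimes>\<^sub>M borel) (\<lambda>x. (U x, V x))) (C \<times> D)
      = (\<integral>\<^sup>+ x. ennreal ((Y x * indicator C (U x)) * indicator D (V x)) \<partial>M)"
      using Y(2) by (subst emeasure_distr) (auto simp: emeasure_density ennreal_mult' intro!: nn_integral_cong split: split_indicator)
    also have "\<dots> = ennreal (measure ?N C * measure ?N D)"
      unfolding both[symmetric, OF \<open>C \<in> sets borel\<close> \<open>D \<in> sets borel\<close>]
      using YC[of C] Y(2)
      by (intro nn_integral_eq_integral integrable_mult_bounded[OF YC, where K=1]) (auto simp: indicator_def)
    finally show "emeasure ?N C * emeasure ?N D = emeasure (distr (density M (\<lambda>x. ennreal (Y x))) (borel \<Otimes>\<^sub>M borel) (\<lambda>x. (U x, V x))) (C \<times> D)"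
      by (simp add: N.emeasure_eq_measure ennreal_mult')
  qed (auto intro: N.sigma_finite_measure_axioms intro!: sets_pair_measure_cong)
qed

section \<open>Exponential densities for a pair of standard normal variables\<close>

text \<open>
  The substitution \<open>u \<rightarrow> u - r\<close> absorbs the exponential weight into the normal density; this is
  Girsanov's theorem for a single standard normal variable.
\<close>

lemma std_normal_exponential_shift:
  fixes r a :: real
  shows "has_bochner_integral std_normal_distribution
    (\<lambda>u. complex_of_real (exp (- r * u - r\<^sup>2/2)) * iexp (a * (u + r))) (complex_of_real (exp (-(a\<^sup>2)/2)))"
proof -
  have int: "integrable std_normal_distribution (\<lambda>u. iexp (a * u))"
    by (intro prob_space.integrable_iexp[OF real_distribution.axioms(1)[OF real_dist_normal_dist]]) auto
  have "has_bochner_integral std_normal_distribution (\<lambda>u. iexp (a * u)) (char std_normal_distribution a)"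
    using int by (auto simp: has_bochner_integral_iff char_def)
  hence "has_bochner_integral lborel (\<lambda>u. std_normal_density u *\<^sub>R iexp (a * u)) (complex_of_real (exp (-(a\<^sup>2)/2)))"
    by (simp add: char_std_normal_distribution has_bochner_integral_iff integrable_density integral_density)
  hence "has_bochner_integral lborel (\<lambda>u. std_normal_density (r + 1 * u) *\<^sub>R iexp (a * (r + 1 * u))) (complex_of_real (exp (-(a\<^sup>2)/2)))"
    using lborel_has_bochner_integral_real_affine_iff[where c=1 and t=r
      and f="\<lambda>u. std_normal_density u *\<^sub>R iexp (a * u)" and x="complex_of_real (exp (-(a\<^sup>2)/2))"] by simp
  also have "(\<lambda>u. std_normal_density (r + 1 * u) *\<^sub>R iexp (a * (r + 1 * u))) =
     (\<lambda>u. std_normal_density u *\<^sub>R (complex_of_real (exp (- r * u - r\<^sup>2/2)) * iexp (a * (u + r))))"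
    by (auto simp: std_normal_density_def fun_eq_iff scaleR_conv_of_real power2_eq_square add.commute
        field_simps simp flip: of_real_mult exp_add)
  finally show ?thesis
    by (subst has_bochner_integral_density) auto
qed

lemma has_bochner_integral_prod_mult:
  fixes f :: "'a => complex" and g :: "'b => complex"
  assumes "prob_space M1" "prob_space M2"
    and f: "has_bochner_integral M1 f x" and g: "has_bochner_integral M2 g y"
  shows "has_bochner_integral (M1 \<Otimes>\<^sub>M M2) (\<lambda>z. f (fst z) * g (snd z)) (x * y)"
proof -
  interpret M1: prob_space M1 by fact
  interpret M2: prob_space M2 by fact
  interpret P: pair_sigma_finite M1 M2 ..
  have [measurable]: "f \<in> borel_measurable M1" "g \<in> borel_measurable M2"
    using f g by (auto dest: borel_measurable_has_bochner_integral)
  have fi: "integrable M1 f" and gi: "integrable M2 g" using f g by (auto simp: has_bochner_integral_iff)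
  have int: "integrable (M1 \<Otimes>\<^sub>M M2) (\<lambda>z. f (fst z) * g (snd z))"
    by (rule P.Fubini_integrable) (use fi gi in \<open>auto simp: norm_mult\<close>)
  moreover have "(\<integral>z. f (fst z) * g (snd z) \<partial>(M1 \<Otimes>\<^sub>M M2)) = x * y"
    using P.integral_fst'[OF int, symmetric] f g by (simp add: has_bochner_integral_iff)
  ultimately show ?thesis by (simp add: has_bochner_integral_iff)
qed

text \<open>
  One cell: \<open>G\<close> is the past, \<open>U\<close> and \<open>V\<close> are the normalised increments of the two Brownian motions.
\<close>

locale gaussian_step = prob_space M for M :: "'a measure" +
  fixes G :: "'a measure" and U V :: "'a => real"
  assumes subG: "subalgebra M G"
    and UM [measurable]: "U \<in> borel_measurable M" and VM [measurable]: "V \<in> borel_measurable M"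
    and step_char: "\<And>A a b. A \<in> sets G ==>
      (CLINT x|M. indicator A x * iexp (a * U x + b * V x)) = complex_of_real (measure M A * exp (-(a\<^sup>2 + b\<^sup>2)/2))"
begin

abbreviation (input) "NN \<equiv> std_normal_distribution \<Otimes>\<^sub>M std_normal_distribution"

lemma prob_N: "prob_space std_normal_distribution"
  using real_dist_normal_dist unfolding real_distribution_def by auto

lemma prob_NN: "prob_space NN"
proof -
  interpret N: prob_space std_normal_distribution by (rule prob_N)
  interpret NN: pair_prob_space std_normal_distribution std_normal_distribution ..
  show ?thesis by (rule NN.prob_space_axioms)
qed

lemma G_sets: "A \<in> sets G ==> A \<in> sets M" and G_space: "space G = space M"
  using subG by (auto simp: subalgebra_def)

text \<open>
  \<open>step_char\<close> says that \<open>(U, V)\<close> is a standard normal pair independent of \<open>G\<close>; here this is read off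
  event by event.
\<close>

lemma law_given_G:
  assumes A: "A \<in> sets G" and B: "B \<in> sets (borel \<Otimes>\<^sub>M borel)"
  shows "emeasure M (A \<inter> {x \<in> space M. (U x, V x) \<in> B}) = emeasure M A * emeasure NN B"
proof (cases "measure M A = 0")
  case True
  have [measurable]: "A \<in> sets M" using A G_sets by auto
  have "emeasure M A = 0" using True by (simp add: emeasure_eq_measure)
  moreover have "emeasure M (A \<inter> {x \<in> space M. (U x, V x) \<in> B}) <= emeasure M A"
    by (intro emeasure_mono) auto
  ultimately show ?thesis by simp
next
  case False
  have AM [measurable]: "A \<in> sets M" using A G_sets by auto
  let ?p = "measure M A"
  have p: "?p > 0" using False by (simp add: zero_less_measure_iff)
  let ?Y = "\<lambda>x. indicator A x / ?p :: real"
  have "distr (density M (\<lambda>x. ennreal (?Y x))) (borel \<Otimes>\<^sub>M borel) (\<lambda>x. (U x, V x)) = NN"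
  proof (rule joint_char_determines_law)
    show "integrable M ?Y" by (intro integrable_divide) (simp add: less_top[symmetric])
    fix a b
    have "(CLINT x|M. (?Y x) * iexp (a * U x + b * V x)) =
      (CLINT x|M. (indicator A x * iexp (a * U x + b * V x)) / ?p)"
      by (intro Bochner_Integration.integral_cong refl) (auto simp: indicator_def)
    also have "\<dots> = (CLINT x|M. (indicator A x * iexp (a * U x + b * V x))) / ?p"
      by (rule integral_divide_zero)
    also have "\<dots> = complex_of_real (exp (-(a\<^sup>2 + b\<^sup>2)/2))"
      unfolding step_char[OF A] using p by simp
    finally show "(CLINT x|M. (?Y x) * iexp (a * U x + b * V x)) = complex_of_real (exp (-(a\<^sup>2 + b\<^sup>2)/2))" .
  qed auto
  hence "emeasure NN B = emeasure (distr (density M (\<lambda>x. ennreal (?Y x))) (borel \<Otimes>\<^sub>M borel) (\<lambda>x. (U x, V x))) B"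
    by simp
  also have "\<dots> = (\<integral>\<^sup>+ x. ennreal (1/?p) * indicator (A \<inter> {x \<in> space M. (U x, V x) \<in> B}) x \<partial>M)"
    using B p by (subst emeasure_distr)
      (auto simp: emeasure_density intro!: nn_integral_cong split: split_indicator)
  also have "\<dots> = ennreal (1/?p) * emeasure M (A \<inter> {x \<in> space M. (U x, V x) \<in> B})"
    using B by (subst nn_integral_cmult_indicator) auto
  finally have "emeasure M A * emeasure NN B = ennreal ?p * (ennreal (1/?p) * emeasure M (A \<inter> {x \<in> space M. (U x, V x) \<in> B}))"
    by (simp add: emeasure_eq_measure)
  also have "\<dots> = emeasure M (A \<inter> {x \<in> space M. (U x, V x) \<in> B})"
    using p by (simp add: mult.assoc[symmetric] ennreal_mult[symmetric])
  finally show ?thesis by simp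
qed

lemma joint_law:
  "distr M (G \<Otimes>\<^sub>M (borel \<Otimes>\<^sub>M borel)) (\<lambda>x. (x, (U x, V x))) = restr_to_subalg M G \<Otimes>\<^sub>M NN"
proof -
  interpret NN: prob_space NN by (rule prob_NN)
  interpret R: prob_space "restr_to_subalg M G" by (rule prob_space_restr_to_subalg[OF subG prob_space_axioms])
  have [measurable]: "(\<lambda>x. x) \<in> measurable M G" using subG by (auto simp: subalgebra_def measurable_def)
  show ?thesis
  proof (rule pair_measure_eqI[symmetric])
    show "sets (restr_to_subalg M G \<Otimes>\<^sub>M NN) = sets (distr M (G \<Otimes>\<^sub>M (borel \<Otimes>\<^sub>M borel)) (\<lambda>x. (x, (U x, V x))))"
      using sets_restr_to_subalg[OF subG] by (simp cong: sets_pair_measure_cong)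
    fix A B assume "A \<in> sets (restr_to_subalg M G)" and "B \<in> sets NN"
    hence A: "A \<in> sets G" and B: "B \<in> sets (borel \<Otimes>\<^sub>M borel)"
      using sets_restr_to_subalg[OF subG] by (simp_all cong: sets_pair_measure_cong)
    have "emeasure (distr M (G \<Otimes>\<^sub>M (borel \<Otimes>\<^sub>M borel)) (\<lambda>x. (x, (U x, V x)))) (A \<times> B) = emeasure M (A \<inter> {x \<in> space M. (U x, V x) \<in> B})"
      using A B sets.sets_into_space[OF A] G_space by (subst emeasure_distr) (auto intro!: arg_cong[where f="emeasure M"])
    also have "\<dots> = emeasure (restr_to_subalg M G) A * emeasure NN B"
      using law_given_G[OF A B] emeasure_restr_to_subalg[OF subG A] by simp
    finally show "emeasure (restr_to_subalg M G) A * emeasure NN B = emeasure (distr M (G \<Otimes>\<^sub>M (borel \<Otimes>\<^sub>M borel)) (\<lambda>x. (x, (U x, V x)))) (A \<times> B)" by simp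
  qed (auto intro: R.sigma_finite_measure_axioms NN.sigma_finite_measure_axioms)
qed

text \<open>
  Conditionally on \<open>G\<close> the values \<open>Y\<close>, \<open>r1\<close>, \<open>r2\<close> are constants, and the shift formula for standard
  normal variables applies to each of the two factors. Both factors have conditional mean independent
  of \<open>r1\<close> and \<open>r2\<close>, and this is why the drift disappears under the new measure.
\<close>

lemma exponential_step:
  assumes Y: "integrable M Y" "Y \<in> borel_measurable G"
    and r [measurable]: "r1 \<in> borel_measurable G" "r2 \<in> borel_measurable G"
  shows "has_bochner_integral M (\<lambda>x. (Y x :: complex) *
      (complex_of_real (exp (- r1 x * U x - (r1 x)\<^sup>2/2)) * iexp (a * (U x + r1 x)) *
      (complex_of_real (exp (- r2 x * V x - (r2 x)\<^sup>2/2)) * iexp (b * (V x + r2 x)))))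
     ((CLINT x|M. Y x) * complex_of_real (exp (-(a\<^sup>2 + b\<^sup>2)/2)))"
proof -
  let ?R = "restr_to_subalg M G"
  interpret NN: prob_space NN by (rule prob_NN)
  interpret R: prob_space ?R by (rule prob_space_restr_to_subalg[OF subG prob_space_axioms])
  interpret P: pair_sigma_finite ?R NN ..
  have [measurable]: "(\<lambda>x. x) \<in> measurable M G" using subG by (auto simp: subalgebra_def measurable_def)
  have [measurable]: "Y \<in> borel_measurable G" by fact
  have sets_RG [measurable_cong]: "sets ?R = sets G" by (rule sets_restr_to_subalg[OF subG])
  define h where "h a r u = complex_of_real (exp (- r * u - r\<^sup>2/2)) * iexp (a * (u + r))" for a r u :: real
  have h: "has_bochner_integral NN (\<lambda>z. h a r1 (fst z) * h b r2 (snd z)) (complex_of_real (exp (-(a\<^sup>2 + b\<^sup>2)/2)))" for a b r1 r2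
    using has_bochner_integral_prod_mult[OF prob_N prob_N std_normal_exponential_shift[of r1 a] std_normal_exponential_shift[of r2 b]]
    by (simp add: h_def exp_add[symmetric] add_divide_distrib diff_divide_distrib flip: of_real_mult of_real_add)
  have nh: "norm (h a r u) = norm (h 0 r u)" "norm (h 0 r u) = Re (h 0 r u)" "complex_of_real (norm (h a r u)) = h 0 r u" for a r u
    by (auto simp: h_def norm_mult)
  define \<Phi> where "\<Phi> p = Y (fst p) * (h a (r1 (fst p)) (fst (snd p)) * h b (r2 (fst p)) (snd (snd p)))" for p
  have [measurable]: "\<Phi> \<in> borel_measurable (?R \<Otimes>\<^sub>M NN)" unfolding \<Phi>_def h_def by measurable
  have hint: "integrable NN (\<lambda>z. h a r1 (fst z) * h b r2 (snd z))" for a b r1 r2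
    using h[of a r1 b r2] by (simp add: has_bochner_integral_iff)
  have YR: "integrable ?R Y" using Y by (intro integrable_in_subalg[OF subG]) auto
  have normint: "(\<integral>z. norm (h a r1 (fst z) * h b r2 (snd z)) \<partial>NN) = 1" for a b r1 r2
  proof -
    have "complex_of_real (\<integral>z. norm (h a r1 (fst z) * h b r2 (snd z)) \<partial>NN) = (CLINT z|NN. h 0 r1 (fst z) * h 0 r2 (snd z))"
      by (subst integral_complex_of_real[symmetric]) (simp add: norm_mult nh(3))
    also have "\<dots> = 1" using h[of 0 r1 0 r2] by (simp add: has_bochner_integral_iff)
    finally show ?thesis using of_real_eq_1_iff by blast
  qed
  have int: "integrable (?R \<Otimes>\<^sub>M NN) \<Phi>"
  proof (rule P.Fubini_integrable)
    have "(\<integral>y. norm (\<Phi> (x, y)) \<partial>NN) = norm (Y x)" for x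
      using normint[of a "r1 x" b "r2 x"] by (simp add: \<Phi>_def norm_mult)
    thus "integrable ?R (\<lambda>x. \<integral>y. norm (\<Phi> (x, y)) \<partial>NN)" using YR by simp
    show "AE x in ?R. integrable NN (\<lambda>y. \<Phi> (x, y))"
      using hint by (auto simp: \<Phi>_def)
  qed measurable
  have inner: "(\<integral>y. \<Phi> (x, y) \<partial>NN) = Y x * complex_of_real (exp (-(a\<^sup>2 + b\<^sup>2)/2))" for x
    using h[of a "r1 x" b "r2 x"] by (simp add: \<Phi>_def has_bochner_integral_iff)
  have "(\<integral>p. \<Phi> p \<partial>(?R \<Otimes>\<^sub>M NN)) = (\<integral>x. Y x * complex_of_real (exp (-(a\<^sup>2 + b\<^sup>2)/2)) \<partial>?R)"
    using P.integral_fst'[OF int, symmetric] unfolding inner .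
  also have "\<dots> = (CLINT x|M. Y x) * complex_of_real (exp (-(a\<^sup>2 + b\<^sup>2)/2))"
    using integral_subalgebra2[OF subG Y(2)] by simp
  finally have val: "(\<integral>p. \<Phi> p \<partial>(?R \<Otimes>\<^sub>M NN)) = (CLINT x|M. Y x) * complex_of_real (exp (-(a\<^sup>2 + b\<^sup>2)/2))" .
  have meas: "(\<lambda>x. (x, (U x, V x))) \<in> measurable M (G \<Otimes>\<^sub>M (borel \<Otimes>\<^sub>M borel))" by measurable
  have \<Phi>': "\<Phi> \<in> borel_measurable (G \<Otimes>\<^sub>M (borel \<Otimes>\<^sub>M borel))" unfolding \<Phi>_def h_def by measurable
  have "integrable M (\<lambda>x. \<Phi> (x, (U x, V x)))"
    using int integrable_distr[OF meas, of \<Phi>] unfolding joint_law by simp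
  moreover have "(CLINT x|M. \<Phi> (x, (U x, V x))) = (CLINT x|M. Y x) * complex_of_real (exp (-(a\<^sup>2 + b\<^sup>2)/2))"
    using val integral_distr[OF meas \<Phi>'] unfolding joint_law by simp
  ultimately show ?thesis by (simp add: has_bochner_integral_iff \<Phi>_def h_def)
qed

end

section \<open>Brownian motions on a filtered space\<close>

locale filtered_space = prob_space M for M :: "'a measure" +
  fixes F :: "real => 'a measure" and T :: real
  assumes sub: "\<And>t. t \<in> {0..T} ==> subalgebra M (F t)"
    and F_mono: "\<And>s t. 0 <= s ==> s <= t ==> t <= T ==> sets (F s) \<subseteq> sets (F t)"
begin

lemma F_space: "t \<in> {0..T} ==> space (F t) = space M"
  and F_sets: "t \<in> {0..T} ==> sets (F t) \<subseteq> sets M"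
  using sub by (auto simp: subalgebra_def)

lemma F_measurable_mono:
  assumes "f \<in> measurable (F s) N" "0 <= s" "s <= t" "t <= T"
  shows "f \<in> measurable (F t) N"
proof (rule measurable_from_subalg[OF _ assms(1)])
  show "subalgebra (F t) (F s)"
    using assms F_mono[of s t] F_space[of s] F_space[of t] by (auto simp: subalgebra_def)
qed

lemma F_measurable_M: "f \<in> measurable (F t) N ==> t \<in> {0..T} ==> f \<in> measurable M N"
  using sub measurable_from_subalg by blast

lemma bm_measurable:
  assumes "brownian_motion M F T W" "0 <= s" "s <= t" "t <= T"
  shows "W s \<in> borel_measurable (F t)" "W s \<in> borel_measurable M"
proof -
  have 1: "W s \<in> borel_measurable (F s)" using assms by (auto simp: brownian_motion_def adapted_def)
  show "W s \<in> borel_measurable (F t)" by (rule F_measurable_mono[OF 1]) (use assms in auto)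
  show "W s \<in> borel_measurable M" by (rule F_measurable_M[OF 1]) (use assms in auto)
qed

lemma bm_increment_char:
  assumes W: "brownian_motion M F T W" and st: "0 <= s" "s < t" "t <= T"
    and Y: "integrable M Y" "Y \<in> borel_measurable (F s)"
  shows "(CLINT x|M. (Y x :: complex) * iexp (a * (W t x - W s x))) = (CLINT x|M. Y x) * complex_of_real (exp (-(a\<^sup>2 * (t - s)/2)))"
    "integrable M (\<lambda>x. (Y x :: complex) * iexp (a * (W t x - W s x)))"
proof -
  let ?\<Delta> = "\<lambda>om. W t om - W s om"
  have dist: "distributed M lborel ?\<Delta> (normal_density 0 (sqrt (t - s)))"
    and ind: "indep_set (sets (F s)) (sets (vimage_algebra (space M) ?\<Delta> borel))"
    using W st by (auto simp: brownian_motion_def)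
  have [measurable]: "W t \<in> borel_measurable M" "W s \<in> borel_measurable M"
    using bm_measurable[OF W, of s t] bm_measurable[OF W, of t t] st by simp_all
  have YM [measurable]: "Y \<in> borel_measurable M" using Y by auto
  have dst: "distr M borel (\<lambda>x. ?\<Delta> x / sqrt (t - s)) = std_normal_distribution"
  proof -
    have "distributed M lborel (\<lambda>x. (?\<Delta> x - 0) / sqrt (t - s)) std_normal_density"
      using normal_standard_normal_convert[of "sqrt (t - s)" ?\<Delta> 0] dist st by simp
    thus ?thesis by (simp add: distributed_def cong: distr_cong)
  qed
  then have "(CLINT x|M. iexp ((a * sqrt (t - s)) * (?\<Delta> x / sqrt (t - s)))) = char std_normal_distribution (a * sqrt (t - s))"
    unfolding char_def by (simp only: dst[symmetric]) (subst integral_distr, auto)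
  hence ch: "(CLINT x|M. iexp (a * ?\<Delta> x)) = complex_of_real (exp (-(a\<^sup>2 * (t - s)/2)))"
    using st by (simp add: char_std_normal_distribution power_mult_distrib)
  have iv: "indep_var borel Y borel (\<lambda>x. iexp (a * ?\<Delta> x))"
    unfolding indep_var_eq
  proof (intro conjI)
    have s1: "sigma_sets (space M) {Y -` A \<inter> space M |A. A \<in> sets borel} \<subseteq> sets (F s)"
    proof -
      have "{Y -` A \<inter> space M |A. A \<in> sets borel} \<subseteq> sets (F s)"
        using measurable_sets[OF Y(2)] F_space[of s] st by auto
      thus ?thesis using F_space[of s] st sets.sigma_sets_subset[of _ "F s"] by auto
    qed
    let ?V = "vimage_algebra (space M) ?\<Delta> borel"
    have [measurable]: "?\<Delta> \<in> borel_measurable ?V" by (rule measurable_vimage_algebra1) auto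
    have s2: "sigma_sets (space M) {(\<lambda>x. iexp (a * ?\<Delta> x)) -` A \<inter> space M |A. A \<in> sets borel} \<subseteq> sets ?V"
    proof -
      have "(\<lambda>x. iexp (a * ?\<Delta> x)) \<in> borel_measurable ?V" by measurable
      from measurable_sets[OF this] have "{(\<lambda>x. iexp (a * ?\<Delta> x)) -` A \<inter> space M |A. A \<in> sets borel} \<subseteq> sets ?V"
        by auto
      thus ?thesis using sets.sigma_sets_subset[of _ ?V] by auto
    qed
    show "indep_set (sigma_sets (space M) {Y -` A \<inter> space M |A. A \<in> sets borel})
     (sigma_sets (space M) {(\<lambda>x. iexp (a * ?\<Delta> x)) -` A \<inter> space M |A. A \<in> sets borel})"
      using ind s1 s2 unfolding indep_sets2_eq by blast
  qed measurable
  have i2: "integrable M (\<lambda>x. iexp (a * ?\<Delta> x))" by (rule integrable_const_bound[where B=1]) auto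
  show "(CLINT x|M. (Y x :: complex) * iexp (a * (W t x - W s x))) = (CLINT x|M. Y x) * complex_of_real (exp (-(a\<^sup>2 * (t - s)/2)))"
    using indep_var_lebesgue_integral[OF iv Y(1) i2] ch by simp
  show "integrable M (\<lambda>x. (Y x :: complex) * iexp (a * (W t x - W s x)))"
    using indep_var_integrable[OF iv Y(1) i2] .
qed

end

locale bm_pair = filtered_space M F T for M :: "'a measure" and F T +
  fixes W B :: "real => 'a => real"
  assumes bW: "brownian_motion M F T W" and bB: "brownian_motion M F T B"
    and indep: "independent_processes M T B W"
begin

lemma independent_functionals:
  assumes "f \<in> borel_measurable (Pi\<^sub>M {0..T} (\<lambda>_. borel))" "g \<in> borel_measurable (Pi\<^sub>M {0..T} (\<lambda>_. borel))"
    and bd: "\<And>p. norm (f p :: complex) <= K" "\<And>p. norm (g p :: complex) <= L"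
  shows "(CLINT x|M. f (\<lambda>t\<in>{0..T}. W t x) * g (\<lambda>t\<in>{0..T}. B t x)) =
    (CLINT x|M. f (\<lambda>t\<in>{0..T}. W t x)) * (CLINT x|M. g (\<lambda>t\<in>{0..T}. B t x))"
proof -
  have "indep_var borel (g \<circ> (\<lambda>x. \<lambda>t\<in>{0..T}. B t x)) borel (f \<circ> (\<lambda>x. \<lambda>t\<in>{0..T}. W t x))"
    using indep[unfolded independent_processes_def] assms by (intro indep_var_compose)
  hence iv: "indep_var borel (\<lambda>x. g (\<lambda>t\<in>{0..T}. B t x)) borel (\<lambda>x. f (\<lambda>t\<in>{0..T}. W t x))" by (simp add: o_def)
  have "integrable M (\<lambda>x. g (\<lambda>t\<in>{0..T}. B t x))" "integrable M (\<lambda>x. f (\<lambda>t\<in>{0..T}. W t x))"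
    using indep_var_rv1[OF iv] indep_var_rv2[OF iv] bd by (auto intro!: integrable_const_bound)
  from indep_var_lebesgue_integral[OF iv this] show ?thesis by (simp add: mult.commute)
qed

end

text \<open>
  The complex exponential martingale started afresh at time \<open>s\<close>.
\<close>

definition exp_mart :: "(real => 'a => real) => real => real => real => 'a => complex" where
  "exp_mart W a s t om = complex_of_real (exp (a\<^sup>2 * (t - s)/2)) * iexp (a * (W t om - W s om))"

lemma norm_exp_mart: "norm (exp_mart W a s t om) = exp (a\<^sup>2 * (t - s)/2)"
  by (simp add: exp_mart_def norm_mult)

lemma exp_mart_split: "exp_mart W a s u om = exp_mart W a s t om * exp_mart W a t u om"
proof -
  have 1: "exp (a\<^sup>2 * (t - s)/2) * exp (a\<^sup>2 * (u - t)/2) = exp (a\<^sup>2 * (u - s)/2)"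
    by (subst exp_add[symmetric]) (simp add: algebra_simps diff_divide_distrib)
  have 2: "iexp (a * (W t om - W s om)) * iexp (a * (W u om - W t om)) = iexp (a * (W u om - W s om))"
    by (subst exp_add[symmetric]) (simp add: algebra_simps)
  have "exp_mart W a s t om * exp_mart W a t u om = complex_of_real (exp (a\<^sup>2 * (t - s)/2) * exp (a\<^sup>2 * (u - t)/2)) *
    (iexp (a * (W t om - W s om)) * iexp (a * (W u om - W t om)))"
    by (simp add: exp_mart_def)
  thus ?thesis unfolding 1 2 by (simp add: exp_mart_def)
qed

lemma exp_mart_refl [simp]: "exp_mart W a s s om = 1" by (simp add: exp_mart_def)

context filtered_space
begin

lemma exp_mart_measurable:
  assumes "brownian_motion M F T W" "0 <= s" "s <= t" "t <= u" "u <= T"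
  shows "exp_mart W a s t \<in> borel_measurable (F u)" "exp_mart W a s t \<in> borel_measurable M"
  using bm_measurable[OF assms(1), of s u] bm_measurable[OF assms(1), of t u] assms
  unfolding exp_mart_def by auto

text \<open>
  The martingale property with respect to \<open>F\<close>: the next increment is independent of the present \<open>\<sigma>\<close>-algebra
  and the normalising factor is the reciprocal of its characteristic function.
\<close>

lemma exp_mart_step:
  assumes W: "brownian_motion M F T W" and st: "0 <= s" "s < t" "t <= T"
    and Y: "integrable M Y" "Y \<in> borel_measurable (F s)"
  shows "(CLINT x|M. Y x * exp_mart W a s t x) = (CLINT x|M. Y x)"
    "integrable M (\<lambda>x. Y x * exp_mart W a s t x)"
    "(CLINT x|M. Y x * (exp_mart W a s t x - 1)) = 0"
    "(CLINT x|M. Y x * (cnj (exp_mart W a s t x) - 1)) = 0"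
proof -
  note 1 = bm_increment_char[OF W st Y]
  have eq: "Y x * exp_mart W a s t x = complex_of_real (exp (a\<^sup>2 * (t - s)/2)) * (Y x * iexp (a * (W t x - W s x)))" for a x
    by (simp add: exp_mart_def)
  have A: "(CLINT x|M. Y x * exp_mart W a s t x) = (CLINT x|M. Y x)" for a
  proof -
    have "complex_of_real (exp (a\<^sup>2 * (t - s)/2)) * complex_of_real (exp (-(a\<^sup>2 * (t - s)/2))) = 1"
      by (simp only: of_real_mult[symmetric] exp_add[symmetric]) simp
    thus ?thesis unfolding eq by (subst integral_mult_right_zero, subst 1(1)) (simp add: mult.left_commute)
  qed
  have B: "integrable M (\<lambda>x. Y x * exp_mart W a s t x)" for a
    unfolding eq using 1(2) by (intro integrable_mult_right)
  show "(CLINT x|M. Y x * exp_mart W a s t x) = (CLINT x|M. Y x)" by (rule A)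
  show "integrable M (\<lambda>x. Y x * exp_mart W a s t x)" by (rule B)
  show C: "(CLINT x|M. Y x * (exp_mart W a s t x - 1)) = 0" for a
    using A[of a] B[of a] Y by (simp add: right_diff_distrib)
  have "cnj (exp_mart W a s t x) = exp_mart W (-a) s t x" for x
    by (simp add: exp_mart_def exp_cnj)
  thus "(CLINT x|M. Y x * (cnj (exp_mart W a s t x) - 1)) = 0" using C[of "-a"] by simp
qed

end

lemma borel_measurable_cnj [measurable (raw)]:
  "f \<in> borel_measurable M ==> (\<lambda>x. cnj (f x)) \<in> borel_measurable M"
  by (rule measurable_compose[of f M borel]) (auto intro!: borel_measurable_continuous_onI continuous_intros)

lemma norm_exp_mart_le:
  fixes c :: real
  assumes "0 <= s" "s <= t" "t <= T"
  shows "norm (exp_mart Z c s t x) <= exp (c\<^sup>2 * T)"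
proof -
  have "c\<^sup>2 * (t - s) <= c\<^sup>2 * T" "0 <= c\<^sup>2 * T" using assms by (auto intro!: mult_left_mono)
  hence "c\<^sup>2 * (t - s) / 2 <= c\<^sup>2 * T" by linarith
  thus ?thesis unfolding norm_exp_mart by simp
qed

lemma sum_if_diag:
  fixes f :: "nat => complex"
  shows "(\<Sum>j<n. \<Sum>k<n. (if j = k then f j else 0)) = (\<Sum>j<n. f j)"
  by (intro sum.cong refl) (simp add: sum.delta)

context bm_pair
begin

lemma exp_mart_functional:
  fixes a :: real
  assumes "0 <= s" "s <= t" "t <= T"
  defines "g \<equiv> \<lambda>p. complex_of_real (exp (a\<^sup>2 * (t - s)/2)) * iexp (a * (p t - p s))"
  shows "exp_mart Z a s t x = g (\<lambda>r\<in>{0..T}. Z r x)" "g \<in> borel_measurable (Pi\<^sub>M {0..T} (\<lambda>_. borel))"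
    "norm (g p) <= exp (a\<^sup>2 * (t - s)/2)"
proof -
  have [measurable]: "(\<lambda>p. p t) \<in> borel_measurable (Pi\<^sub>M {0..T} (\<lambda>_. borel))" "(\<lambda>p. p s) \<in> borel_measurable (Pi\<^sub>M {0..T} (\<lambda>_. borel))"
    using assms by (auto intro!: measurable_component_singleton)
  show "exp_mart Z a s t x = g (\<lambda>r\<in>{0..T}. Z r x)" using assms by (simp add: exp_mart_def g_def)
  show "g \<in> borel_measurable (Pi\<^sub>M {0..T} (\<lambda>_. borel))" unfolding g_def by measurable
  show "norm (g p) <= exp (a\<^sup>2 * (t - s)/2)" by (simp add: g_def norm_mult)
qed

end

context filtered_space
begin

text \<open>
  Increments of the exponential martingale over disjoint cells are orthogonal in \<open>L\<^sup>2\<close>; for equal cells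
  the value is the difference of the exponential second moments.
\<close>

lemma exp_mart_orthogonal:
  fixes a :: real
  assumes W: "brownian_motion M F T W" and s: "0 <= s" and \<tau>: "\<And>j. s <= \<tau> j" "\<And>j. j < N ==> \<tau> (Suc j) <= T" "\<And>j k. j < k ==> \<tau> j < \<tau> k"
  defines "P \<equiv> \<lambda>j x. exp_mart W a s (\<tau> j) x * (exp_mart W a (\<tau> j) (\<tau> (Suc j)) x - 1)"
  assumes jk: "j < N" "k < N"
  shows "(CLINT x|M. P j x * cnj (P k x)) =
    (if j = k then complex_of_real (exp (a\<^sup>2 * (\<tau> j - s)) * (exp (a\<^sup>2 * (\<tau> (Suc j) - \<tau> j)) - 1)) else 0)"
proof -
  have mono: "j <= k ==> \<tau> j <= \<tau> k" for j k using \<tau>(3)[of j k] by (cases "j = k") auto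
  have P_meas: "P j \<in> borel_measurable (F u)" if "\<tau> (Suc j) <= u" "u <= T" for j u
    unfolding P_def using exp_mart_measurable[OF W, of s "\<tau> j" u] exp_mart_measurable[OF W, of "\<tau> j" "\<tau> (Suc j)" u]
      s \<tau>(1)[of j] mono[of j "Suc j"] that by auto
  have P_bd: "norm (P j x) <= exp (a\<^sup>2 * (T - s)/2) * (exp (a\<^sup>2 * (T - s)/2) + 1)" if "j < N" for j x
    unfolding P_def norm_mult
  proof (intro mult_mono)
    have 1: "exp (a\<^sup>2 * (\<tau> j - s)/2) <= exp (a\<^sup>2 * (T - s)/2)" "exp (a\<^sup>2 * (\<tau> (Suc j) - \<tau> j)/2) <= exp (a\<^sup>2 * (T - s)/2)"
      using \<tau>(1)[of j] \<tau>(2)[of j] mono[of j "Suc j"] that by (auto intro!: mult_left_mono)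
    show "norm (exp_mart W a s (\<tau> j) x) <= exp (a\<^sup>2 * (T - s)/2)" unfolding norm_exp_mart by (rule 1)
    show "norm (exp_mart W a (\<tau> j) (\<tau> (Suc j)) x - 1) <= exp (a\<^sup>2 * (T - s)/2) + 1"
      by (rule order_trans[OF norm_triangle_ineq4]) (use 1(2) in \<open>simp add: norm_exp_mart\<close>)
  qed auto
  have U_meas: "exp_mart W a s (\<tau> k) \<in> borel_measurable (F (\<tau> k))" if "k < N" for k
    using exp_mart_measurable(1)[OF W, of s "\<tau> k" "\<tau> k"] s \<tau>(1)[of k] \<tau>(2)[of k] mono[of k "Suc k"] that by auto
  have prod_int: "integrable M (\<lambda>x. P j x * cnj (exp_mart W a s (\<tau> k) x))" if "j < k" "k < N" for j k
  proof (rule integrable_const_bound)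
    show "(\<lambda>x. P j x * cnj (exp_mart W a s (\<tau> k) x)) \<in> borel_measurable M"
      using F_measurable_M[OF P_meas[of j "\<tau> k"]] F_measurable_M[OF U_meas[of k]] mono[of "Suc j" k] that s \<tau>(1)[of k] \<tau>(2)[of k] mono[of k "Suc k"] by auto
    show "AE x in M. norm (P j x * cnj (exp_mart W a s (\<tau> k) x)) <= (exp (a\<^sup>2 * (T - s)/2) * (exp (a\<^sup>2 * (T - s)/2) + 1)) * exp (a\<^sup>2 * (\<tau> k - s)/2)"
      unfolding norm_mult complex_mod_cnj norm_exp_mart using P_bd[of j] that by (auto intro!: mult_right_mono)
  qed
  have less: "(CLINT x|M. P j x * cnj (P k x)) = 0" if "j < k" "k < N" for j k
  proof -
    have "(CLINT x|M. (P j x * cnj (exp_mart W a s (\<tau> k) x)) * (cnj (exp_mart W a (\<tau> k) (\<tau> (Suc k)) x) - 1)) = 0"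
    proof (rule exp_mart_step(4)[OF W])
      show "(\<lambda>x. P j x * cnj (exp_mart W a s (\<tau> k) x)) \<in> borel_measurable (F (\<tau> k))"
        using P_meas[of j "\<tau> k"] U_meas[of k] mono[of "Suc j" k] that \<tau>(2)[of k] mono[of k "Suc k"] by auto
    qed (use prod_int that s \<tau>(1)[of k] \<tau>(2)[of k] \<tau>(3)[of k "Suc k"] in auto)
    thus ?thesis by (simp add: P_def mult.assoc)
  qed
  consider "j = k" | "j < k" | "k < j" by linarith
  then show ?thesis
  proof cases
    case 1
    let ?u = "exp_mart W a (\<tau> j) (\<tau> (Suc j))"
    let ?c = "exp (a\<^sup>2 * (\<tau> (Suc j) - \<tau> j))"
    have uu: "?u x * cnj (?u x) = complex_of_real ?c" for x
      unfolding complex_norm_square[symmetric] norm_exp_mart by (simp add: power2_eq_square flip: exp_add of_real_mult)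
    have UU: "exp_mart W a s (\<tau> j) x * cnj (exp_mart W a s (\<tau> j) x) = complex_of_real (exp (a\<^sup>2 * (\<tau> j - s)))" for x
      unfolding complex_norm_square[symmetric] norm_exp_mart by (simp add: power2_eq_square flip: exp_add of_real_mult)
    have st: "0 <= \<tau> j" "\<tau> j < \<tau> (Suc j)" "\<tau> (Suc j) <= T" using s \<tau>(1)[of j] \<tau>(2)[of j] \<tau>(3)[of j "Suc j"] jk by auto
    have z: "(CLINT x|M. ?u x - 1) = 0" "(CLINT x|M. cnj (?u x) - 1) = 0"
      using exp_mart_step(3,4)[OF W st, of "\<lambda>_. 1" a] by auto
    have iu: "integrable M ?u" using exp_mart_step(2)[OF W st, of "\<lambda>_. 1" a] by simp
    have "P j x * cnj (P j x) = (exp_mart W a s (\<tau> j) x * cnj (exp_mart W a s (\<tau> j) x)) * (?u x * cnj (?u x) - 1 - (?u x - 1) - (cnj (?u x) - 1))" for x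
      by (simp add: P_def algebra_simps)
    hence "(CLINT x|M. P j x * cnj (P j x)) = (CLINT x|M. complex_of_real (exp (a\<^sup>2 * (\<tau> j - s))) * (complex_of_real ?c - 1 - (?u x - 1) - (cnj (?u x) - 1)))"
      unfolding uu UU by simp
    also have "\<dots> = complex_of_real (exp (a\<^sup>2 * (\<tau> j - s))) * (complex_of_real ?c - 1 - (CLINT x|M. ?u x - 1) - (CLINT x|M. cnj (?u x) - 1))"
      using iu by (subst integral_mult_right_zero) (simp add: prob_space)
    finally show ?thesis using 1 unfolding z by simp
  next
    case 2 thus ?thesis using less[OF 2] jk by simp
  next
    case 3
    have "(CLINT x|M. P j x * cnj (P k x)) = cnj (CLINT x|M. P k x * cnj (P j x))"
      by (subst Bochner_Integration.integral_cnj[symmetric]) (simp add: mult.commute)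
    thus ?thesis using less[OF 3] jk 3 by simp
  qed
qed

end

context bm_pair
begin

text \<open>
  The point is that \<open>A\<close> belongs to a filtration for which \<open>W\<close> and \<open>B\<close> are separately Brownian motions, while
  their mutual independence says nothing about \<open>A\<close>. Divide \<open>[s, t]\<close> into \<open>N\<close> cells. The product of the
  two exponential martingales changes over a cell by one term for \<open>W\<close>, one for \<open>B\<close>, and
  one product of increments. The first two have mean zero on \<open>A\<close>; the sum of the products of increments has
  small second moment, since by independence of \<open>W\<close> and \<open>B\<close> and by orthogonality it is a sum of \<open>N\<close> terms of
  order \<open>1 / N\<^sup>2\<close>. Replacing the indicator of \<open>A\<close> by its bound therefore costs nothing as \<open>N\<close> grows.
\<close>

lemma joint_exp_mart:
  assumes st: "0 <= s" "s < t" "t <= T" and A: "A \<in> sets (F s)"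
  shows "(CLINT x|M. indicator A x * (exp_mart W a s t x * exp_mart B b s t x)) = complex_of_real (measure M A)"
proof -
  let ?I = "\<lambda>x. indicator A x :: complex"
  have AM [measurable]: "A \<in> sets M" using A F_sets[of s] st by auto
  let ?\<delta> = "(CLINT x|M. ?I x * (exp_mart W a s t x * exp_mart B b s t x)) - measure M A"
  define \<alpha> where "\<alpha> = a\<^sup>2 * (t - s)"
  define \<beta> where "\<beta> = b\<^sup>2 * (t - s)"
  have \<alpha>\<beta>: "\<alpha> >= 0" "\<beta> >= 0" using st by (auto simp: \<alpha>_def \<beta>_def)
  define C where "C N = (exp \<alpha> * exp \<beta>) * (real N * (exp (\<alpha> / real N) - 1) * (exp (\<beta> / real N) - 1))" for N
  have bound: "norm ?\<delta> <= (c + C N / c) / 2" if c: "c > 0" and N: "N > 0" for c N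
  proof -
    define d where "d = (t - s) / real N"
    have d: "d > 0" using st N by (simp add: d_def)
    define \<tau> where "\<tau> j = s + real j * d" for j
    have \<tau>0: "\<tau> 0 = s" and \<tau>N: "\<tau> N = t" and \<tau>s: "\<And>j. s <= \<tau> j" and \<tau>mono: "\<And>j k. j < k ==> \<tau> j < \<tau> k"
      using N d by (simp_all add: \<tau>_def) (simp add: d_def)
    have \<tau>T: "\<tau> j <= t" if "j <= N" for j using \<tau>mono[of j N] \<tau>N that by (cases "j = N") auto
    have \<tau>d: "\<tau> (Suc j) - \<tau> j = d" for j by (simp add: \<tau>_def algebra_simps)
    define P where "P j x = exp_mart W a s (\<tau> j) x * (exp_mart W a (\<tau> j) (\<tau> (Suc j)) x - 1)" for j x
    define Q where "Q j x = exp_mart B b s (\<tau> j) x * (exp_mart B b (\<tau> j) (\<tau> (Suc j)) x - 1)" for j x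
    have Wm: "exp_mart W a s (\<tau> j) \<in> borel_measurable (F (\<tau> j))" "exp_mart B b s (\<tau> j) \<in> borel_measurable (F (\<tau> j))" if "j <= N" for j
      using exp_mart_measurable(1)[OF bW, of s "\<tau> j" "\<tau> j" a] exp_mart_measurable(1)[OF bB, of s "\<tau> j" "\<tau> j" b] st \<tau>s[of j] \<tau>T[OF that] by auto
    have Wm' [measurable]: "exp_mart W a s (\<tau> j) \<in> borel_measurable M" "exp_mart B b s (\<tau> j) \<in> borel_measurable M" if "j <= N" for j
      using F_measurable_M[OF Wm(1)[OF that]] F_measurable_M[OF Wm(2)[OF that]] st \<tau>s[of j] \<tau>T[OF that] by auto
    have wm [measurable]: "exp_mart W a (\<tau> j) (\<tau> (Suc j)) \<in> borel_measurable M" "exp_mart B b (\<tau> j) (\<tau> (Suc j)) \<in> borel_measurable M" if "j < N" for j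
      using exp_mart_measurable(2)[OF bW, of "\<tau> j" "\<tau> (Suc j)" T a] exp_mart_measurable(2)[OF bB, of "\<tau> j" "\<tau> (Suc j)" T b] st \<tau>s[of j] \<tau>T[of "Suc j"] \<tau>mono[of j "Suc j"] that by auto
    have A\<tau>: "A \<in> sets (F (\<tau> j))" if "j <= N" for j
      using A F_mono[of s "\<tau> j"] st \<tau>s[of j] \<tau>T[OF that] by auto
    have PQm [measurable]: "P j \<in> borel_measurable M" "Q j \<in> borel_measurable M" if "j < N" for j
      unfolding P_def Q_def using that by (auto intro!: borel_measurable_times borel_measurable_diff Wm' wm)
    define K where "K = exp (a\<^sup>2 * T) * (exp (a\<^sup>2 * T) + 1)"
    define L where "L = exp (b\<^sup>2 * T) * (exp (b\<^sup>2 * T) + 1)"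
    have ge: "K >= 0" "L >= 0" by (auto simp: K_def L_def intro!: mult_nonneg_nonneg add_nonneg_nonneg)
    have Pb: "norm (P j x) <= K" and Qb: "norm (Q j x) <= L" if "j < N" for j x
    proof -
      have *: "0 <= s" "s <= \<tau> j" "\<tau> j <= T" "0 <= \<tau> j" "\<tau> j <= \<tau> (Suc j)" "\<tau> (Suc j) <= T"
        using st \<tau>s[of j] \<tau>T[of "Suc j"] \<tau>mono[of j "Suc j"] that by auto
      show "norm (P j x) <= K" unfolding P_def K_def norm_mult
        using norm_exp_mart_le[OF *(1-3), of W a x] order_trans[OF norm_triangle_ineq4[where b=1] add_right_mono[OF norm_exp_mart_le[OF *(4-6), of W a x]]]
        by (intro mult_mono) (auto)
      show "norm (Q j x) <= L" unfolding Q_def L_def norm_mult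
        using norm_exp_mart_le[OF *(1-3), of B b x] order_trans[OF norm_triangle_ineq4[where b=1] add_right_mono[OF norm_exp_mart_le[OF *(4-6), of B b x]]]
        by (intro mult_mono) (auto)
    qed
    define R where "R x = (\<Sum>j<N. P j x * Q j x)" for x
    have PQint: "integrable M (\<lambda>x. P j x * Q j x)" if "j < N" for j
      using Pb Qb that ge by (intro integrable_const_bound[where B="K * L"]) (auto simp: norm_mult intro!: mult_mono)
    have IPQint: "integrable M (\<lambda>x. ?I x * (P j x * Q j x))" if "j < N" for j
      using PQint[OF that] by (subst mult.commute) (rule integrable_mult_bounded[where K=1], auto simp: indicator_def)
    have Rm [measurable]: "R \<in> borel_measurable M" unfolding R_def by (intro borel_measurable_sum) auto
    define UV where "UV j x = ?I x * (exp_mart W a s (\<tau> j) x * exp_mart B b s (\<tau> j) x)" for j x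
    have UVm: "UV j \<in> borel_measurable (F (\<tau> j))" if "j <= N" for j
      unfolding UV_def using Wm[OF that] A\<tau>[OF that] by auto
    have UVi: "integrable M (UV j)" if "j <= N" for j
    proof (rule integrable_const_bound)
      show "UV j \<in> borel_measurable M" by (rule F_measurable_M[OF UVm[OF that]]) (use st \<tau>s[of j] \<tau>T[OF that] in auto)
      show "AE x in M. norm (UV j x) <= 1 * (exp (a\<^sup>2 * T) * exp (b\<^sup>2 * T))"
        unfolding UV_def norm_mult using norm_exp_mart_le[of s "\<tau> j" T W a] norm_exp_mart_le[of s "\<tau> j" T B b] st \<tau>s[of j] \<tau>T[OF that]
        by (intro AE_I2 mult_mono) (auto simp: indicator_def)
    qed
    have step: "(CLINT x|M. UV (Suc j) x) = (CLINT x|M. UV j x) + (CLINT x|M. ?I x * (P j x * Q j x))" if j: "j < N" for j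
    proof -
      let ?u = "exp_mart W a (\<tau> j) (\<tau> (Suc j))" and ?v = "exp_mart B b (\<tau> j) (\<tau> (Suc j))"
      have sj: "0 <= \<tau> j" "\<tau> j < \<tau> (Suc j)" "\<tau> (Suc j) <= T" using st \<tau>s[of j] \<tau>T[of "Suc j"] \<tau>mono[of j "Suc j"] j by auto
      have e: "UV (Suc j) x = UV j x + ?I x * (P j x * Q j x) + UV j x * (?u x - 1) + UV j x * (?v x - 1)" for x
        unfolding UV_def P_def Q_def exp_mart_split[of _ _ s "\<tau> (Suc j)" _ "\<tau> j"] by (simp add: algebra_simps)
      have jj: "j <= N" using j by simp
      note u = exp_mart_step[OF bW sj UVi[OF jj] UVm[OF jj], of a]
      note v = exp_mart_step[OF bB sj UVi[OF jj] UVm[OF jj], of b]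
      have iu: "integrable M (\<lambda>x. UV j x * (?u x - 1))" and iv: "integrable M (\<lambda>x. UV j x * (?v x - 1))"
        using u(2) v(2) UVi[OF jj] by (simp_all add: right_diff_distrib)
      show ?thesis unfolding e using u(3) v(3) iu iv UVi[OF jj] IPQint[OF j] by simp
    qed
    have tele: "(CLINT x|M. UV n x) = (CLINT x|M. UV 0 x) + (\<Sum>j<n. (CLINT x|M. ?I x * (P j x * Q j x)))" if "n <= N" for n
      using that by (induction n) (auto simp: step)
    have "(CLINT x|M. ?I x * R x) = (\<Sum>j<N. (CLINT x|M. ?I x * (P j x * Q j x)))"
      unfolding R_def sum_distrib_left using IPQint by (subst Bochner_Integration.integral_sum) auto
    moreover have "(CLINT x|M. UV 0 x) = complex_of_real (measure M A)"
    proof -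
      have "(CLINT x|M. UV 0 x) = (CLINT x|M. complex_of_real (indicator A x))"
        unfolding UV_def \<tau>0 by (intro Bochner_Integration.integral_cong) (auto simp: indicator_def)
      thus ?thesis by simp
    qed
    moreover have "(CLINT x|M. UV N x) = (CLINT x|M. ?I x * (exp_mart W a s t x * exp_mart B b s t x))" unfolding UV_def \<tau>N ..
    ultimately have \<delta>eq: "?\<delta> = (CLINT x|M. ?I x * R x)" using tele[of N] by (simp add: algebra_simps)
    have RR: "complex_of_real ((norm (R x))\<^sup>2) = (\<Sum>j<N. \<Sum>k<N. (P j x * cnj (P k x)) * (Q j x * cnj (Q k x)))" for x
      unfolding complex_norm_square R_def by (simp add: sum_product algebra_simps)
    have jk_int: "integrable M (\<lambda>x. (P j x * cnj (P k x)) * (Q j x * cnj (Q k x)))" if "j < N" "k < N" for j k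
    proof (rule integrable_const_bound[where B="(K * K) * (L * L)"])
      show "AE x in M. cmod (P j x * cnj (P k x) * (Q j x * cnj (Q k x))) <= K * K * (L * L)"
        unfolding norm_mult complex_mod_cnj using Pb Qb that ge by (intro AE_I2 mult_mono mult_nonneg_nonneg) auto
    qed (use that in measurable)
    have jk_val: "(CLINT x|M. (P j x * cnj (P k x)) * (Q j x * cnj (Q k x))) =
       (if j = k then complex_of_real (exp (a\<^sup>2 * (\<tau> j - s)) * (exp (a\<^sup>2 * d) - 1) * (exp (b\<^sup>2 * (\<tau> j - s)) * (exp (b\<^sup>2 * d) - 1))) else 0)"
      if "j < N" "k < N" for j k
    proof -
      define fW where "fW u v p = complex_of_real (exp (a\<^sup>2 * (v - u)/2)) * iexp (a * (p v - p u))" for u v and p :: "real => real"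
      define fB where "fB u v p = complex_of_real (exp (b\<^sup>2 * (v - u)/2)) * iexp (b * (p v - p u))" for u v and p :: "real => real"
      define p where "p j q = fW s (\<tau> j) q * (fW (\<tau> j) (\<tau> (Suc j)) q - 1)" for j q
      define q where "q j p = fB s (\<tau> j) p * (fB (\<tau> j) (\<tau> (Suc j)) p - 1)" for j p
      have rng: "0 <= s" "s <= \<tau> j" "\<tau> j <= T" "0 <= \<tau> j" "\<tau> j <= \<tau> (Suc j)" "\<tau> (Suc j) <= T" if "j < N" for j
        using st \<tau>s[of j] \<tau>T[of "Suc j"] \<tau>mono[of j "Suc j"] that by auto
      have pP: "P j x = p j (\<lambda>t\<in>{0..T}. W t x)" "Q j x = q j (\<lambda>t\<in>{0..T}. B t x)" if "j < N" for j x
        unfolding P_def Q_def p_def q_def fW_def fB_def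
        by (simp_all only: exp_mart_functional(1)[OF rng(1-3)[OF that]] exp_mart_functional(1)[OF rng(4-6)[OF that]])
      have pm: "p j \<in> borel_measurable (Pi\<^sub>M {0..T} (\<lambda>_. borel))" "q j \<in> borel_measurable (Pi\<^sub>M {0..T} (\<lambda>_. borel))" if "j < N" for j
      proof -
        have [measurable]: "(\<lambda>p. p (\<tau> j)) \<in> borel_measurable (Pi\<^sub>M {0..T} (\<lambda>_. borel))"
          "(\<lambda>p. p (\<tau> (Suc j))) \<in> borel_measurable (Pi\<^sub>M {0..T} (\<lambda>_. borel))" "(\<lambda>p. p s) \<in> borel_measurable (Pi\<^sub>M {0..T} (\<lambda>_. borel))"
          using rng[OF that] by (auto intro!: measurable_component_singleton)
        show "p j \<in> borel_measurable (Pi\<^sub>M {0..T} (\<lambda>_. borel))" "q j \<in> borel_measurable (Pi\<^sub>M {0..T} (\<lambda>_. borel))"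
          unfolding p_def q_def fW_def fB_def by measurable
      qed
      have bf: "norm (fW u v r) <= exp (a\<^sup>2 * T)" "norm (fB u v r) <= exp (b\<^sup>2 * T)" if "0 <= u" "u <= v" "v <= T" for u v r
      proof -
        have "c\<^sup>2 * (v - u) / 2 <= c\<^sup>2 * T" for c :: real
        proof -
          have "c\<^sup>2 * (v - u) <= c\<^sup>2 * T" "0 <= c\<^sup>2 * T" using that by (auto intro!: mult_left_mono)
          thus ?thesis by linarith
        qed
        thus "norm (fW u v r) <= exp (a\<^sup>2 * T)" "norm (fB u v r) <= exp (b\<^sup>2 * T)" by (auto simp: fW_def fB_def norm_mult)
      qed
      have pb: "norm (p j r) <= K" "norm (q j r) <= L" if "j < N" for j r
      proof -
        note * = rng[OF that]
        show "norm (p j r) <= K" unfolding p_def K_def norm_mult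
          using bf(1)[OF *(1-3)] order_trans[OF norm_triangle_ineq4[where b=1] add_right_mono[OF bf(1)[OF *(4-6)]]]
          by (intro mult_mono) auto
        show "norm (q j r) <= L" unfolding q_def L_def norm_mult
          using bf(2)[OF *(1-3)] order_trans[OF norm_triangle_ineq4[where b=1] add_right_mono[OF bf(2)[OF *(4-6)]]]
          by (intro mult_mono) auto
      qed
      have "(CLINT x|M. (P j x * cnj (P k x)) * (Q j x * cnj (Q k x))) = (CLINT x|M. (P j x * cnj (P k x))) * (CLINT x|M. (Q j x * cnj (Q k x)))"
        unfolding pP[OF that(1)] pP[OF that(2)]
      proof (rule independent_functionals[where K="K * K" and L="L * L"])
        show "norm (p j r * cnj (p k r)) <= K * K" "norm (q j r * cnj (q k r)) <= L * L" for r
          unfolding norm_mult complex_mod_cnj using pb that ge by (auto intro!: mult_mono)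
      qed (use pm that in \<open>auto intro!: borel_measurable_times\<close>)
      also have "\<dots> = (if j = k then complex_of_real (exp (a\<^sup>2 * (\<tau> j - s)) * (exp (a\<^sup>2 * d) - 1) * (exp (b\<^sup>2 * (\<tau> j - s)) * (exp (b\<^sup>2 * d) - 1))) else 0)"
      proof -
        have T': "\<tau> (Suc j) <= T" if "j < N" for j using \<tau>T[of "Suc j"] that st by simp
        show ?thesis
          using exp_mart_orthogonal[where \<tau>=\<tau> and N=N, OF bW st(1) \<tau>s T' \<tau>mono that, of a] exp_mart_orthogonal[where \<tau>=\<tau> and N=N, OF bB st(1) \<tau>s T' \<tau>mono that, of b]
          unfolding P_def Q_def \<tau>d by (simp only: of_real_mult split: if_split) simp
      qed
      finally show ?thesis .
    qed
    have "complex_of_real (LINT x|M. (norm (R x))\<^sup>2) = (CLINT x|M. (\<Sum>j<N. \<Sum>k<N. (P j x * cnj (P k x)) * (Q j x * cnj (Q k x))))"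
      unfolding integral_complex_of_real[symmetric] RR ..
    also have "\<dots> = (\<Sum>j<N. \<Sum>k<N. (CLINT x|M. (P j x * cnj (P k x)) * (Q j x * cnj (Q k x))))"
      using jk_int by (subst Bochner_Integration.integral_sum) (auto intro!: sum.cong Bochner_Integration.integrable_sum Bochner_Integration.integral_sum)
    also have "\<dots> = (\<Sum>j<N. \<Sum>k<N. (if j = k then complex_of_real (exp (a\<^sup>2 * (\<tau> j - s)) * (exp (a\<^sup>2 * d) - 1) * (exp (b\<^sup>2 * (\<tau> j - s)) * (exp (b\<^sup>2 * d) - 1))) else 0))"
      using jk_val by (intro sum.cong refl) auto
    also have "\<dots> = complex_of_real (\<Sum>j<N. exp (a\<^sup>2 * (\<tau> j - s)) * (exp (a\<^sup>2 * d) - 1) * (exp (b\<^sup>2 * (\<tau> j - s)) * (exp (b\<^sup>2 * d) - 1)))"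
      unfolding sum_if_diag by simp
    finally have "(LINT x|M. (norm (R x))\<^sup>2) = (\<Sum>j<N. exp (a\<^sup>2 * (\<tau> j - s)) * (exp (a\<^sup>2 * d) - 1) * (exp (b\<^sup>2 * (\<tau> j - s)) * (exp (b\<^sup>2 * d) - 1)))"
      using of_real_eq_iff by blast
    also have "\<dots> <= (\<Sum>j<N. exp \<alpha> * (exp (a\<^sup>2 * d) - 1) * (exp \<beta> * (exp (b\<^sup>2 * d) - 1)))"
      using \<tau>T \<tau>s d by (intro sum_mono mult_mono mult_nonneg_nonneg) (auto simp: \<alpha>_def \<beta>_def intro!: mult_left_mono)
    also have "\<dots> = C N" by (simp add: C_def \<alpha>_def \<beta>_def d_def)
    finally have R2: "(LINT x|M. (norm (R x))\<^sup>2) <= C N" .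
    have R2i: "integrable M (\<lambda>x. (norm (R x))\<^sup>2)"
    proof -
      have "integrable M (\<lambda>x. \<Sum>j<N. \<Sum>k<N. (P j x * cnj (P k x)) * (Q j x * cnj (Q k x)))"
        using jk_int by (intro Bochner_Integration.integrable_sum) auto
      hence "integrable M (\<lambda>x. complex_of_real ((norm (R x))\<^sup>2))" unfolding RR .
      from integrable_Re[OF this] show ?thesis by simp
    qed
    have Ri: "integrable M R" unfolding R_def using PQint by (intro Bochner_Integration.integrable_sum) auto
    have "norm ?\<delta> <= (LINT x|M. norm (?I x * R x))" unfolding \<delta>eq by (rule integral_norm_bound)
    also have "\<dots> <= (LINT x|M. (c + (norm (R x))\<^sup>2 / c) / 2)"
    proof (rule integral_mono)
      show "integrable M (\<lambda>x. norm (?I x * R x))"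
        by (intro integrable_norm, subst mult.commute) (rule integrable_mult_bounded[OF Ri, where K=1], auto simp: indicator_def)
      show "integrable M (\<lambda>x. (c + (norm (R x))\<^sup>2 / c) / 2)" using R2i by auto
      fix x
      have "norm (?I x * R x) <= norm (R x)" by (auto simp: indicator_def)
      also have "\<dots> <= (c + (norm (R x))\<^sup>2 / c) / 2"
        using c sum_squares_bound[of c "norm (R x)"] by (simp add: field_simps power2_eq_square)
      finally show "norm (?I x * R x) <= (c + (norm (R x))\<^sup>2 / c) / 2" .
    qed
    also have "\<dots> = (c + (LINT x|M. (norm (R x))\<^sup>2) / c) / 2" using R2i by (simp add: prob_space)
    also have "\<dots> <= (c + C N / c) / 2" using R2 c by (simp add: divide_right_mono)
    finally show ?thesis .
  qed
  have Clim: "C \<longlonglongrightarrow> 0"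
  proof -
    have "(\<lambda>N. real N * (exp (\<alpha> / real N) - 1) * (exp (\<beta> / real N) - 1)) \<longlonglongrightarrow> 0" by real_asymp
    from tendsto_mult_left[OF this, of "exp \<alpha> * exp \<beta>"] show ?thesis by (simp add: C_def[abs_def])
  qed
  have "norm ?\<delta> <= c / 2" if "c > 0" for c
  proof (rule LIMSEQ_le_const)
    show "(\<lambda>N. (c + C N / c) / 2) \<longlonglongrightarrow> c / 2" using tendsto_divide[OF tendsto_add[OF tendsto_const tendsto_divide[OF Clim tendsto_const[of c]]] tendsto_const[of 2], of c] that by simp
    show "\<exists>N. \<forall>n\<ge>N. norm ?\<delta> <= (c + C n / c) / 2" using bound[OF that] by (intro exI[of _ 1]) auto
  qed
  note half = this
  have "norm ?\<delta> <= 0 + e" if "e > 0" for e using half[of "2 * e"] that by simp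
  hence "norm ?\<delta> <= 0" by (rule field_le_epsilon)
  thus ?thesis by simp
qed

text \<open>
  Consequently the normalised increments over \<open>[s, t]\<close> form a standard normal pair independent of \<open>F s\<close>.
\<close>

lemma bm_pair_gaussian_step:
  assumes st: "0 <= s" "s < t" "t <= T"
  shows "gaussian_step M (F s) (\<lambda>x. (W t x - W s x) / sqrt (t - s)) (\<lambda>x. (B t x - B s x) / sqrt (t - s))"
proof
  have [measurable]: "W t \<in> borel_measurable M" "W s \<in> borel_measurable M" "B t \<in> borel_measurable M" "B s \<in> borel_measurable M"
    using bm_measurable(2)[OF bW, of _ T] bm_measurable(2)[OF bB, of _ T] st by auto
  show "subalgebra M (F s)" using sub st by simp
  show "(\<lambda>x. (W t x - W s x) / sqrt (t - s)) \<in> borel_measurable M" "(\<lambda>x. (B t x - B s x) / sqrt (t - s)) \<in> borel_measurable M" by measurable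
  fix A a b assume A: "A \<in> sets (F s)"
  define \<alpha> where "\<alpha> = a / sqrt (t - s)"
  define \<beta> where "\<beta> = b / sqrt (t - s)"
  have 2: "\<alpha>\<^sup>2 * (t - s) = a\<^sup>2" "\<beta>\<^sup>2 * (t - s) = b\<^sup>2" using st by (auto simp: \<alpha>_def \<beta>_def power_divide)
  have "indicator A x * (exp_mart W \<alpha> s t x * exp_mart B \<beta> s t x) =
     complex_of_real (exp ((a\<^sup>2 + b\<^sup>2)/2)) * (indicator A x * iexp (a * ((W t x - W s x) / sqrt (t - s)) + b * ((B t x - B s x) / sqrt (t - s))))" for x
    unfolding exp_mart_def 2 by (simp add: \<alpha>_def \<beta>_def add_divide_distrib exp_add distrib_left)
  note eq = this
  have eq2: "complex_of_real (exp ((a\<^sup>2 + b\<^sup>2)/2)) * (CLINT x|M. indicator A x * iexp (a * ((W t x - W s x) / sqrt (t - s)) + b * ((B t x - B s x) / sqrt (t - s)))) = measure M A"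
    using joint_exp_mart[OF st A, of \<alpha> \<beta>] unfolding eq integral_mult_right_zero .
  have one: "complex_of_real (exp (-(a\<^sup>2 + b\<^sup>2)/2)) * complex_of_real (exp ((a\<^sup>2 + b\<^sup>2)/2)) = 1"
    by (simp only: of_real_mult[symmetric] exp_add[symmetric]) (simp add: add_divide_distrib diff_divide_distrib)
  have cancel: "z = p * q" if "e * z = p" "q * e = 1" for z p q e :: complex
    using that by (metis mult.assoc mult.commute mult_1)
  show "(CLINT x|M. indicator A x * iexp (a * ((W t x - W s x) / sqrt (t - s)) + b * ((B t x - B s x) / sqrt (t - s)))) = complex_of_real (measure M A * exp (-(a\<^sup>2 + b\<^sup>2)/2))"
    unfolding of_real_mult by (rule cancel[OF eq2 one])
qed

end

section \<open>Step functions\<close>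

definition increasing_upto :: "nat => (nat => real) => bool" where
  "increasing_upto n \<tau> \<longleftrightarrow> (\<forall>i<n. \<tau> i < \<tau> (Suc i))"

lemma chain_less:
  fixes \<tau> :: "nat => real"
  assumes "increasing_upto n \<tau>" "i < j" "j <= n"
  shows "\<tau> i < \<tau> j"
  using assms(2,3)
proof (induction j)
  case (Suc j)
  thus ?case using assms(1) by (cases "i = j") (auto simp: increasing_upto_def intro: less_trans)
qed simp

lemma chain_le:
  fixes \<tau> :: "nat => real"
  assumes "increasing_upto n \<tau>" "i <= j" "j <= n"
  shows "\<tau> i <= \<tau> j"
  using chain_less[of n \<tau> i j] assms by (cases "i = j") auto

lemma chain_cell_unique:
  fixes \<tau> :: "nat => real"
  assumes "increasing_upto n \<tau>" "i < n" "j < n"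
    and "\<tau> i < t" "t <= \<tau> (Suc i)" "\<tau> j < t" "t <= \<tau> (Suc j)"
  shows "i = j"
proof (rule ccontr)
  assume "i \<noteq> j"
  then consider "Suc i <= j" | "Suc j <= i" by linarith
  thus False
  proof cases
    case 1 thus False using chain_le[OF assms(1) 1] assms by auto
  next
    case 2 thus False using chain_le[OF assms(1) 2] assms by auto
  qed
qed

lemma chain_cell_exists:
  fixes \<tau> :: "nat => real"
  assumes "\<tau> 0 < t" "t <= \<tau> n"
  obtains i where "i < n" "\<tau> i < t" "t <= \<tau> (Suc i)"
proof -
  have "\<exists>i<n. \<tau> i < t \<and> t <= \<tau> (Suc i)" using assms
  proof (induction n)
    case (Suc n)
    thus ?case by (cases "t <= \<tau> n") (auto intro: less_SucI)
  qed simp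
  thus ?thesis using that by blast
qed

lemma simple_process_eval:
  assumes "increasing_upto n \<tau>" "j < n" "\<tau> j < t" "t <= \<tau> (Suc j)"
  shows "simple_process n \<tau> \<xi> t om = \<xi> j om"
proof -
  have "simple_process n \<tau> \<xi> t om = (\<Sum>i<n. if i = j then \<xi> i om else 0)"
    unfolding simple_process_def using chain_cell_unique[OF assms(1)] assms
    by (intro sum.cong refl) (auto simp: indicator_def)
  thus ?thesis using assms by simp
qed

lemma simple_process_outside:
  assumes "increasing_upto n \<tau>" "t <= \<tau> 0 \<or> \<tau> n < t"
  shows "simple_process n \<tau> \<xi> t om = 0"
  unfolding simple_process_def
proof (rule sum.neutral, intro ballI)
  fix i assume i: "i \<in> {..<n}"
  have "\<tau> 0 <= \<tau> i" "\<tau> (Suc i) <= \<tau> n" using chain_le[OF assms(1), of 0 i] chain_le[OF assms(1), of "Suc i" n] i by auto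
  thus "\<xi> i om * indicat_real {\<tau> i<..\<tau> (Suc i)} t = 0" using assms(2) by (auto simp: indicator_def)
qed

lemma simple_process_fun2:
  assumes "increasing_upto n \<tau>" "g 0 0 = (0::real)"
  shows "g (simple_process n \<tau> \<xi> t om) (simple_process n \<tau> \<eta> t om) = simple_process n \<tau> (\<lambda>i om. g (\<xi> i om) (\<eta> i om)) t om"
proof (cases "\<tau> 0 < t \<and> t <= \<tau> n")
  case True
  then obtain j where j: "j < n" "\<tau> j < t" "t <= \<tau> (Suc j)" using chain_cell_exists by blast
  show ?thesis by (simp add: simple_process_eval[OF assms(1) j])
next
  case False
  thus ?thesis using assms(2) by (subst (1 2 3) simple_process_outside[OF assms(1)]) auto
qed

lemma has_integral_simple_process:
  assumes "increasing_upto n \<tau>"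
  shows "has_bochner_integral lborel (\<lambda>t. simple_process n \<tau> \<xi> t om) (\<Sum>i<n. \<xi> i om * (\<tau> (Suc i) - \<tau> i))"
  unfolding simple_process_def
proof (intro has_bochner_integral_sum)
  fix i assume "i \<in> {..<n}"
  hence "\<tau> i <= \<tau> (Suc i)" using assms by (auto simp: increasing_upto_def)
  thus "has_bochner_integral lborel (\<lambda>t. \<xi> i om * indicat_real {\<tau> i<..\<tau> (Suc i)} t) (\<xi> i om * (\<tau> (Suc i) - \<tau> i))"
    by (intro has_bochner_integral_mult_right) (auto simp: has_bochner_integral_iff)
qed

lemma set_integral_simple_process:
  assumes "increasing_upto n \<tau>" "\<tau> 0 = 0" "\<tau> n = T"
  shows "set_integrable lborel {0..T} (\<lambda>t. simple_process n \<tau> \<xi> t om)"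
    "(LBINT t:{0..T}. simple_process n \<tau> \<xi> t om) = (\<Sum>i<n. \<xi> i om * (\<tau> (Suc i) - \<tau> i))"
proof -
  have "(\<lambda>t. indicator {0..T} t *\<^sub>R simple_process n \<tau> \<xi> t om) = (\<lambda>t. simple_process n \<tau> \<xi> t om)"
  proof (rule ext)
    fix t show "indicator {0..T} t *\<^sub>R simple_process n \<tau> \<xi> t om = simple_process n \<tau> \<xi> t om"
    proof (cases "t \<in> {0..T}")
      case False
      hence "t <= \<tau> 0 \<or> \<tau> n < t" using assms(2,3) by auto
      from simple_process_outside[OF assms(1) this, of \<xi> om] show ?thesis by simp
    qed simp
  qed
  thus "set_integrable lborel {0..T} (\<lambda>t. simple_process n \<tau> \<xi> t om)"
    "(LBINT t:{0..T}. simple_process n \<tau> \<xi> t om) = (\<Sum>i<n. \<xi> i om * (\<tau> (Suc i) - \<tau> i))"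
    using has_integral_simple_process[OF assms(1), of \<xi> om] unfolding set_integrable_def set_lebesgue_integral_def
    by (auto simp: has_bochner_integral_iff)
qed

section \<open>Square integrable functions on an interval\<close>

definition sq_int :: "real => (real => real) => bool" where
  "sq_int T h \<longleftrightarrow> set_borel_measurable lborel {0..T} h \<and> set_integrable lborel {0..T} (\<lambda>t. (h t)\<^sup>2)"

lemma set_borel_measurable_fun2:
  fixes g h :: "real => real"
  assumes "set_borel_measurable lborel A g" "set_borel_measurable lborel A h" "(\<lambda>p. k (fst p) (snd p)) \<in> borel_measurable borel" "k 0 0 = (0::real)"
  shows "set_borel_measurable lborel A (\<lambda>t. k (g t) (h t))"
proof -
  have [measurable]: "(\<lambda>x. indicator A x *\<^sub>R g x) \<in> borel_measurable lborel" "(\<lambda>x. indicator A x *\<^sub>R h x) \<in> borel_measurable lborel"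
    using assms unfolding set_borel_measurable_def by auto
  have "(\<lambda>x. (indicator A x *\<^sub>R g x, indicator A x *\<^sub>R h x)) \<in> borel_measurable lborel" by (intro borel_measurable_Pair) measurable
  from measurable_compose[OF this assms(3)] have "(\<lambda>x. k (indicator A x *\<^sub>R g x) (indicator A x *\<^sub>R h x)) \<in> borel_measurable lborel" by simp
  also have "(\<lambda>x. k (indicator A x *\<^sub>R g x) (indicator A x *\<^sub>R h x)) = (\<lambda>x. indicator A x *\<^sub>R k (g x) (h x))"
    using assms(4) by (auto simp: indicator_def fun_eq_iff)
  finally show ?thesis unfolding set_borel_measurable_def .
qed

lemma sq_int_mult:
  assumes "sq_int T g" "sq_int T h"
  shows "set_integrable lborel {0..T} (\<lambda>t. g t * h t)"
proof (rule set_integrable_bound[of _ _ "\<lambda>t. (g t)\<^sup>2 + (h t)\<^sup>2"])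
  show "set_integrable lborel {0..T} (\<lambda>t. (g t)\<^sup>2 + (h t)\<^sup>2)"
    using assms unfolding sq_int_def by (intro set_integral_add) auto
  show "set_borel_measurable lborel {0..T} (\<lambda>t. g t * h t)"
    using assms unfolding sq_int_def by (intro set_borel_measurable_fun2[where k="\<lambda>x y. x * y" and g=g and h=h]) (auto intro!: borel_measurable_continuous_onI continuous_intros)
  have "\<bar>g t * h t\<bar> <= (g t)\<^sup>2 + (h t)\<^sup>2" for t
    using sum_squares_bound[of "\<bar>g t\<bar>" "\<bar>h t\<bar>"] mult_nonneg_nonneg[of "\<bar>g t\<bar>" "\<bar>h t\<bar>"]
    unfolding abs_mult power2_abs by linarith
  thus "AE x in lborel. x \<in> {0..T} \<longrightarrow> norm (g x * h x) <= norm ((g x)\<^sup>2 + (h x)\<^sup>2)" by auto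
qed

lemma sq_int_const [simp]: "sq_int T (\<lambda>_. c)"
proof -
  have "integrable lborel (indicat_real {0..T})"
    by (rule integrable_real_indicator) (auto simp: emeasure_lborel_Icc_eq)
  thus ?thesis unfolding sq_int_def set_borel_measurable_def set_integrable_def by auto
qed

lemma sq_int_integrable: "sq_int T h ==> set_integrable lborel {0..T} h"
  using sq_int_mult[of T h "\<lambda>_. 1"] by simp

lemma sq_int_add:
  assumes "sq_int T g" "sq_int T h"
  shows "sq_int T (\<lambda>t. g t + h t)"
proof -
  have "set_integrable lborel {0..T} (\<lambda>t. (g t)\<^sup>2 + (h t)\<^sup>2 + 2 * (g t * h t))"
    using assms sq_int_mult[OF assms] unfolding sq_int_def by (intro set_integral_add set_integrable_mult_right) auto
  moreover have "set_borel_measurable lborel {0..T} (\<lambda>t. g t + h t)"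
    using assms unfolding sq_int_def by (intro set_borel_measurable_fun2[where k="\<lambda>x y. x + y" and g=g and h=h]) (auto intro!: borel_measurable_continuous_onI continuous_intros)
  ultimately show ?thesis unfolding sq_int_def by (simp add: power2_sum mult.assoc)
qed

lemma sq_int_cmult:
  assumes "sq_int T g" shows "sq_int T (\<lambda>t. c * g t)"
proof -
  have "set_borel_measurable lborel {0..T} (\<lambda>t. c * g t)"
    using assms unfolding sq_int_def by (intro set_borel_measurable_fun2[where k="\<lambda>x y. c * x" and g=g and h=g]) (auto intro!: borel_measurable_continuous_onI continuous_intros)
  thus ?thesis using assms unfolding sq_int_def by (auto simp: power_mult_distrib)
qed

lemma sq_int_diff: "sq_int T g ==> sq_int T h ==> sq_int T (\<lambda>t. g t - h t)"
  using sq_int_add[of T g "\<lambda>t. (-1) * h t"] sq_int_cmult[of T h "-1"] by simp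

lemma sq_int_simple_process:
  assumes "increasing_upto n \<tau>" "\<tau> 0 = 0" "\<tau> n = T"
  shows "sq_int T (\<lambda>t. simple_process n \<tau> \<xi> t om)"
proof -
  have "(simple_process n \<tau> \<xi> t om)\<^sup>2 = simple_process n \<tau> (\<lambda>i om. (\<xi> i om)\<^sup>2) t om" for t
    using simple_process_fun2[OF assms(1), where g="\<lambda>x y. x\<^sup>2"] by simp
  thus ?thesis using set_integral_simple_process(1)[OF assms, of _ om]  borel_measurable_integrable[OF set_integral_simple_process(1)[OF assms, unfolded set_integrable_def, of \<xi> om]]
    unfolding sq_int_def set_integrable_def set_borel_measurable_def by simp
qed

definition clip :: "real => real => real" where "clip c x = max (- c) (min c x)"

lemma clip_abs_le: "c >= 0 ==> \<bar>clip c x\<bar> <= c" and clip_abs_le2: "c >= 0 ==> \<bar>clip c x\<bar> <= \<bar>x\<bar>"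
  and clip_diff_le: "c >= 0 ==> \<bar>clip c x - x\<bar> <= \<bar>x\<bar>" and clip_id: "\<bar>x\<bar> <= c ==> clip c x = x" and clip_0: "c >= 0 ==> clip c 0 = 0"
  by (auto simp: clip_def)

lemma clip_measurable [measurable]: "clip c \<in> borel_measurable borel"
  unfolding clip_def by measurable

lemma clip_cont: "continuous_on A f ==> continuous_on A (\<lambda>x. clip c (f x))"
  unfolding clip_def by (intro continuous_intros)

lemma sq_int_clip:
  assumes "sq_int T h" "c >= 0" shows "sq_int T (\<lambda>t. clip c (h t))"
proof -
  have m: "set_borel_measurable lborel {0..T} (\<lambda>t. clip c (h t))"
    using assms unfolding sq_int_def
    by (intro set_borel_measurable_fun2[where k="\<lambda>x y. clip c x" and g=h and h=h])
       (auto simp: clip_0 intro!: clip_cont borel_measurable_continuous_onI continuous_intros)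
  have m2: "set_borel_measurable lborel {0..T} (\<lambda>t. (clip c (h t))\<^sup>2)"
    using m by (intro set_borel_measurable_fun2[where k="\<lambda>x y. x\<^sup>2" and g="\<lambda>t. clip c (h t)" and h="\<lambda>t. clip c (h t)"]) (auto intro!: borel_measurable_continuous_onI continuous_intros)
  have "set_integrable lborel {0..T} (\<lambda>t. (clip c (h t))\<^sup>2)"
    by (rule set_integrable_bound[of _ _ "\<lambda>t. (h t)\<^sup>2"])
       (use assms m2 clip_abs_le2[OF assms(2)] in \<open>auto simp: sq_int_def abs_le_square_iff[symmetric]\<close>)
  thus ?thesis using m by (simp add: sq_int_def)
qed

definition sq_norm :: "real => (real => real) => real" where
  "sq_norm T h = (LBINT t:{0..T}. (h t)\<^sup>2)"

lemma sq_norm_nonneg [simp]: "0 <= sq_norm T h"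
  unfolding sq_norm_def set_lebesgue_integral_def by (intro Bochner_Integration.integral_nonneg) auto

lemma sq_norm_mono:
  assumes "sq_int T g" "sq_int T h" "\<And>t. t \<in> {0..T} ==> \<bar>g t\<bar> <= \<bar>h t\<bar>"
  shows "sq_norm T g <= sq_norm T h"
  unfolding sq_norm_def using assms by (intro set_integral_mono) (auto simp: sq_int_def abs_le_square_iff[symmetric])

lemma sq_norm_add_le:
  assumes "sq_int T g" "sq_int T h"
  shows "sq_norm T (\<lambda>t. g t + h t) <= 2 * sq_norm T g + 2 * sq_norm T h"
proof -
  have "sq_norm T (\<lambda>t. g t + h t) <= (LBINT t:{0..T}. 2 * (g t)\<^sup>2 + 2 * (h t)\<^sup>2)"
    unfolding sq_norm_def
  proof (rule set_integral_mono)
    show "set_integrable lborel {0..T} (\<lambda>t. (g t + h t)\<^sup>2)" using sq_int_add[OF assms] by (simp add: sq_int_def)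
    show "set_integrable lborel {0..T} (\<lambda>t. 2 * (g t)\<^sup>2 + 2 * (h t)\<^sup>2)"
      using assms unfolding sq_int_def by (intro set_integral_add set_integrable_mult_right) auto
    show "(g t + h t)\<^sup>2 <= 2 * (g t)\<^sup>2 + 2 * (h t)\<^sup>2" for t
      using sum_squares_bound[of "g t" "h t"] by (simp add: power2_sum)
  qed
  also have "\<dots> = 2 * sq_norm T g + 2 * sq_norm T h"
    unfolding sq_norm_def using assms by (subst set_integral_add) (auto simp: sq_int_def)
  finally show ?thesis .
qed

lemma sq_norm_diff_le:
  assumes "sq_int T g" "sq_int T h" "sq_int T k"
  shows "sq_norm T (\<lambda>t. g t - k t) <= 2 * sq_norm T (\<lambda>t. g t - h t) + 2 * sq_norm T (\<lambda>t. h t - k t)"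
  using sq_norm_add_le[OF sq_int_diff[OF assms(1,2)] sq_int_diff[OF assms(2,3)]] by simp

lemma sq_norm_diff_commute: "sq_norm T (\<lambda>t. g t - h t) = sq_norm T (\<lambda>t. h t - g t)"
  unfolding sq_norm_def by (simp add: power2_commute)

lemma nn_integral_sq_norm:
  assumes "sq_int T h"
  shows "(\<integral>\<^sup>+t\<in>{0..T}. ennreal ((h t)\<^sup>2) \<partial>lborel) = ennreal (sq_norm T h)"
proof -
  have "(\<integral>\<^sup>+t\<in>{0..T}. ennreal ((h t)\<^sup>2) \<partial>lborel) = (\<integral>\<^sup>+t. ennreal (indicator {0..T} t *\<^sub>R (h t)\<^sup>2) \<partial>lborel)"
    by (intro nn_integral_cong) (auto simp: indicator_def)
  also have "\<dots> = ennreal (sq_norm T h)" unfolding sq_norm_def set_lebesgue_integral_def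
    using assms by (intro nn_integral_eq_integral) (auto simp: sq_int_def set_integrable_def)
  finally show ?thesis .
qed

text \<open>
  Cauchy-Schwarz in the form \<open>2 * x * y <= c * x\<^sup>2 + y\<^sup>2 / c\<close> with a free parameter \<open>c\<close>.
\<close>

lemma tendsto_pairing:
  assumes g: "\<And>n. sq_int T (g n)" "sq_int T G" "(\<lambda>n. sq_norm T (\<lambda>t. g n t - G t)) \<longlonglongrightarrow> 0"
    and h: "\<And>n. sq_int T (h n)" "sq_int T H" "(\<lambda>n. sq_norm T (\<lambda>t. h n t - H t)) \<longlonglongrightarrow> 0"
  shows "(\<lambda>n. LBINT t:{0..T}. g n t * h n t) \<longlonglongrightarrow> (LBINT t:{0..T}. G t * H t)"
proof -
  have abs_le: "\<bar>LBINT t:{0..T}. a t * b t\<bar> <= (c * sq_norm T a + sq_norm T b / c) / 2" if "sq_int T a" "sq_int T b" "c > 0" for a b c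
  proof -
    have "\<bar>LBINT t:{0..T}. a t * b t\<bar> <= (LBINT t:{0..T}. \<bar>a t * b t\<bar>)"
      unfolding set_lebesgue_integral_def by (rule order_trans[OF integral_abs_bound]) (simp add: abs_mult)
    also have "\<dots> <= (LBINT t:{0..T}. (c/2) * (a t)\<^sup>2 + (1/(2*c)) * (b t)\<^sup>2)"
    proof (rule set_integral_mono)
      show "set_integrable lborel {0..T} (\<lambda>t. \<bar>a t * b t\<bar>)" using sq_int_mult[OF that(1,2)] by (rule set_integrable_abs)
      show "set_integrable lborel {0..T} (\<lambda>t. (c/2) * (a t)\<^sup>2 + (1/(2*c)) * (b t)\<^sup>2)"
        using that unfolding sq_int_def by (intro set_integral_add set_integrable_mult_right) auto
      fix t
      have "2 * (c * \<bar>a t\<bar>) * \<bar>b t\<bar> <= (c * \<bar>a t\<bar>)\<^sup>2 + \<bar>b t\<bar>\<^sup>2" by (rule sum_squares_bound)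
      thus "\<bar>a t * b t\<bar> <= (c/2) * (a t)\<^sup>2 + (1/(2*c)) * (b t)\<^sup>2"
        using \<open>c > 0\<close> by (simp add: abs_mult field_simps power2_eq_square)
    qed
    also have "\<dots> = (c * sq_norm T a + sq_norm T b / c) / 2"
      unfolding sq_norm_def using that by (subst set_integral_add) (auto simp: sq_int_def field_simps)
    finally show ?thesis .
  qed
  define D where "D n = (LBINT t:{0..T}. g n t * h n t) - (LBINT t:{0..T}. G t * H t)" for n
  have Deq: "D n = (LBINT t:{0..T}. (g n t - G t) * (h n t - H t)) + (LBINT t:{0..T}. (g n t - G t) * H t) + (LBINT t:{0..T}. (h n t - H t) * G t)" for n
  proof -
    note gd = sq_int_diff[OF g(1)[of n] g(2)] and hd = sq_int_diff[OF h(1)[of n] h(2)]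
    have "(LBINT t:{0..T}. (g n t - G t) * (h n t - H t)) + (LBINT t:{0..T}. (g n t - G t) * H t) + (LBINT t:{0..T}. (h n t - H t) * G t)
      = (LBINT t:{0..T}. (g n t - G t) * (h n t - H t) + (g n t - G t) * H t + (h n t - H t) * G t)"
      using sq_int_mult[OF gd hd] sq_int_mult[OF gd h(2)] sq_int_mult[OF hd g(2)] by (simp add: set_integral_add)
    also have "\<dots> = (LBINT t:{0..T}. g n t * h n t - G t * H t)" by (rule set_lebesgue_integral_cong) (auto simp: algebra_simps)
    also have "\<dots> = D n" unfolding D_def using sq_int_mult[OF g(1) h(1)] sq_int_mult[OF g(2) h(2)] by (rule set_integral_diff)
    finally show ?thesis by simp
  qed
  let ?a = "\<lambda>n. sq_norm T (\<lambda>t. g n t - G t)" and ?b = "\<lambda>n. sq_norm T (\<lambda>t. h n t - H t)"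
  have Db: "\<bar>D n\<bar> <= (?a n + ?b n)/2 + (?a n / c + c * sq_norm T H) / 2 + (?b n / c + c * sq_norm T G) / 2" if c: "c > 0" for n c
  proof -
    note gd = sq_int_diff[OF g(1)[of n] g(2)] and hd = sq_int_diff[OF h(1)[of n] h(2)]
    have ic: "inverse c > 0" using c by simp
    have a1: "\<bar>LBINT t:{0..T}. (g n t - G t) * (h n t - H t)\<bar> <= (?a n + ?b n)/2"
      using abs_le[OF gd hd zero_less_one] by simp
    have eqn: "(inverse c * x + y / inverse c)/2 = (x / c + c * y)/2" for x y
      using c by (simp add: field_simps)
    have a2: "\<bar>LBINT t:{0..T}. (g n t - G t) * H t\<bar> <= (?a n / c + c * sq_norm T H) / 2"
      using abs_le[OF gd h(2) ic] unfolding eqn .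
    have a3: "\<bar>LBINT t:{0..T}. (h n t - H t) * G t\<bar> <= (?b n / c + c * sq_norm T G) / 2"
      using abs_le[OF hd g(2) ic] unfolding eqn .
    show ?thesis unfolding Deq using a1 a2 a3 by linarith
  qed
  have "D \<longlonglongrightarrow> 0"
  proof (rule LIMSEQ_I)
    fix r :: real assume r: "r > 0"
    define c where "c = r / (1 + sq_norm T H + sq_norm T G)"
    have den: "1 + sq_norm T H + sq_norm T G > 0" using sq_norm_nonneg[of T H] sq_norm_nonneg[of T G] by linarith
    have c: "c > 0" using r den by (simp add: c_def)
    have cr: "c * (sq_norm T H + sq_norm T G) <= r"
    proof -
      have "r * (sq_norm T H + sq_norm T G) <= r * (1 + sq_norm T H + sq_norm T G)" using r by (intro mult_left_mono) auto
      thus ?thesis using den by (simp add: c_def pos_divide_le_eq)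
    qed
    have "(\<lambda>n. (?a n + ?b n)/2 + (?a n / c + c * sq_norm T H) / 2 + (?b n / c + c * sq_norm T G) / 2) \<longlonglongrightarrow> (0 + 0)/2 + (0 / c + c * sq_norm T H) / 2 + (0 / c + c * sq_norm T G) / 2"
      using c by (intro tendsto_intros g h) auto
    moreover have "(0 + 0)/2 + (0 / c + c * sq_norm T H) / 2 + (0 / c + c * sq_norm T G) / 2 < r"
      using cr r by (simp add: algebra_simps)
    ultimately have "eventually (\<lambda>n. (?a n + ?b n)/2 + (?a n / c + c * sq_norm T H) / 2 + (?b n / c + c * sq_norm T G) / 2 < r) sequentially"
      by (rule order_tendstoD(2))
    hence "eventually (\<lambda>n. norm (D n - 0) < r) sequentially"
    proof eventually_elim
      case (elim n)
      show ?case using le_less_trans[OF Db[OF c] elim] by simp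
    qed
    thus "\<exists>no. \<forall>n\<ge>no. norm (D n - 0) < r" unfolding eventually_sequentially .
  qed
  hence "(\<lambda>n. (LBINT t:{0..T}. g n t * h n t) - (LBINT t:{0..T}. G t * H t)) \<longlonglongrightarrow> 0" unfolding D_def[abs_def] .
  thus ?thesis by (rule LIM_zero_cancel)
qed

section \<open>Adapted step approximations\<close>

definition grid :: "real => nat => nat => real" where
  "grid T N j = T * real j / real N"

text \<open>The value on cell \<open>j\<close> is the mean of \<open>h\<close> over the preceding cell.\<close>

definition cell_avg :: "real => nat => (real => real) => nat => real" where
  "cell_avg T N h j = (if j = 0 then 0 else (real N / T) * (LBINT t:{grid T N (j - 1)<..grid T N j}. h t))"

definition step_avg :: "real => nat => (real => real) => real => real" where
  "step_avg T N h t = simple_process N (grid T N) (\<lambda>j _. cell_avg T N h j) t ()"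

context
  fixes T :: real and N :: nat
  assumes T: "0 < T" and N: "0 < N"
begin

lemma grid_increasing: "increasing_upto N (grid T N)"
  using T N by (auto simp: increasing_upto_def grid_def divide_strict_right_mono)

lemma grid_0 [simp]: "grid T N 0 = 0" and grid_N [simp]: "grid T N N = T"
  using N by (auto simp: grid_def)

lemma grid_Suc: "grid T N (Suc j) - grid T N j = T / real N"
  by (simp add: grid_def add_divide_distrib[symmetric] diff_divide_distrib[symmetric] algebra_simps)

lemma grid_range: "j <= N ==> 0 <= grid T N j" "j <= N ==> grid T N j <= T"
  using chain_le[OF grid_increasing, of 0 j] chain_le[OF grid_increasing, of j N] by auto

lemma grid_cell_subset: "j < N ==> {grid T N j<..grid T N (Suc j)} \<subseteq> {0..T}"
  using grid_range[of j] grid_range[of "Suc j"] by auto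

lemma set_integrable_cell: "set_integrable lborel {0..T} h ==> j < N ==> set_integrable lborel {grid T N j<..grid T N (Suc j)} h"
  for h :: "real => real"
  by (rule set_integrable_subset[OF _ _ grid_cell_subset]) auto

lemma sq_int_step_avg: "sq_int T (step_avg T N h)"
  unfolding step_avg_def[abs_def] by (rule sq_int_simple_process[OF grid_increasing grid_0 grid_N])

lemma cell_avg_add:
  assumes "set_integrable lborel {0..T} g" "set_integrable lborel {0..T} h" "j < N"
  shows "cell_avg T N (\<lambda>t. g t + h t) j = cell_avg T N g j + cell_avg T N h j"
proof (cases j)
  case (Suc i)
  hence "set_integrable lborel {grid T N i<..grid T N j} g" "set_integrable lborel {grid T N i<..grid T N j} h"
    using set_integrable_cell[of _ i] assms by auto
  thus ?thesis using Suc by (simp add: cell_avg_def set_integral_add distrib_left)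
qed (simp add: cell_avg_def)

lemma step_avg_eval:
  assumes "j < N" "grid T N j < t" "t <= grid T N (Suc j)"
  shows "step_avg T N h t = cell_avg T N h j"
  unfolding step_avg_def by (rule simple_process_eval[OF grid_increasing assms])

lemma step_avg_add:
  assumes "set_integrable lborel {0..T} g" "set_integrable lborel {0..T} h"
  shows "step_avg T N (\<lambda>t. g t + h t) t = step_avg T N g t + step_avg T N h t"
  unfolding step_avg_def simple_process_def sum.distrib[symmetric] distrib_right[symmetric]
  by (intro sum.cong refl) (simp add: cell_avg_add[OF assms])

lemma sq_norm_step_avg: "sq_norm T (step_avg T N h) = (\<Sum>j<N. (cell_avg T N h j)\<^sup>2 * (T / real N))"
proof -
  have "(step_avg T N h t)\<^sup>2 = simple_process N (grid T N) (\<lambda>j _. (cell_avg T N h j)\<^sup>2) t ()" for t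
    unfolding step_avg_def using simple_process_fun2[OF grid_increasing, where g="\<lambda>x y. x\<^sup>2"] by simp
  thus ?thesis unfolding sq_norm_def
    using set_integral_simple_process(2)[OF grid_increasing grid_0 grid_N, of "\<lambda>j _. (cell_avg T N h j)\<^sup>2" "()"] by (simp add: grid_Suc)
qed

lemma cell_avg_square_le:
  assumes h: "sq_int T h" and j: "Suc j < N"
  shows "(cell_avg T N h (Suc j))\<^sup>2 * (T / real N) <= (LBINT t:{grid T N j<..grid T N (Suc j)}. (h t)\<^sup>2)"
proof -
  let ?A = "{grid T N j<..grid T N (Suc j)}"
  define m where "m = cell_avg T N h (Suc j)"
  define L where "L = T / real N"
  have L: "L > 0" using T N by (simp add: L_def)
  have jN: "j < N" using j by simp
  have i1: "set_integrable lborel ?A h" and i2: "set_integrable lborel ?A (\<lambda>t. (h t)\<^sup>2)"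
    using set_integrable_cell[OF sq_int_integrable[OF h] jN] set_integrable_cell[of "\<lambda>t. (h t)\<^sup>2", OF _ jN] h by (auto simp: sq_int_def)
  have ic: "set_integrable lborel ?A (\<lambda>t. c)" for c :: real
    using set_integrable_cell[OF sq_int_integrable[OF sq_int_const] jN] .
  have LA: "(LBINT t:?A. c) = c * L" for c
    using chain_le[OF grid_increasing, of j "Suc j"] jN grid_Suc[of j] by (simp add: L_def set_lebesgue_integral_def)
  have mh: "(LBINT t:?A. h t) = m * L" using T N by (simp add: m_def cell_avg_def L_def)
  have "0 <= (LBINT t:?A. (h t - m)\<^sup>2)"
    unfolding set_lebesgue_integral_def by (intro Bochner_Integration.integral_nonneg) auto
  also have "\<dots> = (LBINT t:?A. (h t)\<^sup>2 + (- 2 * m) * h t + m\<^sup>2)"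
    by (rule set_lebesgue_integral_cong) (auto simp: power2_diff algebra_simps)
  also have "\<dots> = (LBINT t:?A. (h t)\<^sup>2) + (- 2 * m) * (LBINT t:?A. h t) + m\<^sup>2 * L"
  proof -
    have i1': "set_integrable lborel ?A (\<lambda>t. (- 2 * m) * h t)" using i1 by (rule set_integrable_mult_right)
    have e1: "(LBINT t:?A. (- 2 * m) * h t) = (- 2 * m) * (LBINT t:?A. h t)" by (rule set_integral_mult_right)
    show ?thesis unfolding set_integral_add(2)[OF set_integral_add(1)[OF i2 i1'] ic] set_integral_add(2)[OF i2 i1'] e1 LA ..
  qed
  also have "\<dots> = (LBINT t:?A. (h t)\<^sup>2) - m\<^sup>2 * L" unfolding mh by (simp add: power2_eq_square)
  finally show ?thesis by (simp add: m_def L_def)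
qed

lemma sum_cells_le:
  assumes f: "set_integrable lborel {0..T} f" "\<And>t. 0 <= f t" and n: "n <= N"
  shows "(\<Sum>j<n. LBINT t:{grid T N j<..grid T N (Suc j)}. f t) <= (LBINT t:{0..T}. (f t :: real))"
proof -
  have "(\<Sum>j<n. LBINT t:{grid T N j<..grid T N (Suc j)}. f t) = (LBINT t:{0<..grid T N n}. f t)" using n
  proof (induction n)
    case 0 thus ?case by (simp add: set_lebesgue_integral_def)
  next
    case (Suc n)
    have le: "0 <= grid T N n" "grid T N n <= grid T N (Suc n)" "grid T N (Suc n) <= T"
      using Suc.prems grid_range[of n] grid_range[of "Suc n"] chain_le[OF grid_increasing, of n "Suc n"] by auto
    have e: "{0<..grid T N (Suc n)} = {0<..grid T N n} \<union> {grid T N n<..grid T N (Suc n)}" using le by auto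
    have "(LBINT t:{0<..grid T N (Suc n)}. f t) = (LBINT t:{0<..grid T N n}. f t) + (LBINT t:{grid T N n<..grid T N (Suc n)}. f t)"
      unfolding e using le by (intro set_integral_Un set_integrable_subset[OF f(1)]) auto
    thus ?case using Suc by simp
  qed
  also have "\<dots> <= (LBINT t:{0..T}. f t)"
    using grid_range[OF n] f unfolding set_lebesgue_integral_def
    by (intro integral_mono set_integrable_subset[OF f(1), unfolded set_integrable_def] f(1)[unfolded set_integrable_def]) (auto simp: indicator_def)
  finally show ?thesis .
qed

lemma sq_norm_step_avg_le:
  assumes h: "sq_int T h"
  shows "sq_norm T (step_avg T N h) <= sq_norm T h"
proof -
  obtain n where n: "N = Suc n" using N by (cases N) auto
  have "sq_norm T (step_avg T N h) = (\<Sum>j<n. (cell_avg T N h (Suc j))\<^sup>2 * (T / real N))"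
    unfolding sq_norm_step_avg unfolding n sum.lessThan_Suc_shift by (simp add: cell_avg_def)
  also have "\<dots> <= (\<Sum>j<n. LBINT t:{grid T N j<..grid T N (Suc j)}. (h t)\<^sup>2)"
    using n by (intro sum_mono cell_avg_square_le[OF h]) auto
  also have "\<dots> <= sq_norm T h" unfolding sq_norm_def
    using h n by (intro sum_cells_le) (auto simp: sq_int_def)
  finally show ?thesis .
qed

lemma cell_avg_abs_le:
  assumes h: "set_integrable lborel {0..T} h" and c: "\<And>t. \<bar>h t\<bar> <= c" and j: "j < N"
  shows "\<bar>cell_avg T N h j\<bar> <= c"
proof (cases j)
  case (Suc i)
  have c0: "c >= 0" using c[of 0] by linarith
  let ?A = "{grid T N i<..grid T N j}"
  have iN: "i < N" using j Suc by simp
  have LA: "(LBINT t:?A. c) = c * (T / real N)"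
    using chain_le[OF grid_increasing, of i "Suc i"] iN grid_Suc[of i] Suc by (simp add: set_lebesgue_integral_def)
  have "\<bar>LBINT t:?A. h t\<bar> <= (LBINT t:?A. \<bar>h t\<bar>)"
    unfolding set_lebesgue_integral_def by (rule order_trans[OF integral_abs_bound]) (simp add: abs_mult)
  also have "\<dots> <= (LBINT t:?A. c)"
    using set_integrable_cell[OF h iN] set_integrable_cell[OF sq_int_integrable[OF sq_int_const] iN] c Suc
    by (intro set_integral_mono set_integrable_abs) auto
  finally have "\<bar>LBINT t:?A. h t\<bar> <= c * (T / real N)" unfolding LA .
  hence "(real N / T) * \<bar>LBINT t:?A. h t\<bar> <= (real N / T) * (c * (T / real N))"
    using T N by (intro mult_left_mono) auto
  also have "\<dots> = c" using T N by simp
  finally show ?thesis using Suc T N by (simp add: cell_avg_def abs_mult)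
qed (use c[of 0] in \<open>auto simp: cell_avg_def\<close>)

end

text \<open>
  The cell of \<open>t\<close> and the one before it shrink to \<open>t\<close>. The first cell, where the step function is zero by
  convention, does not contain \<open>t > 0\<close> once the mesh is small.
\<close>

lemma step_avg_tendsto_continuous:
  assumes T: "0 < T" and g: "continuous_on UNIV g" and t: "0 < t" "t <= T"
  shows "(\<lambda>n. step_avg T (Suc n) g t) \<longlonglongrightarrow> g t"
proof (rule LIMSEQ_I)
  fix r :: real assume r: "r > 0"
  have "isCont g t" using g by (simp add: continuous_on_eq_continuous_at)
  then obtain d where d: "d > 0" "\<And>s. \<bar>s - t\<bar> < d ==> \<bar>g s - g t\<bar> < r / 2"
    using r unfolding continuous_at_eps_delta dist_real_def by (metis half_gt_zero)
  obtain n0 where n0: "2 * T / real (Suc n0) < min d t"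
  proof -
    have "\<exists>n::nat. 2 * T / min d t < real n" by (rule reals_Archimedean2)
    then obtain n :: nat where "2 * T / min d t < real n" by auto
    hence "2 * T / min d t < real (Suc n)" by simp
    hence "2 * T < real (Suc n) * min d t" using d t by (simp only: pos_divide_less_eq min_less_iff_conj)
    hence "2 * T / real (Suc n) < min d t" by (subst pos_divide_less_eq) (simp_all only: mult.commute of_nat_0_less_iff zero_less_Suc)
    thus ?thesis using that by blast
  qed
  show "\<exists>no. \<forall>n\<ge>no. norm (step_avg T (Suc n) g t - g t) < r"
  proof (intro exI allI impI)
    fix n assume n: "n >= n0"
    let ?N = "Suc n"
    have "2 * T / real ?N <= 2 * T / real (Suc n0)" using n T by (intro divide_left_mono) auto
    hence small: "2 * T / real ?N < d" "2 * T / real ?N < t" using n0 by auto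
    obtain j where j: "j < ?N" "grid T ?N j < t" "t <= grid T ?N (Suc j)"
      by (rule chain_cell_exists[of "grid T ?N" t ?N]) (use t grid_N[OF T] grid_0[OF T] in auto)
    have gs: "grid T ?N (Suc i) - grid T ?N i = T / real ?N" for i by (rule grid_Suc[OF T]) simp
    have Tn: "2 * T / real ?N = T / real ?N + T / real ?N" by simp
    have "j \<noteq> 0"
    proof
      assume "j = 0"
      hence "t <= T / real ?N" using j gs[of 0] by (simp add: grid_def)
      moreover have "T / real ?N > 0" using T by simp
      ultimately show False using small Tn by linarith
    qed
    then obtain i where i: "j = Suc i" by (cases j) auto
    let ?A = "{grid T ?N i<..grid T ?N j}"
    have iN: "i < ?N" using i j by simp
    have gi: "set_integrable lborel {0..T} g"
      by (rule borel_integrable_atLeastAtMost') (rule continuous_on_subset[OF g], simp)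
    have giA: "set_integrable lborel ?A g" using set_integrable_cell[OF T _ gi iN] i by simp
    have ci: "set_integrable lborel ?A (\<lambda>_. c)" for c :: real
      using set_integrable_cell[OF T _ sq_int_integrable[OF sq_int_const] iN] i by simp
    have LA: "(LBINT s:?A. c) = c * (T / real ?N)" for c
      using chain_le[OF grid_increasing[OF T], of ?N i "Suc i"] iN gs[of i] i by (simp add: set_lebesgue_integral_def)
    have near: "\<bar>g s - g t\<bar> <= r / 2" if "s \<in> ?A" for s
    proof -
      have "\<bar>s - t\<bar> < d" using that j gs[of i] gs[of j] small Tn i by auto
      thus ?thesis using d(2) by (simp add: less_imp_le)
    qed
    have up: "(LBINT s:?A. g s) <= (LBINT s:?A. g t + r / 2)" by (intro set_integral_mono giA ci) (drule near, linarith)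
    have lo: "(LBINT s:?A. g t - r / 2) <= (LBINT s:?A. g s)" by (intro set_integral_mono giA ci) (drule near, linarith)
    have TN: "T / real ?N > 0" using T by simp
    have "step_avg T ?N g t = (LBINT s:?A. g s) / (T / real ?N)"
      using step_avg_eval[OF T _ j] i by (simp add: cell_avg_def)
    moreover have "(LBINT s:?A. g s) / (T / real ?N) <= g t + r / 2" using up unfolding LA by (simp only: pos_divide_le_eq[OF TN])
    moreover have "g t - r / 2 <= (LBINT s:?A. g s) / (T / real ?N)" using lo unfolding LA by (simp only: pos_le_divide_eq[OF TN])
    ultimately show "norm (step_avg T ?N g t - g t) < r" using r by auto
  qed
qed

lemma tendsto_sq_norm_dominated:
  assumes "\<And>n. set_borel_measurable lborel {0..T} (f n)" and "AE t in lborel. t \<in> {0..T} \<longrightarrow> (\<lambda>n. f n t) \<longlonglongrightarrow> 0"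
    and "\<And>n t. t \<in> {0..T} ==> \<bar>f n t\<bar> <= \<bar>w t\<bar>" "sq_int T w"
  shows "(\<lambda>n. sq_norm T (f n)) \<longlonglongrightarrow> 0"
proof -
  have "(\<lambda>n. \<integral>t. indicator {0..T} t *\<^sub>R (f n t)\<^sup>2 \<partial>lborel) \<longlonglongrightarrow> (\<integral>t. 0 \<partial>(lborel :: real measure))"
  proof (rule integral_dominated_convergence)
    show "integrable lborel (\<lambda>t. indicator {0..T} t *\<^sub>R (w t)\<^sup>2)" using assms(4) by (simp add: sq_int_def set_integrable_def)
    show "(\<lambda>t. indicator {0..T} t *\<^sub>R (f n t)\<^sup>2) \<in> borel_measurable lborel" for n
    proof -
      have "(\<lambda>t. (indicator {0..T} t *\<^sub>R f n t)\<^sup>2) \<in> borel_measurable lborel"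
        using assms(1)[of n] unfolding set_borel_measurable_def by (rule borel_measurable_power)
      moreover have "(\<lambda>t. (indicator {0..T} t *\<^sub>R f n t)\<^sup>2) = (\<lambda>t. indicator {0..T} t *\<^sub>R (f n t)\<^sup>2)" by (auto simp: indicator_def)
      ultimately show ?thesis by simp
    qed
    show "AE t in lborel. (\<lambda>n. indicator {0..T} t *\<^sub>R (f n t)\<^sup>2) \<longlonglongrightarrow> 0"
      using assms(2)
    proof eventually_elim
      case (elim t)
      show ?case
      proof (cases "t \<in> {0..T}")
        case True
        with elim have "(\<lambda>n. (f n t)\<^sup>2) \<longlonglongrightarrow> 0\<^sup>2" by (intro tendsto_intros) auto
        thus ?thesis using True by simp
      qed simp
    qed
    show "AE t in lborel. norm (indicator {0..T} t *\<^sub>R (f n t)\<^sup>2) <= indicator {0..T} t *\<^sub>R (w t)\<^sup>2" for n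
      using assms(3) by (intro AE_I2) (auto simp: indicator_def abs_le_square_iff[symmetric])
  qed simp
  thus ?thesis by (simp add: sq_norm_def set_lebesgue_integral_def)
qed

lemma sq_int_continuous:
  assumes "continuous_on UNIV g" shows "sq_int T g"
  unfolding sq_int_def
proof
  have "g \<in> borel_measurable borel" using assms by (rule borel_measurable_continuous_onI)
  thus "set_borel_measurable lborel {0..T} g" unfolding set_borel_measurable_def by auto
  show "set_integrable lborel {0..T} (\<lambda>t. (g t)\<^sup>2)"
    by (intro borel_integrable_atLeastAtMost' continuous_intros continuous_on_subset[OF assms]) auto
qed

lemma step_avg_tendsto_sq_continuous:
  assumes T: "0 < T" and g: "continuous_on UNIV g" and b: "\<And>t. \<bar>g t\<bar> <= c"
  shows "(\<lambda>n. sq_norm T (\<lambda>t. step_avg T (Suc n) g t - g t)) \<longlonglongrightarrow> 0"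
proof (rule tendsto_sq_norm_dominated[where w="\<lambda>_. 2 * c"])
  have gs: "sq_int T g" by (rule sq_int_continuous[OF g])
  show "set_borel_measurable lborel {0..T} (\<lambda>t. step_avg T (Suc n) g t - g t)" for n
    using sq_int_diff[OF sq_int_step_avg[OF T] gs, of "Suc n" g] by (simp add: sq_int_def)
  have "AE t in lborel. t \<noteq> (0::real)" by (rule AE_lborel_singleton)
  thus "AE t in lborel. t \<in> {0..T} \<longrightarrow> (\<lambda>n. step_avg T (Suc n) g t - g t) \<longlonglongrightarrow> 0"
    by eventually_elim (auto intro!: LIM_zero step_avg_tendsto_continuous[OF T g])
  fix n t assume "t \<in> {0..T}"
  have c0: "c >= 0" using b[of 0] by linarith
  have "\<bar>step_avg T (Suc n) g t\<bar> <= c"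
  proof (cases "0 < t \<and> t <= T")
    case True
    obtain j where j: "j < Suc n" "grid T (Suc n) j < t" "t <= grid T (Suc n) (Suc j)"
      by (rule chain_cell_exists[of "grid T (Suc n)" t "Suc n"]) (use True grid_N[OF T] grid_0[OF T] in auto)
    show ?thesis unfolding step_avg_eval[OF T zero_less_Suc j]
      by (rule cell_avg_abs_le[OF T zero_less_Suc sq_int_integrable[OF gs] b j(1)])
  next
    case False
    hence "step_avg T (Suc n) g t = 0" unfolding step_avg_def
      by (intro simple_process_outside[OF grid_increasing[OF T]]) (auto simp: grid_0[OF T] grid_N[OF T])
    thus ?thesis using c0 by simp
  qed
  thus "\<bar>step_avg T (Suc n) g t - g t\<bar> <= \<bar>2 * c\<bar>" using b[of t] by linarith
qed simp

lemma tendsto_clip: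
  assumes "sq_int T h"
  shows "(\<lambda>n. sq_norm T (\<lambda>t. clip (real n) (h t) - h t)) \<longlonglongrightarrow> 0"
proof (rule tendsto_sq_norm_dominated[where w="h"])
  show "set_borel_measurable lborel {0..T} (\<lambda>t. clip (real n) (h t) - h t)" for n
    using sq_int_diff[OF sq_int_clip[OF assms, of "real n"] assms] by (simp add: sq_int_def)
  have "(\<lambda>n. clip (real n) x - x) \<longlonglongrightarrow> 0" for x
  proof -
    have "eventually (\<lambda>n. clip (real n) x - x = 0) sequentially"
      using eventually_ge_at_top[of "nat \<lceil>\<bar>x\<bar>\<rceil>"] by eventually_elim (auto intro!: clip_id simp: le_nat_iff nat_le_iff ceiling_le_iff)
    thus ?thesis by (rule tendsto_eventually)
  qed
  thus "AE t in lborel. t \<in> {0..T} \<longrightarrow> (\<lambda>n. clip (real n) (h t) - h t) \<longlonglongrightarrow> 0" by simp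
qed (use assms in \<open>auto simp: clip_diff_le\<close>)

text \<open>
  Density of the continuous functions in \<open>L\<^sup>2\<close>; averaging is a contraction, so convergence of the averages
  passes from continuous functions to all square integrable ones.
\<close>

lemma sq_int_approx_continuous:
  assumes h: "sq_int T h" and \<epsilon>: "\<epsilon> > 0"
  shows "\<exists>g c. continuous_on UNIV g \<and> (\<forall>t. \<bar>g t\<bar> <= c) \<and> sq_norm T (\<lambda>t. h t - g t) < \<epsilon>"
proof -
  have "eventually (\<lambda>n. sq_norm T (\<lambda>t. clip (real n) (h t) - h t) < \<epsilon> / 4) sequentially"
    by (rule order_tendstoD[OF tendsto_clip[OF h]]) (use \<epsilon> in simp)
  then obtain m :: nat where m: "sq_norm T (\<lambda>t. clip (real m) (h t) - h t) < \<epsilon> / 4"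
    unfolding eventually_sequentially by blast
  define k where "k t = clip (real m) (h t)" for t
  have ks: "sq_int T k" unfolding k_def[abs_def] by (rule sq_int_clip[OF h]) simp
  have km: "(\<lambda>t. indicator {0..T} t *\<^sub>R k t) \<in> borel_measurable lborel" using ks by (simp add: sq_int_def set_borel_measurable_def)
  hence "(\<lambda>t. indicator {0..T} t *\<^sub>R k t) \<in> borel_measurable lebesgue" by (rule measurable_completion)
  hence "(\<lambda>t. indicator {0..T} t *\<^sub>R k t) measurable_on UNIV" by (rule lebesgue_measurable_imp_measurable_on_real) auto
  then obtain Ng G where Ng: "negligible Ng" and G: "\<And>n. continuous_on UNIV (G n :: real => real)"
    and lim: "\<And>x. x \<notin> Ng ==> (\<lambda>n. G n x) \<longlonglongrightarrow> indicator {0..T} x *\<^sub>R k x"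
    unfolding measurable_on_def by auto
  have kb: "\<bar>k t\<bar> <= real m" for t unfolding k_def by (rule clip_abs_le) simp
  have cc: "continuous_on UNIV (\<lambda>t. clip (real m) (G n t))" for n by (rule clip_cont[OF G])
  have "(\<lambda>n. sq_norm T (\<lambda>t. k t - clip (real m) (G n t))) \<longlonglongrightarrow> 0"
  proof (rule tendsto_sq_norm_dominated[where w="\<lambda>_. 2 * real m"])
    show "set_borel_measurable lborel {0..T} (\<lambda>t. k t - clip (real m) (G n t))" for n
      using sq_int_diff[OF ks sq_int_continuous[OF cc, of T n]] by (simp add: sq_int_def)
    have "Ng \<in> null_sets lebesgue" using Ng by (simp add: negligible_iff_null_sets)
    hence "AE t in lebesgue. t \<notin> Ng" by (rule AE_not_in)
    hence "AE t in lborel. t \<notin> Ng" by (simp add: AE_completion_iff)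
    thus "AE t in lborel. t \<in> {0..T} \<longrightarrow> (\<lambda>n. k t - clip (real m) (G n t)) \<longlonglongrightarrow> 0"
    proof eventually_elim
      case (elim t)
      show ?case
      proof
      assume t: "t \<in> {0..T}"
      have "(\<lambda>n. G n t) \<longlonglongrightarrow> k t" using lim[OF elim] t by simp
      hence "(\<lambda>n. clip (real m) (G n t)) \<longlonglongrightarrow> clip (real m) (k t)" unfolding clip_def by (intro tendsto_intros)
      also have "clip (real m) (k t) = k t" by (rule clip_id[OF kb])
      finally show "(\<lambda>n. k t - clip (real m) (G n t)) \<longlonglongrightarrow> 0" using tendsto_diff[OF tendsto_const[of "k t"], of "\<lambda>n. clip (real m) (G n t)" "k t"] by simp
      qed
    qed
    show "\<bar>k t - clip (real m) (G n t)\<bar> <= \<bar>2 * real m\<bar>" for n t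
      using kb[of t] clip_abs_le[of "real m" "G n t"] by simp
  qed simp
  hence "eventually (\<lambda>n. sq_norm T (\<lambda>t. k t - clip (real m) (G n t)) < \<epsilon> / 4) sequentially"
    by (rule order_tendstoD) (use \<epsilon> in simp)
  then obtain n where n: "sq_norm T (\<lambda>t. k t - clip (real m) (G n t)) < \<epsilon> / 4"
    unfolding eventually_sequentially by blast
  let ?g = "\<lambda>t. clip (real m) (G n t)"
  have "sq_norm T (\<lambda>t. h t - ?g t) <= 2 * sq_norm T (\<lambda>t. h t - k t) + 2 * sq_norm T (\<lambda>t. k t - ?g t)"
    by (rule sq_norm_diff_le[OF h ks sq_int_continuous[OF cc]])
  also have "\<dots> < \<epsilon>" using m n sq_norm_diff_commute[of T h k] by (simp add: k_def)
  finally have "sq_norm T (\<lambda>t. h t - ?g t) < \<epsilon>" .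
  thus ?thesis using cc[of n] clip_abs_le[of "real m"] by (intro exI[of _ ?g] exI[of _ "real m"]) auto
qed

text \<open>The adapted step approximations: clip, then average over the preceding cell.\<close>

definition lag :: "real => nat => (real => real) => nat => real" where
  "lag T n h j = cell_avg T (Suc n) (\<lambda>t. clip (real n) (h t)) j"

definition lag_step :: "real => nat => (real => real) => real => real" where
  "lag_step T n h = step_avg T (Suc n) (\<lambda>t. clip (real n) (h t))"

lemma sq_int_lag_step: "0 < T ==> sq_int T (lag_step T n h)"
  unfolding lag_step_def by (rule sq_int_step_avg) auto

lemma sq_norm_lag_step_le:
  assumes "0 < T" "sq_int T h"
  shows "sq_norm T (lag_step T n h) <= sq_norm T h"
proof -
  have "sq_norm T (lag_step T n h) <= sq_norm T (\<lambda>t. clip (real n) (h t))"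
    unfolding lag_step_def by (rule sq_norm_step_avg_le[OF assms(1) _ sq_int_clip[OF assms(2)]]) auto
  also have "\<dots> <= sq_norm T h" by (rule sq_norm_mono[OF sq_int_clip[OF assms(2)] assms(2)]) (auto intro: clip_abs_le2)
  finally show ?thesis .
qed

text \<open>
  Clipping at height \<open>n\<close> keeps the values bounded, as simple integrands require, and is harmless in the
  limit.
\<close>

lemma lag_step_tendsto:
  assumes T: "0 < T" and h: "sq_int T h"
  shows "(\<lambda>n. sq_norm T (\<lambda>t. lag_step T n h t - h t)) \<longlonglongrightarrow> 0"
proof (rule LIMSEQ_I)
  fix r :: real assume r: "r > 0"
  obtain g c where g: "continuous_on UNIV g" "\<And>t. \<bar>g t\<bar> <= c" "sq_norm T (\<lambda>t. h t - g t) < r / 32"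
    using sq_int_approx_continuous[OF h, of "r / 32"] r by auto
  have gs: "sq_int T g" by (rule sq_int_continuous[OF g(1)])
  have e1: "eventually (\<lambda>n. sq_norm T (\<lambda>t. clip (real n) (h t) - h t) < r / 32) sequentially"
    by (rule order_tendstoD[OF tendsto_clip[OF h]]) (use r in simp)
  have e2: "eventually (\<lambda>n. sq_norm T (\<lambda>t. step_avg T (Suc n) g t - g t) < r / 32) sequentially"
    by (rule order_tendstoD[OF step_avg_tendsto_sq_continuous[OF T g(1,2)]]) (use r in simp)
  have "eventually (\<lambda>n. norm (sq_norm T (\<lambda>t. lag_step T n h t - h t) - 0) < r) sequentially"
    using e1 e2
  proof eventually_elim
    case (elim n)
    let ?A = "step_avg T (Suc n)"
    have hc: "sq_int T (\<lambda>t. clip (real n) (h t))" by (rule sq_int_clip[OF h]) simp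
    have d: "sq_int T (\<lambda>t. clip (real n) (h t) - g t)" by (rule sq_int_diff[OF hc gs])
    have "sq_norm T (\<lambda>t. lag_step T n h t - ?A g t) = sq_norm T (?A (\<lambda>t. clip (real n) (h t) - g t))"
    proof -
      have "lag_step T n h t = ?A (\<lambda>t. clip (real n) (h t) - g t) t + ?A g t" for t
        unfolding lag_step_def using step_avg_add[OF T zero_less_Suc sq_int_integrable[OF d] sq_int_integrable[OF gs], of n t] by simp
      thus ?thesis by simp
    qed
    also have "\<dots> <= sq_norm T (\<lambda>t. clip (real n) (h t) - g t)" by (rule sq_norm_step_avg_le[OF T _ d]) simp
    also have "\<dots> <= 2 * sq_norm T (\<lambda>t. clip (real n) (h t) - h t) + 2 * sq_norm T (\<lambda>t. h t - g t)"
      by (rule sq_norm_diff_le[OF hc h gs])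
    finally have 1: "sq_norm T (\<lambda>t. lag_step T n h t - ?A g t) < r / 8" using elim g(3) by simp
    have 2: "sq_norm T (\<lambda>t. ?A g t - h t) <= 2 * sq_norm T (\<lambda>t. ?A g t - g t) + 2 * sq_norm T (\<lambda>t. g t - h t)"
      by (rule sq_norm_diff_le[OF sq_int_step_avg[OF T] gs h]) simp
    have 3: "sq_norm T (\<lambda>t. lag_step T n h t - h t) <= 2 * sq_norm T (\<lambda>t. lag_step T n h t - ?A g t) + 2 * sq_norm T (\<lambda>t. ?A g t - h t)"
      by (rule sq_norm_diff_le[OF sq_int_lag_step[OF T] sq_int_step_avg[OF T] h]) simp
    show ?case using 1 2 3 elim g(3) sq_norm_diff_commute[of T g h] r by simp
  qed
  thus "\<exists>no. \<forall>n\<ge>no. norm (sq_norm T (\<lambda>t. lag_step T n h t - h t) - 0) < r" unfolding eventually_sequentially .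
qed

section \<open>Exponentials of simple integrals\<close>

text \<open>
  The contribution of cell \<open>i\<close> to density and phase, for one of the two Brownian motions.
\<close>

definition exp_cell :: "(real => 'a => real) => (nat => real) => (nat => 'a => real) => (nat => real) => nat => 'a => complex" where
  "exp_cell Z \<tau> \<xi> a i om =
    complex_of_real (exp (- \<xi> i om * (Z (\<tau> (Suc i)) om - Z (\<tau> i) om) - (\<xi> i om)\<^sup>2 * (\<tau> (Suc i) - \<tau> i) / 2)) *
    iexp (a i * (Z (\<tau> (Suc i)) om - Z (\<tau> i) om + \<xi> i om * (\<tau> (Suc i) - \<tau> i)))"

lemma simple_integrand_increasing: "simple_integrand F T n \<tau> \<xi> ==> increasing_upto n \<tau>"
  and simple_integrand_ends: "simple_integrand F T n \<tau> \<xi> ==> \<tau> 0 = 0" "simple_integrand F T n \<tau> \<xi> ==> \<tau> n = T"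
  by (auto simp: simple_integrand_def increasing_upto_def)

lemma simple_integrand_range:
  assumes "simple_integrand F T n \<tau> \<xi>" "i <= n"
  shows "0 <= \<tau> i" "\<tau> i <= T"
  using chain_le[OF simple_integrand_increasing[OF assms(1)], of 0 i] chain_le[OF simple_integrand_increasing[OF assms(1)], of i n]
    simple_integrand_ends[OF assms(1)] assms(2) by auto

context bm_pair
begin

lemma exp_cell_measurable:
  assumes \<xi>: "simple_integrand F T n \<tau> \<xi>" and i: "i < n" and Z: "brownian_motion M F T Z"
  shows "exp_cell Z \<tau> \<xi> a i \<in> borel_measurable (F (\<tau> (Suc i)))"
proof -
  have r: "0 <= \<tau> i" "\<tau> i <= \<tau> (Suc i)" "\<tau> (Suc i) <= T"
    using simple_integrand_range[OF \<xi>, of i] simple_integrand_range[OF \<xi>, of "Suc i"] chain_le[OF simple_integrand_increasing[OF \<xi>], of i "Suc i"] i by auto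
  have [measurable]: "\<xi> i \<in> borel_measurable (F (\<tau> (Suc i)))"
    using \<xi> i by (intro F_measurable_mono[OF _ r]) (auto simp: simple_integrand_def)
  have [measurable]: "Z (\<tau> i) \<in> borel_measurable (F (\<tau> (Suc i)))" "Z (\<tau> (Suc i)) \<in> borel_measurable (F (\<tau> (Suc i)))"
    using bm_measurable(1)[OF Z] r by auto
  show ?thesis unfolding exp_cell_def[abs_def] by measurable
qed

lemma exp_cell_step:
  assumes \<xi>: "simple_integrand F T n \<tau> \<xi>" and \<eta>: "simple_integrand F T n \<tau> \<eta>" and i: "i < n"
    and Y: "integrable M Y" "Y \<in> borel_measurable (F (\<tau> i))"
  shows "has_bochner_integral M (\<lambda>om. Y om * (exp_cell W \<tau> \<xi> a i om * exp_cell B \<tau> \<eta> b i om))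
    ((CLINT om|M. Y om) * complex_of_real (exp (- (((a i)\<^sup>2 + (b i)\<^sup>2) * (\<tau> (Suc i) - \<tau> i)) / 2)))"
proof -
  have r: "0 <= \<tau> i" "\<tau> (Suc i) <= T" and lt: "\<tau> i < \<tau> (Suc i)"
    using simple_integrand_range[OF \<xi>, of i] simple_integrand_range[OF \<xi>, of "Suc i"] simple_integrand_increasing[OF \<xi>] i by (auto simp: increasing_upto_def)
  interpret G: gaussian_step M "F (\<tau> i)" "\<lambda>x. (W (\<tau> (Suc i)) x - W (\<tau> i) x) / sqrt (\<tau> (Suc i) - \<tau> i)" "\<lambda>x. (B (\<tau> (Suc i)) x - B (\<tau> i) x) / sqrt (\<tau> (Suc i) - \<tau> i)"
    by (rule bm_pair_gaussian_step[OF r(1) lt r(2)])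
  define s where "s = sqrt (\<tau> (Suc i) - \<tau> i)"
  have s: "s > 0" "s\<^sup>2 = \<tau> (Suc i) - \<tau> i" using lt by (auto simp: s_def)
  have [measurable]: "\<xi> i \<in> borel_measurable (F (\<tau> i))" "\<eta> i \<in> borel_measurable (F (\<tau> i))"
    using \<xi> \<eta> i by (auto simp: simple_integrand_def)
  have m: "(\<lambda>x. \<xi> i x * s) \<in> borel_measurable (F (\<tau> i))" "(\<lambda>x. \<eta> i x * s) \<in> borel_measurable (F (\<tau> i))" by measurable
  have e1: "exp (- (x * s) * (w / s) - (x * s)\<^sup>2 / 2) = exp (- x * w - x\<^sup>2 * (\<tau> (Suc i) - \<tau> i) / 2)" for x w
    unfolding s(2)[symmetric] using s(1) by (simp add: power_mult_distrib)
  have e2: "(c * s) * (w / s + x * s) = c * (w + x * (\<tau> (Suc i) - \<tau> i))" for c x w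
    unfolding s(2)[symmetric] using s(1) by (simp add: power2_eq_square field_simps)
  have e3: "- ((c * s)\<^sup>2 + (d * s)\<^sup>2) / 2 = - ((c\<^sup>2 + d\<^sup>2) * (\<tau> (Suc i) - \<tau> i)) / 2" for c d
    unfolding s(2)[symmetric] by (simp add: power_mult_distrib algebra_simps)
  from G.exponential_step[OF Y m, of "a i * s" "b i * s"] show ?thesis
    unfolding s_def[symmetric] e1 e2 e3 exp_cell_def .
qed

text \<open>
  Given the past of the last cell, its factor integrates to \<open>exp (- (a\<^sup>2 + b\<^sup>2) * length / 2)\<close> whatever the
  random coefficients are, so the cells can be removed one after the other.
\<close>

lemma exp_cells_from:
  assumes \<xi>: "simple_integrand F T n \<tau> \<xi>" and \<eta>: "simple_integrand F T n \<tau> \<eta>"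
    and Y: "integrable M Y" "Y \<in> borel_measurable (F (\<tau> p))" and m: "p <= m" "m <= n"
  shows "has_bochner_integral M (\<lambda>om. Y om * (\<Prod>i\<in>{p..<m}. exp_cell W \<tau> \<xi> a i om * exp_cell B \<tau> \<eta> b i om))
    ((CLINT om|M. Y om) * complex_of_real (exp (- (\<Sum>i\<in>{p..<m}. ((a i)\<^sup>2 + (b i)\<^sup>2) * (\<tau> (Suc i) - \<tau> i)) / 2)))
    \<and> (\<lambda>om. Y om * (\<Prod>i\<in>{p..<m}. exp_cell W \<tau> \<xi> a i om * exp_cell B \<tau> \<eta> b i om)) \<in> borel_measurable (F (\<tau> m))"
  using m
proof (induction m rule: dec_induct)
  case base
  show ?case using Y by (simp add: has_bochner_integral_iff)
next
  case (step m)
  have m: "m < n" using step by simp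
  let ?Q = "\<lambda>om. Y om * (\<Prod>i\<in>{p..<m}. exp_cell W \<tau> \<xi> a i om * exp_cell B \<tau> \<eta> b i om)"
  have IH: "has_bochner_integral M ?Q ((CLINT om|M. Y om) * complex_of_real (exp (- (\<Sum>i\<in>{p..<m}. ((a i)\<^sup>2 + (b i)\<^sup>2) * (\<tau> (Suc i) - \<tau> i)) / 2)))"
    "?Q \<in> borel_measurable (F (\<tau> m))" using step by auto
  have Qi: "integrable M ?Q" "(CLINT om|M. ?Q om) = (CLINT om|M. Y om) * complex_of_real (exp (- (\<Sum>i\<in>{p..<m}. ((a i)\<^sup>2 + (b i)\<^sup>2) * (\<tau> (Suc i) - \<tau> i)) / 2))"
    using IH(1) by (auto simp: has_bochner_integral_iff)
  have pr: "(\<Prod>i\<in>{p..<Suc m}. f i) = (\<Prod>i\<in>{p..<m}. f i) * f m" for f :: "nat => complex" using step by simp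
  have sr: "(\<Sum>i\<in>{p..<Suc m}. f i) = (\<Sum>i\<in>{p..<m}. f i) + f m" for f :: "nat => real" using step by simp
  have ex: "complex_of_real (exp (- (x + y) / 2)) = complex_of_real (exp (- x / 2)) * complex_of_real (exp (- y / 2))" for x y
    by (simp add: exp_add[symmetric] add_divide_distrib diff_divide_distrib flip: of_real_mult)
  have r: "0 <= \<tau> m" "\<tau> m <= \<tau> (Suc m)" "\<tau> (Suc m) <= T"
    using simple_integrand_range[OF \<xi>, of m] simple_integrand_range[OF \<xi>, of "Suc m"] chain_le[OF simple_integrand_increasing[OF \<xi>], of m "Suc m"] m by auto
  have 1: "(\<lambda>om. Y om * (\<Prod>i\<in>{p..<Suc m}. exp_cell W \<tau> \<xi> a i om * exp_cell B \<tau> \<eta> b i om)) = (\<lambda>om. ?Q om * (exp_cell W \<tau> \<xi> a m om * exp_cell B \<tau> \<eta> b m om))"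
    unfolding pr by (simp add: mult.assoc)
  have "?Q \<in> borel_measurable (F (\<tau> (Suc m)))" by (rule F_measurable_mono[OF IH(2) r])
  hence 2: "(\<lambda>om. ?Q om * (exp_cell W \<tau> \<xi> a m om * exp_cell B \<tau> \<eta> b m om)) \<in> borel_measurable (F (\<tau> (Suc m)))"
    by (rule borel_measurable_times[OF _ borel_measurable_times[OF exp_cell_measurable[OF \<xi> m bW, of a] exp_cell_measurable[OF \<eta> m bB, of b]]])
  show ?case unfolding 1 sr ex using exp_cell_step[OF \<xi> \<eta> m Qi(1) IH(2), of a b] 2 unfolding Qi(2)
    by (simp add: mult.assoc)
qed

definition simple_exp :: "nat => (nat => real) => (nat => 'a => real) => (nat => 'a => real) => 'a => real" where
  "simple_exp n \<tau> \<xi> \<eta> om = exp (- simple_ito_integral W n \<tau> \<xi> om - simple_ito_integral B n \<tau> \<eta> om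
     - (\<Sum>i<n. ((\<xi> i om)\<^sup>2 + (\<eta> i om)\<^sup>2) * (\<tau> (Suc i) - \<tau> i)) / 2)"

definition simple_phase :: "nat => (nat => real) => (nat => 'a => real) => (nat => 'a => real) => (nat => real) => (nat => real) => 'a => real" where
  "simple_phase n \<tau> \<xi> \<eta> a b om = simple_ito_integral W n \<tau> (\<lambda>i _. a i) om + simple_ito_integral B n \<tau> (\<lambda>i _. b i) om
     + (\<Sum>i<n. (a i * \<xi> i om + b i * \<eta> i om) * (\<tau> (Suc i) - \<tau> i))"

lemma prod_exp_cell:
  "(\<Prod>i<n. exp_cell W \<tau> \<xi> a i om * exp_cell B \<tau> \<eta> b i om) = complex_of_real (simple_exp n \<tau> \<xi> \<eta> om) * iexp (simple_phase n \<tau> \<xi> \<eta> a b om)"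
proof -
  have c: "exp_cell W \<tau> \<xi> a i om * exp_cell B \<tau> \<eta> b i om =
    complex_of_real (exp ((- \<xi> i om * (W (\<tau> (Suc i)) om - W (\<tau> i) om) - (\<xi> i om)\<^sup>2 * (\<tau> (Suc i) - \<tau> i) / 2) + (- \<eta> i om * (B (\<tau> (Suc i)) om - B (\<tau> i) om) - (\<eta> i om)\<^sup>2 * (\<tau> (Suc i) - \<tau> i) / 2)))
    * iexp (a i * (W (\<tau> (Suc i)) om - W (\<tau> i) om + \<xi> i om * (\<tau> (Suc i) - \<tau> i)) + b i * (B (\<tau> (Suc i)) om - B (\<tau> i) om + \<eta> i om * (\<tau> (Suc i) - \<tau> i)))" for i
    unfolding exp_cell_def by (simp only: exp_add of_real_add of_real_mult distrib_left mult.assoc mult.left_commute mult.commute)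
  have "(\<Prod>i<n. complex_of_real (exp (f i)) * iexp (g i)) = complex_of_real (exp (\<Sum>i<n. f i)) * iexp (\<Sum>i<n. g i)" for f g
    by (simp add: prod.distrib exp_sum sum_distrib_left)
  note pr = this
  have e: "(\<Sum>i<n. (- \<xi> i om * (W (\<tau> (Suc i)) om - W (\<tau> i) om) - (\<xi> i om)\<^sup>2 * (\<tau> (Suc i) - \<tau> i) / 2) + (- \<eta> i om * (B (\<tau> (Suc i)) om - B (\<tau> i) om) - (\<eta> i om)\<^sup>2 * (\<tau> (Suc i) - \<tau> i) / 2))
    = - simple_ito_integral W n \<tau> \<xi> om - simple_ito_integral B n \<tau> \<eta> om - (\<Sum>i<n. ((\<xi> i om)\<^sup>2 + (\<eta> i om)\<^sup>2) * (\<tau> (Suc i) - \<tau> i)) / 2"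
    unfolding simple_ito_integral_def sum_negf[symmetric] sum_divide_distrib sum_subtractf[symmetric]
    by (intro sum.cong refl) (simp add: distrib_right add_divide_distrib)
  have ph: "(\<Sum>i<n. a i * (W (\<tau> (Suc i)) om - W (\<tau> i) om + \<xi> i om * (\<tau> (Suc i) - \<tau> i)) + b i * (B (\<tau> (Suc i)) om - B (\<tau> i) om + \<eta> i om * (\<tau> (Suc i) - \<tau> i)))
    = simple_phase n \<tau> \<xi> \<eta> a b om"
    unfolding simple_phase_def simple_ito_integral_def sum.distrib[symmetric]
    by (intro sum.cong refl) (simp add: algebra_simps)
  show ?thesis unfolding c pr e ph simple_exp_def ..
qed

text \<open>
  The master identity for step integrands. Cells before \<open>s\<close> carry no phase, so they only reproduce the
  expectation of the density on \<open>A\<close>.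
\<close>

lemma simple_exp_phase:
  assumes \<xi>: "simple_integrand F T n \<tau> \<xi>" and \<eta>: "simple_integrand F T n \<tau> \<eta>"
    and s: "0 <= s" "s <= T" and A: "A \<in> sets (F s)"
    and ab: "\<And>i. i < n ==> \<tau> i < s ==> a i = 0 \<and> b i = 0"
  shows "(CLINT om|M. indicator A om * (complex_of_real (simple_exp n \<tau> \<xi> \<eta> om) * iexp (simple_phase n \<tau> \<xi> \<eta> a b om)))
     = (CLINT om|M. indicator A om * complex_of_real (simple_exp n \<tau> \<xi> \<eta> om)) * complex_of_real (exp (- (\<Sum>i<n. ((a i)\<^sup>2 + (b i)\<^sup>2) * (\<tau> (Suc i) - \<tau> i)) / 2))"
proof -
  note ends = simple_integrand_ends[OF \<xi>]
  define p where "p = (LEAST p. s <= \<tau> p)"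
  have ex: "s <= \<tau> n" using ends s by simp
  have sp: "s <= \<tau> p" unfolding p_def using ex by (rule LeastI)
  have pn: "p <= n" unfolding p_def using ex by (rule Least_le)
  have below: "\<tau> i < s" if "i < p" for i using not_less_Least[of i "\<lambda>p. s <= \<tau> p"] that unfolding p_def by simp
  let ?c = "\<lambda>a b i om. exp_cell W \<tau> \<xi> a i om * exp_cell B \<tau> \<eta> b i om"
  have split: "(\<Prod>i<n. f i) = (\<Prod>i\<in>{0..<p}. f i) * (\<Prod>i\<in>{p..<n}. f i)" for f :: "nat => complex"
    using pn by (simp add: prod.atLeastLessThan_concat lessThan_atLeast0)
  have ssplit: "(\<Sum>i<n. ((a i)\<^sup>2 + (b i)\<^sup>2) * (\<tau> (Suc i) - \<tau> i)) = (\<Sum>i\<in>{p..<n}. ((a i)\<^sup>2 + (b i)\<^sup>2) * (\<tau> (Suc i) - \<tau> i))"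
    using pn below ab by (intro sum.mono_neutral_right) auto
  define Y where "Y om = (\<Prod>i\<in>{0..<p}. ?c (\<lambda>_. 0) (\<lambda>_. 0) i om)" for om
  have Y0: "Y \<in> borel_measurable (F (\<tau> p))" "integrable M Y"
    using exp_cells_from[OF \<xi> \<eta>, of "\<lambda>_. 1" 0 p "\<lambda>_. 0" "\<lambda>_. 0"] pn by (auto simp: Y_def[abs_def] has_bochner_integral_iff)
  have Ysame: "(\<Prod>i\<in>{0..<p}. ?c a b i om) = Y om" for om
    unfolding Y_def using below ab pn by (intro prod.cong refl) (auto simp: exp_cell_def)
  have Ap: "A \<in> sets (F (\<tau> p))" using A F_mono[OF s(1) sp] simple_integrand_range[OF \<xi> pn] by auto
  have Y1: "(\<lambda>om. indicator A om * Y om) \<in> borel_measurable (F (\<tau> p))" using Y0(1) Ap by measurable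
  have AM: "A \<in> sets M" using A F_sets[of s] s by auto
  have Y2: "integrable M (\<lambda>om. indicator A om * Y om)"
    using AM by (subst mult.commute) (rule integrable_mult_bounded[OF Y0(2), where K=1], auto simp: indicator_def)
  note frm = exp_cells_from[OF \<xi> \<eta> Y2 Y1 pn order_refl, THEN conjunct1, THEN has_bochner_integral_integral_eq]
  have "(CLINT om|M. indicator A om * (complex_of_real (simple_exp n \<tau> \<xi> \<eta> om) * iexp (simple_phase n \<tau> \<xi> \<eta> a b om)))
    = (CLINT om|M. (indicator A om * Y om) * (\<Prod>i\<in>{p..<n}. ?c a b i om))"
    unfolding prod_exp_cell[symmetric] split Ysame by (simp add: mult.assoc)
  also have "\<dots> = (CLINT om|M. indicator A om * Y om) * complex_of_real (exp (- (\<Sum>i<n. ((a i)\<^sup>2 + (b i)\<^sup>2) * (\<tau> (Suc i) - \<tau> i)) / 2))"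
    unfolding frm ssplit ..
  also have "(CLINT om|M. indicator A om * Y om) = (CLINT om|M. (indicator A om * Y om) * (\<Prod>i\<in>{p..<n}. ?c (\<lambda>_. 0) (\<lambda>_. 0) i om))"
    unfolding frm by simp
  also have "\<dots> = (CLINT om|M. indicator A om * (complex_of_real (simple_exp n \<tau> \<xi> \<eta> om) * iexp (simple_phase n \<tau> \<xi> \<eta> (\<lambda>_. 0) (\<lambda>_. 0) om)))"
    unfolding prod_exp_cell[symmetric] split Y_def by (simp add: mult.assoc)
  also have "\<dots> = (CLINT om|M. indicator A om * complex_of_real (simple_exp n \<tau> \<xi> \<eta> om))"
    by (simp add: simple_phase_def simple_ito_integral_def)
  finally show ?thesis .
qed

lemma simple_exp_expectation:
  assumes \<xi>: "simple_integrand F T n \<tau> \<xi>" and \<eta>: "simple_integrand F T n \<tau> \<eta>"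
  shows "integrable M (simple_exp n \<tau> \<xi> \<eta>)" "(LINT om|M. simple_exp n \<tau> \<xi> \<eta> om) = 1"
proof -
  have "simple_phase n \<tau> \<xi> \<eta> (\<lambda>_. 0) (\<lambda>_. 0) om = 0" for om
    by (simp add: simple_phase_def simple_ito_integral_def)
  hence "(\<Prod>i\<in>{0..<n}. exp_cell W \<tau> \<xi> (\<lambda>_. 0) i om * exp_cell B \<tau> \<eta> (\<lambda>_. 0) i om) = complex_of_real (simple_exp n \<tau> \<xi> \<eta> om)" for om
    using prod_exp_cell[where n=n and \<tau>=\<tau> and \<xi>=\<xi> and \<eta>=\<eta> and a="\<lambda>_. 0" and b="\<lambda>_. 0" and om=om] by (simp add: lessThan_atLeast0)
  hence "has_bochner_integral M (\<lambda>om. complex_of_real (simple_exp n \<tau> \<xi> \<eta> om)) 1"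
    using exp_cells_from[OF \<xi> \<eta>, of "\<lambda>_. 1" 0 n "\<lambda>_. 0" "\<lambda>_. 0"] by (simp add: prob_space)
  hence "has_bochner_integral M (\<lambda>om. Re (complex_of_real (simple_exp n \<tau> \<xi> \<eta> om))) (Re 1)" by (rule has_bochner_integral_Re)
  thus "integrable M (simple_exp n \<tau> \<xi> \<eta>)" "(LINT om|M. simple_exp n \<tau> \<xi> \<eta> om) = 1"
    by (simp_all add: has_bochner_integral_iff)
qed

end

context filtered_space
begin

lemma simple_integrand_cmult:
  assumes "simple_integrand F T n \<tau> \<xi>" shows "simple_integrand F T n \<tau> (\<lambda>i om. c * \<xi> i om)"
  unfolding simple_integrand_def
proof (intro conjI allI impI)
  fix i assume i: "i < n"
  then obtain C where C: "\<And>om. om \<in> space (F (\<tau> i)) ==> \<bar>\<xi> i om\<bar> <= C" using assms unfolding simple_integrand_def by blast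
  show "(\<lambda>om. c * \<xi> i om) \<in> borel_measurable (F (\<tau> i))" using assms i by (auto simp: simple_integrand_def)
  show "\<exists>C. \<forall>om\<in>space (F (\<tau> i)). \<bar>c * \<xi> i om\<bar> <= C"
    using C by (intro exI[of _ "\<bar>c\<bar> * C"]) (auto simp: abs_mult intro!: mult_left_mono)
qed (use assms in \<open>auto simp: simple_integrand_def\<close>)

lemma simple_integrand_measurable_M:
  assumes "simple_integrand F T n \<tau> \<xi>" "i < n"
  shows "\<xi> i \<in> borel_measurable M"
  using F_measurable_M[of "\<xi> i" "\<tau> i" borel] assms simple_integrand_range[OF assms(1), of i] by (auto simp: simple_integrand_def)

lemma simple_ito_integral_measurable:
  assumes \<xi>: "simple_integrand F T n \<tau> \<xi>" and Z: "brownian_motion M F T Z"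
  shows "simple_ito_integral Z n \<tau> \<xi> \<in> borel_measurable M"
proof -
  have "\<xi> i \<in> borel_measurable M" "Z (\<tau> i) \<in> borel_measurable M" "Z (\<tau> (Suc i)) \<in> borel_measurable M" if "i < n" for i
    using simple_integrand_measurable_M[OF \<xi> that] bm_measurable(2)[OF Z, of "\<tau> i" T] bm_measurable(2)[OF Z, of "\<tau> (Suc i)" T]
      simple_integrand_range[OF \<xi>, of i] simple_integrand_range[OF \<xi>, of "Suc i"] that by auto
  thus ?thesis unfolding simple_ito_integral_def[abs_def] by (intro borel_measurable_sum) auto
qed

end

context bm_pair
begin

text \<open>
  Exponential Chebyshev inequality for the variable \<open>exp (l * S - l\<^sup>2 * q / 2)\<close> of mean one, with the
  optimal \<open>l = \<epsilon> / \<delta>\<close>. It bounds a stochastic integral in probability by its quadratic variation with no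
  moment assumption, which is what integrands that are only pathwise square integrable call for.
\<close>

lemma simple_tail_upper:
  assumes \<xi>: "simple_integrand F T n \<tau> \<xi>" and \<epsilon>: "\<epsilon> > 0" and \<delta>: "\<delta> > 0"
  shows "measure M {om \<in> space M. simple_ito_integral W n \<tau> \<xi> om > \<epsilon> \<and> (\<Sum>i<n. (\<xi> i om)\<^sup>2 * (\<tau> (Suc i) - \<tau> i)) <= \<delta>} <= exp (- (\<epsilon>\<^sup>2 / (2 * \<delta>)))"
proof -
  define l where "l = \<epsilon> / \<delta>"
  have l: "l > 0" using \<epsilon> \<delta> by (simp add: l_def)
  let ?E = "simple_exp n \<tau> (\<lambda>i om. (- l) * \<xi> i om) (\<lambda>i om. 0 * \<xi> i om)"
  let ?S = "simple_ito_integral W n \<tau> \<xi>" and ?q = "\<lambda>om. \<Sum>i<n. (\<xi> i om)\<^sup>2 * (\<tau> (Suc i) - \<tau> i)"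
  note E = simple_exp_expectation[OF simple_integrand_cmult[OF \<xi>, of "-l"] simple_integrand_cmult[OF \<xi>, of 0]]
  have Eeq: "?E om = exp (l * ?S om - l\<^sup>2 * ?q om / 2)" for om
    unfolding simple_exp_def simple_ito_integral_def
    by (simp add: sum_distrib_left power_mult_distrib sum_negf mult.assoc)
  let ?A = "{om \<in> space M. ?S om > \<epsilon> \<and> ?q om <= \<delta>}"
  let ?c = "exp (l * \<epsilon> - l\<^sup>2 * \<delta> / 2)"
  have "measure M ?A <= measure M {om \<in> space M. ?E om >= ?c}"
  proof (rule finite_measure_mono)
    show "{om \<in> space M. ?E om >= ?c} \<in> sets M" using E(1)[THEN borel_measurable_integrable] by measurable
    show "?A \<subseteq> {om \<in> space M. ?E om >= ?c}"
    proof safe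
      fix om assume "om \<in> space M" "?S om > \<epsilon>" "?q om <= \<delta>"
      hence "l * \<epsilon> <= l * ?S om" "l\<^sup>2 * ?q om <= l\<^sup>2 * \<delta>" using l by (auto intro!: mult_left_mono)
      thus "?c <= ?E om" unfolding Eeq by simp
    qed
  qed
  also have "\<dots> <= (LINT om|M. ?E om) / ?c"
    by (rule integral_Markov_inequality_measure[OF E(1), of "{}"]) (auto simp: simple_exp_def)
  also have "\<dots> = exp (- (l * \<epsilon> - l\<^sup>2 * \<delta> / 2))" unfolding E(2) by (simp add: exp_minus field_simps)
  also have "l * \<epsilon> - l\<^sup>2 * \<delta> / 2 = \<epsilon>\<^sup>2 / (2 * \<delta>)" using \<delta> by (simp add: l_def field_simps power2_eq_square)
  finally show ?thesis .
qed

lemma simple_tail: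
  assumes \<xi>: "simple_integrand F T n \<tau> \<xi>" and \<epsilon>: "\<epsilon> > 0" and \<delta>: "\<delta> > 0"
  shows "measure M {om \<in> space M. \<bar>simple_ito_integral W n \<tau> \<xi> om\<bar> > \<epsilon>} \<le>
    measure M {om \<in> space M. (\<Sum>i<n. (\<xi> i om)\<^sup>2 * (\<tau> (Suc i) - \<tau> i)) > \<delta>} + 2 * exp (- (\<epsilon>\<^sup>2 / (2 * \<delta>)))"
proof -
  let ?S = "simple_ito_integral W n \<tau> \<xi>" and ?q = "\<lambda>om. \<Sum>i<n. (\<xi> i om)\<^sup>2 * (\<tau> (Suc i) - \<tau> i)"
  have neg: "simple_ito_integral W n \<tau> (\<lambda>i om. (-1) * \<xi> i om) om = - ?S om" for om
    by (simp add: simple_ito_integral_def sum_negf)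
  have [measurable]: "?S \<in> borel_measurable M" by (rule simple_ito_integral_measurable[OF \<xi> bW])
  have [measurable]: "?q \<in> borel_measurable M" using simple_integrand_measurable_M[OF \<xi>] by (intro borel_measurable_sum) auto
  let ?U = "{om \<in> space M. ?S om > \<epsilon> \<and> ?q om <= \<delta>}" and ?L = "{om \<in> space M. - ?S om > \<epsilon> \<and> ?q om <= \<delta>}" and ?D = "{om \<in> space M. ?q om > \<delta>}"
  have "measure M {om \<in> space M. \<bar>?S om\<bar> > \<epsilon>} <= measure M (?D \<union> (?U \<union> ?L))"
    by (rule finite_measure_mono) (auto, measurable)
  also have "\<dots> <= measure M ?D + measure M (?U \<union> ?L)" by (rule measure_Un_le) measurable
  also have "measure M (?U \<union> ?L) <= measure M ?U + measure M ?L" by (rule measure_Un_le) measurable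
  also have "measure M ?U <= exp (- (\<epsilon>\<^sup>2 / (2 * \<delta>)))" by (rule simple_tail_upper[OF assms])
  also have "measure M ?L <= exp (- (\<epsilon>\<^sup>2 / (2 * \<delta>)))"
    using simple_tail_upper[OF simple_integrand_cmult[OF \<xi>, of "-1"] \<epsilon> \<delta>] unfolding neg by simp
  finally show ?thesis by simp
qed

end

lemma simple_integrand_bounded:
  "simple_integrand F T n \<tau> \<xi> ==> i < n ==> \<exists>C. \<forall>om\<in>space (F (\<tau> i)). \<bar>\<xi> i om\<bar> <= C"
  by (simp add: simple_integrand_def)

section \<open>Common refinements\<close>

lemma partition_of_finite_set:
  fixes A :: "real set"
  assumes A: "finite A" "0 \<in> A" "T \<in> A" and rng: "\<And>x. x \<in> A ==> 0 <= x \<and> x <= T"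
  obtains m \<sigma> where "increasing_upto m \<sigma>" "\<sigma> 0 = 0" "\<sigma> m = T" "\<sigma> ` {..m} = A"
proof -
  define xs where "xs = sorted_list_of_set A"
  have xs: "sorted xs" "distinct xs" "set xs = A" "length xs = card A" unfolding xs_def using A by auto
  have "A \<noteq> {}" using A by blast
  hence len: "length xs > 0" using A xs by (metis length_greater_0_conv set_empty)
  define m where "m = length xs - 1"
  have Sm: "length xs = Suc m" using len by (simp add: m_def)
  define \<sigma> where "\<sigma> j = xs ! j" for j
  have lt: "xs ! i < xs ! j" if "i < j" "j < length xs" for i j
    using xs that sorted_nth_mono[OF xs(1), of i j] nth_eq_iff_index_eq[OF xs(2), of i j] by (simp add: order.strict_iff_order)
  have im: "\<sigma> ` {..m} = A"
  proof -
    have "\<sigma> ` {..m} = (\<lambda>i. xs ! i) ` {..<length xs}" unfolding \<sigma>_def using Sm by (intro image_cong) (auto simp: lessThan_Suc_atMost)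
    also have "\<dots> = set xs" by (auto simp: set_conv_nth)
    finally show ?thesis using xs by simp
  qed
  have "increasing_upto m \<sigma>" unfolding increasing_upto_def \<sigma>_def m_def using lt by auto
  moreover have "\<sigma> 0 = 0"
  proof -
    obtain i where i: "i <= m" "\<sigma> i = 0" using A(2) unfolding im[symmetric] by auto
    have "\<sigma> 0 \<in> A" unfolding im[symmetric] by auto
    thus ?thesis using rng[of "\<sigma> 0"] lt[of 0 i] i len by (cases "i = 0") (auto simp: \<sigma>_def Sm)
  qed
  moreover have "\<sigma> m = T"
  proof -
    obtain i where i: "i <= m" "\<sigma> i = T" using A(3) unfolding im[symmetric] by auto
    have "\<sigma> m \<in> A" unfolding im[symmetric] by auto
    thus ?thesis using rng[of "\<sigma> m"] lt[of i m] i len by (cases "i = m") (auto simp: \<sigma>_def Sm)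
  qed
  ultimately show ?thesis using that im by blast
qed

lemma common_partition:
  fixes \<tau>1 \<tau>2 :: "nat => real"
  assumes i1: "increasing_upto n1 \<tau>1" "\<tau>1 0 = 0" "\<tau>1 n1 = T" and i2: "increasing_upto n2 \<tau>2" "\<tau>2 0 = 0" "\<tau>2 n2 = T"
  obtains m \<sigma> where "increasing_upto m \<sigma>" "\<sigma> 0 = 0" "\<sigma> m = T" "\<tau>1 ` {..n1} \<subseteq> \<sigma> ` {..m}" "\<tau>2 ` {..n2} \<subseteq> \<sigma> ` {..m}"
proof -
  define A where "A = \<tau>1 ` {..n1} \<union> \<tau>2 ` {..n2}"
  have A: "finite A" "0 \<in> A" "T \<in> A" unfolding A_def using i1 i2 by auto
  have rng: "0 <= x \<and> x <= T" if "x \<in> A" for x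
  proof -
    have "0 <= \<tau>1 i \<and> \<tau>1 i <= T" if "i <= n1" for i
      using chain_le[OF i1(1), of 0 i] chain_le[OF i1(1), of i n1] i1 that by simp
    moreover have "0 <= \<tau>2 i \<and> \<tau>2 i <= T" if "i <= n2" for i
      using chain_le[OF i2(1), of 0 i] chain_le[OF i2(1), of i n2] i2 that by simp
    ultimately show ?thesis using that unfolding A_def by blast
  qed
  obtain m \<sigma> where "increasing_upto m \<sigma>" "\<sigma> 0 = 0" "\<sigma> m = T" "\<sigma> ` {..m} = A"
    by (rule partition_of_finite_set[OF A rng])
  thus ?thesis using that unfolding A_def by blast
qed

text \<open>
  The coefficient on a cell of \<open>\<sigma>\<close> is that of the cell of \<open>\<tau>\<close> containing it.
\<close>

definition refined :: "nat => (nat => real) => (nat => 'a => real) => (nat => real) => nat => 'a => real" where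
  "refined n \<tau> \<xi> \<sigma> j om = simple_process n \<tau> \<xi> (\<sigma> (Suc j)) om"

context
  fixes n m :: nat and \<tau> \<sigma> :: "nat => real"
  assumes \<tau>: "increasing_upto n \<tau>" and \<sigma>: "increasing_upto m \<sigma>"
    and ends: "\<sigma> 0 = \<tau> 0" "\<sigma> m = \<tau> n" and sub: "\<tau> ` {..n} \<subseteq> \<sigma> ` {..m}"
begin

lemma refined_cell:
  assumes "j < m"
  obtains i where "i < n" "\<tau> i <= \<sigma> j" "\<sigma> (Suc j) <= \<tau> (Suc i)"
proof -
  have "\<tau> 0 < \<sigma> (Suc j)" "\<sigma> (Suc j) <= \<tau> n"
    using chain_less[OF \<sigma>, of 0 "Suc j"] chain_le[OF \<sigma>, of "Suc j" m] ends assms by auto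
  then obtain i where i: "i < n" "\<tau> i < \<sigma> (Suc j)" "\<sigma> (Suc j) <= \<tau> (Suc i)" by (rule chain_cell_exists)
  have "\<tau> i \<in> \<sigma> ` {..m}" using i(1) by (intro subsetD[OF sub]) auto
  then obtain k where k: "k <= m" "\<tau> i = \<sigma> k" by auto
  have "k <= j"
  proof (rule ccontr)
    assume "\<not> k <= j"
    thus False using chain_le[OF \<sigma>, of "Suc j" k] k i by auto
  qed
  hence "\<tau> i <= \<sigma> j" using chain_le[OF \<sigma>, of k j] k assms by auto
  thus ?thesis using that i by blast
qed

lemma refined_eval:
  assumes "j < m" "i < n" "\<tau> i <= \<sigma> j" "\<sigma> (Suc j) <= \<tau> (Suc i)"
  shows "refined n \<tau> \<xi> \<sigma> j om = \<xi> i om"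
  unfolding refined_def using chain_less[OF \<sigma>, of j "Suc j"] assms
  by (intro simple_process_eval[OF \<tau>]) auto

lemma simple_process_refined: "simple_process m \<sigma> (refined n \<tau> \<xi> \<sigma>) t om = simple_process n \<tau> \<xi> t om"
proof (cases "\<sigma> 0 < t \<and> t <= \<sigma> m")
  case True
  then obtain j where j: "j < m" "\<sigma> j < t" "t <= \<sigma> (Suc j)" using chain_cell_exists by blast
  then obtain i where i: "i < n" "\<tau> i <= \<sigma> j" "\<sigma> (Suc j) <= \<tau> (Suc i)" using refined_cell by blast
  have "simple_process n \<tau> \<xi> t om = \<xi> i om" using i j by (intro simple_process_eval[OF \<tau>]) auto
  thus ?thesis using simple_process_eval[OF \<sigma> j] refined_eval[OF j(1) i] by metis
next
  case False
  thus ?thesis using simple_process_outside[OF \<sigma>, of t] simple_process_outside[OF \<tau>, of t] ends by (metis not_le)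
qed

lemma simple_ito_integral_refined:
  "simple_ito_integral Z m \<sigma> (refined n \<tau> \<xi> \<sigma>) om = simple_ito_integral Z n \<tau> \<xi> om"
proof -
  \<comment> \<open>the integral stopped at \<open>u\<close>\<close>
  define G where "G u = (\<Sum>i<n. \<xi> i om * (Z (min u (\<tau> (Suc i))) om - Z (min u (\<tau> i)) om))" for u
  have inc: "G (\<sigma> (Suc j)) - G (\<sigma> j) = refined n \<tau> \<xi> \<sigma> j om * (Z (\<sigma> (Suc j)) om - Z (\<sigma> j) om)" if j: "j < m" for j
  proof -
    obtain i where i: "i < n" "\<tau> i <= \<sigma> j" "\<sigma> (Suc j) <= \<tau> (Suc i)" using refined_cell[OF j] by blast
    have lt: "\<sigma> j < \<sigma> (Suc j)" using chain_less[OF \<sigma>, of j "Suc j"] j by auto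
    have "G (\<sigma> (Suc j)) - G (\<sigma> j) = (\<Sum>k<n. \<xi> k om * (Z (min (\<sigma> (Suc j)) (\<tau> (Suc k))) om - Z (min (\<sigma> (Suc j)) (\<tau> k)) om) - \<xi> k om * (Z (min (\<sigma> j) (\<tau> (Suc k))) om - Z (min (\<sigma> j) (\<tau> k)) om))"
      by (simp add: G_def sum_subtractf)
    also have "\<dots> = (\<Sum>k<n. if k = i then \<xi> i om * (Z (\<sigma> (Suc j)) om - Z (\<sigma> j) om) else 0)"
    proof (intro sum.cong refl)
      fix k assume k: "k \<in> {..<n}"
      consider "k = i" | "k < i" | "i < k" by linarith
      thus "\<xi> k om * (Z (min (\<sigma> (Suc j)) (\<tau> (Suc k))) om - Z (min (\<sigma> (Suc j)) (\<tau> k)) om) - \<xi> k om * (Z (min (\<sigma> j) (\<tau> (Suc k))) om - Z (min (\<sigma> j) (\<tau> k)) om)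
        = (if k = i then \<xi> i om * (Z (\<sigma> (Suc j)) om - Z (\<sigma> j) om) else 0)"
      proof cases
        case 1
        thus ?thesis using i lt by (simp add: min_absorb1 min_absorb2 algebra_simps)
      next
        case 2
        have "\<tau> (Suc k) <= \<tau> i" "\<tau> k <= \<tau> (Suc k)" using chain_le[OF \<tau>, of "Suc k" i] chain_le[OF \<tau>, of k "Suc k"] 2 i k by auto
        thus ?thesis using i lt 2 by (simp add: min_absorb2)
      next
        case 3
        have "\<tau> (Suc i) <= \<tau> k" "\<tau> k <= \<tau> (Suc k)" using chain_le[OF \<tau>, of "Suc i" k] chain_le[OF \<tau>, of k "Suc k"] 3 i k by auto
        thus ?thesis using i lt 3 by (simp add: min_absorb1)
      qed
    qed
    also have "\<dots> = \<xi> i om * (Z (\<sigma> (Suc j)) om - Z (\<sigma> j) om)" using i by simp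
    finally show ?thesis using refined_eval[OF j i, of \<xi> om] by metis
  qed
  have "simple_ito_integral Z m \<sigma> (refined n \<tau> \<xi> \<sigma>) om = (\<Sum>j<m. G (\<sigma> (Suc j)) - G (\<sigma> j))"
    unfolding simple_ito_integral_def by (intro sum.cong refl) (simp add: inc)
  also have "\<dots> = G (\<sigma> m) - G (\<sigma> 0)" by (rule sum_lessThan_telescope)
  also have "G (\<sigma> 0) = 0" unfolding G_def
  proof (rule sum.neutral, intro ballI)
    fix i assume i: "i \<in> {..<n}"
    have "\<tau> 0 <= \<tau> i" "\<tau> 0 <= \<tau> (Suc i)" using chain_le[OF \<tau>, of 0 i] chain_le[OF \<tau>, of 0 "Suc i"] i by auto
    thus "\<xi> i om * (Z (min (\<sigma> 0) (\<tau> (Suc i))) om - Z (min (\<sigma> 0) (\<tau> i)) om) = 0" by (simp add: ends min_absorb1)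
  qed
  also have "G (\<sigma> m) = simple_ito_integral Z n \<tau> \<xi> om" unfolding G_def simple_ito_integral_def
  proof (intro sum.cong refl)
    fix i assume i: "i \<in> {..<n}"
    have "\<tau> i <= \<tau> n" "\<tau> (Suc i) <= \<tau> n" using chain_le[OF \<tau>, of i n] chain_le[OF \<tau>, of "Suc i" n] i by auto
    thus "\<xi> i om * (Z (min (\<sigma> m) (\<tau> (Suc i))) om - Z (min (\<sigma> m) (\<tau> i)) om) = \<xi> i om * (Z (\<tau> (Suc i)) om - Z (\<tau> i) om)"
      by (simp add: ends min_absorb2)
  qed
  finally show ?thesis by simp
qed

end

context bm_pair
begin

lemma simple_integrand_refined:
  assumes \<xi>: "simple_integrand F T n \<tau> \<xi>" and \<sigma>: "increasing_upto m \<sigma>" "\<sigma> 0 = 0" "\<sigma> m = T" and sub: "\<tau> ` {..n} \<subseteq> \<sigma> ` {..m}"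
  shows "simple_integrand F T m \<sigma> (refined n \<tau> \<xi> \<sigma>)"
proof -
  note \<tau> = simple_integrand_increasing[OF \<xi>] and e = simple_integrand_ends[OF \<xi>]
  have e': "\<sigma> 0 = \<tau> 0" "\<sigma> m = \<tau> n" using e \<sigma> by auto
  show ?thesis unfolding simple_integrand_def
  proof (intro conjI allI impI)
    fix j assume j: "j < m"
    show "\<sigma> j < \<sigma> (Suc j)" using \<sigma> j by (auto simp: increasing_upto_def)
    obtain i where i: "i < n" "\<tau> i <= \<sigma> j" "\<sigma> (Suc j) <= \<tau> (Suc i)" by (rule refined_cell[OF \<tau> \<sigma>(1) e' sub j])
    have eq: "refined n \<tau> \<xi> \<sigma> j = \<xi> i" by (rule ext) (rule refined_eval[OF \<tau> \<sigma>(1) e' sub j i])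
    have r: "0 <= \<tau> i" "\<sigma> j <= T" using simple_integrand_range[OF \<xi>, of i] i chain_le[OF \<sigma>(1), of j m] j \<sigma> by auto
    show "refined n \<tau> \<xi> \<sigma> j \<in> borel_measurable (F (\<sigma> j))" unfolding eq
      using \<xi> i by (intro F_measurable_mono[OF _ r(1) i(2) r(2)]) (auto simp: simple_integrand_def)
    have "space (F (\<sigma> j)) = space (F (\<tau> i))" using F_space[of "\<sigma> j"] F_space[of "\<tau> i"] r i by auto
    moreover have "\<exists>C. \<forall>om\<in>space (F (\<tau> i)). \<bar>\<xi> i om\<bar> <= C" using simple_integrand_bounded[OF \<xi> i(1)] .
    ultimately show "\<exists>C. \<forall>om\<in>space (F (\<sigma> j)). \<bar>refined n \<tau> \<xi> \<sigma> j om\<bar> <= C" unfolding eq by simp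
  qed (use \<sigma> in auto)
qed

lemma simple_integrand_diff:
  assumes "simple_integrand F T n \<tau> \<xi>" "simple_integrand F T n \<tau> \<eta>"
  shows "simple_integrand F T n \<tau> (\<lambda>i om. \<xi> i om - \<eta> i om)"
  unfolding simple_integrand_def
proof (intro conjI allI impI)
  fix i assume i: "i < n"
  obtain C where C: "\<And>om. om \<in> space (F (\<tau> i)) ==> \<bar>\<xi> i om\<bar> <= C" using simple_integrand_bounded[OF assms(1) i] by blast
  obtain D where D: "\<And>om. om \<in> space (F (\<tau> i)) ==> \<bar>\<eta> i om\<bar> <= D" using simple_integrand_bounded[OF assms(2) i] by blast
  have "\<xi> i \<in> borel_measurable (F (\<tau> i))" "\<eta> i \<in> borel_measurable (F (\<tau> i))" using assms i by (auto simp: simple_integrand_def)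
  thus "(\<lambda>om. \<xi> i om - \<eta> i om) \<in> borel_measurable (F (\<tau> i))" by (rule borel_measurable_diff)
  have "\<bar>\<xi> i om - \<eta> i om\<bar> <= C + D" if "om \<in> space (F (\<tau> i))" for om using C[OF that] D[OF that] by linarith
  thus "\<exists>C. \<forall>om\<in>space (F (\<tau> i)). \<bar>\<xi> i om - \<eta> i om\<bar> <= C" by blast
qed (use assms in \<open>auto simp: simple_integrand_def\<close>)

lemma sq_norm_simple_process:
  assumes "simple_integrand F T n \<tau> \<xi>"
  shows "sq_norm T (\<lambda>t. simple_process n \<tau> \<xi> t om) = (\<Sum>i<n. (\<xi> i om)\<^sup>2 * (\<tau> (Suc i) - \<tau> i))"
proof -
  note \<tau> = simple_integrand_increasing[OF assms] and e = simple_integrand_ends[OF assms]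
  have "(simple_process n \<tau> \<xi> t om)\<^sup>2 = simple_process n \<tau> (\<lambda>i om. (\<xi> i om)\<^sup>2) t om" for t
    using simple_process_fun2[OF \<tau>, where g="\<lambda>x y. x\<^sup>2"] by simp
  thus ?thesis unfolding sq_norm_def using set_integral_simple_process(2)[OF \<tau> e] by simp
qed

text \<open>
  Two simple integrands live on different partitions; on a common refinement their difference is again
  simple, for the process as well as for the integral.
\<close>

lemma simple_diff:
  assumes \<xi>: "simple_integrand F T n \<tau> \<xi>" and \<eta>: "simple_integrand F T k \<upsilon> \<eta>"
  obtains m \<sigma> \<zeta> where "simple_integrand F T m \<sigma> \<zeta>"
    "\<And>t om. simple_process m \<sigma> \<zeta> t om = simple_process n \<tau> \<xi> t om - simple_process k \<upsilon> \<eta> t om"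
    "\<And>Z om. simple_ito_integral Z m \<sigma> \<zeta> om = simple_ito_integral Z n \<tau> \<xi> om - simple_ito_integral Z k \<upsilon> \<eta> om"
proof -
  note i1 = simple_integrand_increasing[OF \<xi>] simple_integrand_ends[OF \<xi>] and i2 = simple_integrand_increasing[OF \<eta>] simple_integrand_ends[OF \<eta>]
  obtain m \<sigma> where \<sigma>: "increasing_upto m \<sigma>" "\<sigma> 0 = 0" "\<sigma> m = T" and s1: "\<tau> ` {..n} \<subseteq> \<sigma> ` {..m}" and s2: "\<upsilon> ` {..k} \<subseteq> \<sigma> ` {..m}"
    by (rule common_partition[OF i1 i2])
  have e1: "\<sigma> 0 = \<tau> 0" "\<sigma> m = \<tau> n" and e2: "\<sigma> 0 = \<upsilon> 0" "\<sigma> m = \<upsilon> k" using \<sigma> i1 i2 by auto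
  let ?\<zeta> = "\<lambda>i om. refined n \<tau> \<xi> \<sigma> i om - refined k \<upsilon> \<eta> \<sigma> i om"
  have "simple_integrand F T m \<sigma> ?\<zeta>"
    by (intro simple_integrand_diff simple_integrand_refined[OF \<xi> \<sigma> s1] simple_integrand_refined[OF \<eta> \<sigma> s2])
  moreover have "simple_process m \<sigma> ?\<zeta> t om = simple_process n \<tau> \<xi> t om - simple_process k \<upsilon> \<eta> t om" for t om
    unfolding simple_process_refined[OF i1(1) \<sigma>(1) e1 s1, symmetric] simple_process_refined[OF i2(1) \<sigma>(1) e2 s2, symmetric]
    by (simp add: simple_process_def left_diff_distrib sum_subtractf)
  moreover have "simple_ito_integral Z m \<sigma> ?\<zeta> om = simple_ito_integral Z n \<tau> \<xi> om - simple_ito_integral Z k \<upsilon> \<eta> om" for Z om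
    unfolding simple_ito_integral_refined[OF i1(1) \<sigma>(1) e1 s1, symmetric] simple_ito_integral_refined[OF i2(1) \<sigma>(1) e2 s2, symmetric]
    by (simp add: simple_ito_integral_def left_diff_distrib sum_subtractf)
  ultimately show ?thesis using that by blast
qed

lemma simple_diff_tail:
  assumes \<xi>: "simple_integrand F T n \<tau> \<xi>" and \<eta>: "simple_integrand F T k \<upsilon> \<eta>" and \<epsilon>: "\<epsilon> > 0" and \<delta>: "\<delta> > 0"
  shows "measure M {om \<in> space M. \<bar>simple_ito_integral W n \<tau> \<xi> om - simple_ito_integral W k \<upsilon> \<eta> om\<bar> > \<epsilon>} \<le>
    measure M {om \<in> space M. sq_norm T (\<lambda>t. simple_process n \<tau> \<xi> t om - simple_process k \<upsilon> \<eta> t om) > \<delta>} + 2 * exp (- (\<epsilon>\<^sup>2 / (2 * \<delta>)))"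
    and "(\<lambda>om. sq_norm T (\<lambda>t. simple_process n \<tau> \<xi> t om - simple_process k \<upsilon> \<eta> t om)) \<in> borel_measurable M"
proof -
  obtain m \<sigma> \<zeta> where z: "simple_integrand F T m \<sigma> \<zeta>"
    "\<And>t om. simple_process m \<sigma> \<zeta> t om = simple_process n \<tau> \<xi> t om - simple_process k \<upsilon> \<eta> t om"
    "\<And>Z om. simple_ito_integral Z m \<sigma> \<zeta> om = simple_ito_integral Z n \<tau> \<xi> om - simple_ito_integral Z k \<upsilon> \<eta> om"
    by (rule simple_diff[OF \<xi> \<eta>]) blast
  show "measure M {om \<in> space M. \<bar>simple_ito_integral W n \<tau> \<xi> om - simple_ito_integral W k \<upsilon> \<eta> om\<bar> > \<epsilon>} \<le>
    measure M {om \<in> space M. sq_norm T (\<lambda>t. simple_process n \<tau> \<xi> t om - simple_process k \<upsilon> \<eta> t om) > \<delta>} + 2 * exp (- (\<epsilon>\<^sup>2 / (2 * \<delta>)))"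
    using simple_tail[OF z(1) \<epsilon> \<delta>] unfolding sq_norm_simple_process[OF z(1), symmetric] z(2,3) .
  show "(\<lambda>om. sq_norm T (\<lambda>t. simple_process n \<tau> \<xi> t om - simple_process k \<upsilon> \<eta> t om)) \<in> borel_measurable M"
    unfolding z(2)[symmetric] sq_norm_simple_process[OF z(1)]
    using simple_integrand_measurable_M[OF z(1)] by (intro borel_measurable_sum) auto
qed

end

section \<open>Convergence in probability\<close>

definition tends_prob :: "'a measure => (nat => 'a => real) => ('a => real) => bool" where
  "tends_prob M X Y \<longleftrightarrow> (\<forall>\<epsilon>>0. (\<lambda>k. measure M {om \<in> space M. \<bar>X k om - Y om\<bar> > \<epsilon>}) \<longlonglongrightarrow> 0)"

context prob_space
begin

lemma measure_gt_add_le: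
  assumes [measurable]: "f \<in> borel_measurable M" "g \<in> borel_measurable M" "h \<in> borel_measurable M"
    and le: "AE x in M. \<bar>h x\<bar> <= \<bar>f x\<bar> + \<bar>g x\<bar>"
  shows "measure M {x \<in> space M. \<bar>h x\<bar> > a + b} <= measure M {x \<in> space M. \<bar>f x\<bar> > a} + measure M {x \<in> space M. \<bar>g x\<bar> > (b::real)}"
proof -
  have "measure M {x \<in> space M. \<bar>h x\<bar> > a + b} <= measure M ({x \<in> space M. \<bar>f x\<bar> > a} \<union> {x \<in> space M. \<bar>g x\<bar> > b})"
    using le by (intro finite_measure_mono_AE) (auto elim!: eventually_mono)
  also have "\<dots> <= measure M {x \<in> space M. \<bar>f x\<bar> > a} + measure M {x \<in> space M. \<bar>g x\<bar> > b}"
    by (rule measure_Un_le) measurable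
  finally show ?thesis .
qed

lemma AE_tendsto_imp_tends_prob:
  assumes [measurable]: "\<And>n. X n \<in> borel_measurable M" "Y \<in> borel_measurable M"
    and lim: "AE x in M. (\<lambda>n. X n x) \<longlonglongrightarrow> Y x"
  shows "tends_prob M X Y"
  unfolding tends_prob_def
proof (intro allI impI)
  fix \<epsilon> :: real assume e: "\<epsilon> > 0"
  have "(\<lambda>n. LINT x|M. indicator {x \<in> space M. \<bar>X n x - Y x\<bar> > \<epsilon>} x) \<longlonglongrightarrow> (LINT x|M. (0::real))"
  proof (rule integral_dominated_convergence[where w="\<lambda>_. 1"])
    show "AE x in M. (\<lambda>n. indicator {x \<in> space M. \<bar>X n x - Y x\<bar> > \<epsilon>} x) \<longlonglongrightarrow> (0::real)"
      using lim
    proof eventually_elim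
      case (elim x)
      have "eventually (\<lambda>n. dist (X n x) (Y x) < \<epsilon>) sequentially" using elim e by (rule tendstoD)
      hence "eventually (\<lambda>n. indicator {x \<in> space M. \<bar>X n x - Y x\<bar> > \<epsilon>} x = (0::real)) sequentially"
        by eventually_elim (auto simp: indicator_def dist_real_def)
      thus ?case by (rule tendsto_eventually)
    qed
  qed (auto simp: indicator_def)
  thus "(\<lambda>k. measure M {om \<in> space M. \<bar>X k om - Y om\<bar> > \<epsilon>}) \<longlonglongrightarrow> 0" by simp
qed

lemma tends_prob_add_null:
  assumes m [measurable]: "\<And>n. X n \<in> borel_measurable M" "Y \<in> borel_measurable M" "\<And>n. X' n \<in> borel_measurable M"
    and X: "tends_prob M X Y" and D: "tends_prob M (\<lambda>n x. X' n x - X n x) (\<lambda>_. 0)"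
  shows "tends_prob M X' Y"
  unfolding tends_prob_def
proof (intro allI impI)
  fix \<epsilon> :: real assume e: "\<epsilon> > 0"
  hence e2: "\<epsilon> / 2 > 0" by simp
  have "(\<lambda>k. measure M {om \<in> space M. \<bar>X' k om - X k om - 0\<bar> > \<epsilon> / 2} + measure M {om \<in> space M. \<bar>X k om - Y om\<bar> > \<epsilon> / 2}) \<longlonglongrightarrow> 0 + 0"
    by (intro tendsto_add D[unfolded tends_prob_def, rule_format, OF e2] X[unfolded tends_prob_def, rule_format, OF e2])
  hence L: "(\<lambda>k. measure M {om \<in> space M. \<bar>X' k om - X k om - 0\<bar> > \<epsilon> / 2} + measure M {om \<in> space M. \<bar>X k om - Y om\<bar> > \<epsilon> / 2}) \<longlonglongrightarrow> 0" by simp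
  show "(\<lambda>k. measure M {om \<in> space M. \<bar>X' k om - Y om\<bar> > \<epsilon>}) \<longlonglongrightarrow> 0"
  proof (rule tendsto_sandwich[OF _ _ tendsto_const L])
    have "measure M {om \<in> space M. \<bar>X' k om - Y om\<bar> > \<epsilon> / 2 + \<epsilon> / 2} <= measure M {om \<in> space M. \<bar>X' k om - X k om - 0\<bar> > \<epsilon> / 2} + measure M {om \<in> space M. \<bar>X k om - Y om\<bar> > \<epsilon> / 2}" for k
      by (rule measure_gt_add_le) auto
    thus "\<forall>\<^sub>F k in sequentially. measure M {om \<in> space M. \<bar>X' k om - Y om\<bar> > \<epsilon>} <= measure M {om \<in> space M. \<bar>X' k om - X k om - 0\<bar> > \<epsilon> / 2} + measure M {om \<in> space M. \<bar>X k om - Y om\<bar> > \<epsilon> / 2}"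
      by simp
  qed simp
qed

lemma tends_prob_unique:
  assumes m [measurable]: "\<And>n. X n \<in> borel_measurable M" "Y \<in> borel_measurable M" "Y' \<in> borel_measurable M"
    and X: "tends_prob M X Y" and X': "tends_prob M X Y'"
  shows "AE x in M. Y x = Y' x"
proof -
  have z: "measure M {x \<in> space M. \<bar>Y x - Y' x\<bar> > \<epsilon>} = 0" if e: "\<epsilon> > 0" for \<epsilon> :: real
  proof -
    have e2: "\<epsilon> / 2 > 0" using e by simp
    have L: "(\<lambda>k. measure M {om \<in> space M. \<bar>X k om - Y om\<bar> > \<epsilon> / 2} + measure M {om \<in> space M. \<bar>X k om - Y' om\<bar> > \<epsilon> / 2}) \<longlonglongrightarrow> 0 + 0"
      by (intro tendsto_add X[unfolded tends_prob_def, rule_format, OF e2] X'[unfolded tends_prob_def, rule_format, OF e2])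
    have b: "measure M {x \<in> space M. \<bar>Y x - Y' x\<bar> > \<epsilon> / 2 + \<epsilon> / 2} <= measure M {om \<in> space M. \<bar>X k om - Y om\<bar> > \<epsilon> / 2} + measure M {om \<in> space M. \<bar>X k om - Y' om\<bar> > \<epsilon> / 2}" for k
      by (rule measure_gt_add_le) auto
    have "measure M {x \<in> space M. \<bar>Y x - Y' x\<bar> > \<epsilon> / 2 + \<epsilon> / 2} <= 0 + 0"
      by (rule LIMSEQ_le_const[OF L]) (use b in auto)
    thus ?thesis using measure_nonneg[of M "{x \<in> space M. \<bar>Y x - Y' x\<bar> > \<epsilon>}"] by simp
  qed
  have "AE x in M. \<not> \<bar>Y x - Y' x\<bar> > 1 / real (Suc n)" for n
    using z[of "1 / real (Suc n)"] by (subst AE_iff_measurable[OF _ refl]) (auto simp: emeasure_eq_measure)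
  hence "AE x in M. \<forall>n. \<not> \<bar>Y x - Y' x\<bar> > 1 / real (Suc n)" by (simp add: AE_all_countable)
  thus ?thesis
  proof eventually_elim
    case (elim x)
    show ?case
    proof (rule ccontr)
      assume "Y x \<noteq> Y' x"
      hence "0 < \<bar>Y x - Y' x\<bar>" by simp
      then obtain n where "inverse (real (Suc n)) < \<bar>Y x - Y' x\<bar>" using reals_Archimedean by blast
      thus False using elim by (simp add: inverse_eq_divide)
    qed
  qed
qed

lemma tends_prob_subseq:
  assumes m [measurable]: "\<And>n. X n \<in> borel_measurable M" "Y \<in> borel_measurable M"
    and X: "tends_prob M X Y"
  obtains r where "strict_mono (r::nat=>nat)" "AE x in M. (\<lambda>n. X (r n) x) \<longlonglongrightarrow> Y x"
proof -
  let ?u = "\<lambda>n x. min 1 \<bar>X n x - Y x\<bar>"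
  have int: "integrable M (?u n)" for n by (rule integrable_const_bound[where B=1]) auto
  have "(\<lambda>n. LINT x|M. ?u n x) \<longlonglongrightarrow> 0"
  proof (rule LIMSEQ_I)
    fix e :: real assume e: "e > 0"
    have "eventually (\<lambda>k. measure M {om \<in> space M. \<bar>X k om - Y om\<bar> > e / 2} < e / 2) sequentially"
      using e by (intro order_tendstoD(2)[OF X[unfolded tends_prob_def, rule_format]]) auto
    hence "eventually (\<lambda>k. norm ((LINT x|M. ?u k x) - 0) < e) sequentially"
    proof eventually_elim
      case (elim k)
      let ?A = "{om \<in> space M. \<bar>X k om - Y om\<bar> > e / 2}"
      have iA: "integrable M (indicator ?A :: _ => real)" by (rule integrable_real_indicator) (auto simp: less_top[symmetric])
      have "(LINT x|M. ?u k x) <= (LINT x|M. e / 2 + indicator ?A x)"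
      proof (rule integral_mono[OF int])
        show "integrable M (\<lambda>x. e / 2 + indicator ?A x)" using iA by simp
        show "?u k x <= e / 2 + indicator ?A x" if "x \<in> space M" for x
          using that e by (cases "\<bar>X k x - Y x\<bar> > e / 2") (auto simp: min_def)
      qed
      also have "\<dots> = e / 2 + measure M ?A" using iA by (subst Bochner_Integration.integral_add) (auto simp: prob_space)
      also have "\<dots> < e" using elim by simp
      finally have "(LINT x|M. ?u k x) < e" .
      moreover have "0 <= (LINT x|M. ?u k x)" by (intro Bochner_Integration.integral_nonneg) auto
      ultimately show ?case by simp
    qed
    thus "\<exists>no. \<forall>n\<ge>no. norm ((LINT x|M. ?u n x) - 0) < e" unfolding eventually_sequentially .
  qed
  hence "(\<lambda>n. LINT x|M. norm (?u n x)) \<longlonglongrightarrow> 0" by simp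
  from tendsto_L1_AE_subseq[OF int this] obtain r where r: "strict_mono r" "AE x in M. (\<lambda>n. ?u (r n) x) \<longlonglongrightarrow> 0" by auto
  have "AE x in M. (\<lambda>n. X (r n) x) \<longlonglongrightarrow> Y x" using r(2)
  proof eventually_elim
    case (elim x)
    have "eventually (\<lambda>n. ?u (r n) x < 1) sequentially" by (rule order_tendstoD(2)[OF elim]) simp
    hence "eventually (\<lambda>n. ?u (r n) x = \<bar>X (r n) x - Y x\<bar>) sequentially" by eventually_elim auto
    hence "(\<lambda>n. \<bar>X (r n) x - Y x\<bar>) \<longlonglongrightarrow> 0" using elim tendsto_cong by fast
    hence "(\<lambda>n. X (r n) x - Y x) \<longlonglongrightarrow> 0" by (rule tendsto_rabs_zero_cancel)
    thus ?case by (rule LIM_zero_cancel)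
  qed
  thus ?thesis using that r(1) by blast
qed

lemma tends_prob_subseq_imp:
  assumes "tends_prob M X Y" "strict_mono (r::nat=>nat)"
  shows "tends_prob M (\<lambda>n. X (r n)) Y"
  unfolding tends_prob_def
proof (intro allI impI)
  fix \<epsilon> :: real assume "\<epsilon> > 0"
  hence "(\<lambda>k. measure M {om \<in> space M. \<bar>X k om - Y om\<bar> > \<epsilon>}) \<longlonglongrightarrow> 0" using assms by (simp add: tends_prob_def)
  from LIMSEQ_subseq_LIMSEQ[OF this assms(2)] show "(\<lambda>k. measure M {om \<in> space M. \<bar>X (r k) om - Y om\<bar> > \<epsilon>}) \<longlonglongrightarrow> 0"
    by (simp add: o_def)
qed

text \<open>
  Completeness of convergence in probability: a subsequence with summable deviations converges almost
  surely by Borel-Cantelli, and the Cauchy property carries the whole sequence along.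
\<close>

lemma cauchy_in_prob_convergent:
  assumes m [measurable]: "\<And>n. X n \<in> borel_measurable M"
    and C: "\<And>e h. e > 0 ==> h > 0 ==> \<exists>n0. \<forall>k\<ge>n0. \<forall>l\<ge>n0. measure M {x \<in> space M. \<bar>X k x - X l x\<bar> > e} < (h::real)"
  obtains Y where "Y \<in> borel_measurable M" "tends_prob M X Y"
proof -
  let ?e = "\<lambda>j. (1/2) ^ j :: real"
  have "\<exists>n0. \<forall>k\<ge>n0. \<forall>l\<ge>n0. measure M {x \<in> space M. \<bar>X k x - X l x\<bar> > ?e j} < ?e j" for j by (rule C) auto
  then obtain N where N: "\<And>j k l. k >= N j ==> l >= N j ==> measure M {x \<in> space M. \<bar>X k x - X l x\<bar> > ?e j} < ?e j" by metis
  define r where "r = rec_nat (N 0) (\<lambda>j rj. max (Suc rj) (N (Suc j)))"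
  have r0: "r 0 = N 0" and rS: "r (Suc j) = max (Suc (r j)) (N (Suc j))" for j by (auto simp: r_def)
  have rN: "N j <= r j" for j by (cases j) (auto simp: r0 rS)
  have rm: "strict_mono r" by (rule strict_monoI_Suc) (simp add: rS less_Suc_eq_le)
  let ?A = "\<lambda>j. {x \<in> space M. \<bar>X (r (Suc j)) x - X (r j) x\<bar> > ?e j}"
  have A: "measure M (?A j) < ?e j" for j
    by (rule N[OF order_trans[OF rN[of j] less_imp_le[OF strict_monoD[OF rm lessI]]] rN])
  have "AE x in M. eventually (\<lambda>j. x \<in> space M - ?A j) sequentially"
  proof (rule borel_cantelli_AE1)
    show "summable (\<lambda>j. measure M (?A j))"
      by (rule summable_comparison_test'[OF summable_geometric[of "1/2"], of 0]) (use A in \<open>auto intro: less_imp_le\<close>)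
  qed (auto simp: less_top[symmetric])
  hence conv: "AE x in M. convergent (\<lambda>j. X (r j) x)"
  proof eventually_elim
    case (elim x)
    then obtain J where J: "\<And>j. j >= J ==> x \<in> space M - ?A j" unfolding eventually_sequentially by auto
    have b: "norm (X (r (Suc j)) x - X (r j) x) <= ?e j" if "j >= J" for j using J[OF that] by auto
    have "summable (\<lambda>j. X (r (Suc j)) x - X (r j) x)"
      by (rule summable_comparison_test'[OF summable_geometric[of "1/2"], of J]) (use b in auto)
    hence "convergent (\<lambda>n. \<Sum>j<n. X (r (Suc j)) x - X (r j) x)" by (simp add: summable_iff_convergent)
    hence "convergent (\<lambda>n. X (r n) x - X (r 0) x)" unfolding sum_lessThan_telescope[of "\<lambda>j. X (r j) x"] .
    thus ?case by (simp add: convergent_diff_const_right_iff)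
  qed
  define Y where "Y x = lim (\<lambda>j. X (r j) x)" for x
  have Ym [measurable]: "Y \<in> borel_measurable M" unfolding Y_def[abs_def] by (rule borel_measurable_lim_metric) auto
  have lim: "AE x in M. (\<lambda>j. X (r j) x) \<longlonglongrightarrow> Y x" using conv by eventually_elim (simp add: Y_def convergent_LIMSEQ_iff)
  have sub: "tends_prob M (\<lambda>j. X (r j)) Y" by (rule AE_tendsto_imp_tends_prob[OF _ _ lim]) auto
  have "tends_prob M (\<lambda>n x. X n x - X (r n) x) (\<lambda>_. 0)" unfolding tends_prob_def
  proof (intro allI impI)
    fix \<epsilon> :: real assume e: "\<epsilon> > 0"
    show "(\<lambda>k. measure M {om \<in> space M. \<bar>X k om - X (r k) om - 0\<bar> > \<epsilon>}) \<longlonglongrightarrow> 0"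
    proof (rule LIMSEQ_I)
      fix h :: real assume "h > 0"
      then obtain n0 where n0: "\<And>k l. k >= n0 ==> l >= n0 ==> measure M {x \<in> space M. \<bar>X k x - X l x\<bar> > \<epsilon>} < h" using C[OF e] by blast
      have "norm (measure M {om \<in> space M. \<bar>X k om - X (r k) om - 0\<bar> > \<epsilon>} - 0) < h" if "k >= n0" for k
        using n0[of k "r k"] that seq_suble[OF rm, of k] by simp
      thus "\<exists>no. \<forall>k\<ge>no. norm (measure M {om \<in> space M. \<bar>X k om - X (r k) om - 0\<bar> > \<epsilon>} - 0) < h" by blast
    qed
  qed
  from tends_prob_add_null[OF _ Ym _ sub this] have "tends_prob M X Y" by simp
  thus ?thesis using that Ym by blast
qed

end

section \<open>The Ito integral of a square integrable process\<close>

context filtered_space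
begin

lemma progressive_joint:
  assumes pm: "progressively_measurable F T f" and t: "t \<in> {0..T}"
  shows "(\<lambda>p. indicator {0..t} (fst p) * f (fst p) (snd p)) \<in> borel_measurable (borel \<Otimes>\<^sub>M F t)"
proof -
  have g: "(\<lambda>p. f (fst p) (snd p)) \<in> borel_measurable (restrict_space borel {0..t} \<Otimes>\<^sub>M F t)"
    using pm t unfolding progressively_measurable_def case_prod_unfold by blast
  define pr where "pr s = max 0 (min t s)" for s :: real
  have [measurable]: "pr \<in> measurable borel (restrict_space borel {0..t})"
    using t unfolding pr_def[abs_def] by (intro measurable_restrict_space2) auto
  have m: "(\<lambda>p. (pr (fst p), snd p)) \<in> measurable (borel \<Otimes>\<^sub>M F t) (restrict_space borel {0..t} \<Otimes>\<^sub>M F t)" by measurable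
  have [measurable]: "(\<lambda>p. f (pr (fst p)) (snd p)) \<in> borel_measurable (borel \<Otimes>\<^sub>M F t)"
    using measurable_compose[OF m g] by simp
  have "(\<lambda>p. indicator {0..t} (fst p) * f (pr (fst p)) (snd p)) \<in> borel_measurable (borel \<Otimes>\<^sub>M F t)" by measurable
  also have "(\<lambda>p. indicator {0..t} (fst p) * f (pr (fst p)) (snd p)) = (\<lambda>p. indicator {0..t} (fst p) * f (fst p) (snd p))"
    by (auto simp: fun_eq_iff indicator_def pr_def)
  finally show ?thesis .
qed

lemma progressive_path:
  assumes pm: "progressively_measurable F T f" and T: "0 <= T" and om: "om \<in> space M"
  shows "set_borel_measurable lborel {0..T} (\<lambda>s. f s om)"
proof -
  have TT: "T \<in> {0..T}" using T by simp
  have "(\<lambda>s. (s, om)) \<in> measurable borel (borel \<Otimes>\<^sub>M F T)" using om F_space[OF TT] by (intro measurable_Pair) auto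
  from measurable_compose[OF this progressive_joint[OF pm TT]] show ?thesis
    by (simp add: set_borel_measurable_def)
qed

lemma progressive_joint_M:
  assumes pm: "progressively_measurable F T f" and T: "0 <= T"
  shows "(\<lambda>p. indicator {0..T} (snd p) * f (snd p) (fst p)) \<in> borel_measurable (M \<Otimes>\<^sub>M lborel)"
proof -
  have TT: "T \<in> {0..T}" using T by simp
  have id: "(\<lambda>om. om) \<in> measurable M (F T)" using sub[OF TT] by (auto simp: subalgebra_def measurable_def)
  have m1: "fst \<in> measurable (M \<Otimes>\<^sub>M (lborel :: real measure)) (F T)" using measurable_compose[OF measurable_fst id] .
  have m2: "snd \<in> measurable (M \<Otimes>\<^sub>M (lborel :: real measure)) borel" using measurable_snd[of M "lborel :: real measure"] by (simp cong: measurable_cong_sets)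
  have "(\<lambda>p. (snd p, fst p)) \<in> measurable (M \<Otimes>\<^sub>M (lborel :: real measure)) (borel \<Otimes>\<^sub>M F T)" by (rule measurable_Pair[OF m2 m1])
  from measurable_compose[OF this progressive_joint[OF pm TT]] show ?thesis by simp
qed

lemma progressive_time_integral_measurable:
  assumes pm: "progressively_measurable F T f" and t: "t \<in> {0..T}" and A: "A \<in> sets borel" "A \<subseteq> {0..t}" and k: "k \<in> borel_measurable borel"
  shows "(\<lambda>om. LBINT s:A. (k (f s om) :: real)) \<in> borel_measurable (F t)"
proof -
  note j = progressive_joint[OF pm t]
  have m1: "fst \<in> measurable (F t \<Otimes>\<^sub>M (lborel :: real measure)) (F t)" by (rule measurable_fst)
  have m2 [measurable]: "snd \<in> measurable (F t \<Otimes>\<^sub>M (lborel :: real measure)) borel" using measurable_snd[of "F t" "lborel :: real measure"] by (simp cong: measurable_cong_sets)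
  have jj [measurable]: "(\<lambda>p. indicator {0..t} (snd p) * f (snd p) (fst p)) \<in> borel_measurable (F t \<Otimes>\<^sub>M lborel)"
    using measurable_compose[OF measurable_Pair[OF m2 m1] j] by simp
  have [measurable]: "k \<in> borel_measurable borel" "A \<in> sets borel" by fact+
  have "(\<lambda>p. indicator A (snd p) * k (indicator {0..t} (snd p) * f (snd p) (fst p))) \<in> borel_measurable (F t \<Otimes>\<^sub>M lborel)"
    by measurable
  also have "(\<lambda>p. indicator A (snd p) * k (indicator {0..t} (snd p) * f (snd p) (fst p))) = (\<lambda>p. indicator A (snd p) * k (f (snd p) (fst p)))"
    using A(2) by (auto simp: fun_eq_iff indicator_def)
  finally have m: "(\<lambda>(om, s). indicator A s * k (f s om)) \<in> borel_measurable (F t \<Otimes>\<^sub>M lborel)" by (simp add: case_prod_beta)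
  show ?thesis unfolding set_lebesgue_integral_def using lborel.borel_measurable_lebesgue_integral[OF m] by simp
qed

lemma L2_process_sq_int:
  assumes "L2_process M F T f" "0 <= T"
  shows "AE om in M. sq_int T (\<lambda>t. f t om)"
proof -
  have "AE om in M. set_integrable lborel {0..T} (\<lambda>t. (f t om)\<^sup>2)" using assms by (simp add: L2_process_def)
  thus ?thesis using AE_space
  proof eventually_elim
    case (elim om)
    thus ?case using progressive_path[OF _ assms(2) elim(2), of f] assms(1) by (simp add: sq_int_def L2_process_def)
  qed
qed

text \<open>
  The mean over the preceding cell is known at the start of the current one; this is why the
  averages are lagged.
\<close>

lemma lag_simple_integrand:
  assumes pm: "progressively_measurable F T f" and T: "0 < T"
  shows "simple_integrand F T (Suc n) (grid T (Suc n)) (\<lambda>j om. lag T n (\<lambda>s. f s om) j)"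
  unfolding simple_integrand_def
proof (intro conjI allI impI)
  show "grid T (Suc n) 0 = 0" "grid T (Suc n) (Suc n) = T" using grid_0[OF T] grid_N[OF T] by auto
  fix i assume i: "i < Suc n"
  show "grid T (Suc n) i < grid T (Suc n) (Suc i)" using grid_increasing[OF T, of "Suc n"] i by (simp add: increasing_upto_def)
  have r: "grid T (Suc n) i \<in> {0..T}" using grid_range[OF T, of "Suc n" i] i by auto
  show "(\<lambda>om. lag T n (\<lambda>s. f s om) i) \<in> borel_measurable (F (grid T (Suc n) i))"
  proof (cases i)
    case 0
    thus ?thesis by (simp add: lag_def cell_avg_def)
  next
    case (Suc j)
    have "0 <= grid T (Suc n) j" using grid_range[OF T, of "Suc n" j] i Suc by auto
    hence s: "{grid T (Suc n) j<..grid T (Suc n) i} \<subseteq> {0..grid T (Suc n) i}" by auto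
    have "(\<lambda>om. LBINT s:{grid T (Suc n) j<..grid T (Suc n) i}. clip (real n) (f s om)) \<in> borel_measurable (F (grid T (Suc n) i))"
      by (rule progressive_time_integral_measurable[OF pm r _ s clip_measurable]) simp
    thus ?thesis unfolding lag_def cell_avg_def using Suc by simp
  qed
  have "\<bar>lag T n (\<lambda>s. f s om) i\<bar> <= real n" if "om \<in> space M" for om
    unfolding lag_def
  proof (rule cell_avg_abs_le[OF T _ _ _ i])
    have "sq_int T (\<lambda>t. clip (real n) (f t om))"
      unfolding sq_int_def
    proof
      have p: "set_borel_measurable lborel {0..T} (\<lambda>s. f s om)" using progressive_path[OF pm _ that] T by simp
      show c: "set_borel_measurable lborel {0..T} (\<lambda>t. clip (real n) (f t om))"
        using p by (intro set_borel_measurable_fun2[where k="\<lambda>x y. clip (real n) x" and g="\<lambda>s. f s om" and h="\<lambda>s. f s om"])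
          (auto simp: clip_0 intro!: clip_cont borel_measurable_continuous_onI continuous_intros)
      have c2: "set_borel_measurable lborel {0..T} (\<lambda>t. (clip (real n) (f t om))\<^sup>2)"
        using c by (intro set_borel_measurable_fun2[where k="\<lambda>x y. x\<^sup>2" and g="\<lambda>t. clip (real n) (f t om)" and h="\<lambda>t. clip (real n) (f t om)"])
          (auto intro!: borel_measurable_continuous_onI continuous_intros)
      show "set_integrable lborel {0..T} (\<lambda>t. (clip (real n) (f t om))\<^sup>2)"
      proof (rule set_integrable_bound[of _ _ "\<lambda>_. (real n)\<^sup>2", OF _ c2])
        show "set_integrable lborel {0..T} (\<lambda>_. (real n)\<^sup>2)" using sq_int_integrable[OF sq_int_const] .
        show "AE x in lborel. x \<in> {0..T} \<longrightarrow> norm ((clip (real n) (f x om))\<^sup>2) <= norm ((real n)\<^sup>2)"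
          using clip_abs_le[of "real n"] by (auto simp: abs_le_square_iff[symmetric])
      qed
    qed
    thus "set_integrable lborel {0..T} (\<lambda>t. clip (real n) (f t om))" by (rule sq_int_integrable)
  qed (auto intro: clip_abs_le)
  thus "\<exists>C. \<forall>om\<in>space (F (grid T (Suc n) i)). \<bar>lag T n (\<lambda>s. f s om) i\<bar> <= C" using F_space[OF r] by auto
qed

lemma simple_process_lag:
  "simple_process (Suc n) (grid T (Suc n)) (\<lambda>j om. lag T n (\<lambda>s. f s om) j) t om = lag_step T n (\<lambda>s. f s om) t"
  by (simp add: simple_process_def lag_step_def step_avg_def lag_def)

text \<open>
  The pathwise \<open>L\<^sup>2\<close>-distance of a simple process from its target.
\<close>

definition sq_dist :: "nat => (nat => real) => (nat => 'a => real) => (real => 'a => real) => 'a => real" where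
  "sq_dist n \<tau> \<xi> f om = sq_norm T (\<lambda>t. simple_process n \<tau> \<xi> t om - f t om)"

lemma sq_dist_measurable:
  assumes \<xi>: "simple_integrand F T n \<tau> \<xi>" and pm: "progressively_measurable F T f" and T: "0 <= T"
  shows "sq_dist n \<tau> \<xi> f \<in> borel_measurable M"
proof -
  note [measurable] = progressive_joint_M[OF pm T]
  have [measurable]: "(\<lambda>p. simple_process n \<tau> \<xi> (snd p) (fst p)) \<in> borel_measurable (M \<Otimes>\<^sub>M lborel)"
    unfolding simple_process_def
  proof (intro borel_measurable_sum borel_measurable_times)
    fix i assume "i \<in> {..<n}"
    hence "\<xi> i \<in> borel_measurable M" using simple_integrand_measurable_M[OF \<xi>] by auto
    thus "(\<lambda>p. \<xi> i (fst p)) \<in> borel_measurable (M \<Otimes>\<^sub>M lborel)" by measurable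
  qed measurable
  have "(\<lambda>p. indicator {0..T} (snd p) * (simple_process n \<tau> \<xi> (snd p) (fst p) - indicator {0..T} (snd p) * f (snd p) (fst p))\<^sup>2) \<in> borel_measurable (M \<Otimes>\<^sub>M lborel)"
    by measurable
  also have "(\<lambda>p. indicator {0..T} (snd p) * (simple_process n \<tau> \<xi> (snd p) (fst p) - indicator {0..T} (snd p) * f (snd p) (fst p))\<^sup>2)
    = (\<lambda>p. indicator {0..T} (snd p) * (simple_process n \<tau> \<xi> (snd p) (fst p) - f (snd p) (fst p))\<^sup>2)"
    by (auto simp: fun_eq_iff indicator_def)
  finally have m: "(\<lambda>(om, s). indicator {0..T} s * (simple_process n \<tau> \<xi> s om - f s om)\<^sup>2) \<in> borel_measurable (M \<Otimes>\<^sub>M lborel)"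
    by (simp add: case_prod_beta)
  show ?thesis unfolding sq_dist_def[abs_def] sq_norm_def set_lebesgue_integral_def
    using lborel.borel_measurable_lebesgue_integral[OF m] by simp
qed

lemma sq_int_simple: "simple_integrand F T n \<tau> \<xi> ==> sq_int T (\<lambda>t. simple_process n \<tau> \<xi> t om)"
  by (rule sq_int_simple_process[OF simple_integrand_increasing simple_integrand_ends])

text \<open>
  For an integrand with square integrable paths the extended nonnegative time integral of the definition
  is almost surely finite and equals \<open>sq_norm\<close>.
\<close>

lemma has_ito_integral_iff:
  assumes f: "L2_process M F T f" and T: "0 <= T"
  shows "has_ito_integral M F Z T f I \<longleftrightarrow> I \<in> borel_measurable M \<and>
    (\<exists>n \<tau> \<xi>. (\<forall>k. simple_integrand F T (n k) (\<tau> k) (\<xi> k)) \<and>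
      tends_prob M (\<lambda>k. sq_dist (n k) (\<tau> k) (\<xi> k) f) (\<lambda>_. 0) \<and>
      tends_prob M (\<lambda>k. simple_ito_integral Z (n k) (\<tau> k) (\<xi> k)) I)"
proof -
  have pm: "progressively_measurable F T f" using f by (simp add: L2_process_def)
  have eq: "measure M {om \<in> space M. (\<integral>\<^sup>+t\<in>{0..T}. ennreal ((simple_process n \<tau> \<xi> t om - f t om)\<^sup>2) \<partial>lborel) > ennreal \<epsilon>}
     = measure M {om \<in> space M. \<bar>sq_dist n \<tau> \<xi> f om - 0\<bar> > \<epsilon>}"
    if \<xi>: "simple_integrand F T n \<tau> \<xi>" and \<epsilon>: "\<epsilon> > 0" for n \<tau> \<xi> and \<epsilon> :: real
  proof (rule measure_eq_AE)
    note [measurable] = progressive_joint_M[OF pm T]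
    have [measurable]: "(\<lambda>p. simple_process n \<tau> \<xi> (snd p) (fst p)) \<in> borel_measurable (M \<Otimes>\<^sub>M lborel)"
      unfolding simple_process_def
    proof (intro borel_measurable_sum borel_measurable_times)
      fix i assume "i \<in> {..<n}"
      hence "\<xi> i \<in> borel_measurable M" using simple_integrand_measurable_M[OF \<xi>] by auto
      thus "(\<lambda>p. \<xi> i (fst p)) \<in> borel_measurable (M \<Otimes>\<^sub>M lborel)" by measurable
    qed measurable
    have "(\<lambda>p. ennreal ((simple_process n \<tau> \<xi> (snd p) (fst p) - indicator {0..T} (snd p) * f (snd p) (fst p))\<^sup>2) * indicator {0..T} (snd p)) \<in> borel_measurable (M \<Otimes>\<^sub>M lborel)"
      by measurable
    also have "(\<lambda>p. ennreal ((simple_process n \<tau> \<xi> (snd p) (fst p) - indicator {0..T} (snd p) * f (snd p) (fst p))\<^sup>2) * indicator {0..T} (snd p))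
      = (\<lambda>p. ennreal ((simple_process n \<tau> \<xi> (snd p) (fst p) - f (snd p) (fst p))\<^sup>2) * indicator {0..T} (snd p))"
      by (auto simp: fun_eq_iff indicator_def)
    finally have m: "(\<lambda>(om, t). ennreal ((simple_process n \<tau> \<xi> t om - f t om)\<^sup>2) * indicator {0..T} t) \<in> borel_measurable (M \<Otimes>\<^sub>M lborel)"
      by (simp add: case_prod_beta)
    have [measurable]: "(\<lambda>om. \<integral>\<^sup>+t\<in>{0..T}. ennreal ((simple_process n \<tau> \<xi> t om - f t om)\<^sup>2) \<partial>lborel) \<in> borel_measurable M"
      using lborel.borel_measurable_nn_integral[OF m] by simp
    show "{om \<in> space M. (\<integral>\<^sup>+t\<in>{0..T}. ennreal ((simple_process n \<tau> \<xi> t om - f t om)\<^sup>2) \<partial>lborel) > ennreal \<epsilon>} \<in> sets M" by measurable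
    show "{om \<in> space M. \<bar>sq_dist n \<tau> \<xi> f om - 0\<bar> > \<epsilon>} \<in> sets M"
      using sq_dist_measurable[OF \<xi> pm T] by measurable
    show "AE om in M. (om \<in> {om \<in> space M. (\<integral>\<^sup>+t\<in>{0..T}. ennreal ((simple_process n \<tau> \<xi> t om - f t om)\<^sup>2) \<partial>lborel) > ennreal \<epsilon>})
      = (om \<in> {om \<in> space M. \<bar>sq_dist n \<tau> \<xi> f om - 0\<bar> > \<epsilon>})"
      using L2_process_sq_int[OF f T]
    proof eventually_elim
      case (elim om)
      have "(\<integral>\<^sup>+t\<in>{0..T}. ennreal ((simple_process n \<tau> \<xi> t om - f t om)\<^sup>2) \<partial>lborel) = ennreal (sq_dist n \<tau> \<xi> f om)"
        unfolding sq_dist_def by (rule nn_integral_sq_norm[OF sq_int_diff[OF sq_int_simple[OF \<xi>] elim]])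
      thus ?case using \<epsilon> by (simp add: ennreal_less_iff sq_dist_def)
    qed
  qed
  have key: "(\<forall>\<epsilon>>0. (\<lambda>k. measure M {om \<in> space M. (\<integral>\<^sup>+t\<in>{0..T}. ennreal ((simple_process (n k) (\<tau> k) (\<xi> k) t om - f t om)\<^sup>2) \<partial>lborel) > ennreal \<epsilon>}) \<longlonglongrightarrow> 0)
    \<longleftrightarrow> tends_prob M (\<lambda>k. sq_dist (n k) (\<tau> k) (\<xi> k) f) (\<lambda>_. 0)"
    if "\<forall>k. simple_integrand F T (n k) (\<tau> k) (\<xi> k)" for n \<tau> \<xi>
  proof -
    have "(\<lambda>k. measure M {om \<in> space M. (\<integral>\<^sup>+t\<in>{0..T}. ennreal ((simple_process (n k) (\<tau> k) (\<xi> k) t om - f t om)\<^sup>2) \<partial>lborel) > ennreal \<epsilon>})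
      = (\<lambda>k. measure M {om \<in> space M. \<bar>sq_dist (n k) (\<tau> k) (\<xi> k) f om - 0\<bar> > \<epsilon>})" if "\<epsilon> > 0" for \<epsilon> :: real
      by (rule ext, rule eq[OF _ that]) (use \<open>\<forall>k. _\<close> in simp)
    thus ?thesis unfolding tends_prob_def by (intro iff_allI imp_cong refl) (simp only:)
  qed
  have pm': "progressively_measurable F T f \<and> P \<longleftrightarrow> P" for P using pm by simp
  show ?thesis unfolding has_ito_integral_def tends_prob_def[of M _ I, symmetric] pm'
    by (intro conj_cong refl iff_exI key)
qed

end

context bm_pair
begin

lemma simple_ito_diff_bound:
  assumes f: "L2_process M F T f" and T: "0 <= T"
    and \<xi>: "simple_integrand F T n \<tau> \<xi>" and \<eta>: "simple_integrand F T k \<upsilon> \<eta>" and \<epsilon>: "\<epsilon> > 0" and \<delta>: "\<delta> > 0"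
  shows "measure M {om \<in> space M. \<bar>simple_ito_integral W n \<tau> \<xi> om - simple_ito_integral W k \<upsilon> \<eta> om\<bar> > \<epsilon>} \<le>
    measure M {om \<in> space M. \<bar>sq_dist n \<tau> \<xi> f om - 0\<bar> > \<delta>} + measure M {om \<in> space M. \<bar>sq_dist k \<upsilon> \<eta> f om - 0\<bar> > \<delta>} + 2 * exp (- (\<epsilon>\<^sup>2 / (2 * (4 * \<delta>))))"
proof -
  have pm: "progressively_measurable F T f" using f by (simp add: L2_process_def)
  have d4: "4 * \<delta> > 0" using \<delta> by simp
  note [measurable] = sq_dist_measurable[OF \<xi> pm T] sq_dist_measurable[OF \<eta> pm T] simple_diff_tail(2)[OF \<xi> \<eta> \<epsilon> \<delta>]
  have "measure M {om \<in> space M. sq_norm T (\<lambda>t. simple_process n \<tau> \<xi> t om - simple_process k \<upsilon> \<eta> t om) > 4 * \<delta>}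
    = measure M {om \<in> space M. \<bar>sq_norm T (\<lambda>t. simple_process n \<tau> \<xi> t om - simple_process k \<upsilon> \<eta> t om)\<bar> > 2 * \<delta> + 2 * \<delta>}"
    by simp
  also have "\<dots> <= measure M {om \<in> space M. \<bar>2 * sq_dist n \<tau> \<xi> f om\<bar> > 2 * \<delta>} + measure M {om \<in> space M. \<bar>2 * sq_dist k \<upsilon> \<eta> f om\<bar> > 2 * \<delta>}"
  proof (rule measure_gt_add_le)
    show "AE om in M. \<bar>sq_norm T (\<lambda>t. simple_process n \<tau> \<xi> t om - simple_process k \<upsilon> \<eta> t om)\<bar> <= \<bar>2 * sq_dist n \<tau> \<xi> f om\<bar> + \<bar>2 * sq_dist k \<upsilon> \<eta> f om\<bar>"
      using L2_process_sq_int[OF f T]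
    proof eventually_elim
      case (elim om)
      have "sq_norm T (\<lambda>t. simple_process n \<tau> \<xi> t om - simple_process k \<upsilon> \<eta> t om) <= 2 * sq_dist n \<tau> \<xi> f om + 2 * sq_norm T (\<lambda>t. f t om - simple_process k \<upsilon> \<eta> t om)"
        unfolding sq_dist_def by (rule sq_norm_diff_le[OF sq_int_simple[OF \<xi>] elim sq_int_simple[OF \<eta>]])
      also have "sq_norm T (\<lambda>t. f t om - simple_process k \<upsilon> \<eta> t om) = sq_dist k \<upsilon> \<eta> f om"
        unfolding sq_dist_def by (rule sq_norm_diff_commute)
      finally show ?case by (simp add: sq_dist_def)
    qed
  qed measurable
  finally have "measure M {om \<in> space M. sq_norm T (\<lambda>t. simple_process n \<tau> \<xi> t om - simple_process k \<upsilon> \<eta> t om) > 4 * \<delta>}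
    <= measure M {om \<in> space M. \<bar>sq_dist n \<tau> \<xi> f om - 0\<bar> > \<delta>} + measure M {om \<in> space M. \<bar>sq_dist k \<upsilon> \<eta> f om - 0\<bar> > \<delta>}"
    by (simp add: abs_mult)
  thus ?thesis using simple_diff_tail(1)[OF \<xi> \<eta> \<epsilon> d4] by linarith
qed

lemma small_gaussian_tail:
  assumes "\<epsilon> > 0" "h > 0"
  obtains \<delta> :: real where "\<delta> > 0" "2 * exp (- (\<epsilon>\<^sup>2 / (2 * (4 * \<delta>)))) < (h::real)"
proof -
  define K where "K = 2 / h"
  have K: "K > 0" using assms by (simp add: K_def)
  define \<delta> where "\<delta> = \<epsilon>\<^sup>2 / (8 * K)"
  have "\<epsilon>\<^sup>2 / (2 * (4 * \<delta>)) = K" using assms K by (simp add: \<delta>_def)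
  moreover have "2 * exp (- K) < h"
  proof -
    have "K < exp K" using exp_ge_add_one_self[of K] by linarith
    hence "2 < h * exp K" using assms by (simp add: K_def pos_divide_less_eq mult.commute)
    hence "2 / exp K < h" by (simp add: pos_divide_less_eq)
    thus ?thesis by (simp add: exp_minus divide_inverse)
  qed
  moreover have "\<delta> > 0" using assms K by (simp add: \<delta>_def)
  ultimately show ?thesis using that by metis
qed

lemma simple_ito_diff_tends:
  assumes f: "L2_process M F T f" and T: "0 <= T"
    and \<xi>: "\<And>k. simple_integrand F T (n k) (\<tau> k) (\<xi> k)" "tends_prob M (\<lambda>k. sq_dist (n k) (\<tau> k) (\<xi> k) f) (\<lambda>_. 0)"
    and \<eta>: "\<And>k. simple_integrand F T (m k) (\<upsilon> k) (\<eta> k)" "tends_prob M (\<lambda>k. sq_dist (m k) (\<upsilon> k) (\<eta> k) f) (\<lambda>_. 0)"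
    and e: "e > 0" and h: "h > 0"
  shows "\<exists>n0. \<forall>k\<ge>n0. \<forall>l\<ge>n0. measure M {om \<in> space M. \<bar>simple_ito_integral W (n k) (\<tau> k) (\<xi> k) om - simple_ito_integral W (m l) (\<upsilon> l) (\<eta> l) om\<bar> > e} < h"
proof -
  have h3: "h / 3 > 0" using h by simp
  obtain \<delta> where \<delta>: "\<delta> > 0" "2 * exp (- (e\<^sup>2 / (2 * (4 * \<delta>)))) < h / 3" using small_gaussian_tail[OF e h3] by blast
  have "eventually (\<lambda>k. measure M {om \<in> space M. \<bar>sq_dist (n k) (\<tau> k) (\<xi> k) f om - 0\<bar> > \<delta>} < h / 3) sequentially"
    by (rule order_tendstoD(2)[OF \<xi>(2)[unfolded tends_prob_def, rule_format, OF \<delta>(1)] h3])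
  moreover have "eventually (\<lambda>k. measure M {om \<in> space M. \<bar>sq_dist (m k) (\<upsilon> k) (\<eta> k) f om - 0\<bar> > \<delta>} < h / 3) sequentially"
    by (rule order_tendstoD(2)[OF \<eta>(2)[unfolded tends_prob_def, rule_format, OF \<delta>(1)] h3])
  ultimately obtain n1 n2 where
    n1: "\<And>k. k >= n1 ==> measure M {om \<in> space M. \<bar>sq_dist (n k) (\<tau> k) (\<xi> k) f om - 0\<bar> > \<delta>} < h / 3"
    and n2: "\<And>k. k >= n2 ==> measure M {om \<in> space M. \<bar>sq_dist (m k) (\<upsilon> k) (\<eta> k) f om - 0\<bar> > \<delta>} < h / 3"
    unfolding eventually_sequentially by blast
  show ?thesis
  proof (intro exI[of _ "max n1 n2"] allI impI)
    fix k l assume "k >= max n1 n2" "l >= max n1 n2"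
    hence "k >= n1" "l >= n2" by auto
    thus "measure M {om \<in> space M. \<bar>simple_ito_integral W (n k) (\<tau> k) (\<xi> k) om - simple_ito_integral W (m l) (\<upsilon> l) (\<eta> l) om\<bar> > e} < h"
      using simple_ito_diff_bound[OF f T \<xi>(1)[of k] \<eta>(1)[of l] e \<delta>(1)] n1[of k] n2[of l] \<delta>(2) by linarith
  qed
qed

lemma simple_ito_limit_transfer:
  assumes f: "L2_process M F T f" and T: "0 <= T"
    and \<xi>: "\<And>k. simple_integrand F T (n k) (\<tau> k) (\<xi> k)" "tends_prob M (\<lambda>k. sq_dist (n k) (\<tau> k) (\<xi> k) f) (\<lambda>_. 0)"
    and \<eta>: "\<And>k. simple_integrand F T (m k) (\<upsilon> k) (\<eta> k)" "tends_prob M (\<lambda>k. sq_dist (m k) (\<upsilon> k) (\<eta> k) f) (\<lambda>_. 0)"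
    and I: "I \<in> borel_measurable M" "tends_prob M (\<lambda>k. simple_ito_integral W (n k) (\<tau> k) (\<xi> k)) I"
  shows "tends_prob M (\<lambda>k. simple_ito_integral W (m k) (\<upsilon> k) (\<eta> k)) I"
proof (rule tends_prob_add_null[OF _ I(1) _ I(2)])
  show "simple_ito_integral W (n k) (\<tau> k) (\<xi> k) \<in> borel_measurable M" "simple_ito_integral W (m k) (\<upsilon> k) (\<eta> k) \<in> borel_measurable M" for k
    by (rule simple_ito_integral_measurable[OF \<xi>(1) bW] simple_ito_integral_measurable[OF \<eta>(1) bW])+
  show "tends_prob M (\<lambda>k om. simple_ito_integral W (m k) (\<upsilon> k) (\<eta> k) om - simple_ito_integral W (n k) (\<tau> k) (\<xi> k) om) (\<lambda>_. 0)"
    unfolding tends_prob_def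
  proof (intro allI impI LIMSEQ_I)
    fix e h :: real assume "e > 0" "h > 0"
    from simple_ito_diff_tends[OF f T \<eta> \<xi> this] show "\<exists>no. \<forall>k\<ge>no. norm (measure M {om \<in> space M. \<bar>simple_ito_integral W (m k) (\<upsilon> k) (\<eta> k) om - simple_ito_integral W (n k) (\<tau> k) (\<xi> k) om - 0\<bar> > e} - 0) < h"
      by auto
  qed
qed

text \<open>
  By the tail bound two approximating sequences have integrals with the same limit in probability.
\<close>

lemma has_ito_integral_unique:
  assumes f: "L2_process M F T f" and T: "0 <= T"
    and I: "has_ito_integral M F W T f I" and J: "has_ito_integral M F W T f J"
  shows "AE om in M. I om = J om"
proof -
  obtain n \<tau> \<xi> where \<xi>: "\<And>k. simple_integrand F T (n k) (\<tau> k) (\<xi> k)" "tends_prob M (\<lambda>k. sq_dist (n k) (\<tau> k) (\<xi> k) f) (\<lambda>_. 0)"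
      "tends_prob M (\<lambda>k. simple_ito_integral W (n k) (\<tau> k) (\<xi> k)) I" and Im: "I \<in> borel_measurable M"
    using I unfolding has_ito_integral_iff[OF f T] by blast
  obtain m \<upsilon> \<eta> where \<eta>: "\<And>k. simple_integrand F T (m k) (\<upsilon> k) (\<eta> k)" "tends_prob M (\<lambda>k. sq_dist (m k) (\<upsilon> k) (\<eta> k) f) (\<lambda>_. 0)"
      "tends_prob M (\<lambda>k. simple_ito_integral W (m k) (\<upsilon> k) (\<eta> k)) J" and Jm: "J \<in> borel_measurable M"
    using J unfolding has_ito_integral_iff[OF f T] by blast
  show ?thesis
    by (rule tends_prob_unique[OF simple_ito_integral_measurable[OF \<eta>(1) bW] Im Jm simple_ito_limit_transfer[OF f T \<xi>(1,2) \<eta>(1,2) Im \<xi>(3)] \<eta>(3)])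
qed

lemma lag_sq_dist_AE:
  assumes f: "L2_process M F T f" and T: "0 < T"
  shows "AE om in M. (\<lambda>n. sq_dist (Suc n) (grid T (Suc n)) (\<lambda>j om. lag T n (\<lambda>s. f s om) j) f om) \<longlonglongrightarrow> 0"
  using L2_process_sq_int[OF f less_imp_le[OF T]] unfolding sq_dist_def simple_process_lag
  by eventually_elim (rule lag_step_tendsto[OF T])

lemma lag_sq_dist_tends:
  assumes f: "L2_process M F T f" and T: "0 < T"
  shows "tends_prob M (\<lambda>n. sq_dist (Suc n) (grid T (Suc n)) (\<lambda>j om. lag T n (\<lambda>s. f s om) j) f) (\<lambda>_. 0)"
proof (rule AE_tendsto_imp_tends_prob[OF _ _ lag_sq_dist_AE[OF f T]])
  have pm: "progressively_measurable F T f" using f by (simp add: L2_process_def)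
  show "sq_dist (Suc n) (grid T (Suc n)) (\<lambda>j om. lag T n (\<lambda>s. f s om) j) f \<in> borel_measurable M" for n
    using T by (intro sq_dist_measurable[OF lag_simple_integrand[OF pm T] pm]) simp
qed simp

text \<open>
  The lagged averages approximate the integrand, their integrals are Cauchy in probability by the
  tail bound, and the limit exists by completeness. At horizon zero the only partition is empty.
\<close>

lemma has_ito_integral_exists:
  assumes f: "L2_process M F T f" and T: "0 <= T"
  shows "\<exists>I. has_ito_integral M F W T f I"
proof (cases "T = 0")
  case True
  have "tends_prob M (\<lambda>k. sq_dist 0 (\<lambda>_. 0) (\<lambda>_ _. 0) f) (\<lambda>_. 0)"
  proof -
    have "sq_dist 0 (\<lambda>_. 0) (\<lambda>_ _. 0) f om = 0" for om
    proof -
      have "AE t in lborel. t \<noteq> (0::real)" by (rule AE_lborel_singleton)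
      hence "AE t in lborel. indicator {0..0} t *\<^sub>R (- f t om)\<^sup>2 = (0::real)"
        by eventually_elim (simp add: indicator_def)
      hence "(\<integral>t. indicator {0..0} t *\<^sub>R (- f t om)\<^sup>2 \<partial>lborel) = (0::real)"
        by (rule integral_eq_zero_AE)
      thus ?thesis unfolding sq_dist_def unfolding sq_norm_def set_lebesgue_integral_def True by (simp add: simple_process_def)
    qed
    thus ?thesis by (simp add: tends_prob_def)
  qed
  moreover have "simple_integrand F T 0 (\<lambda>_. 0) (\<lambda>_ _. 0)" by (simp add: simple_integrand_def True)
  moreover have "tends_prob M (\<lambda>k. simple_ito_integral W 0 (\<lambda>_. 0) (\<lambda>_ _. 0)) (\<lambda>_. 0)"
    by (simp add: tends_prob_def simple_ito_integral_def)
  ultimately have "has_ito_integral M F W T f (\<lambda>_. 0)" unfolding has_ito_integral_iff[OF f T]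
    by (intro conjI exI[of _ "\<lambda>_. 0"] exI[of _ "\<lambda>_ _. 0"] exI[of _ "\<lambda>_ _ _. 0"]) auto
  thus ?thesis by blast
next
  case False
  hence T': "0 < T" using T by simp
  have pm: "progressively_measurable F T f" using f by (simp add: L2_process_def)
  note si = lag_simple_integrand[OF pm T'] and d = lag_sq_dist_tends[OF f T']
  obtain I where I: "I \<in> borel_measurable M" "tends_prob M (\<lambda>n. simple_ito_integral W (Suc n) (grid T (Suc n)) (\<lambda>j om. lag T n (\<lambda>s. f s om) j)) I"
    by (rule cauchy_in_prob_convergent[OF simple_ito_integral_measurable[OF si bW] simple_ito_diff_tends[OF f T si d si d]])
  show ?thesis unfolding has_ito_integral_iff[OF f T]
    by (intro exI[of _ I] conjI exI[of _ "\<lambda>n. Suc n"] exI[of _ "\<lambda>n. grid T (Suc n)"]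
      exI[of _ "\<lambda>n j om. lag T n (\<lambda>s. f s om) j"] allI I si d)
qed

lemma has_ito_integral_ito_integral:
  assumes f: "L2_process M F T f" and T: "0 <= T"
  shows "has_ito_integral M F W T f (ito_integral M F W T f)"
  unfolding ito_integral_def using has_ito_integral_exists[OF assms] by (rule someI_ex)

lemma lag_tends_ito_integral:
  assumes f: "L2_process M F T f" and T: "0 < T"
  shows "tends_prob M (\<lambda>n. simple_ito_integral W (Suc n) (grid T (Suc n)) (\<lambda>j om. lag T n (\<lambda>s. f s om) j)) (ito_integral M F W T f)"
    "ito_integral M F W T f \<in> borel_measurable M"
proof -
  have T0: "0 <= T" using T by simp
  have pm: "progressively_measurable F T f" using f by (simp add: L2_process_def)
  note si = lag_simple_integrand[OF pm T] and d = lag_sq_dist_tends[OF f T]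
  obtain n \<tau> \<xi> where \<xi>: "\<And>k. simple_integrand F T (n k) (\<tau> k) (\<xi> k)" "tends_prob M (\<lambda>k. sq_dist (n k) (\<tau> k) (\<xi> k) f) (\<lambda>_. 0)"
      "tends_prob M (\<lambda>k. simple_ito_integral W (n k) (\<tau> k) (\<xi> k)) (ito_integral M F W T f)" and Im: "ito_integral M F W T f \<in> borel_measurable M"
    using has_ito_integral_ito_integral[OF f T0] unfolding has_ito_integral_iff[OF f T0] by blast
  show "tends_prob M (\<lambda>n. simple_ito_integral W (Suc n) (grid T (Suc n)) (\<lambda>j om. lag T n (\<lambda>s. f s om) j)) (ito_integral M F W T f)"
    by (rule simple_ito_limit_transfer[OF f T0 \<xi>(1,2) si d Im \<xi>(3)])
  show "ito_integral M F W T f \<in> borel_measurable M" by (rule Im)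
qed

lemma bm_pair_swap: "bm_pair M F T B W"
proof (unfold_locales, rule bB, rule bW)
  let ?S = "\<lambda>Z. sigma_sets (space M) {(\<lambda>om. \<lambda>t\<in>{0..T}. Z t om) -` A \<inter> space M |A. A \<in> sets (Pi\<^sub>M {0..T} (\<lambda>_. borel))}"
  have i: "random_variable (Pi\<^sub>M {0..T} (\<lambda>_. borel)) (\<lambda>om. \<lambda>t\<in>{0..T}. B t om)" "random_variable (Pi\<^sub>M {0..T} (\<lambda>_. borel)) (\<lambda>om. \<lambda>t\<in>{0..T}. W t om)"
    "?S B \<subseteq> events" "?S W \<subseteq> events" and p: "\<And>a b. a \<in> ?S B ==> b \<in> ?S W ==> prob (a \<inter> b) = prob a * prob b"
    using indep unfolding independent_processes_def indep_var_eq indep_sets2_eq by blast+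
  show "independent_processes M T W B"
    unfolding independent_processes_def indep_var_eq indep_sets2_eq
    by (intro conjI ballI i) (subst Int_commute, subst mult.commute, rule p)
qed

end

lemma (in bm_pair) bm_pair_restrict:
  assumes t: "0 <= t" "t <= T"
  shows "bm_pair M F t W B"
proof -
  have bm: "brownian_motion M F t Z" if "brownian_motion M F T Z" for Z
    using that t unfolding brownian_motion_def adapted_def continuous_paths_def
    by (auto elim!: eventually_mono intro: continuous_on_subset)
  have ip: "independent_processes M t B W"
  proof -
    let ?r = "\<lambda>p. restrict p {0..t}"
    have r: "?r \<in> measurable (Pi\<^sub>M {0..T} (\<lambda>_. borel)) (Pi\<^sub>M {0..t} (\<lambda>_. borel))"
      using t by (intro measurable_restrict_subset) auto
    have "indep_var (Pi\<^sub>M {0..t} (\<lambda>_. borel)) (?r \<circ> (\<lambda>om. \<lambda>t\<in>{0..T}. B t om)) (Pi\<^sub>M {0..t} (\<lambda>_. borel)) (?r \<circ> (\<lambda>om. \<lambda>t\<in>{0..T}. W t om))"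
      using indep[unfolded independent_processes_def] r r by (rule indep_var_compose)
    moreover have "?r \<circ> (\<lambda>om. \<lambda>t\<in>{0..T}. Z t om) = (\<lambda>om. \<lambda>t\<in>{0..t}. Z t om)" for Z :: "real => 'a => real"
      using t by (auto simp: fun_eq_iff restrict_def)
    ultimately show ?thesis unfolding independent_processes_def by simp
  qed
  show ?thesis
    by unfold_locales (use sub F_mono t bm[OF bW] bm[OF bB] ip in auto)
qed

section \<open>Novikov's criterion\<close>

context prob_space
begin

lemma integral_limit_le:
  assumes i: "\<And>n. integrable M (X n)" "\<And>n x. 0 <= (X n x :: real)" "\<And>n. (LINT x|M. X n x) <= c"
    and lim: "AE x in M. (\<lambda>n. X n x) \<longlonglongrightarrow> Y x" and [measurable]: "Y \<in> borel_measurable M" and Y0: "\<And>x. 0 <= Y x"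
  shows "integrable M Y" "(LINT x|M. Y x) <= c"
proof -
  have [measurable]: "X n \<in> borel_measurable M" for n using i(1)[of n] by auto
  have c0: "0 <= c" by (rule order_trans[OF Bochner_Integration.integral_nonneg i(3)[of 0]]) (rule i(2))
  have "(\<integral>\<^sup>+x. ennreal (Y x) \<partial>M) = (\<integral>\<^sup>+x. liminf (\<lambda>n. ennreal (X n x)) \<partial>M)"
  proof (rule nn_integral_cong_AE)
    show "AE x in M. ennreal (Y x) = liminf (\<lambda>n. ennreal (X n x))" using lim
    proof eventually_elim
      case (elim x)
      hence "(\<lambda>n. ennreal (X n x)) \<longlonglongrightarrow> ennreal (Y x)" by (rule tendsto_ennrealI)
      thus ?case by (rule lim_imp_Liminf[OF trivial_limit_sequentially, symmetric])
    qed
  qed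
  also have "\<dots> <= liminf (\<lambda>n. \<integral>\<^sup>+x. ennreal (X n x) \<partial>M)" by (rule nn_integral_liminf) simp
  also have "\<dots> <= ennreal c"
  proof -
    have "(\<integral>\<^sup>+x. ennreal (X n x) \<partial>M) <= ennreal c" for n
      using i(3)[of n] nn_integral_eq_integral[OF i(1)[of n]] i(2) by (simp add: ennreal_leI)
    hence "liminf (\<lambda>n. \<integral>\<^sup>+x. ennreal (X n x) \<partial>M) <= liminf (\<lambda>n::nat. ennreal c)" by (intro Liminf_mono) auto
    also have "\<dots> = ennreal c" by (rule Liminf_const[OF trivial_limit_sequentially])
    finally show ?thesis .
  qed
  finally have le: "(\<integral>\<^sup>+x. ennreal (Y x) \<partial>M) <= ennreal c" .
  show iY: "integrable M Y"
    using le Y0 by (intro integrableI_bounded) (auto simp: le_less_trans[OF _ ennreal_less_top])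
  show "(LINT x|M. Y x) <= c"
    using le c0 Y0 nn_integral_eq_integral[OF iY] by simp
qed

text \<open>
  A bound on \<open>p\<close>-th moments for some \<open>p > 1\<close> prevents mass from escaping in the limit.
\<close>

lemma expectation_limit_ge_one:
  assumes [measurable]: "\<And>n. x n \<in> borel_measurable M" "y \<in> borel_measurable M"
    and lim: "AE om in M. (\<lambda>n. x n om) \<longlonglongrightarrow> y om"
    and one: "\<And>n. integrable M (\<lambda>om. exp (x n om))" "\<And>n. (LINT om|M. exp (x n om)) = 1"
    and p: "p > 1" "\<And>n. integrable M (\<lambda>om. exp (p * x n om))" "\<And>n. (LINT om|M. exp (p * x n om)) <= K"
    and iy: "integrable M (\<lambda>om. exp (y om))"
  shows "(LINT om|M. exp (y om)) >= (1::real)"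
proof -
  have low: "1 - exp (- (p - 1) * u) * K <= (LINT om|M. exp (y om))" for u
  proof -
    have im: "integrable M (\<lambda>om. min (exp (x n om)) (exp u))" for n
      by (rule integrable_const_bound[where B="exp u"]) auto
    have b: "1 - exp (- (p - 1) * u) * K <= (LINT om|M. min (exp (x n om)) (exp u))" for n
    proof -
      have "1 = (LINT om|M. exp (x n om))" using one(2) by simp
      also have "\<dots> <= (LINT om|M. min (exp (x n om)) (exp u) + exp (- (p - 1) * u) * exp (p * x n om))"
      proof (rule integral_mono[OF one(1)])
        show "integrable M (\<lambda>om. min (exp (x n om)) (exp u) + exp (- (p - 1) * u) * exp (p * x n om))" using im p(2) by auto
        fix om
        show "exp (x n om) <= min (exp (x n om)) (exp u) + exp (- (p - 1) * u) * exp (p * x n om)"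
        proof (cases "x n om <= u")
          case False
          hence "0 <= (p - 1) * (x n om - u)" using p by (intro mult_nonneg_nonneg) auto
          hence "x n om <= - (p - 1) * u + p * x n om" by (simp add: algebra_simps)
          hence "exp (x n om) <= exp (- (p - 1) * u) * exp (p * x n om)" by (simp only: exp_add[symmetric] exp_le_cancel_iff)
          thus ?thesis by (smt (verit) exp_ge_zero)
        qed (simp add: min_def)
      qed
      also have "\<dots> = (LINT om|M. min (exp (x n om)) (exp u)) + exp (- (p - 1) * u) * (LINT om|M. exp (p * x n om))"
        using im p(2) by (subst Bochner_Integration.integral_add) auto
      also have "\<dots> <= (LINT om|M. min (exp (x n om)) (exp u)) + exp (- (p - 1) * u) * K"
        using p(3) by (intro add_left_mono mult_left_mono) auto
      finally show ?thesis by simp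
    qed
    have "(\<lambda>n. LINT om|M. min (exp (x n om)) (exp u)) \<longlonglongrightarrow> (LINT om|M. min (exp (y om)) (exp u))"
    proof (rule integral_dominated_convergence[where w="\<lambda>_. exp u"])
      show "AE om in M. (\<lambda>n. min (exp (x n om)) (exp u)) \<longlonglongrightarrow> min (exp (y om)) (exp u)"
        using lim by eventually_elim (intro tendsto_intros)
    qed auto
    hence "1 - exp (- (p - 1) * u) * K <= (LINT om|M. min (exp (y om)) (exp u))" by (rule LIMSEQ_le_const) (use b in auto)
    also have "\<dots> <= (LINT om|M. exp (y om))" by (intro integral_mono iy integrable_const_bound[where B="exp u"]) auto
    finally show ?thesis .
  qed
  have "((\<lambda>u. 1 - exp (- (p - 1) * u) * K) \<longlongrightarrow> 1 - 0 * K) at_top"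
    using p by (intro tendsto_intros filterlim_compose[OF exp_at_bot] filterlim_tendsto_neg_mult_at_bot[OF tendsto_const]) (auto simp: filterlim_ident)
  hence "((\<lambda>u. 1 - exp (- (p - 1) * u) * K) \<longlongrightarrow> 1) at_top" by simp
  thus ?thesis by (rule tendsto_upperbound) (use low in \<open>auto simp: trivial_limit_at_top_linorder\<close>)
qed

lemma exp_weighted_le:
  assumes "0 <= a" "0 <= b" "a + b = 1"
  shows "exp (a * x + b * y) <= a * exp x + b * exp (y::real)"
proof -
  have a: "a = 1 - b" and "b <= 1" using assms by auto
  thus ?thesis unfolding a using convex_onD[OF exp_convex, of b x y] assms by simp
qed


text \<open>
  Novikov's criterion. Fatou's lemma gives the upper bound one. For the lower bound take \<open>l < 1\<close> and
  \<open>p = 1 / (l * (2 - l)) > 1\<close>: the \<open>p\<close>-th power of the exponential with parameter \<open>l\<close> is then a weighted geometric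
  mean of the exponential with parameter one and \<open>exp (- S n / 2)\<close>, and the latter is at most the mean of
  the exponential with parameter one and \<open>exp (q n / 2)\<close>. So \<open>p\<close>-th moments are bounded uniformly in \<open>n\<close>, and
  the limit with parameter \<open>l\<close> has mean one. Finally \<open>l\<close> tends to one.
\<close>

lemma exponential_limit_one:
  assumes Sm: "\<And>n. S n \<in> borel_measurable M" "S' \<in> borel_measurable M"
    and qm: "\<And>n. q n \<in> borel_measurable M" "q' \<in> borel_measurable M"
    and S: "AE om in M. (\<lambda>n. S n om) \<longlonglongrightarrow> S' om" and q: "AE om in M. (\<lambda>n. q n om) \<longlonglongrightarrow> q' om"
    and q0: "\<And>n om. 0 <= q n om" and qle: "\<And>n. AE om in M. q n om <= q' om"
    and nov: "integrable M (\<lambda>om. exp (q' om / 2))"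
    and one: "\<And>n l. integrable M (\<lambda>om. exp (- (l * S n om) - l\<^sup>2 * q n om / 2))" "\<And>n l. (LINT om|M. exp (- (l * S n om) - l\<^sup>2 * q n om / 2)) = (1::real)"
  shows "integrable M (\<lambda>om. exp (- S' om - q' om / 2))" "(LINT om|M. exp (- S' om - q' om / 2)) = 1"
proof -
  note [measurable] = Sm qm
  have q'0: "AE om in M. 0 <= q' om" using qle[of 0] by eventually_elim (use q0 order_trans in blast)
  let ?E = "\<lambda>l n om. exp (- (l * S n om) - l\<^sup>2 * q n om / 2)" and ?L = "\<lambda>l om. exp (- (l * S' om) - l\<^sup>2 * q' om / 2)"
  have lim: "AE om in M. (\<lambda>n. - (l * S n om) - l\<^sup>2 * q n om / 2) \<longlonglongrightarrow> - (l * S' om) - l\<^sup>2 * q' om / 2" for l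
    using S q by eventually_elim (intro tendsto_intros, auto)
  have limE: "AE om in M. (\<lambda>n. ?E l n om) \<longlonglongrightarrow> ?L l om" for l
    using lim by eventually_elim (rule tendsto_exp)
  have Li: "integrable M (?L l)" "(LINT om|M. ?L l om) <= 1" for l
  proof -
    have m: "?L l \<in> borel_measurable M" by measurable
    show "integrable M (?L l)" by (rule integral_limit_le(1)[OF one(1) _ _ limE m, where c=1]) (auto simp: one(2))
    show "(LINT om|M. ?L l om) <= 1" by (rule integral_limit_le(2)[OF one(1) _ _ limE m, where c=1]) (auto simp: one(2))
  qed
  define C where "C = (LINT om|M. exp (q' om / 2))"
  have half: "exp (- (s / 2)) <= exp (- s - r / 2) / 2 + exp (r / 2) / 2" for s r :: real
    using exp_weighted_le[of "1/2" "1/2" "- s - r / 2" "r / 2"] by (simp add: field_simps)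
  have ge: "1 <= (LINT om|M. ?L l om)" if l: "0 < l" "l < 1" for l
  proof -
    define p where "p = 1 / (l * (2 - l))"
    define \<alpha> where "\<alpha> = l / (2 - l)"
    define \<beta> where "\<beta> = 1 - \<alpha>"
    have "l * (2 - l) < 1"
    proof -
      have "0 < (1 - l)\<^sup>2" using l by simp
      thus ?thesis by (simp add: power2_eq_square algebra_simps)
    qed
    moreover have "0 < l * (2 - l)" using l by simp
    ultimately have p1: "p > 1" by (simp add: p_def)
    have \<alpha>: "0 <= \<alpha>" "\<alpha> <= 1" using l by (auto simp: \<alpha>_def)
    have \<beta>: "0 <= \<beta>" "\<alpha> + \<beta> = 1" using \<alpha> by (auto simp: \<beta>_def)
    have pl: "p * l\<^sup>2 = \<alpha>" using l by (simp add: p_def \<alpha>_def power2_eq_square)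
    have pl1: "p * l = \<alpha> + \<beta> / 2"
    proof -
      have "p * l = 1 / (2 - l)" using l by (simp add: p_def)
      moreover have "\<alpha> + \<beta> / 2 = 1 / (2 - l)"
      proof -
        have "\<alpha> * (2 - l) = l" using l by (simp add: \<alpha>_def)
        hence "(\<alpha> + \<beta> / 2) * (2 - l) = 1" by (simp add: \<beta>_def algebra_simps diff_divide_distrib)
        thus ?thesis using l by (simp add: eq_divide_eq)
      qed
      ultimately show ?thesis by simp
    qed
    have pt: "exp (p * (- (l * s) - l\<^sup>2 * r / 2)) <= \<alpha> * exp (- s - r / 2) + \<beta> * (exp (- s - r / 2) / 2 + exp (r / 2) / 2)" for s r
    proof -
      have "p * (- (l * s) - l\<^sup>2 * r / 2) = - (p * l) * s - (p * l\<^sup>2) * r / 2" by (simp add: algebra_simps)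
      also have "\<dots> = \<alpha> * (- s - r / 2) + \<beta> * (- (s / 2))" unfolding pl pl1 by (simp add: algebra_simps)
      finally have "exp (p * (- (l * s) - l\<^sup>2 * r / 2)) <= \<alpha> * exp (- s - r / 2) + \<beta> * exp (- (s / 2))"
        using exp_weighted_le[OF \<alpha>(1) \<beta>, of "- s - r / 2" "- (s / 2)"] by (simp only:)
      also have "\<dots> <= \<alpha> * exp (- s - r / 2) + \<beta> * (exp (- s - r / 2) / 2 + exp (r / 2) / 2)"
        using half \<beta> by (intro add_left_mono mult_left_mono) auto
      finally show ?thesis .
    qed
    have iE1: "integrable M (\<lambda>om. exp (- S n om - q n om / 2))" "(LINT om|M. exp (- S n om - q n om / 2)) = 1" for n
      using one(1)[of 1 n] one(2)[of 1 n] by simp_all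
    let ?B = "\<lambda>n om. \<alpha> * exp (- S n om - q n om / 2) + \<beta> * (exp (- S n om - q n om / 2) / 2 + exp (q' om / 2) / 2)"
    have iB: "integrable M (?B n)" for n using iE1(1) nov by auto
    have B: "(LINT om|M. ?B n om) = \<alpha> + \<beta> * (1/2 + C/2)" for n
      using iE1 nov by (simp add: C_def)
    have ptn: "AE om in M. exp (p * (- (l * S n om) - l\<^sup>2 * q n om / 2)) <= ?B n om" for n
      using qle[of n]
    proof eventually_elim
      case (elim om)
      have "exp (q n om / 2) <= exp (q' om / 2)" using elim by simp
      hence "\<beta> * (exp (- S n om - q n om / 2) / 2 + exp (q n om / 2) / 2) <= \<beta> * (exp (- S n om - q n om / 2) / 2 + exp (q' om / 2) / 2)"
        using \<beta> by (intro mult_left_mono) auto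
      thus ?case using pt[of "S n om" "q n om"] by linarith
    qed
    have ip: "integrable M (\<lambda>om. exp (p * (- (l * S n om) - l\<^sup>2 * q n om / 2)))" for n
      by (rule Bochner_Integration.integrable_bound[OF iB[of n]]) (use ptn[of n] in \<open>auto elim!: eventually_mono intro: order_trans[OF _ abs_ge_self]\<close>)
    have vp: "(LINT om|M. exp (p * (- (l * S n om) - l\<^sup>2 * q n om / 2))) <= \<alpha> + \<beta> * (1/2 + C/2)" for n
      unfolding B[of n, symmetric] by (rule integral_mono_AE[OF ip iB ptn])
    show ?thesis
      by (rule expectation_limit_ge_one[OF _ _ lim one p1 ip vp Li(1)]) auto
  qed
  let ?D = "\<lambda>om. exp (- S' om - q' om / 2) / 2 + exp (q' om / 2) / 2"
  have L1: "integrable M (\<lambda>om. exp (- S' om - q' om / 2))" "(LINT om|M. exp (- S' om - q' om / 2)) <= 1"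
    using Li[of 1] by simp_all
  have iD: "integrable M ?D" using L1 nov by auto
  have bound: "1 <= (2 * l - 1) * (LINT om|M. exp (- S' om - q' om / 2)) + (2 - 2 * l) * (LINT om|M. ?D om)" if l: "1/2 < l" "l < 1" for l
  proof -
    have "1 <= (LINT om|M. ?L l om)" using ge[of l] l by simp
    also have "\<dots> <= (LINT om|M. (2 * l - 1) * exp (- S' om - q' om / 2) + (2 - 2 * l) * ?D om)"
    proof (rule integral_mono_AE[OF Li(1)])
      show "integrable M (\<lambda>om. (2 * l - 1) * exp (- S' om - q' om / 2) + (2 - 2 * l) * ?D om)"
        by (rule Bochner_Integration.integrable_add; intro integrable_mult_right L1(1) iD)
      show "AE om in M. ?L l om <= (2 * l - 1) * exp (- S' om - q' om / 2) + (2 - 2 * l) * ?D om"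
        using q'0
      proof eventually_elim
        case (elim om)
        have "0 <= (1 - l)\<^sup>2" by simp
        hence "2 * l - 1 <= l\<^sup>2" by (simp add: power2_eq_square algebra_simps)
        hence "(2 * l - 1) * (q' om / 2) <= l\<^sup>2 * (q' om / 2)" using elim by (intro mult_right_mono) auto
        hence "- (l * S' om) - l\<^sup>2 * q' om / 2 <= (2 * l - 1) * (- S' om - q' om / 2) + (2 - 2 * l) * (- (S' om / 2))"
          by (simp add: algebra_simps)
        hence "?L l om <= exp ((2 * l - 1) * (- S' om - q' om / 2) + (2 - 2 * l) * (- (S' om / 2)))" by simp
        also have "\<dots> <= (2 * l - 1) * exp (- S' om - q' om / 2) + (2 - 2 * l) * exp (- (S' om / 2))"
          by (rule exp_weighted_le) (use l in auto)
        also have "\<dots> <= (2 * l - 1) * exp (- S' om - q' om / 2) + (2 - 2 * l) * ?D om"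
          using half[of "S' om" "q' om"] l by (intro add_left_mono mult_left_mono) auto
        finally show ?case .
      qed
    qed
    also have "\<dots> = (2 * l - 1) * (LINT om|M. exp (- S' om - q' om / 2)) + (2 - 2 * l) * (LINT om|M. ?D om)"
      by (subst Bochner_Integration.integral_add; (intro integrable_mult_right L1(1) iD)?) simp
    finally show ?thesis .
  qed
  let ?v = "(LINT om|M. exp (- S' om - q' om / 2))" and ?d = "(LINT om|M. ?D om)"
  have "((\<lambda>l. (2 * l - 1) * ?v + (2 - 2 * l) * ?d) \<longlongrightarrow> (2 * 1 - 1) * ?v + (2 - 2 * 1) * ?d) (at_left 1)"
    by (intro tendsto_intros)
  moreover have "eventually (\<lambda>l. 1 <= (2 * l - 1) * ?v + (2 - 2 * l) * ?d) (at_left 1)"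
    using eventually_at_left_real[of "1/2" "1::real"] by (auto elim!: eventually_mono intro: bound)
  ultimately have "1 <= (2 * 1 - 1) * ?v + (2 - 2 * 1) * ?d" by (rule tendsto_lowerbound) simp
  thus "integrable M (\<lambda>om. exp (- S' om - q' om / 2))" "?v = 1" using L1 by auto
qed

end

section \<open>The exponential density and the master identity\<close>

context prob_space
begin

lemma AE_LIMSEQ_subseq:
  assumes "AE x in M. (\<lambda>n. X (r n) x) \<longlonglongrightarrow> (Y x :: real)" "strict_mono (s :: nat => nat)"
  shows "AE x in M. (\<lambda>n. X (r (s n)) x) \<longlonglongrightarrow> Y x"
  using assms(1)
proof eventually_elim
  case (elim x)
  from LIMSEQ_subseq_LIMSEQ[OF this assms(2)] show ?case by (simp add: o_def)
qed

lemma tends_prob_subseq4: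
  assumes m: "\<And>n. X1 n \<in> borel_measurable M" "\<And>n. X2 n \<in> borel_measurable M" "\<And>n. X3 n \<in> borel_measurable M" "\<And>n. X4 n \<in> borel_measurable M"
    and Y: "Y1 \<in> borel_measurable M" "Y2 \<in> borel_measurable M" "Y3 \<in> borel_measurable M" "Y4 \<in> borel_measurable M"
    and t: "tends_prob M X1 Y1" "tends_prob M X2 Y2" "tends_prob M X3 Y3" "tends_prob M X4 Y4"
  obtains r where "strict_mono (r::nat=>nat)" "AE x in M. (\<lambda>n. X1 (r n) x) \<longlonglongrightarrow> Y1 x" "AE x in M. (\<lambda>n. X2 (r n) x) \<longlonglongrightarrow> Y2 x"
    "AE x in M. (\<lambda>n. X3 (r n) x) \<longlonglongrightarrow> Y3 x" "AE x in M. (\<lambda>n. X4 (r n) x) \<longlonglongrightarrow> Y4 x"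
proof -
  note sub = AE_LIMSEQ_subseq
  obtain r1 where r1: "strict_mono r1" "AE x in M. (\<lambda>n. X1 (r1 n) x) \<longlonglongrightarrow> Y1 x"
    by (rule tends_prob_subseq[OF m(1) Y(1) t(1)]) blast
  obtain r2 where r2: "strict_mono r2" "AE x in M. (\<lambda>n. X2 (r1 (r2 n)) x) \<longlonglongrightarrow> Y2 x"
    by (rule tends_prob_subseq[OF m(2) Y(2) tends_prob_subseq_imp[OF t(2) r1(1)]]) blast
  have r12: "strict_mono (\<lambda>n. r1 (r2 n))" using strict_mono_o[OF r1(1) r2(1)] by (simp add: o_def)
  obtain r3 where r3: "strict_mono r3" "AE x in M. (\<lambda>n. X3 (r1 (r2 (r3 n))) x) \<longlonglongrightarrow> Y3 x"
    by (rule tends_prob_subseq[OF m(3) Y(3) tends_prob_subseq_imp[OF t(3) r12]]) blast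
  have r123: "strict_mono (\<lambda>n. r1 (r2 (r3 n)))" using strict_mono_o[OF r12 r3(1)] by (simp add: o_def)
  obtain r4 where r4: "strict_mono r4" "AE x in M. (\<lambda>n. X4 (r1 (r2 (r3 (r4 n)))) x) \<longlonglongrightarrow> Y4 x"
    by (rule tends_prob_subseq[OF m(4) Y(4) tends_prob_subseq_imp[OF t(4) r123]]) blast
  have r1234: "strict_mono (\<lambda>n. r1 (r2 (r3 (r4 n))))" using strict_mono_o[OF r123 r4(1)] by (simp add: o_def)
  have s34: "strict_mono (\<lambda>n. r3 (r4 n))" using strict_mono_o[OF r3(1) r4(1)] by (simp add: o_def)
  have s234: "strict_mono (\<lambda>n. r2 (r3 (r4 n)))" using strict_mono_o[OF r2(1) s34] by (simp add: o_def)
  show ?thesis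
    by (rule that[OF r1234 sub[where X=X1 and Y=Y1 and r=r1, OF r1(2) s234] sub[where X=X2 and Y=Y2 and r="\<lambda>n. r1 (r2 n)", OF r2(2) s34]
      sub[where X=X3 and Y=Y3 and r="\<lambda>n. r1 (r2 (r3 n))", OF r3(2) r4(1)] r4(2)])
qed

end

lemma sq_norm_tendsto:
  assumes T: "0 < T" and h: "sq_int T h"
  shows "(\<lambda>n. sq_norm T (lag_step T n h)) \<longlonglongrightarrow> sq_norm T h"
  using tendsto_pairing[OF sq_int_lag_step[OF T] h lag_step_tendsto[OF T h] sq_int_lag_step[OF T] h lag_step_tendsto[OF T h]]
  by (simp add: sq_norm_def power2_eq_square)

lemma (in filtered_space) deterministic_L2_process:
  assumes a: "a \<in> borel_measurable borel" "sq_int T a"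
  shows "L2_process M F T (\<lambda>t _. a t)"
  unfolding L2_process_def progressively_measurable_def
proof (intro conjI ballI)
  fix t
  have "fst \<in> measurable (restrict_space borel {0..t} \<Otimes>\<^sub>M F t) (borel :: real measure)"
    by (rule measurable_compose[OF measurable_fst]) (rule measurable_restrict_space1, simp)
  from measurable_compose[OF this a(1)] show "(\<lambda>(s, om). a s) \<in> borel_measurable (restrict_space borel {0..t} \<Otimes>\<^sub>M F t)"
    by (simp add: case_prod_unfold)
  show "AE om in M. set_integrable lborel {0..T} (\<lambda>t. (a t)\<^sup>2)" using a(2) by (simp add: sq_int_def)
qed

lemma lag_zero:
  assumes T: "0 < T" and a: "\<And>t. t < s ==> a t = 0" and j: "grid T (Suc n) j < s"
  shows "lag T n a j = 0"
proof (cases j)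
  case (Suc i)
  have "(LBINT t:{grid T (Suc n) i<..grid T (Suc n) j}. clip (real n) (a t)) = (LBINT t:{grid T (Suc n) i<..grid T (Suc n) j}. 0)"
    using a j by (intro set_lebesgue_integral_cong) (auto simp: clip_0)
  thus ?thesis using Suc by (simp add: lag_def cell_avg_def)
qed (simp add: lag_def cell_avg_def)

locale girsanov = bm_pair M F T W B for M :: "'a measure" and F T W B +
  fixes f g :: "real => 'a => real"
  assumes T: "0 < T" and fL2: "L2_process M F T f" and gL2: "L2_process M F T g"
    and novikov: "integrable M (\<lambda>om. exp (1/2 * (LBINT t:{0..T}. (f t om)\<^sup>2 + (g t om)\<^sup>2)))"
begin

sublocale swap: bm_pair M F T B W by (rule bm_pair_swap)

abbreviation "IW a \<equiv> ito_integral M F W T a"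
abbreviation "IB b \<equiv> ito_integral M F B T b"

definition dens :: "'a => real" where
  "dens om = exp (- IW f om - 1/2 * (LBINT t:{0..T}. (f t om)\<^sup>2) - IB g om - 1/2 * (LBINT t:{0..T}. (g t om)\<^sup>2))"

definition xi :: "nat => nat => 'a => real" where "xi n j om = lag T n (\<lambda>s. f s om) j"
definition eta :: "nat => nat => 'a => real" where "eta n j om = lag T n (\<lambda>s. g s om) j"
definition qv :: "nat => 'a => real" where
  "qv n om = (\<Sum>i<Suc n. ((xi n i om)\<^sup>2 + (eta n i om)\<^sup>2) * (grid T (Suc n) (Suc i) - grid T (Suc n) i))"
definition qlim :: "'a => real" where "qlim om = sq_norm T (\<lambda>t. f t om) + sq_norm T (\<lambda>t. g t om)"

lemma T0: "0 <= T" using T by simp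

lemma xi_simple: "simple_integrand F T (Suc n) (grid T (Suc n)) (xi n)"
  and eta_simple: "simple_integrand F T (Suc n) (grid T (Suc n)) (eta n)"
  using lag_simple_integrand[OF _ T, of f n] lag_simple_integrand[OF _ T, of g n] fL2 gL2 unfolding L2_process_def xi_def[abs_def] eta_def[abs_def] by auto

lemma qv_eq: "qv n om = sq_norm T (lag_step T n (\<lambda>t. f t om)) + sq_norm T (lag_step T n (\<lambda>t. g t om))"
  using sq_norm_simple_process[OF xi_simple, of n om] sq_norm_simple_process[OF eta_simple, of n om]
  unfolding xi_def eta_def simple_process_lag qv_def by (simp add: distrib_right sum.distrib)

lemma sq_int_fg: "AE om in M. sq_int T (\<lambda>t. f t om)" "AE om in M. sq_int T (\<lambda>t. g t om)"
  using L2_process_sq_int[OF fL2 T0] L2_process_sq_int[OF gL2 T0] by auto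

lemma qv_tendsto: "AE om in M. (\<lambda>n. qv n om) \<longlonglongrightarrow> qlim om"
  using sq_int_fg by eventually_elim (auto simp: qv_eq qlim_def intro!: tendsto_add sq_norm_tendsto[OF T])

lemma qv_le: "AE om in M. qv n om <= qlim om"
  using sq_int_fg by eventually_elim (auto simp: qv_eq qlim_def intro!: add_mono sq_norm_lag_step_le[OF T])

lemma qv_nonneg: "0 <= qv n om" by (simp add: qv_eq)

lemma sq_norm_process_measurable:
  assumes "L2_process M F T h" shows "(\<lambda>om. sq_norm T (\<lambda>t. h t om)) \<in> borel_measurable M"
proof -
  have "(\<lambda>om. LBINT s:{0..T}. (\<lambda>x. x\<^sup>2) (h s om)) \<in> borel_measurable (F T)"
    using assms T by (intro progressive_time_integral_measurable) (auto simp: L2_process_def)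
  thus ?thesis unfolding sq_norm_def using F_measurable_M[of _ T borel] T by simp
qed

lemma qv_measurable: "qv n \<in> borel_measurable M" "qlim \<in> borel_measurable M"
proof -
  have "xi n i \<in> borel_measurable M" "eta n i \<in> borel_measurable M" if "i < Suc n" for i
    using simple_integrand_measurable_M[OF xi_simple that] simple_integrand_measurable_M[OF eta_simple that] by auto
  thus "qv n \<in> borel_measurable M" unfolding qv_def[abs_def] by (intro borel_measurable_sum) auto
  show "qlim \<in> borel_measurable M" unfolding qlim_def[abs_def]
    using sq_norm_process_measurable[OF fL2] sq_norm_process_measurable[OF gL2] by measurable
qed

lemma dens_eq: "dens om = exp (- (IW f om + IB g om) - qlim om / 2)"
  by (simp add: dens_def qlim_def sq_norm_def add_divide_distrib algebra_simps)

lemma simple_exp_eq: "simple_exp (Suc n) (grid T (Suc n)) (\<lambda>i om. l * xi n i om) (\<lambda>i om. l * eta n i om) om =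
   exp (- (l * (simple_ito_integral W (Suc n) (grid T (Suc n)) (xi n) om + simple_ito_integral B (Suc n) (grid T (Suc n)) (eta n) om)) - l\<^sup>2 * qv n om / 2)"
proof -
  have "simple_ito_integral Z m \<tau> (\<lambda>i om. l * \<xi> i om) om = l * simple_ito_integral Z m \<tau> \<xi> om" for Z m \<tau> \<xi>
    by (simp add: simple_ito_integral_def sum_distrib_left mult.assoc)
  moreover have "(\<Sum>i<Suc n. ((l * xi n i om)\<^sup>2 + (l * eta n i om)\<^sup>2) * (grid T (Suc n) (Suc i) - grid T (Suc n) i)) = l\<^sup>2 * qv n om"
    unfolding qv_def sum_distrib_left by (intro sum.cong refl) (simp add: power_mult_distrib algebra_simps)
  ultimately show ?thesis unfolding simple_exp_def by (simp add: distrib_left)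
qed

lemma novikov_q: "integrable M (\<lambda>om. exp (qlim om / 2))"
proof (rule integrable_cong_AE_imp[OF novikov])
  show "(\<lambda>om. exp (qlim om / 2)) \<in> borel_measurable M" using qv_measurable by measurable
  show "AE om in M. exp (1/2 * (LBINT t:{0..T}. (f t om)\<^sup>2 + (g t om)\<^sup>2)) = exp (qlim om / 2)"
    using sq_int_fg by eventually_elim (simp add: qlim_def sq_norm_def sq_int_def set_integral_add)
qed

lemma SW_tends: "tends_prob M (\<lambda>n. simple_ito_integral W (Suc n) (grid T (Suc n)) (xi n)) (IW f)" "IW f \<in> borel_measurable M"
  and SB_tends: "tends_prob M (\<lambda>n. simple_ito_integral B (Suc n) (grid T (Suc n)) (eta n)) (IB g)" "IB g \<in> borel_measurable M"
  using lag_tends_ito_integral[OF fL2 T] swap.lag_tends_ito_integral[OF gL2 T] unfolding xi_def[abs_def] eta_def[abs_def] by auto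

lemma SW_measurable: "simple_ito_integral W (Suc n) (grid T (Suc n)) (xi n) \<in> borel_measurable M"
  "simple_ito_integral B (Suc n) (grid T (Suc n)) (eta n) \<in> borel_measurable M"
  by (rule simple_ito_integral_measurable[OF xi_simple bW] simple_ito_integral_measurable[OF eta_simple bB])+

text \<open>
  Novikov's criterion along the lagged step approximations, after passing to an almost surely
  convergent subsequence.
\<close>

lemma dens_integral: "integrable M dens" "(LINT om|M. dens om) = 1"
proof -
  obtain r where r: "strict_mono (r :: nat => nat)"
    "AE x in M. (\<lambda>n. simple_ito_integral W (Suc (r n)) (grid T (Suc (r n))) (xi (r n)) x) \<longlonglongrightarrow> IW f x"
    "AE x in M. (\<lambda>n. simple_ito_integral B (Suc (r n)) (grid T (Suc (r n))) (eta (r n)) x) \<longlonglongrightarrow> IB g x"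
    by (rule tends_prob_subseq4[OF SW_measurable(1) SW_measurable(2) SW_measurable(1) SW_measurable(2) SW_tends(2) SB_tends(2) SW_tends(2) SB_tends(2) SW_tends(1) SB_tends(1) SW_tends(1) SB_tends(1)]) blast
  let ?S = "\<lambda>n x. simple_ito_integral W (Suc (r n)) (grid T (Suc (r n))) (xi (r n)) x + simple_ito_integral B (Suc (r n)) (grid T (Suc (r n))) (eta (r n)) x"
  note E = simple_exp_expectation[OF simple_integrand_cmult[OF xi_simple] simple_integrand_cmult[OF eta_simple]]
  have lim: "AE x in M. (\<lambda>n. ?S n x) \<longlonglongrightarrow> IW f x + IB g x" using r(2,3) by eventually_elim (rule tendsto_add)
  have qlim': "AE x in M. (\<lambda>n. qv (r n) x) \<longlonglongrightarrow> qlim x" using qv_tendsto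
  proof eventually_elim
    case (elim x)
    from LIMSEQ_subseq_LIMSEQ[OF this r(1)] show ?case by (simp add: o_def)
  qed
  have 1: "integrable M (\<lambda>om. exp (- (l * ?S n om) - l\<^sup>2 * qv (r n) om / 2))" "(LINT om|M. exp (- (l * ?S n om) - l\<^sup>2 * qv (r n) om / 2)) = 1" for n l
    using E[of "r n" l l] unfolding simple_exp_eq by auto
  have m: "?S n \<in> borel_measurable M" "(\<lambda>x. IW f x + IB g x) \<in> borel_measurable M" for n
    by (intro borel_measurable_add SW_measurable SW_tends SB_tends)+
  note L = exponential_limit_one[OF m qv_measurable lim qlim' qv_nonneg qv_le novikov_q 1]
  show "integrable M dens" "(LINT om|M. dens om) = 1" using L unfolding dens_eq[abs_def] by auto
qed

definition phase :: "(real => real) => (real => real) => 'a => real" where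
  "phase a b om = IW (\<lambda>t _. a t) om + IB (\<lambda>t _. b t) om + (LBINT t:{0..T}. a t * f t om) + (LBINT t:{0..T}. b t * g t om)"

lemma pairing_sum:
  assumes "simple_integrand F T n \<tau> \<xi>"
  shows "(\<Sum>i<n. (a i * \<xi> i om) * (\<tau> (Suc i) - \<tau> i)) = (LBINT t:{0..T}. simple_process n \<tau> (\<lambda>i _. a i) t om * simple_process n \<tau> \<xi> t om)"
proof -
  note \<tau> = simple_integrand_increasing[OF assms] and e = simple_integrand_ends[OF assms]
  have "simple_process n \<tau> (\<lambda>i _. a i) t om * simple_process n \<tau> \<xi> t om = simple_process n \<tau> (\<lambda>i om. a i * \<xi> i om) t om" for t
    using simple_process_fun2[OF \<tau>, where g="\<lambda>x y. x * y"] by simp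
  thus ?thesis using set_integral_simple_process(2)[OF \<tau> e, of "\<lambda>i om. a i * \<xi> i om" om] by simp
qed

text \<open>
  The limit of \<open>simple_exp_phase\<close>. The discrete densities are nonnegative, converge almost surely along a
  subsequence and have the same mean as their limit, hence converge in mean (Scheffe); the phases are
  bounded by one in modulus.
\<close>

lemma master_identity:
  assumes a: "a \<in> borel_measurable borel" "sq_int T a" and b: "b \<in> borel_measurable borel" "sq_int T b"
    and s: "0 <= s" "s <= T" and A: "A \<in> sets (F s)" and ab: "\<And>t. t < s ==> a t = 0" "\<And>t. t < s ==> b t = 0"
  shows "(CLINT om|M. indicator A om * (complex_of_real (dens om) * iexp (phase a b om)))
     = (CLINT om|M. indicator A om * complex_of_real (dens om)) * complex_of_real (exp (- (sq_norm T a + sq_norm T b) / 2))"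
    and "phase a b \<in> borel_measurable M"
proof -
  note aL2 = deterministic_L2_process[OF a] and bL2 = deterministic_L2_process[OF b]
  note ta = lag_tends_ito_integral[OF aL2 T] and tb = swap.lag_tends_ito_integral[OF bL2 T]
  have pa: "simple_integrand F T (Suc n) (grid T (Suc n)) (\<lambda>j _. lag T n a j)" for n
    using lag_simple_integrand[OF _ T, of "\<lambda>t _. a t" n] aL2 by (simp add: L2_process_def)
  have pb: "simple_integrand F T (Suc n) (grid T (Suc n)) (\<lambda>j _. lag T n b j)" for n
    using lag_simple_integrand[OF _ T, of "\<lambda>t _. b t" n] bL2 by (simp add: L2_process_def)
  obtain r where r: "strict_mono (r :: nat => nat)"
    "AE x in M. (\<lambda>n. simple_ito_integral W (Suc (r n)) (grid T (Suc (r n))) (xi (r n)) x) \<longlonglongrightarrow> IW f x"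
    "AE x in M. (\<lambda>n. simple_ito_integral B (Suc (r n)) (grid T (Suc (r n))) (eta (r n)) x) \<longlonglongrightarrow> IB g x"
    "AE x in M. (\<lambda>n. simple_ito_integral W (Suc (r n)) (grid T (Suc (r n))) (\<lambda>j _. lag T (r n) a j) x) \<longlonglongrightarrow> IW (\<lambda>t _. a t) x"
    "AE x in M. (\<lambda>n. simple_ito_integral B (Suc (r n)) (grid T (Suc (r n))) (\<lambda>j _. lag T (r n) b j) x) \<longlonglongrightarrow> IB (\<lambda>t _. b t) x"
    by (rule tends_prob_subseq4[OF SW_measurable(1) SW_measurable(2) simple_ito_integral_measurable[OF pa bW] simple_ito_integral_measurable[OF pb bB]
       SW_tends(2) SB_tends(2) ta(2) tb(2) SW_tends(1) SB_tends(1) ta(1) tb(1)]) blast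
  define N where "N n = Suc (r n)" for n
  let ?E = "\<lambda>n om. simple_exp (N n) (grid T (N n)) (xi (r n)) (eta (r n)) om"
  let ?P = "\<lambda>n om. simple_phase (N n) (grid T (N n)) (xi (r n)) (eta (r n)) (lag T (r n) a) (lag T (r n) b) om"
  have E1: "?E n om = exp (- (simple_ito_integral W (N n) (grid T (N n)) (xi (r n)) om + simple_ito_integral B (N n) (grid T (N n)) (eta (r n)) om) - qv (r n) om / 2)" for n om
    using simple_exp_eq[of "r n" 1 om] by (simp add: N_def)
  have mea [measurable]: "IW (\<lambda>t _. a t) \<in> borel_measurable M" "IB (\<lambda>t _. b t) \<in> borel_measurable M" by (rule ta(2), rule tb(2))
  have pair_m: "(\<lambda>om. LBINT t:{0..T}. c t * h t om) \<in> borel_measurable M" if h: "L2_process M F T h" and c: "c \<in> borel_measurable borel" for c h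
  proof -
    have pm: "progressively_measurable F T h" using h by (simp add: L2_process_def)
    have [measurable]: "c \<in> borel_measurable borel" by fact
    have [measurable]: "(\<lambda>p. indicator {0..T} (snd p) * h (snd p) (fst p)) \<in> borel_measurable (M \<Otimes>\<^sub>M lborel)" by (rule progressive_joint_M[OF pm T0])
    have "(\<lambda>p. c (snd p) * (indicator {0..T} (snd p) * h (snd p) (fst p))) \<in> borel_measurable (M \<Otimes>\<^sub>M lborel)" by measurable
    hence "(\<lambda>(om, t). indicator {0..T} t * (c t * h t om)) \<in> borel_measurable (M \<Otimes>\<^sub>M lborel)" by (simp add: case_prod_beta mult.left_commute)
    from lborel.borel_measurable_lebesgue_integral[OF this] show ?thesis by (simp add: set_lebesgue_integral_def)
  qed
  show pm: "phase a b \<in> borel_measurable M" unfolding phase_def[abs_def]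
    by (intro borel_measurable_add mea pair_m fL2 gL2 a b)
  have dm: "dens \<in> borel_measurable M" using dens_integral by auto
  have Ei: "integrable M (?E n)" "(LINT om|M. ?E n om) = 1" for n
    using simple_exp_expectation[OF xi_simple eta_simple, of "r n"] by (simp_all add: N_def)
  have limE: "AE om in M. (\<lambda>n. ?E n om) \<longlonglongrightarrow> dens om"
    using r(2,3) qv_tendsto
  proof eventually_elim
    case (elim om)
    have "(\<lambda>n. qv (r n) om) \<longlonglongrightarrow> qlim om" using LIMSEQ_subseq_LIMSEQ[OF elim(3) r(1)] by (simp add: o_def)
    thus ?case unfolding E1 dens_eq unfolding N_def using elim(1,2) by (intro tendsto_intros) auto
  qed
  have limP: "AE om in M. (\<lambda>n. ?P n om) \<longlonglongrightarrow> phase a b om"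
    using r(4,5) sq_int_fg
  proof eventually_elim
    case (elim om)
    have sum: "(\<Sum>i<N n. (lag T (r n) a i * xi (r n) i om + lag T (r n) b i * eta (r n) i om) * (grid T (N n) (Suc i) - grid T (N n) i))
      = (LBINT t:{0..T}. lag_step T (r n) a t * lag_step T (r n) (\<lambda>t. f t om) t) + (LBINT t:{0..T}. lag_step T (r n) b t * lag_step T (r n) (\<lambda>t. g t om) t)" for n
      unfolding distrib_right sum.distrib N_def pairing_sum[OF xi_simple] pairing_sum[OF eta_simple]
      unfolding xi_def eta_def using simple_process_lag[of _ "\<lambda>s _. a s"] simple_process_lag[of _ "\<lambda>s _. b s"] by (simp add: simple_process_lag)
    have t1: "(\<lambda>n. LBINT t:{0..T}. lag_step T n a t * lag_step T n (\<lambda>t. f t om) t) \<longlonglongrightarrow> (LBINT t:{0..T}. a t * f t om)"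
      by (rule tendsto_pairing[OF sq_int_lag_step[OF T] a(2) lag_step_tendsto[OF T a(2)] sq_int_lag_step[OF T] elim(3) lag_step_tendsto[OF T elim(3)]])
    have t2: "(\<lambda>n. LBINT t:{0..T}. lag_step T n b t * lag_step T n (\<lambda>t. g t om) t) \<longlonglongrightarrow> (LBINT t:{0..T}. b t * g t om)"
      by (rule tendsto_pairing[OF sq_int_lag_step[OF T] b(2) lag_step_tendsto[OF T b(2)] sq_int_lag_step[OF T] elim(4) lag_step_tendsto[OF T elim(4)]])
    have t1': "(\<lambda>n. LBINT t:{0..T}. lag_step T (r n) a t * lag_step T (r n) (\<lambda>t. f t om) t) \<longlonglongrightarrow> (LBINT t:{0..T}. a t * f t om)"
      using LIMSEQ_subseq_LIMSEQ[OF t1 r(1)] by (simp add: o_def)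
    have t2': "(\<lambda>n. LBINT t:{0..T}. lag_step T (r n) b t * lag_step T (r n) (\<lambda>t. g t om) t) \<longlonglongrightarrow> (LBINT t:{0..T}. b t * g t om)"
      using LIMSEQ_subseq_LIMSEQ[OF t2 r(1)] by (simp add: o_def)
    show ?case unfolding simple_phase_def sum phase_def add.assoc using elim(1,2) t1' t2' unfolding N_def[symmetric]
      by (intro tendsto_add) auto
  qed
  have Pm [measurable]: "?P n \<in> borel_measurable M" for n
  proof -
    have "xi (r n) i \<in> borel_measurable M" "eta (r n) i \<in> borel_measurable M" if "i < N n" for i
      using simple_integrand_measurable_M[OF xi_simple, of i "r n"] simple_integrand_measurable_M[OF eta_simple, of i "r n"] that by (auto simp: N_def)
    thus ?thesis unfolding simple_phase_def[abs_def] N_def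
      by (intro borel_measurable_add borel_measurable_sum borel_measurable_times simple_ito_integral_measurable[OF pa bW] simple_ito_integral_measurable[OF pb bB]) (auto simp: N_def)
  qed
  have AM [measurable]: "A \<in> sets M" using A F_sets[of s] s by auto
  have conv: "(\<lambda>n. CLINT om|M. indicator A om * (complex_of_real (?E n om) * iexp (Q n om))) \<longlonglongrightarrow> (CLINT om|M. indicator A om * (complex_of_real (dens om) * iexp (Q' om)))"
    if Q: "AE om in M. (\<lambda>n. Q n om) \<longlonglongrightarrow> Q' om" and Qm [measurable]: "\<And>n. Q n \<in> borel_measurable M" "Q' \<in> borel_measurable M" for Q Q'
  proof -
    let ?G = "\<lambda>n om. complex_of_real (?E n om) * iexp (Q n om)" and ?H = "\<lambda>om. complex_of_real (dens om) * iexp (Q' om)"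
    have [measurable]: "?E n \<in> borel_measurable M" for n using Ei(1) by auto
    have [measurable]: "dens \<in> borel_measurable M" by (rule dm)
    have Gi: "integrable M (?G n)" for n by (rule integrable_real_mult_complex[OF Ei(1), where K=1]) auto
    have Hi: "integrable M ?H" by (rule integrable_real_mult_complex[OF dens_integral(1), where K=1]) auto
    have nG: "norm (?G n om) = ?E n om" "norm (?H om) = dens om" for n om by (auto simp: norm_mult simple_exp_def dens_def)
    have lim: "AE om in M. (\<lambda>n. ?G n om) \<longlonglongrightarrow> ?H om" using limE Q by eventually_elim (intro tendsto_intros)
    have "(\<lambda>n. \<integral>\<^sup>+ om. norm (?G n om - ?H om) \<partial>M) \<longlonglongrightarrow> 0"
    proof (rule Scheffe_lemma2[OF _ Hi lim])
      show "?G n \<in> borel_measurable M" for n by measurable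
      show "(\<integral>\<^sup>+ om. norm (?G n om) \<partial>M) <= (\<integral>\<^sup>+ om. norm (?H om) \<partial>M)" for n
        unfolding nG using nn_integral_eq_integral[OF Ei(1)[of n]] nn_integral_eq_integral[OF dens_integral(1)] Ei(2)[of n] dens_integral(2)
        by (simp add: simple_exp_def dens_def)
    qed
    hence L1: "(\<lambda>n. enn2real (\<integral>\<^sup>+ om. norm (?G n om - ?H om) \<partial>M)) \<longlonglongrightarrow> enn2real 0" by (intro tendsto_enn2real) auto
    have Di: "integrable M (\<lambda>om. ?G n om - ?H om)" for n using Gi Hi by simp
    have L1': "(\<lambda>n. LINT om|M. norm (?G n om - ?H om)) \<longlonglongrightarrow> 0"
      using L1 nn_integral_eq_integral[OF integrable_norm[OF Di]] by simp
    have iA: "integrable M (\<lambda>om. indicator A om * X om)" if "integrable M X" for X :: "'a => complex"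
      by (subst mult.commute) (rule integrable_mult_bounded[OF that, where K=1], auto simp: indicator_def)
    have bound: "norm ((CLINT om|M. indicator A om * ?G n om) - (CLINT om|M. indicator A om * ?H om)) <= (LINT om|M. norm (?G n om - ?H om))" for n
    proof -
      have e: "(CLINT om|M. indicator A om * ?G n om) - (CLINT om|M. indicator A om * ?H om) = (CLINT om|M. indicator A om * (?G n om - ?H om))"
        by (subst Bochner_Integration.integral_diff[OF iA[OF Gi] iA[OF Hi], symmetric]) (simp add: right_diff_distrib)
      have "norm ((CLINT om|M. indicator A om * ?G n om) - (CLINT om|M. indicator A om * ?H om)) <= (LINT om|M. norm (indicator A om * (?G n om - ?H om)))"
        unfolding e by (rule integral_norm_bound)
      also have "\<dots> <= (LINT om|M. norm (?G n om - ?H om))"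
        by (rule integral_mono[OF integrable_norm[OF iA[OF Di]] integrable_norm[OF Di]]) (auto simp: indicator_def)
      finally show ?thesis .
    qed
    have "(\<lambda>n. (CLINT om|M. indicator A om * ?G n om) - (CLINT om|M. indicator A om * ?H om)) \<longlonglongrightarrow> 0"
      by (rule tendsto_norm_zero_cancel, rule tendsto_sandwich[OF _ _ tendsto_const L1']) (use bound in auto)
    thus ?thesis by (rule LIM_zero_cancel)
  qed
  have sqs: "(\<Sum>i<N n. ((lag T (r n) a i)\<^sup>2 + (lag T (r n) b i)\<^sup>2) * (grid T (N n) (Suc i) - grid T (N n) i)) = sq_norm T (lag_step T (r n) a) + sq_norm T (lag_step T (r n) b)" for n
    using sq_norm_simple_process[OF pa, of "r n" "undefined"] sq_norm_simple_process[OF pb, of "r n" "undefined"]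
    unfolding simple_process_lag[of "r n" "\<lambda>s _. a s"] simple_process_lag[of "r n" "\<lambda>s _. b s"] N_def distrib_right sum.distrib
    by simp
  have fin: "(CLINT om|M. indicator A om * (complex_of_real (?E n om) * iexp (?P n om)))
    = (CLINT om|M. indicator A om * (complex_of_real (?E n om) * iexp ((\<lambda>_. 0) om))) * complex_of_real (exp (- (sq_norm T (lag_step T (r n) a) + sq_norm T (lag_step T (r n) b)) / 2))" for n
  proof -
    have z: "lag T (r n) a i = 0 \<and> lag T (r n) b i = 0" if "i < N n" "grid T (N n) i < s" for i
      using lag_zero[OF T ab(1), where n="r n" and j=i] lag_zero[OF T ab(2), where n="r n" and j=i] that by (simp add: N_def)
    show ?thesis
      using simple_exp_phase[OF xi_simple eta_simple s A, of "r n" "lag T (r n) a" "lag T (r n) b"] z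
      unfolding sqs[symmetric] N_def by simp
  qed
  have "(\<lambda>n. sq_norm T (lag_step T (r n) a)) \<longlonglongrightarrow> sq_norm T a" "(\<lambda>n. sq_norm T (lag_step T (r n) b)) \<longlonglongrightarrow> sq_norm T b"
    using LIMSEQ_subseq_LIMSEQ[OF sq_norm_tendsto[OF T a(2)] r(1)] LIMSEQ_subseq_LIMSEQ[OF sq_norm_tendsto[OF T b(2)] r(1)] by (simp_all add: o_def)
  hence "(\<lambda>n. complex_of_real (exp (- (sq_norm T (lag_step T (r n) a) + sq_norm T (lag_step T (r n) b)) / 2))) \<longlonglongrightarrow> complex_of_real (exp (- (sq_norm T a + sq_norm T b) / 2))"
    by (intro tendsto_intros) auto
  from tendsto_mult[OF conv[of "\<lambda>_ _. 0" "\<lambda>_. 0"] this]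
  have R: "(\<lambda>n. (CLINT om|M. indicator A om * (complex_of_real (?E n om) * iexp (?P n om)))) \<longlonglongrightarrow> (CLINT om|M. indicator A om * (complex_of_real (dens om) * iexp 0)) * complex_of_real (exp (- (sq_norm T a + sq_norm T b) / 2))"
    unfolding fin by simp
  from LIMSEQ_unique[OF conv[OF limP Pm pm] R]
  show "(CLINT om|M. indicator A om * (complex_of_real (dens om) * iexp (phase a b om)))
     = (CLINT om|M. indicator A om * complex_of_real (dens om)) * complex_of_real (exp (- (sq_norm T a + sq_norm T b) / 2))" by simp
qed

end

section \<open>The Volterra kernel of fractional Brownian motion\<close>

text \<open>
  With \<open>a = H - 1/2\<close> the kernel is, after rescaling time to the unit interval, the function \<open>kern_k a\<close>
  below: the power \<open>x powr (- a) * (1 - x) powr a\<close> minus a multiple of the tail integral \<open>kern_I\<close> of \<open>kern_h\<close>.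
  The tail integral is kept extended nonnegative, as it diverges at \<open>x = 0\<close>.
\<close>

definition kern_h :: "real => real => real" where
  "kern_h a v = v powr (- 2 * a - 1) * (1 - v) powr a"

definition kern_I :: "real => real => ennreal" where
  "kern_I a x = (\<integral>\<^sup>+v. ennreal (kern_h a v) * indicator {x<..1} v \<partial>lborel)"

lemma kern_h_nonneg: "0 <= kern_h a v" by (simp add: kern_h_def)

lemma kern_h_measurable [measurable]: "kern_h a \<in> borel_measurable borel"
  unfolding kern_h_def[abs_def] by measurable

lemma pred_Ioc_Ico [measurable (raw)]:
  fixes f g :: "'b => real"
  assumes [measurable]: "f \<in> borel_measurable M" "g \<in> borel_measurable M"
  shows "Measurable.pred M (\<lambda>x. f x \<in> {g x<..1})" "Measurable.pred M (\<lambda>x. f x \<in> {0..<g x})"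
  by (simp_all only: greaterThanAtMost_iff atLeastLessThan_iff) measurable

lemma kern_I_measurable [measurable]: "kern_I a \<in> borel_measurable borel"
proof -
  have "(\<lambda>(x, v). ennreal (kern_h a v) * indicator {x<..1} v) \<in> borel_measurable (borel \<Otimes>\<^sub>M lborel)"
    unfolding case_prod_beta by measurable
  from lborel.borel_measurable_nn_integral[OF this] show ?thesis by (simp add: kern_I_def[abs_def])
qed

lemma tonelli_triangle:
  fixes u h :: "real => ennreal"
  assumes [measurable]: "u \<in> borel_measurable borel" "h \<in> borel_measurable borel"
  shows "(\<integral>\<^sup>+x. u x * indicator {0..1} x * (\<integral>\<^sup>+v. h v * indicator {x<..1} v \<partial>lborel) \<partial>lborel)
    = (\<integral>\<^sup>+v. h v * indicator {0..1} v * (\<integral>\<^sup>+x. u x * indicator {0..<v} x \<partial>lborel) \<partial>lborel)"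
proof -
  have "(\<integral>\<^sup>+x. u x * indicator {0..1} x * (\<integral>\<^sup>+v. h v * indicator {x<..1} v \<partial>lborel) \<partial>lborel)
    = (\<integral>\<^sup>+x. \<integral>\<^sup>+v. (u x * indicator {0..1} x) * (h v * indicator {x<..1} v) \<partial>lborel \<partial>lborel)"
    by (intro nn_integral_cong nn_integral_cmult[symmetric]) measurable
  also have "\<dots> = (\<integral>\<^sup>+v. \<integral>\<^sup>+x. (u x * indicator {0..1} x) * (h v * indicator {x<..1} v) \<partial>lborel \<partial>lborel)"
    by (rule lborel_pair.Fubini') measurable
  also have "\<dots> = (\<integral>\<^sup>+v. \<integral>\<^sup>+x. (h v * indicator {0..1} v) * (u x * indicator {0..<v} x) \<partial>lborel \<partial>lborel)"
    by (intro nn_integral_cong) (auto simp: indicator_def mult_ac)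
  also have "\<dots> = (\<integral>\<^sup>+v. h v * indicator {0..1} v * (\<integral>\<^sup>+x. u x * indicator {0..<v} x \<partial>lborel) \<partial>lborel)"
    by (intro nn_integral_cong nn_integral_cmult) measurable
  finally show ?thesis .
qed

text \<open>
  The square of an integral over \<open>(x, 1]\<close> is twice the integral over ordered pairs.
\<close>

lemma tonelli_square:
  fixes h :: "real => ennreal"
  assumes [measurable]: "h \<in> borel_measurable borel"
  defines "R \<equiv> \<lambda>x. (\<integral>\<^sup>+v. h v * indicator {x<..1} v \<partial>lborel)"
  shows "(R x)\<^sup>2 = 2 * (\<integral>\<^sup>+v. (h v * R v) * indicator {x<..1} v \<partial>lborel)"
proof -
  let ?p = "\<lambda>v. h v * indicator {x<..1} v"
  have [measurable]: "?p \<in> borel_measurable borel" by measurable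
  have m1: "(\<lambda>q. ?p (fst q) * ?p (snd q) * indicator {fst q<..1} (snd q)) \<in> borel_measurable (lborel \<Otimes>\<^sub>M lborel)" by measurable
  have inner: "(\<integral>\<^sup>+w. ?p v * ?p w * indicator {v<..1} w \<partial>lborel) = (h v * R v) * indicator {x<..1} v" for v
  proof -
    have "(\<integral>\<^sup>+w. ?p v * ?p w * indicator {v<..1} w \<partial>lborel) = (\<integral>\<^sup>+w. ?p v * (h w * indicator {v<..1} w) \<partial>lborel)"
      by (intro nn_integral_cong) (auto simp: indicator_def mult_ac)
    also have "\<dots> = ?p v * R v" unfolding R_def by (rule nn_integral_cmult) measurable
    finally show ?thesis by (simp add: mult_ac)
  qed
  have "(R x)\<^sup>2 = (\<integral>\<^sup>+v. ?p v * R x \<partial>lborel)" unfolding power2_eq_square by (subst nn_integral_multc) (auto simp: R_def)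
  also have "\<dots> = (\<integral>\<^sup>+v. \<integral>\<^sup>+w. ?p v * ?p w \<partial>lborel \<partial>lborel)"
    unfolding R_def by (intro nn_integral_cong nn_integral_cmult[symmetric]) measurable
  also have "\<dots> = (\<integral>\<^sup>+v. (\<integral>\<^sup>+w. ?p v * ?p w * indicator {v<..1} w + ?p v * ?p w * indicator {w<..1} v \<partial>lborel) \<partial>lborel)"
  proof (rule nn_integral_cong, rule nn_integral_cong_AE)
    fix v :: real
    have "AE w in lborel. w \<noteq> v" by (rule AE_lborel_singleton)
    thus "AE w in lborel. ?p v * ?p w = ?p v * ?p w * indicator {v<..1} w + ?p v * ?p w * indicator {w<..1} v"
      by eventually_elim (auto simp: indicator_def)
  qed
  also have "\<dots> = (\<integral>\<^sup>+v. (\<integral>\<^sup>+w. ?p v * ?p w * indicator {v<..1} w \<partial>lborel) + (\<integral>\<^sup>+w. ?p v * ?p w * indicator {w<..1} v \<partial>lborel) \<partial>lborel)"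
    by (intro nn_integral_cong nn_integral_add) measurable
  also have "\<dots> = (\<integral>\<^sup>+v. (\<integral>\<^sup>+w. ?p v * ?p w * indicator {v<..1} w \<partial>lborel) \<partial>lborel) + (\<integral>\<^sup>+v. (\<integral>\<^sup>+w. ?p v * ?p w * indicator {w<..1} v \<partial>lborel) \<partial>lborel)"
    by (intro nn_integral_add) measurable
  also have "(\<integral>\<^sup>+v. (\<integral>\<^sup>+w. ?p v * ?p w * indicator {w<..1} v \<partial>lborel) \<partial>lborel) = (\<integral>\<^sup>+w. (\<integral>\<^sup>+v. ?p v * ?p w * indicator {w<..1} v \<partial>lborel) \<partial>lborel)"
    by (intro lborel_pair.Fubini'[symmetric]) measurable
  also have "\<dots> = (\<integral>\<^sup>+v. (\<integral>\<^sup>+w. ?p v * ?p w * indicator {v<..1} w \<partial>lborel) \<partial>lborel)"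
    by (simp add: mult.commute mult.left_commute)
  finally show ?thesis unfolding inner by (simp add: mult_2)
qed

lemma integral_powr_below:
  assumes "p > -1" "0 <= v"
  shows "(\<integral>\<^sup>+x. ennreal (x powr p) * indicator {0..<v} x \<partial>lborel) = ennreal (v powr (p + 1) / (p + 1))"
proof -
  have "(\<integral>\<^sup>+x. ennreal (x powr p) * indicator {0..<v} x \<partial>lborel) = (\<integral>\<^sup>+x. ennreal (x powr p) * indicator {0..v} x \<partial>lborel)"
    by (rule nn_integral_cong_AE, use AE_lborel_singleton[of v] in eventually_elim) (auto simp: indicator_def)
  also have "\<dots> = ennreal (v powr (p + 1) / (p + 1))"
    by (rule nn_integral_has_integral_lebesgue'[OF _ has_integral_powr_from_0[OF assms]]) simp
  finally show ?thesis .
qed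

lemma integral_powr_mirror:
  assumes "p > -1" "0 <= v" "v <= 1"
  shows "(\<integral>\<^sup>+x. ennreal ((1 - x) powr p) * indicator {0..<v} x \<partial>lborel) = ennreal ((1 - (1 - v) powr (p + 1)) / (p + 1))"
proof -
  have hi: "((\<lambda>x. (1 - x) powr p) has_integral (- ((1 - v) powr (p + 1)) / (p + 1)) - (- ((1 - 0) powr (p + 1)) / (p + 1))) {0..v}"
  proof (rule fundamental_theorem_of_calculus_interior[OF assms(2)])
    show "continuous_on {0..v} (\<lambda>x. - ((1 - x) powr (p + 1)) / (p + 1))"
      using assms by (intro continuous_intros continuous_on_powr') auto
    fix x assume "x \<in> {0<..<v}"
    thus "((\<lambda>x. - ((1 - x) powr (p + 1)) / (p + 1)) has_vector_derivative (1 - x) powr p) (at x)"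
      using assms unfolding has_real_derivative_iff_has_vector_derivative[symmetric]
      by (auto intro!: derivative_eq_intros)
  qed
  have "(\<integral>\<^sup>+x. ennreal ((1 - x) powr p) * indicator {0..<v} x \<partial>lborel) = (\<integral>\<^sup>+x. ennreal ((1 - x) powr p) * indicator {0..v} x \<partial>lborel)"
    by (rule nn_integral_cong_AE, use AE_lborel_singleton[of v] in eventually_elim) (auto simp: indicator_def)
  also have "\<dots> = ennreal ((- ((1 - v) powr (p + 1)) / (p + 1)) - (- ((1 - 0) powr (p + 1)) / (p + 1)))"
    by (rule nn_integral_has_integral_lebesgue'[OF _ hi]) simp
  finally show ?thesis by (simp add: diff_divide_distrib)
qed

context
  fixes a :: real
  assumes a: "- 1 / 2 < a" "a < 1 / 2"
begin

text \<open>
  For \<open>a < 0\<close> this is a difference of two Beta integrals, written in a form that makes sense for \<open>a > 0\<close> too.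
\<close>

definition kern_J :: real where
  "kern_J = ((a - 1) * Beta (1 - 2 * a) (a + 1) + 2 * Beta (1 - 2 * a) (2 * a + 2)) / (2 * a * (a + 1))"

lemma one_minus_powr_bounds:
  assumes "0 <= x" "x <= 1" "0 <= p" "p <= (3::real)"
  shows "1 - 3 * x <= (1 - x) powr p" "(1 - x) powr p <= 1"
proof -
  show "(1 - x) powr p <= 1" using assms by (intro powr_le1) auto
  show "1 - 3 * x <= (1 - x) powr p"
  proof (cases "x = 1")
    case False
    hence x: "0 < 1 - x" using assms by simp
    have "1 - 3 * x <= (1 - x) ^ 3"
    proof -
      have "(1 - x) ^ 3 - (1 - 3 * x) = x\<^sup>2 * (3 - x)" by (simp add: power2_eq_square power3_eq_cube algebra_simps)
      moreover have "0 <= x\<^sup>2 * (3 - x)" using assms by auto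
      ultimately show ?thesis by simp
    qed
    also have "\<dots> = (1 - x) powr 3" using x by simp
    also have "\<dots> <= (1 - x) powr p" using assms x by (intro powr_mono') auto
    finally show ?thesis .
  qed simp
qed

text \<open>
  The two Beta integrals into which the integrand splits need not converge separately for \<open>a > 0\<close>. An
  integration by parts with the primitive \<open>?G\<close> raises the exponent at zero, and the boundary terms vanish.
\<close>

lemma kern_J_has_integral:
  assumes a0: "a \<noteq> 0"
  shows "((\<lambda>v. kern_h a v * ((1 - (1 - v) powr (a + 1)) / (a + 1))) has_integral kern_J) {0..1}"
proof -
  let ?j = "\<lambda>v. kern_h a v * ((1 - (1 - v) powr (a + 1)) / (a + 1))"
  let ?b1 = "\<lambda>v. v powr (- 2 * a) * (1 - v) powr a" and ?b2 = "\<lambda>v. v powr (- 2 * a) * (1 - v) powr (2 * a + 1)"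
  let ?G = "\<lambda>v. v powr (- 2 * a) * ((1 - v) powr (a + 1) - (1 - v) powr (2 * a + 2))"
  let ?G' = "\<lambda>v. (a - 1) * ?b1 v + 2 * ?b2 v - 2 * a * (a + 1) * ?j v"
  have cont: "continuous_on {0..1} ?G"
    unfolding continuous_on_def
  proof
    fix x :: real assume x: "x \<in> {0..1}"
    show "(?G \<longlongrightarrow> ?G x) (at x within {0..1})"
    proof (cases "x = 0")
      case False
      have x2: "0 < x / 2" using x False by simp
      have pw: "continuous_on {x/2..1} (\<lambda>v. (1 - v) powr q)" if "q > 0" for q :: real
        by (rule continuous_on_powr') (use that in \<open>auto intro!: continuous_intros\<close>)
      have p0: "continuous_on {x/2..1} (\<lambda>v. v powr (- 2 * a))"
        by (rule continuous_on_powr') (use x2 in \<open>auto intro!: continuous_intros\<close>)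
      have "continuous_on {x/2..1} ?G"
        by (rule continuous_on_mult[OF p0 continuous_on_diff[OF pw pw]]) (use a in auto)
      hence "(?G \<longlongrightarrow> ?G x) (at x within {x/2..1})" using x by (auto simp: continuous_on_def)
      moreover have "at x within {x/2..1} = at x within {0..1}"
        using x False by (intro at_within_nhd[of _ "{x/2<..}"]) auto
      ultimately show ?thesis by simp
    next
      case True
      have lim: "((\<lambda>v. 3 * v powr (1 - 2 * a)) \<longlongrightarrow> 3 * 0 powr (1 - 2 * a)) (at 0 within {0..1})"
      proof -
        have "continuous_on {0..1} (\<lambda>v. 3 * v powr (1 - 2 * a))"
          using a by (intro continuous_intros continuous_on_powr') auto
        thus ?thesis unfolding continuous_on_def by (rule bspec) simp
      qed
      have "(?G \<longlongrightarrow> 0) (at 0 within {0..1})"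
      proof (rule Lim_null_comparison)
        show "((\<lambda>v. 3 * v powr (1 - 2 * a)) \<longlongrightarrow> 0) (at 0 within {0..1})" using lim by simp
        show "\<forall>\<^sub>F v in at 0 within {0..1}. norm (?G v) <= 3 * v powr (1 - 2 * a)"
          unfolding eventually_at_filter
        proof (intro always_eventually allI impI)
          fix v :: real assume v: "v \<noteq> 0" "v \<in> {0..1}"
          have "\<bar>(1 - v) powr (a + 1) - (1 - v) powr (2 * a + 2)\<bar> <= 3 * v"
            using one_minus_powr_bounds[of v "a + 1"] one_minus_powr_bounds[of v "2 * a + 2"] v a by auto
          hence "norm (?G v) <= v powr (- 2 * a) * (3 * v)" by (simp add: abs_mult mult_left_mono)
          also have "\<dots> = 3 * v powr (1 - 2 * a)" using v by (simp add: powr_diff powr_minus divide_inverse)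
          finally show "norm (?G v) <= 3 * v powr (1 - 2 * a)" .
        qed
      qed
      thus ?thesis using True by simp
    qed
  qed
  have "(?G' has_integral (?G 1 - ?G 0)) {0..1}"
  proof (rule fundamental_theorem_of_calculus_interior[OF _ cont])
    fix v :: real assume "v \<in> {0<..<1}"
    hence v: "0 < v" "v < 1" by auto
    define V where "V = v powr (- 2 * a)"
    define P where "P = (1 - v) powr a"
    have e: "v powr (- 2 * a - 1) = V / v" "(1 - v) powr (a + 1) = P * (1 - v)" "(1 - v) powr (2 * a + 1) = P * P * (1 - v)"
      "(1 - v) powr (2 * a + 2) = P * P * (1 - v) * (1 - v)"
    proof -
      show "v powr (- 2 * a - 1) = V / v" using v by (simp add: V_def powr_diff)
      show "(1 - v) powr (a + 1) = P * (1 - v)" using v by (simp add: P_def powr_add)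
      have PP: "(1 - v) powr (2 * a) = P * P" unfolding P_def powr_add[symmetric] by (simp only: mult_2)
      show "(1 - v) powr (2 * a + 1) = P * P * (1 - v)" using v by (simp add: powr_add PP)
      have "(1 - v) powr (2 * a + 2) = (1 - v) powr (2 * a) * (1 - v) powr 2" by (rule powr_add)
      thus "(1 - v) powr (2 * a + 2) = P * P * (1 - v) * (1 - v)" using v by (simp add: PP power2_eq_square)
    qed
    have d1: "((\<lambda>v. v powr (- 2 * a)) has_real_derivative (- 2 * a) * (V / v)) (at v)"
      using has_real_derivative_powr[OF v(1), of "- 2 * a"] unfolding e .
    have d2: "((\<lambda>v. (1 - v) powr (a + 1)) has_real_derivative - ((a + 1) * P)) (at v)"
      using v by (auto intro!: derivative_eq_intros simp: P_def)
    have d3: "((\<lambda>v. (1 - v) powr (2 * a + 2)) has_real_derivative - ((2 * a + 2) * (P * P * (1 - v)))) (at v)"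
      using v e(3) by (auto intro!: derivative_eq_intros simp: add.commute)
    have "(?G has_real_derivative ((- 2 * a) * (V / v)) * ((1 - v) powr (a + 1) - (1 - v) powr (2 * a + 2)) + (- ((a + 1) * P) - - ((2 * a + 2) * (P * P * (1 - v)))) * v powr (- 2 * a)) (at v)"
      by (rule DERIV_mult[OF d1 DERIV_diff[OF d2 d3]])
    also have "((- 2 * a) * (V / v)) * ((1 - v) powr (a + 1) - (1 - v) powr (2 * a + 2)) + (- ((a + 1) * P) - - ((2 * a + 2) * (P * P * (1 - v)))) * v powr (- 2 * a) = ?G' v"
    proof -
      have j: "2 * a * (a + 1) * ?j v = 2 * a * (V / v) * P * (1 - P * (1 - v))"
        using a unfolding kern_h_def e P_def[symmetric] by simp
      show ?thesis unfolding j unfolding e V_def[symmetric] P_def[symmetric] using v by (simp add: field_simps)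
    qed
    finally show "(?G has_vector_derivative ?G' v) (at v)"
      by (simp only: has_real_derivative_iff_has_vector_derivative)
  qed simp
  moreover have "?G 1 - ?G 0 = 0" using a by simp
  ultimately have G': "(?G' has_integral 0) {0..1}" by simp
  have B1: "(?b1 has_integral Beta (1 - 2 * a) (a + 1)) {0..1}" and B2: "(?b2 has_integral Beta (1 - 2 * a) (2 * a + 2)) {0..1}"
    using has_integral_Beta_real[of "1 - 2 * a" "a + 1"] has_integral_Beta_real[of "1 - 2 * a" "2 * a + 2"] a by (simp_all add: add.commute)
  have c: "((\<lambda>v. (1 / (2 * a * (a + 1))) * ((a - 1) * ?b1 v + 2 * ?b2 v - ?G' v)) has_integral (1 / (2 * a * (a + 1))) * ((a - 1) * Beta (1 - 2 * a) (a + 1) + 2 * Beta (1 - 2 * a) (2 * a + 2) - 0)) {0..1}"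
    by (intro has_integral_mult_right has_integral_diff has_integral_add B1 B2 G')
  have "(1 / (2 * a * (a + 1))) * ((a - 1) * ?b1 v + 2 * ?b2 v - ?G' v) = ?j v" for v
    using a a0 by simp
  with c show ?thesis by (simp add: kern_J_def)
qed

end

context
  fixes a :: real
  assumes a: "- 1 / 2 < a" "a < 1 / 2"
begin

lemma kern_X_square: "(\<integral>\<^sup>+x. ennreal ((x powr (- a) * (1 - x) powr a)\<^sup>2) * indicator {0..1} x \<partial>lborel) = ennreal (Beta (1 - 2 * a) (1 + 2 * a))"
proof -
  have "((\<lambda>x. x powr ((1 - 2 * a) - 1) * (1 - x) powr ((1 + 2 * a) - 1)) has_integral Beta (1 - 2 * a) (1 + 2 * a)) {0..1}"
    using a by (intro has_integral_Beta_real) auto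
  from nn_integral_has_integral_lebesgue'[OF _ this]
  have "(\<integral>\<^sup>+x. ennreal (x powr (- 2 * a) * (1 - x) powr (2 * a)) * indicator {0..1} x \<partial>lborel) = ennreal (Beta (1 - 2 * a) (1 + 2 * a))" by simp
  moreover have "(x powr (- a) * (1 - x) powr a)\<^sup>2 = x powr (- 2 * a) * (1 - x) powr (2 * a)" for x
  proof -
    have "(y powr b)\<^sup>2 = y powr (2 * b)" for y b :: real
      unfolding power2_eq_square powr_add[symmetric] by (simp only: mult_2)
    thus ?thesis unfolding power_mult_distrib by simp
  qed
  ultimately show ?thesis by simp
qed

lemma kern_X_integral: "(\<integral>\<^sup>+x. ennreal (x powr (- a) * (1 - x) powr a) * indicator {0..1} x \<partial>lborel) = ennreal (Beta (1 - a) (1 + a))"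
proof -
  have "((\<lambda>x. x powr ((1 - a) - 1) * (1 - x) powr ((1 + a) - 1)) has_integral Beta (1 - a) (1 + a)) {0..1}"
    using a by (intro has_integral_Beta_real) auto
  from nn_integral_has_integral_lebesgue'[OF _ this] show ?thesis by simp
qed

text \<open>
  Tonelli's theorem on the triangle, with the inner integral elementary.
\<close>

lemma kern_XY:
  assumes "a \<noteq> 0"
  shows "(\<integral>\<^sup>+x. ennreal ((1 - x) powr a) * indicator {0..1} x * kern_I a x \<partial>lborel) = ennreal (kern_J a)"
proof -
  have "(\<integral>\<^sup>+x. ennreal ((1 - x) powr a) * indicator {0..1} x * kern_I a x \<partial>lborel)
    = (\<integral>\<^sup>+v. ennreal (kern_h a v) * indicator {0..1} v * (\<integral>\<^sup>+x. ennreal ((1 - x) powr a) * indicator {0..<v} x \<partial>lborel) \<partial>lborel)"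
    unfolding kern_I_def by (rule tonelli_triangle) auto
  also have "\<dots> = (\<integral>\<^sup>+v. ennreal (kern_h a v * ((1 - (1 - v) powr (a + 1)) / (a + 1))) * indicator {0..1} v \<partial>lborel)"
  proof (rule nn_integral_cong)
    fix v :: real
    show "ennreal (kern_h a v) * indicator {0..1} v * (\<integral>\<^sup>+x. ennreal ((1 - x) powr a) * indicator {0..<v} x \<partial>lborel)
      = ennreal (kern_h a v * ((1 - (1 - v) powr (a + 1)) / (a + 1))) * indicator {0..1} v"
    proof (cases "v \<in> {0..1}")
      case True
      thus ?thesis using a by (subst integral_powr_mirror) (auto simp: ennreal_mult'[OF kern_h_nonneg, symmetric])
    qed simp
  qed
  also have "\<dots> = ennreal (kern_J a)"
  proof (rule nn_integral_has_integral_lebesgue'[OF _ kern_J_has_integral[OF a assms]])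
    fix v :: real assume v: "v \<in> {0..1}"
    have "(1 - v) powr (a + 1) <= 1" using v a by (intro powr_le1) auto
    thus "0 <= kern_h a v * ((1 - (1 - v) powr (a + 1)) / (a + 1))" using a by (simp add: kern_h_nonneg)
  qed
  finally show ?thesis .
qed

text \<open>
  Tonelli again; here the powers of \<open>v\<close> combine to a Beta integrand.
\<close>

lemma kern_Y:
  "(\<integral>\<^sup>+x. ennreal (x powr a) * indicator {0..1} x * kern_I a x \<partial>lborel) = ennreal (Beta (1 - a) (1 + a) / (a + 1))"
proof -
  have "(\<integral>\<^sup>+x. ennreal (x powr a) * indicator {0..1} x * kern_I a x \<partial>lborel)
    = (\<integral>\<^sup>+v. ennreal (kern_h a v) * indicator {0..1} v * (\<integral>\<^sup>+x. ennreal (x powr a) * indicator {0..<v} x \<partial>lborel) \<partial>lborel)"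
    unfolding kern_I_def by (rule tonelli_triangle) auto
  also have "\<dots> = (\<integral>\<^sup>+v. ennreal (v powr (- a) * (1 - v) powr a / (a + 1)) * indicator {0..1} v \<partial>lborel)"
  proof (rule nn_integral_cong)
    fix v :: real
    have e: "kern_h a v * (v powr (a + 1) / (a + 1)) = v powr (- a) * (1 - v) powr a / (a + 1)"
    proof -
      have "v powr (- 2 * a - 1) * v powr (a + 1) = v powr (- a)" unfolding powr_add[symmetric] by (rule arg_cong2[where f="(powr)"]) auto
      thus ?thesis by (simp add: kern_h_def mult_ac)
    qed
    show "ennreal (kern_h a v) * indicator {0..1} v * (\<integral>\<^sup>+x. ennreal (x powr a) * indicator {0..<v} x \<partial>lborel)
      = ennreal (v powr (- a) * (1 - v) powr a / (a + 1)) * indicator {0..1} v"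
    proof (cases "v \<in> {0..1}")
      case True
      thus ?thesis using a unfolding e[symmetric] by (subst integral_powr_below) (auto simp: ennreal_mult'[OF kern_h_nonneg, symmetric])
    qed simp
  qed
  also have "\<dots> = (\<integral>\<^sup>+v. ennreal (1 / (a + 1)) * (ennreal (v powr (- a) * (1 - v) powr a) * indicator {0..1} v) \<partial>lborel)"
    using a by (intro nn_integral_cong) (simp add: ennreal_mult'[symmetric] mult.assoc[symmetric])
  also have "\<dots> = ennreal (1 / (a + 1)) * ennreal (Beta (1 - a) (1 + a))"
    by (subst nn_integral_cmult) (auto simp: kern_X_integral)
  also have "\<dots> = ennreal (Beta (1 - a) (1 + a) / (a + 1))" using a by (subst ennreal_mult'[symmetric]) auto
  finally show ?thesis .
qed

text \<open>
  Writing the square as an iterated integral and integrating the power of \<open>x\<close> first leaves the same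
  integral as in the mixed term, which is why only \<open>kern_J\<close> remains.
\<close>

lemma kern_Y_square:
  assumes "a \<noteq> 0"
  shows "(\<integral>\<^sup>+x. ennreal (x powr (2 * a)) * indicator {0..1} x * (kern_I a x)\<^sup>2 \<partial>lborel) = ennreal (2 / (2 * a + 1) * kern_J a)"
proof -
  have "(\<integral>\<^sup>+x. ennreal (x powr (2 * a)) * indicator {0..1} x * (kern_I a x)\<^sup>2 \<partial>lborel)
    = (\<integral>\<^sup>+x. 2 * (ennreal (x powr (2 * a)) * indicator {0..1} x * (\<integral>\<^sup>+v. (ennreal (kern_h a v) * kern_I a v) * indicator {x<..1} v \<partial>lborel)) \<partial>lborel)"
    using tonelli_square[of "\<lambda>v. ennreal (kern_h a v)"] by (intro nn_integral_cong) (simp add: kern_I_def[symmetric] mult_ac)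
  also have "\<dots> = 2 * (\<integral>\<^sup>+x. ennreal (x powr (2 * a)) * indicator {0..1} x * (\<integral>\<^sup>+v. (ennreal (kern_h a v) * kern_I a v) * indicator {x<..1} v \<partial>lborel) \<partial>lborel)"
  proof (rule nn_integral_cmult)
    have "(\<lambda>(x, v). (ennreal (kern_h a v) * kern_I a v) * indicator {x<..1} v) \<in> borel_measurable (borel \<Otimes>\<^sub>M lborel)"
      unfolding case_prod_beta by measurable
    from lborel.borel_measurable_nn_integral[OF this]
    have [measurable]: "(\<lambda>x. \<integral>\<^sup>+v. (ennreal (kern_h a v) * kern_I a v) * indicator {x<..1} v \<partial>lborel) \<in> borel_measurable borel" by simp
    show "(\<lambda>x. ennreal (x powr (2 * a)) * indicator {0..1} x * (\<integral>\<^sup>+v. (ennreal (kern_h a v) * kern_I a v) * indicator {x<..1} v \<partial>lborel)) \<in> borel_measurable lborel"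
      by measurable
  qed
  also have "(\<integral>\<^sup>+x. ennreal (x powr (2 * a)) * indicator {0..1} x * (\<integral>\<^sup>+v. (ennreal (kern_h a v) * kern_I a v) * indicator {x<..1} v \<partial>lborel) \<partial>lborel)
    = (\<integral>\<^sup>+v. (ennreal (kern_h a v) * kern_I a v) * indicator {0..1} v * (\<integral>\<^sup>+x. ennreal (x powr (2 * a)) * indicator {0..<v} x \<partial>lborel) \<partial>lborel)"
    by (rule tonelli_triangle) auto
  also have "\<dots> = (\<integral>\<^sup>+v. ennreal (1 / (2 * a + 1)) * (ennreal ((1 - v) powr a) * indicator {0..1} v * kern_I a v) \<partial>lborel)"
  proof (rule nn_integral_cong_AE, use AE_lborel_singleton[of "0::real"] in eventually_elim)
    fix v :: real assume v0: "v \<noteq> 0"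
    show "(ennreal (kern_h a v) * kern_I a v) * indicator {0..1} v * (\<integral>\<^sup>+x. ennreal (x powr (2 * a)) * indicator {0..<v} x \<partial>lborel)
      = ennreal (1 / (2 * a + 1)) * (ennreal ((1 - v) powr a) * indicator {0..1} v * kern_I a v)"
    proof (cases "v \<in> {0..1}")
      case True
      have "v powr (- 2 * a - 1) * v powr (2 * a + 1) = 1" unfolding powr_add[symmetric] using v0 by simp
      hence e: "kern_h a v * (v powr (2 * a + 1) / (2 * a + 1)) = 1 / (2 * a + 1) * (1 - v) powr a" by (simp add: kern_h_def mult_ac)
      have "(\<integral>\<^sup>+x. ennreal (x powr (2 * a)) * indicator {0..<v} x \<partial>lborel) = ennreal (v powr (2 * a + 1) / (2 * a + 1))"
        using True a by (intro integral_powr_below) auto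
      hence "(ennreal (kern_h a v) * kern_I a v) * indicator {0..1} v * (\<integral>\<^sup>+x. ennreal (x powr (2 * a)) * indicator {0..<v} x \<partial>lborel)
        = ennreal (kern_h a v * (v powr (2 * a + 1) / (2 * a + 1))) * kern_I a v"
        using True by (subst ennreal_mult'[OF kern_h_nonneg]) (simp add: mult_ac)
      also have "\<dots> = ennreal (1 / (2 * a + 1)) * (ennreal ((1 - v) powr a) * indicator {0..1} v * kern_I a v)"
        unfolding e using True a by (subst ennreal_mult') (auto simp: mult_ac)
      finally show ?thesis .
    qed simp
  qed
  also have "\<dots> = ennreal (1 / (2 * a + 1)) * ennreal (kern_J a)"
    by (subst nn_integral_cmult) (auto simp: kern_XY[OF assms])
  also have "2 * (ennreal (1 / (2 * a + 1)) * ennreal (kern_J a)) = ennreal (2 / (2 * a + 1) * kern_J a)"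
  proof -
    have "ennreal (2 / (2 * a + 1) * kern_J a) = ennreal (2 * (1 / (2 * a + 1))) * ennreal (kern_J a)" using a by (subst ennreal_mult'[symmetric]) auto
    also have "ennreal (2 * (1 / (2 * a + 1))) = 2 * ennreal (1 / (2 * a + 1))" using a by (subst ennreal_mult') auto
    finally show ?thesis by (simp add: mult.assoc)
  qed
  finally show ?thesis .
qed

definition kern_k :: "real => real" where
  "kern_k x = indicator {0..1} x * (x powr (- a) * (1 - x) powr a - a * x powr a * enn2real (kern_I a x))"

lemma kern_J_nonneg: "a \<noteq> 0 ==> 0 <= kern_J a"
proof (rule has_integral_nonneg[OF kern_J_has_integral[OF a]])
  fix v :: real assume v: "v \<in> {0..1}"
  have "(1 - v) powr (a + 1) <= 1" using v a by (intro powr_le1) auto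
  thus "0 <= kern_h a v * ((1 - (1 - v) powr (a + 1)) / (a + 1))" using a by (simp add: kern_h_nonneg)
qed

lemma kern_I_finite: "AE x in lborel. x \<in> {0..1} \<longrightarrow> ennreal (enn2real (kern_I a x)) = kern_I a x"
proof -
  have "AE x in lborel. ennreal (x powr a) * indicator {0..1} x * kern_I a x \<noteq> \<infinity>"
    by (rule nn_integral_PInf_AE) (auto simp: kern_Y)
  thus ?thesis using AE_lborel_singleton[of "0::real"]
  proof eventually_elim
    case (elim x)
    show ?case
    proof
      assume x: "x \<in> {0..1}"
      hence "0 < x powr a" using elim by simp
      hence "kern_I a x \<noteq> \<infinity>" using elim x by (auto simp: ennreal_mult_eq_top_iff)
      thus "ennreal (enn2real (kern_I a x)) = kern_I a x" by (simp add: less_top)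
    qed
  qed
qed

lemma hbi_from_nn:
  fixes f :: "real => real"
  assumes [measurable]: "f \<in> borel_measurable borel" and "\<And>x. 0 <= f x" "0 <= r" and "(\<integral>\<^sup>+x. g x \<partial>lborel) = ennreal r"
    and "AE x in lborel. ennreal (f x) = g x"
  shows "has_bochner_integral lborel f r"
proof (rule has_bochner_integral_nn_integral)
  show "(\<integral>\<^sup>+x. ennreal (f x) \<partial>lborel) = ennreal r" unfolding assms(4)[symmetric] by (rule nn_integral_cong_AE[OF assms(5)])
qed (use assms in auto)

lemma Beta_nonneg: "0 < x ==> 0 < y ==> 0 <= Beta x (y::real)"
  by (simp add: Beta_def Gamma_real_nonneg)

lemma kern_k_integral: "has_bochner_integral lborel kern_k (Beta (1 - a) (1 + a) / (a + 1))"
proof -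
  have 1: "has_bochner_integral lborel (\<lambda>x. indicator {0..1} x * (x powr (- a) * (1 - x) powr a)) (Beta (1 - a) (1 + a))"
    by (rule hbi_from_nn[OF _ _ _ kern_X_integral]) (use a in \<open>auto simp: indicator_def intro!: Beta_nonneg\<close>)
  have 2: "has_bochner_integral lborel (\<lambda>x. indicator {0..1} x * (x powr a * enn2real (kern_I a x))) (Beta (1 - a) (1 + a) / (a + 1))"
  proof (rule hbi_from_nn[OF _ _ _ kern_Y])
    show "AE x in lborel. ennreal (indicator {0..1} x * (x powr a * enn2real (kern_I a x))) = ennreal (x powr a) * indicator {0..1} x * kern_I a x"
      using kern_I_finite by eventually_elim (auto simp: indicator_def ennreal_mult)
  qed (use a in \<open>auto intro!: divide_nonneg_nonneg Beta_nonneg\<close>)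
  have "has_bochner_integral lborel (\<lambda>x. indicator {0..1} x * (x powr (- a) * (1 - x) powr a) - a * (indicator {0..1} x * (x powr a * enn2real (kern_I a x))))
    (Beta (1 - a) (1 + a) - a * (Beta (1 - a) (1 + a) / (a + 1)))"
    by (intro has_bochner_integral_diff has_bochner_integral_mult_right 1 2)
  moreover have "Beta (1 - a) (1 + a) - a * (Beta (1 - a) (1 + a) / (a + 1)) = Beta (1 - a) (1 + a) / (a + 1)"
    using a by (simp add: field_simps)
  moreover have "(\<lambda>x. indicator {0..1} x * (x powr (- a) * (1 - x) powr a) - a * (indicator {0..1} x * (x powr a * enn2real (kern_I a x)))) = kern_k"
    by (auto simp: kern_k_def fun_eq_iff indicator_def)
  ultimately show ?thesis by simp
qed

text \<open>
  Expanding the square gives the three integrals above; they combine to a Gamma quotient, the reciprocal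
  of the square of the normalising constant.
\<close>

lemma kern_k_square:
  "has_bochner_integral lborel (\<lambda>x. (kern_k x)\<^sup>2) (Beta (1 - 2 * a) (1 + 2 * a) - ((a - 1) * Beta (1 - 2 * a) (a + 1) + 2 * Beta (1 - 2 * a) (2 * a + 2)) / (2 * a + 1))"
proof -
  have 1: "has_bochner_integral lborel (\<lambda>x. indicator {0..1} x * (x powr (- a) * (1 - x) powr a)\<^sup>2) (Beta (1 - 2 * a) (1 + 2 * a))"
    by (rule hbi_from_nn[OF _ _ _ kern_X_square]) (use a in \<open>auto simp: indicator_def intro!: Beta_nonneg\<close>)
  show ?thesis
  proof (cases "a = 0")
    case True
    have k2: "(\<lambda>x. (kern_k x)\<^sup>2) = (\<lambda>x. indicator {0..1} x * (x powr (- a) * (1 - x) powr a)\<^sup>2)"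
      unfolding kern_k_def using True by (auto simp: fun_eq_iff indicator_def)
    have z: "((a - 1) * Beta (1 - 2 * a) (a + 1) + 2 * Beta (1 - 2 * a) (2 * a + 2)) / (2 * a + 1) = 0"
      using True by (simp add: Beta_def Gamma_numeral)
    show ?thesis unfolding k2 z diff_zero by (rule 1)
  next
    case False
    have 2: "has_bochner_integral lborel (\<lambda>x. indicator {0..1} x * ((1 - x) powr a * enn2real (kern_I a x))) (kern_J a)"
    proof (rule hbi_from_nn[OF _ _ _ kern_XY[OF False]])
      show "AE x in lborel. ennreal (indicator {0..1} x * ((1 - x) powr a * enn2real (kern_I a x))) = ennreal ((1 - x) powr a) * indicator {0..1} x * kern_I a x"
        using kern_I_finite by eventually_elim (auto simp: indicator_def ennreal_mult)
    qed (use kern_J_nonneg[OF False] in auto)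
    have 3: "has_bochner_integral lborel (\<lambda>x. indicator {0..1} x * (x powr (2 * a) * (enn2real (kern_I a x))\<^sup>2)) (2 / (2 * a + 1) * kern_J a)"
    proof (rule hbi_from_nn[OF _ _ _ kern_Y_square[OF False]])
      show "AE x in lborel. ennreal (indicator {0..1} x * (x powr (2 * a) * (enn2real (kern_I a x))\<^sup>2)) = ennreal (x powr (2 * a)) * indicator {0..1} x * (kern_I a x)\<^sup>2"
        using kern_I_finite by eventually_elim (auto simp: indicator_def ennreal_mult ennreal_power[symmetric])
    qed (use kern_J_nonneg[OF False] a in auto)
    have hb: "has_bochner_integral lborel (\<lambda>x. indicator {0..1} x * (x powr (- a) * (1 - x) powr a)\<^sup>2
        + (- 2 * a) * (indicator {0..1} x * ((1 - x) powr a * enn2real (kern_I a x)))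
        + a\<^sup>2 * (indicator {0..1} x * (x powr (2 * a) * (enn2real (kern_I a x))\<^sup>2)))
      (Beta (1 - 2 * a) (1 + 2 * a) + (- 2 * a) * kern_J a + a\<^sup>2 * (2 / (2 * a + 1) * kern_J a))"
      by (intro has_bochner_integral_add has_bochner_integral_mult_right 1 2 3)
    have eq: "AE x in lborel. indicator {0..1} x * (x powr (- a) * (1 - x) powr a)\<^sup>2
        + (- 2 * a) * (indicator {0..1} x * ((1 - x) powr a * enn2real (kern_I a x)))
        + a\<^sup>2 * (indicator {0..1} x * (x powr (2 * a) * (enn2real (kern_I a x))\<^sup>2)) = (kern_k x)\<^sup>2"
      using AE_lborel_singleton[of "0::real"]
    proof eventually_elim
      case (elim x)
      show ?case
      proof (cases "x \<in> {0..1}")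
        case True
        hence x: "x > 0" using elim by auto
        have p: "x powr (2 * a) = (x powr a)\<^sup>2" by (simp add: powr_add[symmetric] power2_eq_square)
        have q: "x powr (- a) * x powr a = 1" using x by (simp add: powr_add[symmetric])
        have r: "(x powr (- a) * (1 - x) powr a) * (x powr a * y) = (1 - x) powr a * y" for y
        proof -
          have "(x powr (- a) * (1 - x) powr a) * (x powr a * y) = (x powr (- a) * x powr a) * ((1 - x) powr a * y)" by (simp only: mult_ac)
          thus ?thesis unfolding q by simp
        qed
        have "(kern_k x)\<^sup>2 = (x powr (- a) * (1 - x) powr a)\<^sup>2 - 2 * a * ((x powr (- a) * (1 - x) powr a) * (x powr a * enn2real (kern_I a x))) + a\<^sup>2 * ((x powr a)\<^sup>2 * (enn2real (kern_I a x))\<^sup>2)"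
          using True by (simp add: kern_k_def power2_diff power_mult_distrib algebra_simps)
        thus ?thesis unfolding r p using True by simp
      qed (simp add: kern_k_def)
    qed
    have m: "kern_k \<in> borel_measurable borel" unfolding kern_k_def[abs_def] by measurable
    have "has_bochner_integral lborel (\<lambda>x. (kern_k x)\<^sup>2) (Beta (1 - 2 * a) (1 + 2 * a) + (- 2 * a) * kern_J a + a\<^sup>2 * (2 / (2 * a + 1) * kern_J a))"
      using has_bochner_integralI_AE[OF hb _ eq] m by simp
    also have "Beta (1 - 2 * a) (1 + 2 * a) + (- 2 * a) * kern_J a + a\<^sup>2 * (2 / (2 * a + 1) * kern_J a) =
      Beta (1 - 2 * a) (1 + 2 * a) - (2 * a * (a + 1) * kern_J a) / (2 * a + 1)"
      using a by (simp add: field_simps power2_eq_square)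
    also have "2 * a * (a + 1) * kern_J a = (a - 1) * Beta (1 - 2 * a) (a + 1) + 2 * Beta (1 - 2 * a) (2 * a + 2)"
      using a False by (simp add: kern_J_def)
    finally show ?thesis .
  qed
qed

end

lemma kern_I_at_1: "kern_I a 1 = 0"
  by (simp add: kern_I_def)

text \<open>
  The substitution \<open>u = s / (1 - w)\<close>, followed by \<open>v = 1 - w\<close>, brings the inner integral of the kernel
  to the unit interval.
\<close>

lemma kernel_substitution:
  assumes s: "0 < s" "s < t" and a: "- 1 / 2 < a" "a < 1 / 2"
  shows "(LBINT u:{s..t}. u powr (a - 1) * (u - s) powr a) = s powr (2 * a) * enn2real (kern_I a (s / t))"
proof -
  define \<sigma> where "\<sigma> = s / t"
  have \<sigma>: "0 < \<sigma>" "\<sigma> < 1" using s by (auto simp: \<sigma>_def)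
  let ?f = "\<lambda>u. u powr (a - 1) * (u - s) powr a"
  let ?g = "\<lambda>w. s / (1 - w)" and ?g' = "\<lambda>w. s / (1 - w)\<^sup>2"
  have g0: "?g 0 = s" and g1: "?g (1 - \<sigma>) = t" using s by (auto simp: \<sigma>_def)
  have "(\<integral>\<^sup>+u. ennreal (?f u * indicator {?g 0..?g (1 - \<sigma>)} u) \<partial>lborel) = (\<integral>\<^sup>+w. ennreal (?f (?g w) * ?g' w * indicator {0..1 - \<sigma>} w) \<partial>lborel)"
  proof (rule nn_integral_substitution)
    show "set_borel_measurable borel {?g 0..?g (1 - \<sigma>)} ?f" unfolding set_borel_measurable_def by measurable
    fix w assume w: "w \<in> {0..1 - \<sigma>}"
    hence w1: "1 - w > 0" using \<sigma> by auto
    show "(?g has_real_derivative ?g' w) (at w)"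
      using w1 by (auto intro!: derivative_eq_intros simp: power2_eq_square field_simps)
    show "0 <= ?g' w" using s by simp
  next
    show "continuous_on {0..1 - \<sigma>} ?g'" using \<sigma> by (intro continuous_intros) auto
  qed (use \<sigma> in auto)
  also have "\<dots> = (\<integral>\<^sup>+w. ennreal (s powr (2 * a)) * ennreal (kern_h a (1 - w) * indicator {0..1 - \<sigma>} w) \<partial>lborel)"
  proof (rule nn_integral_cong)
    fix w :: real
    have "?f (?g w) * ?g' w = s powr (2 * a) * kern_h a (1 - w)" if w: "0 <= w" "w <= 1 - \<sigma>"
    proof (cases "w = 0")
      case False
      hence w0: "w > 0" using w by simp
      define y where "y = 1 - w"
      have y: "y > 0" using w \<sigma> by (simp add: y_def)
      have d: "s / y - s = s * w / y" using y by (simp add: y_def field_simps)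
      have yp: "y powr (a - 1) * y powr a * y\<^sup>2 = y powr (2 * a + 1)"
      proof -
        have "y powr (a - 1) * y powr a * y powr 2 = y powr (2 * a + 1)" unfolding powr_add[symmetric] by (rule arg_cong2[where f="(powr)"]) auto
        thus ?thesis using y by simp
      qed
      have sp: "s powr (a - 1) * s powr a * s = s powr (2 * a)"
      proof -
        have "s powr (a - 1) * s powr a * s powr 1 = s powr (2 * a)" unfolding powr_add[symmetric] by (rule arg_cong2[where f="(powr)"]) auto
        thus ?thesis using s by simp
      qed
      have "?f (s / y) * (s / y\<^sup>2) = (s powr (a - 1) * s powr a * s) * w powr a / (y powr (a - 1) * y powr a * y\<^sup>2)"
        unfolding d using s y w0 by (simp add: powr_divide powr_mult)
      also have "\<dots> = s powr (2 * a) * (y powr (- 2 * a - 1) * w powr a)"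
      proof -
        have "y powr (- 2 * a - 1) = 1 / y powr (2 * a + 1)" by (subst powr_minus_divide[symmetric]) simp
        thus ?thesis unfolding yp sp by simp
      qed
      finally show ?thesis by (simp add: kern_h_def y_def)
    qed (simp add: kern_h_def)
    thus "ennreal (?f (?g w) * ?g' w * indicator {0..1 - \<sigma>} w) = ennreal (s powr (2 * a)) * ennreal (kern_h a (1 - w) * indicator {0..1 - \<sigma>} w)"
      by (cases "w \<in> {0..1 - \<sigma>}") (simp_all add: ennreal_mult kern_h_nonneg)
  qed
  also have "\<dots> = ennreal (s powr (2 * a)) * (\<integral>\<^sup>+w. ennreal (kern_h a (1 - w) * indicator {0..1 - \<sigma>} w) \<partial>lborel)"
    by (rule nn_integral_cmult) measurable
  also have "(\<integral>\<^sup>+w. ennreal (kern_h a (1 - w) * indicator {0..1 - \<sigma>} w) \<partial>lborel) = kern_I a \<sigma>"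
  proof -
    have "(\<integral>\<^sup>+w. ennreal (kern_h a (1 - w) * indicator {0..1 - \<sigma>} w) \<partial>lborel) = (\<integral>\<^sup>+v. ennreal (kern_h a v * indicator {0..1 - \<sigma>} (1 - v)) \<partial>lborel)"
      by (subst nn_integral_real_affine[where c="-1" and t=1]) auto
    also have "\<dots> = kern_I a \<sigma>" unfolding kern_I_def
      by (rule nn_integral_cong_AE, use AE_lborel_singleton[of \<sigma>] in eventually_elim) (auto simp: indicator_def)
    finally show ?thesis .
  qed
  finally have nn: "(\<integral>\<^sup>+u. ennreal (?f u * indicator {s..t} u) \<partial>lborel) = ennreal (s powr (2 * a)) * kern_I a \<sigma>" unfolding g0 g1 .
  have "(LBINT u:{s..t}. ?f u) = (LBINT u. ?f u * indicator {s..t} u)" by (simp add: set_lebesgue_integral_def mult.commute)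
  also have "\<dots> = enn2real (\<integral>\<^sup>+u. ennreal (?f u * indicator {s..t} u) \<partial>lborel)"
    by (rule integral_eq_nn_integral) auto
  also have "\<dots> = s powr (2 * a) * enn2real (kern_I a \<sigma>)" unfolding nn by (simp add: enn2real_mult)
  finally show ?thesis by (simp add: \<sigma>_def)
qed

text \<open>
  Self-similarity: up to a power of \<open>t\<close> the kernel depends on \<open>s / t\<close> only, so all its integrals reduce to
  the unit interval.
\<close>

lemma K_kernel_scaling:
  assumes H: "0 < H" "H < 1" and s: "0 < s" "s < t"
  shows "K_kernel H t s = c_const H * (t powr (H - 1/2) * kern_k (H - 1/2) (s / t))"
proof -
  define a where "a = H - 1/2"
  have a: "- 1 / 2 < a" "a < 1 / 2" using H by (auto simp: a_def)
  have t: "t > 0" using s by simp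
  have e: "1/2 - H = - a" "H - 3/2 = a - 1" "H - 1/2 = a" by (auto simp: a_def)
  have "(t / s) powr a = t powr a * (t powr (- a) * (s / t) powr (- a))"
  proof -
    have "t powr (- a) * (s / t) powr (- a) = s powr (- a)" using s t by (simp add: powr_mult[symmetric])
    thus ?thesis using s t by (simp only: powr_divide powr_minus_divide less_imp_le) simp
  qed
  moreover have "(t - s) powr a = t powr a * (1 - s / t) powr a"
  proof -
    have "t - s = t * (1 - s / t)" using t by (simp add: field_simps)
    thus ?thesis using s t by (simp add: powr_mult)
  qed
  moreover have "t powr (- a) * t powr a = 1" using t by (simp add: powr_add[symmetric])
  ultimately have 1: "(t / s) powr a * (t - s) powr a = t powr a * ((s / t) powr (- a) * (1 - s / t) powr a)"
    by (simp add: mult_ac)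
  have 2: "s powr (- a) * (s powr (2 * a) * y) = t powr a * ((s / t) powr a * y)" for y
  proof -
    have "s powr (- a) * s powr (2 * a) = s powr a" unfolding powr_add[symmetric] by simp
    moreover have "t powr a * (s / t) powr a = s powr a" using s t by (simp add: powr_mult[symmetric])
    ultimately show ?thesis by (simp only: mult.assoc[symmetric])
  qed
  have st: "s / t \<in> {0..1}" using s by simp
  have "K_kernel H t s = c_const H * ((t / s) powr a * (t - s) powr a - a * s powr (- a) * (s powr (2 * a) * enn2real (kern_I a (s / t))))"
    using s unfolding K_kernel_def e kernel_substitution[OF s a] by simp
  also have "\<dots> = c_const H * (t powr a * ((s / t) powr (- a) * (1 - s / t) powr a) - a * (t powr a * ((s / t) powr a * enn2real (kern_I a (s / t)))))"
    unfolding 1 2[symmetric] by (simp only: mult.assoc)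
  also have "\<dots> = c_const H * (t powr a * kern_k a (s / t))"
    using st by (simp add: kern_k_def[OF a] algebra_simps)
  finally show ?thesis by (simp add: a_def)
qed

lemma K_kernel_measurable: "K_kernel H t \<in> borel_measurable borel"
proof -
  have "(\<lambda>(s, u). indicator {s..t} u * (u powr (H - 3/2) * (u - s) powr (H - 1/2)) :: real) =
    (\<lambda>p. if fst p <= snd p \<and> snd p <= t then snd p powr (H - 3/2) * (snd p - fst p) powr (H - 1/2) else 0)"
    by (auto simp: fun_eq_iff indicator_def)
  moreover have "(\<lambda>p. if fst p <= snd p \<and> snd p <= t then snd p powr (H - 3/2) * (snd p - fst p) powr (H - 1/2) else 0) \<in> borel_measurable (borel \<Otimes>\<^sub>M (lborel :: real measure))"
    by measurable
  ultimately have "(\<lambda>(s, u). indicator {s..t} u * (u powr (H - 3/2) * (u - s) powr (H - 1/2)) :: real) \<in> borel_measurable (borel \<Otimes>\<^sub>M lborel)"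
    by simp
  from lborel.borel_measurable_lebesgue_integral[OF this]
  have [measurable]: "(\<lambda>s. LBINT u:{s..t}. u powr (H - 3/2) * (u - s) powr (H - 1/2)) \<in> borel_measurable borel"
    by (simp add: set_lebesgue_integral_def)
  show ?thesis unfolding K_kernel_def[abs_def] by measurable
qed

lemma c_const_square:
  assumes H: "0 < H" "H < 1"
  shows "(c_const H)\<^sup>2 = 2 * H * Gamma (3/2 - H) / (Gamma (2 - 2 * H) * Gamma (H + 1/2))" "0 < c_const H"
proof -
  have "0 < 2 * H * Gamma (3/2 - H) / (Gamma (2 - 2 * H) * Gamma (H + 1/2))"
    using H by (intro divide_pos_pos mult_pos_pos Gamma_real_pos) auto
  thus "(c_const H)\<^sup>2 = 2 * H * Gamma (3/2 - H) / (Gamma (2 - 2 * H) * Gamma (H + 1/2))" "0 < c_const H"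
    by (auto simp: c_const_def)
qed

lemma kern_constant:
  fixes a :: real
  assumes a: "- 1 / 2 < a" "a < 1 / 2"
  shows "Beta (1 - 2 * a) (1 + 2 * a) - ((a - 1) * Beta (1 - 2 * a) (a + 1) + 2 * Beta (1 - 2 * a) (2 * a + 2)) / (2 * a + 1)
    = Gamma (1 - 2 * a) * Gamma (a + 1) / (Gamma (1 - a) * (2 * a + 1))"
proof -
  have np: "x \<notin> \<int>\<^sub>\<le>\<^sub>0" if "x > 0" for x :: real using that by (auto elim!: nonpos_Ints_cases)
  have g1: "Gamma (2 - a) = (1 - a) * Gamma (1 - a)" using Gamma_plus1[OF np, of "1 - a"] a by (simp add: algebra_simps)
  have g2: "Gamma (2 * a + 2) = (2 * a + 1) * Gamma (2 * a + 1)" using Gamma_plus1[OF np, of "2 * a + 1"] a by (simp add: algebra_simps)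
  have B0: "Beta (1 - 2 * a) (1 + 2 * a) = Gamma (1 - 2 * a) * Gamma (2 * a + 1)" by (simp add: Beta_def Gamma_numeral add.commute)
  have B1: "(a - 1) * Beta (1 - 2 * a) (a + 1) = - (Gamma (1 - 2 * a) * Gamma (a + 1) / Gamma (1 - a))"
  proof -
    have pos: "Gamma (1 - a) > 0" using a by (intro Gamma_real_pos) auto
    have "Beta (1 - 2 * a) (a + 1) = Gamma (1 - 2 * a) * Gamma (a + 1) / ((1 - a) * Gamma (1 - a))"
      unfolding g1[symmetric] Beta_def by (simp add: algebra_simps)
    hence "(1 - a) * Beta (1 - 2 * a) (a + 1) = Gamma (1 - 2 * a) * Gamma (a + 1) / Gamma (1 - a)" using a by simp
    thus ?thesis by (simp add: algebra_simps)
  qed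
  have B2: "2 * Beta (1 - 2 * a) (2 * a + 2) = (2 * a + 1) * (Gamma (1 - 2 * a) * Gamma (2 * a + 1))"
    by (simp add: Beta_def Gamma_numeral g2 fact_numeral)
  show ?thesis unfolding B0 B1 B2 using a by (simp add: field_simps)
qed

text \<open>
  The variance of fractional Brownian motion, and its covariance with the generating Brownian motion.
\<close>

lemma K_kernel_integrals:
  assumes H: "0 < H" "H < 1" and t: "0 < t"
  shows "sq_int t (K_kernel H t)" "sq_norm t (K_kernel H t) = (t powr H)\<^sup>2"
    "(LBINT s:{0..t}. K_kernel H t s) = kappa_const H * t powr (H + 1/2)"
proof -
  define a where "a = H - 1/2"
  have a: "- 1 / 2 < a" "a < 1 / 2" using H by (auto simp: a_def)
  let ?c = "c_const H * t powr a"
  have k0: "kern_k a x = 0" if "x \<notin> {0<..<1}" for x using that by (auto simp: kern_k_def[OF a] indicator_def kern_I_at_1)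
  have eq: "indicator {0..t} s * K_kernel H t s = ?c * kern_k a (0 + (1 / t) * s)" for s
  proof (cases "0 < s \<and> s < t")
    case True
    thus ?thesis using K_kernel_scaling[OF H, of s t] by (simp add: a_def mult.assoc)
  next
    case False
    hence "s / t \<notin> {0<..<1}" using t by (auto simp: zero_less_divide_iff divide_less_eq)
    hence "kern_k a (s / t) = 0" by (rule k0)
    moreover have "K_kernel H t s = 0" using False by (auto simp: K_kernel_def)
    ultimately show ?thesis by simp
  qed
  have i1: "has_bochner_integral lborel (\<lambda>s. kern_k a (0 + (1 / t) * s)) (t * (Beta (1 - a) (1 + a) / (a + 1)))"
    using kern_k_integral[OF a] lborel_has_bochner_integral_real_affine_iff[of "1 / t" "kern_k a" "Beta (1 - a) (1 + a) / (a + 1)" 0] t by simp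
  have i2: "has_bochner_integral lborel (\<lambda>s. (kern_k a (0 + (1 / t) * s))\<^sup>2) (t * (Gamma (1 - 2 * a) * Gamma (a + 1) / (Gamma (1 - a) * (2 * a + 1))))"
    using kern_k_square[OF a] lborel_has_bochner_integral_real_affine_iff[of "1 / t" "\<lambda>x. (kern_k a x)\<^sup>2" "Gamma (1 - 2 * a) * Gamma (a + 1) / (Gamma (1 - a) * (2 * a + 1))" 0] t
    unfolding kern_constant[OF a] by simp
  have j1: "has_bochner_integral lborel (\<lambda>s. indicator {0..t} s * K_kernel H t s) (?c * (t * (Beta (1 - a) (1 + a) / (a + 1))))"
    unfolding eq by (rule has_bochner_integral_mult_right[OF i1])
  have sqeq: "indicator {0..t} s * (K_kernel H t s)\<^sup>2 = ?c\<^sup>2 * (kern_k a (0 + (1 / t) * s))\<^sup>2" for s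
  proof -
    have "indicator {0..t} s * (K_kernel H t s)\<^sup>2 = (indicator {0..t} s * K_kernel H t s)\<^sup>2" by (simp add: indicator_def)
    thus ?thesis unfolding eq by (simp add: power_mult_distrib)
  qed
  have j2: "has_bochner_integral lborel (\<lambda>s. indicator {0..t} s * (K_kernel H t s)\<^sup>2) (?c\<^sup>2 * (t * (Gamma (1 - 2 * a) * Gamma (a + 1) / (Gamma (1 - a) * (2 * a + 1)))))"
    unfolding sqeq by (rule has_bochner_integral_mult_right[OF i2])
  show "sq_int t (K_kernel H t)" unfolding sq_int_def set_integrable_def set_borel_measurable_def
    using j2 K_kernel_measurable[of H t] by (auto simp: has_bochner_integral_iff)
  have tp: "t powr a * t = t powr (H + 1/2)"
  proof -
    have "t powr a * t powr 1 = t powr (H + 1/2)" unfolding powr_add[symmetric] by (simp add: a_def add.commute)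
    thus ?thesis using t by simp
  qed
  have "(LBINT s:{0..t}. K_kernel H t s) = ?c * (t * (Beta (1 - a) (1 + a) / (a + 1)))"
    using j1 by (simp add: set_lebesgue_integral_def has_bochner_integral_iff)
  also have "\<dots> = c_const H * (Beta (1 - a) (1 + a) / (a + 1)) * (t powr a * t)" by (simp only: mult_ac)
  also have "\<dots> = kappa_const H * t powr (H + 1/2)" unfolding tp by (simp add: kappa_const_def a_def algebra_simps)
  finally show "(LBINT s:{0..t}. K_kernel H t s) = kappa_const H * t powr (H + 1/2)" .
  have cc: "(c_const H)\<^sup>2 * (Gamma (1 - 2 * a) * Gamma (a + 1) / (Gamma (1 - a) * (2 * a + 1))) = 1"
  proof -
    have c2: "(c_const H)\<^sup>2 = (2 * a + 1) * Gamma (1 - a) / (Gamma (1 - 2 * a) * Gamma (a + 1))"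
      unfolding c_const_square(1)[OF H] by (simp add: a_def algebra_simps)
    have pos: "Gamma (1 - a) > 0" "Gamma (1 - 2 * a) > 0" "Gamma (a + 1) > 0" "2 * a + 1 > 0" using a by (auto intro!: Gamma_real_pos)
    have cancel: "(x * p / (q * r)) * (q * r / (p * x)) = 1" if "x > 0" "p > 0" "q > 0" "r > 0" for x p q r :: real
      using that by simp
    show ?thesis unfolding c2 by (rule cancel[OF pos(4,1,2,3)])
  qed
  have tp2: "(t powr a)\<^sup>2 * t = (t powr H)\<^sup>2"
  proof -
    have "t powr a * t powr a * t powr 1 = t powr H * t powr H" unfolding powr_add[symmetric] by (simp add: a_def)
    thus ?thesis using t by (simp add: power2_eq_square)
  qed
  have "sq_norm t (K_kernel H t) = ?c\<^sup>2 * (t * (Gamma (1 - 2 * a) * Gamma (a + 1) / (Gamma (1 - a) * (2 * a + 1))))"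
    using j2 by (simp add: sq_norm_def set_lebesgue_integral_def has_bochner_integral_iff)
  also have "\<dots> = ((c_const H)\<^sup>2 * (Gamma (1 - 2 * a) * Gamma (a + 1) / (Gamma (1 - a) * (2 * a + 1)))) * ((t powr a)\<^sup>2 * t)"
    by (simp only: power_mult_distrib mult_ac)
  also have "\<dots> = (t powr H)\<^sup>2" unfolding cc tp2 by simp
  finally show "sq_norm t (K_kernel H t) = (t powr H)\<^sup>2" .
qed

text \<open>
  \<open>kappa_const H\<close> is the correlation of \<open>B 1\<close> and \<open>BH 1\<close>; the bound is Cauchy-Schwarz. It makes the
  Gaussian law of the terminal point nondegenerate for \<open>\<bar>\<rho>\<bar> < 1\<close>.
\<close>

lemma kappa_const_bounds:
  assumes H: "0 < H" "H < 1"
  shows "\<bar>kappa_const H\<bar> <= 1"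
proof -
  note k = K_kernel_integrals[OF H zero_less_one]
  have "0 <= sq_norm 1 (\<lambda>s. K_kernel H 1 s - kappa_const H * 1)" by simp
  also have "sq_norm 1 (\<lambda>s. K_kernel H 1 s - kappa_const H * 1) = (LBINT s:{0..1}. (K_kernel H 1 s)\<^sup>2 + ((- 2 * kappa_const H) * K_kernel H 1 s + (kappa_const H)\<^sup>2))"
    unfolding sq_norm_def by (rule set_lebesgue_integral_cong) (auto simp: power2_diff algebra_simps)
  also have "\<dots> = sq_norm 1 (K_kernel H 1) + ((- 2 * kappa_const H) * (LBINT s:{0..1}. K_kernel H 1 s) + (kappa_const H)\<^sup>2)"
  proof -
    have i: "set_integrable lborel {0..1} (\<lambda>s. (K_kernel H 1 s)\<^sup>2)" "set_integrable lborel {0..1} (\<lambda>s. (- 2 * kappa_const H) * K_kernel H 1 s)"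
      "set_integrable lborel {0..1} (\<lambda>s::real. (kappa_const H)\<^sup>2)"
    proof -
      show "set_integrable lborel {0..1} (\<lambda>s. (K_kernel H 1 s)\<^sup>2)" using k(1) by (simp add: sq_int_def)
      show "set_integrable lborel {0..1} (\<lambda>s. (- 2 * kappa_const H) * K_kernel H 1 s)"
        by (rule set_integrable_mult_right) (rule sq_int_integrable[OF k(1)])
      show "set_integrable lborel {0..1} (\<lambda>s::real. (kappa_const H)\<^sup>2)" by (rule sq_int_integrable[OF sq_int_const])
    qed
    have c: "(LBINT s:{0..1::real}. (kappa_const H)\<^sup>2) = (kappa_const H)\<^sup>2" by (simp add: set_lebesgue_integral_def)
    have m: "(LBINT s:{0..1}. (- 2 * kappa_const H) * K_kernel H 1 s) = (- 2 * kappa_const H) * (LBINT s:{0..1}. K_kernel H 1 s)" by (rule set_integral_mult_right)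
    show ?thesis unfolding set_integral_add(2)[OF i(1) set_integral_add(1)[OF i(2,3)]] set_integral_add(2)[OF i(2,3)] c m sq_norm_def ..
  qed
  also have "\<dots> = 1 - (kappa_const H)\<^sup>2" unfolding k(2,3) by (simp add: power2_eq_square)
  finally have "(kappa_const H)\<^sup>2 <= 1\<^sup>2" by simp
  thus ?thesis by (simp add: abs_square_le_1)
qed

section \<open>Linearity of the Ito integral\<close>

lemma pairing_abs_le:
  assumes "sq_int T a" "sq_int T b" "c > 0"
  shows "\<bar>LBINT t:{0..T}. a t * b t\<bar> <= (c * sq_norm T a + sq_norm T b / c) / 2"
proof -
  have "\<bar>LBINT t:{0..T}. a t * b t\<bar> <= (LBINT t:{0..T}. \<bar>a t * b t\<bar>)"
    unfolding set_lebesgue_integral_def by (rule order_trans[OF integral_abs_bound]) (simp add: abs_mult)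
  also have "\<dots> <= (LBINT t:{0..T}. (c/2) * (a t)\<^sup>2 + (1/(2*c)) * (b t)\<^sup>2)"
  proof (rule set_integral_mono)
    show "set_integrable lborel {0..T} (\<lambda>t. \<bar>a t * b t\<bar>)" using sq_int_mult[OF assms(1,2)] by (rule set_integrable_abs)
    show "set_integrable lborel {0..T} (\<lambda>t. (c/2) * (a t)\<^sup>2 + (1/(2*c)) * (b t)\<^sup>2)"
      using assms unfolding sq_int_def by (intro set_integral_add set_integrable_mult_right) auto
    fix t
    have "2 * (c * \<bar>a t\<bar>) * \<bar>b t\<bar> <= (c * \<bar>a t\<bar>)\<^sup>2 + \<bar>b t\<bar>\<^sup>2" by (rule sum_squares_bound)
    thus "\<bar>a t * b t\<bar> <= (c/2) * (a t)\<^sup>2 + (1/(2*c)) * (b t)\<^sup>2"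
      using \<open>c > 0\<close> by (simp add: abs_mult field_simps power2_eq_square)
  qed
  also have "\<dots> = (c * sq_norm T a + sq_norm T b / c) / 2"
    unfolding sq_norm_def using assms by (subst set_integral_add) (auto simp: sq_int_def field_simps)
  finally show ?thesis .
qed

context prob_space
begin

lemma tends_prob_of_sum_bound:
  assumes m [measurable]: "\<And>n. X n \<in> borel_measurable M" "X' \<in> borel_measurable M" "\<And>n. Y n \<in> borel_measurable M" "Y' \<in> borel_measurable M"
      "\<And>n. Z n \<in> borel_measurable M" "Z' \<in> borel_measurable M"
    and X: "tends_prob M X X'" and Y: "tends_prob M Y Y'"
    and le: "\<And>n. AE x in M. \<bar>Z n x - Z' x\<bar> <= \<bar>X n x - X' x\<bar> + \<bar>Y n x - Y' x\<bar>"
  shows "tends_prob M Z Z'"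
  unfolding tends_prob_def
proof (intro allI impI)
  fix \<epsilon> :: real assume e: "\<epsilon> > 0"
  hence e2: "\<epsilon> / 2 > 0" by simp
  have "(\<lambda>k. measure M {om \<in> space M. \<bar>X k om - X' om\<bar> > \<epsilon> / 2} + measure M {om \<in> space M. \<bar>Y k om - Y' om\<bar> > \<epsilon> / 2}) \<longlonglongrightarrow> 0 + 0"
    by (intro tendsto_add X[unfolded tends_prob_def, rule_format, OF e2] Y[unfolded tends_prob_def, rule_format, OF e2])
  hence L: "(\<lambda>k. measure M {om \<in> space M. \<bar>X k om - X' om\<bar> > \<epsilon> / 2} + measure M {om \<in> space M. \<bar>Y k om - Y' om\<bar> > \<epsilon> / 2}) \<longlonglongrightarrow> 0" by simp
  show "(\<lambda>k. measure M {om \<in> space M. \<bar>Z k om - Z' om\<bar> > \<epsilon>}) \<longlonglongrightarrow> 0"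
  proof (rule tendsto_sandwich[OF _ _ tendsto_const L])
    have "measure M {om \<in> space M. \<bar>Z k om - Z' om\<bar> > \<epsilon> / 2 + \<epsilon> / 2} <= measure M {om \<in> space M. \<bar>X k om - X' om\<bar> > \<epsilon> / 2} + measure M {om \<in> space M. \<bar>Y k om - Y' om\<bar> > \<epsilon> / 2}" for k
      by (rule measure_gt_add_le[OF _ _ _ le]) measurable
    thus "\<forall>\<^sub>F k in sequentially. measure M {om \<in> space M. \<bar>Z k om - Z' om\<bar> > \<epsilon>} <= measure M {om \<in> space M. \<bar>X k om - X' om\<bar> > \<epsilon> / 2} + measure M {om \<in> space M. \<bar>Y k om - Y' om\<bar> > \<epsilon> / 2}"
      by simp
  qed simp
qed

lemma tends_prob_cmult:
  assumes "tends_prob M X Y" shows "tends_prob M (\<lambda>n x. c * X n x) (\<lambda>x. c * Y x)"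
  unfolding tends_prob_def
proof (intro allI impI)
  fix \<epsilon> :: real assume e: "\<epsilon> > 0"
  show "(\<lambda>k. measure M {x \<in> space M. \<bar>c * X k x - c * Y x\<bar> > \<epsilon>}) \<longlonglongrightarrow> 0"
  proof (cases "c = 0")
    case False
    have "\<epsilon> / \<bar>c\<bar> > 0" using e False by simp
    hence "(\<lambda>k. measure M {x \<in> space M. \<bar>X k x - Y x\<bar> > \<epsilon> / \<bar>c\<bar>}) \<longlonglongrightarrow> 0" using assms unfolding tends_prob_def by blast
    moreover have "(\<bar>c * X k x - c * Y x\<bar> > \<epsilon>) = (\<bar>X k x - Y x\<bar> > \<epsilon> / \<bar>c\<bar>)" for k x
    proof -
      have "\<bar>c * X k x - c * Y x\<bar> = \<bar>c\<bar> * \<bar>X k x - Y x\<bar>" by (simp add: right_diff_distrib[symmetric] abs_mult)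
      thus ?thesis using False by (simp add: pos_divide_less_eq mult.commute)
    qed
    ultimately show ?thesis by simp
  qed (use e in simp)
qed

end

lemma (in filtered_space) L2_process_linear:
  assumes f: "L2_process M F T f" and g: "L2_process M F T g" and T: "0 <= T"
  shows "L2_process M F T (\<lambda>t om. c * f t om + d * g t om)"
  unfolding L2_process_def
proof
  show "progressively_measurable F T (\<lambda>t om. c * f t om + d * g t om)"
    unfolding progressively_measurable_def case_prod_unfold
  proof (intro ballI borel_measurable_add borel_measurable_times borel_measurable_const)
    fix t assume t: "t \<in> {0..T}"
    show "(\<lambda>p. f (fst p) (snd p)) \<in> borel_measurable (restrict_space borel {0..t} \<Otimes>\<^sub>M F t)"
      using f t unfolding L2_process_def progressively_measurable_def case_prod_unfold by blast
    show "(\<lambda>p. g (fst p) (snd p)) \<in> borel_measurable (restrict_space borel {0..t} \<Otimes>\<^sub>M F t)"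
      using g t unfolding L2_process_def progressively_measurable_def case_prod_unfold by blast
  qed
  show "AE om in M. set_integrable lborel {0..T} (\<lambda>t. (c * f t om + d * g t om)\<^sup>2)"
    using L2_process_sq_int[OF f T] L2_process_sq_int[OF g T]
  proof eventually_elim
    case (elim om)
    from sq_int_add[OF sq_int_cmult[OF elim(1)] sq_int_cmult[OF elim(2)]] show ?case by (simp add: sq_int_def)
  qed
qed

context bm_pair
begin

lemma ito_integral_linear:
  assumes f: "L2_process M F T f" and g: "L2_process M F T g" and T: "0 < T"
  shows "AE om in M. ito_integral M F W T (\<lambda>t om. c * f t om + d * g t om) om = c * ito_integral M F W T f om + d * ito_integral M F W T g om"
proof -
  have T0: "0 <= T" using T by simp
  note L = L2_process_linear[OF f g T0, of c d]
  have pf: "progressively_measurable F T f" and pg: "progressively_measurable F T g" using f g by (auto simp: L2_process_def)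
  note sf = lag_simple_integrand[OF pf T] and sg = lag_simple_integrand[OF pg T]
  let ?f = "\<lambda>n j om. lag T n (\<lambda>s. f s om) j" and ?g = "\<lambda>n j om. lag T n (\<lambda>s. g s om) j"
  let ?\<xi> = "\<lambda>n j om. c * ?f n j om - (- d) * ?g n j om"
  have s\<xi>: "simple_integrand F T (Suc n) (grid T (Suc n)) (?\<xi> n)" for n
    by (rule simple_integrand_diff[OF simple_integrand_cmult[OF sf] simple_integrand_cmult[OF sg]])
  have pr: "simple_process (Suc n) (grid T (Suc n)) (?\<xi> n) t om = c * simple_process (Suc n) (grid T (Suc n)) (?f n) t om + d * simple_process (Suc n) (grid T (Suc n)) (?g n) t om" for n t om
    unfolding simple_process_def sum_distrib_left sum.distrib[symmetric] by (intro sum.cong refl) (simp add: algebra_simps)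
  have S: "simple_ito_integral W (Suc n) (grid T (Suc n)) (?\<xi> n) om = c * simple_ito_integral W (Suc n) (grid T (Suc n)) (?f n) om + d * simple_ito_integral W (Suc n) (grid T (Suc n)) (?g n) om" for n om
    unfolding simple_ito_integral_def sum_distrib_left sum.distrib[symmetric] by (intro sum.cong refl) (simp add: algebra_simps)
  have d: "tends_prob M (\<lambda>n. sq_dist (Suc n) (grid T (Suc n)) (?\<xi> n) (\<lambda>t om. c * f t om + d * g t om)) (\<lambda>_. 0)"
  proof (rule AE_tendsto_imp_tends_prob)
    show "sq_dist (Suc n) (grid T (Suc n)) (?\<xi> n) (\<lambda>t om. c * f t om + d * g t om) \<in> borel_measurable M" for n
      using L by (intro sq_dist_measurable[OF s\<xi> _ T0]) (simp add: L2_process_def)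
    show "AE om in M. (\<lambda>n. sq_dist (Suc n) (grid T (Suc n)) (?\<xi> n) (\<lambda>t om. c * f t om + d * g t om) om) \<longlonglongrightarrow> 0"
      using lag_sq_dist_AE[OF f T] lag_sq_dist_AE[OF g T] L2_process_sq_int[OF f T0] L2_process_sq_int[OF g T0]
    proof eventually_elim
      case (elim om)
      let ?F = "\<lambda>n t. simple_process (Suc n) (grid T (Suc n)) (?f n) t om - f t om" and ?G = "\<lambda>n t. simple_process (Suc n) (grid T (Suc n)) (?g n) t om - g t om"
      have iF: "sq_int T (?F n)" and iG: "sq_int T (?G n)" for n
        by (rule sq_int_diff[OF sq_int_simple[OF sf] elim(3)], rule sq_int_diff[OF sq_int_simple[OF sg] elim(4)])
      have c2: "sq_norm T (\<lambda>t. k * h t) = k\<^sup>2 * sq_norm T h" for k h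
        unfolding sq_norm_def power_mult_distrib by (rule set_integral_mult_right)
      have b: "sq_dist (Suc n) (grid T (Suc n)) (?\<xi> n) (\<lambda>t om. c * f t om + d * g t om) om <= 2 * (c\<^sup>2 * sq_norm T (?F n)) + 2 * (d\<^sup>2 * sq_norm T (?G n))" for n
      proof -
        have "sq_dist (Suc n) (grid T (Suc n)) (?\<xi> n) (\<lambda>t om. c * f t om + d * g t om) om = sq_norm T (\<lambda>t. c * ?F n t + d * ?G n t)"
          unfolding sq_dist_def pr by (rule arg_cong[where f="sq_norm T"]) (auto simp: algebra_simps)
        also have "\<dots> <= 2 * sq_norm T (\<lambda>t. c * ?F n t) + 2 * sq_norm T (\<lambda>t. d * ?G n t)"
          by (rule sq_norm_add_le[OF sq_int_cmult[OF iF] sq_int_cmult[OF iG]])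
        finally show ?thesis unfolding c2 .
      qed
      have "(\<lambda>n. 2 * (c\<^sup>2 * sq_norm T (?F n)) + 2 * (d\<^sup>2 * sq_norm T (?G n))) \<longlonglongrightarrow> 2 * (c\<^sup>2 * 0) + 2 * (d\<^sup>2 * 0)"
        using elim(1,2) unfolding sq_dist_def by (intro tendsto_intros)
      hence L0: "(\<lambda>n. 2 * (c\<^sup>2 * sq_norm T (?F n)) + 2 * (d\<^sup>2 * sq_norm T (?G n))) \<longlonglongrightarrow> 0" by simp
      show ?case by (rule tendsto_sandwich[OF _ _ tendsto_const L0]) (use b in \<open>auto simp: sq_dist_def\<close>)
    qed
  qed simp
  note tf = lag_tends_ito_integral[OF f T] and tg = lag_tends_ito_integral[OF g T]
  have m: "(\<lambda>om. c * simple_ito_integral W (Suc n) (grid T (Suc n)) (?f n) om) \<in> borel_measurable M" "(\<lambda>om. d * simple_ito_integral W (Suc n) (grid T (Suc n)) (?g n) om) \<in> borel_measurable M"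
    "simple_ito_integral W (Suc n) (grid T (Suc n)) (?\<xi> n) \<in> borel_measurable M" for n
    using simple_ito_integral_measurable[OF sf bW] simple_ito_integral_measurable[OF sg bW] simple_ito_integral_measurable[OF s\<xi> bW] by auto
  have m': "(\<lambda>om. c * ito_integral M F W T f om) \<in> borel_measurable M" "(\<lambda>om. d * ito_integral M F W T g om) \<in> borel_measurable M"
    "(\<lambda>om. c * ito_integral M F W T f om + d * ito_integral M F W T g om) \<in> borel_measurable M" using tf(2) tg(2) by auto
  have t: "tends_prob M (\<lambda>n. simple_ito_integral W (Suc n) (grid T (Suc n)) (?\<xi> n)) (\<lambda>om. c * ito_integral M F W T f om + d * ito_integral M F W T g om)"
    by (rule tends_prob_of_sum_bound[OF m(1) m'(1) m(2) m'(2) m(3) m'(3) tends_prob_cmult[OF tf(1)] tends_prob_cmult[OF tg(1)]]) (unfold S, intro AE_I2, linarith)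
  have "has_ito_integral M F W T (\<lambda>t om. c * f t om + d * g t om) (\<lambda>om. c * ito_integral M F W T f om + d * ito_integral M F W T g om)"
    unfolding has_ito_integral_iff[OF L T0]
    by (intro conjI m'(3) exI[of _ "\<lambda>n. Suc n"] exI[of _ "\<lambda>n. grid T (Suc n)"] exI[of _ ?\<xi>] allI s\<xi> d t)
  from has_ito_integral_unique[OF L T0 has_ito_integral_ito_integral[OF L T0] this] show ?thesis .
qed

lemma sq_int_indicator: "sq_int T (indicator {s<..t})"
proof -
  have "set_integrable lborel {0..T} (\<lambda>u. (indicator {s<..t} u :: real)\<^sup>2)"
    by (rule set_integrable_bound[OF sq_int_integrable[OF sq_int_const, of T 1]]) (auto simp: set_borel_measurable_def indicator_def)
  thus ?thesis by (simp add: sq_int_def set_borel_measurable_def)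
qed

text \<open>
  The indicator is itself a simple process, on a partition containing \<open>s\<close> and \<open>t\<close>.
\<close>

lemma ito_integral_indicator:
  assumes st: "0 <= s" "s < t" "t <= T"
  shows "AE om in M. ito_integral M F W T (\<lambda>u _. indicator {s<..t} u) om = W t om - W s om"
proof -
  have T0: "0 <= T" using st by simp
  note L = deterministic_L2_process[of "indicator {s<..t}", OF _ sq_int_indicator]
  obtain m \<sigma> where \<sigma>: "increasing_upto m \<sigma>" "\<sigma> 0 = 0" "\<sigma> m = T" and im: "\<sigma> ` {..m} = {0, s, t, T}"
    by (rule partition_of_finite_set[of "{0, s, t, T}" T]) (use st in auto)
  obtain p where p: "p <= m" "\<sigma> p = s" using im by (metis (no_types, lifting) atMost_iff image_iff insertI1 insertI2)
  obtain q where q: "q <= m" "\<sigma> q = t" using im by (metis (no_types, lifting) atMost_iff image_iff insertI1 insertI2)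
  have ge: "s <= \<sigma> j" if "j < m" "s < \<sigma> (Suc j)" for j
    using chain_le[OF \<sigma>(1), of "Suc j" p] chain_le[OF \<sigma>(1), of p j] that p by (cases "Suc j <= p") auto
  have le: "\<sigma> (Suc j) <= t" if "j < m" "\<sigma> j < t" for j
    using chain_le[OF \<sigma>(1), of "Suc j" q] chain_le[OF \<sigma>(1), of q j] that q by (cases "Suc j <= q") auto
  define \<xi> where "\<xi> j om = (indicator {s<..t} (\<sigma> (Suc j)) :: real)" for j and om :: 'a
  have si: "simple_integrand F T m \<sigma> \<xi>"
    unfolding simple_integrand_def \<xi>_def using \<sigma> by (auto simp: increasing_upto_def indicator_def intro!: exI[of _ "1::real"])
  have pr: "simple_process m \<sigma> \<xi> u om = indicator {s<..t} u" for u om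
  proof (cases "\<sigma> 0 < u \<and> u <= \<sigma> m")
    case True
    then obtain j where j: "j < m" "\<sigma> j < u" "u <= \<sigma> (Suc j)" using chain_cell_exists by blast
    show ?thesis unfolding simple_process_eval[OF \<sigma>(1) j] \<xi>_def using ge[OF j(1)] le[OF j(1)] j by (force simp: indicator_def)
  next
    case False
    hence "simple_process m \<sigma> \<xi> u om = 0" by (intro simple_process_outside[OF \<sigma>(1)]) auto
    thus ?thesis using False \<sigma> st by (auto simp: indicator_def)
  qed
  have S: "simple_ito_integral W m \<sigma> \<xi> om = W t om - W s om" for om
  proof -
    define G where "G u = W (min u t) om - W (min u s) om" for u
    have "G (\<sigma> (Suc j)) - G (\<sigma> j) = \<xi> j om * (W (\<sigma> (Suc j)) om - W (\<sigma> j) om)" if j: "j < m" for j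
    proof -
      have lt: "\<sigma> j < \<sigma> (Suc j)" using \<sigma>(1) j by (simp add: increasing_upto_def)
      consider "\<sigma> (Suc j) <= s" | "s < \<sigma> (Suc j)" "\<sigma> (Suc j) <= t" | "t < \<sigma> (Suc j)" by linarith
      thus ?thesis
      proof cases
        case 1 thus ?thesis using lt st by (simp add: G_def \<xi>_def min_absorb1)
      next
        case 2
        thus ?thesis using ge[OF j] lt st by (simp add: G_def \<xi>_def min_absorb1 min_absorb2)
      next
        case 3
        hence "t <= \<sigma> j" using le[OF j] by linarith
        thus ?thesis using 3 lt st by (simp add: G_def \<xi>_def min_absorb2)
      qed
    qed
    hence "simple_ito_integral W m \<sigma> \<xi> om = (\<Sum>j<m. G (\<sigma> (Suc j)) - G (\<sigma> j))" unfolding simple_ito_integral_def by (intro sum.cong) auto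
    also have "\<dots> = G (\<sigma> m) - G (\<sigma> 0)" by (rule sum_lessThan_telescope)
    also have "\<dots> = W t om - W s om" using \<sigma> st by (simp add: G_def min_absorb1 min_absorb2)
    finally show ?thesis .
  qed
  have mm: "(\<lambda>om. W t om - W s om) \<in> borel_measurable M" using bm_measurable(2)[OF bW, of _ T] st by auto
  have "has_ito_integral M F W T (\<lambda>u _. indicator {s<..t} u) (\<lambda>om. W t om - W s om)"
    unfolding has_ito_integral_iff[OF L[simplified] T0]
  proof (intro conjI mm exI[of _ "\<lambda>_. m"] exI[of _ "\<lambda>_. \<sigma>"] exI[of _ "\<lambda>_. \<xi>"] allI si)
    have "sq_dist m \<sigma> \<xi> (\<lambda>u _. indicator {s<..t} u) om = 0" for om
      unfolding sq_dist_def pr sq_norm_def by (simp add: set_lebesgue_integral_def)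
    thus "tends_prob M (\<lambda>k. sq_dist m \<sigma> \<xi> (\<lambda>u _. indicator {s<..t} u)) (\<lambda>_. 0)" by (simp add: tends_prob_def)
    show "tends_prob M (\<lambda>k. simple_ito_integral W m \<sigma> \<xi>) (\<lambda>om. W t om - W s om)" by (simp add: S tends_prob_def)
  qed
  from has_ito_integral_unique[OF L[simplified] T0 has_ito_integral_ito_integral[OF L[simplified] T0] this] show ?thesis .
qed

end

section \<open>Adding a drift and changing to an equivalent measure\<close>

context filtered_space
begin

lemma time_pairing_measurable:
  fixes a g :: "real => 'a => real"
  assumes "(\<lambda>p. indicator {0..T} (snd p) * a (snd p) (fst p)) \<in> borel_measurable (M \<Otimes>\<^sub>M lborel)"
    "(\<lambda>p. indicator {0..T} (snd p) * g (snd p) (fst p)) \<in> borel_measurable (M \<Otimes>\<^sub>M lborel)"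
  shows "(\<lambda>om. LBINT s:{0..T}. a s om * g s om) \<in> borel_measurable M"
proof -
  have "(\<lambda>p. (indicator {0..T} (snd p) * a (snd p) (fst p)) * (indicator {0..T} (snd p) * g (snd p) (fst p))) \<in> borel_measurable (M \<Otimes>\<^sub>M lborel)"
    by (rule borel_measurable_times[OF assms])
  also have "(\<lambda>p. (indicator {0..T} (snd p) * a (snd p) (fst p)) * (indicator {0..T} (snd p) * g (snd p) (fst p))) = (\<lambda>(om, s). indicator {0..T} s * (a s om * g s om))"
    by (auto simp: indicator_def fun_eq_iff)
  finally show ?thesis using lborel.borel_measurable_lebesgue_integral[of "\<lambda>om s. indicator {0..T} s * (a s om * g s om)" M] by (simp add: set_lebesgue_integral_def)
qed

lemma simple_process_joint_measurable:
  assumes "simple_integrand F T n \<tau> \<xi>"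
  shows "(\<lambda>p. indicator {0..T} (snd p) * simple_process n \<tau> \<xi> (snd p) (fst p)) \<in> borel_measurable (M \<Otimes>\<^sub>M lborel)"
proof -
  have [measurable]: "(\<lambda>p. simple_process n \<tau> \<xi> (snd p) (fst p)) \<in> borel_measurable (M \<Otimes>\<^sub>M lborel)"
    unfolding simple_process_def
  proof (intro borel_measurable_sum borel_measurable_times)
    fix i assume "i \<in> {..<n}"
    hence "\<xi> i \<in> borel_measurable M" using simple_integrand_measurable_M[OF assms] by auto
    thus "(\<lambda>p. \<xi> i (fst p)) \<in> borel_measurable (M \<Otimes>\<^sub>M lborel)" by measurable
  qed measurable
  show ?thesis by measurable
qed

lemma simple_ito_integral_drift:
  assumes \<xi>: "simple_integrand F T n \<tau> \<xi>" and g: "sq_int T g"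
  shows "simple_ito_integral (\<lambda>t om. Z t om + (LBINT s:{0..t}. g s)) n \<tau> \<xi> om = simple_ito_integral Z n \<tau> \<xi> om + (LBINT s:{0..T}. simple_process n \<tau> \<xi> s om * g s)"
proof -
  note gi = sq_int_integrable[OF g]
  have r: "0 <= \<tau> i" "\<tau> i <= \<tau> (Suc i)" "\<tau> (Suc i) <= T" if "i < n" for i
    using simple_integrand_range[OF \<xi>, of i] simple_integrand_range[OF \<xi>, of "Suc i"] chain_le[OF simple_integrand_increasing[OF \<xi>], of i "Suc i"] that by auto
  have inc: "(LBINT s:{0..\<tau> (Suc i)}. g s) - (LBINT s:{0..\<tau> i}. g s) = (LBINT s:{\<tau> i<..\<tau> (Suc i)}. g s)" if i: "i < n" for i
  proof -
    have e: "{0..\<tau> (Suc i)} = {0..\<tau> i} \<union> {\<tau> i<..\<tau> (Suc i)}" using r[OF i] by auto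
    have "(LBINT s:{0..\<tau> (Suc i)}. g s) = (LBINT s:{0..\<tau> i}. g s) + (LBINT s:{\<tau> i<..\<tau> (Suc i)}. g s)"
      unfolding e using r[OF i] by (intro set_integral_Un set_integrable_subset[OF gi]) auto
    thus ?thesis by simp
  qed
  have "(LBINT s:{0..T}. simple_process n \<tau> \<xi> s om * g s) = (LBINT s. (\<Sum>i<n. \<xi> i om * (indicator {\<tau> i<..\<tau> (Suc i)} s *\<^sub>R g s)))"
    unfolding set_lebesgue_integral_def
  proof (intro Bochner_Integration.integral_cong refl)
    fix s
    have "indicator {0..T} s * indicator {\<tau> i<..\<tau> (Suc i)} s = (indicator {\<tau> i<..\<tau> (Suc i)} s :: real)" if "i < n" for i
      using r[OF that] by (auto simp: indicator_def)
    thus "indicator {0..T} s *\<^sub>R (simple_process n \<tau> \<xi> s om * g s) = (\<Sum>i<n. \<xi> i om * (indicator {\<tau> i<..\<tau> (Suc i)} s *\<^sub>R g s))"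
      unfolding simple_process_def real_scaleR_def sum_distrib_left sum_distrib_right by (intro sum.cong refl) (simp add: indicator_def)
  qed
  also have "\<dots> = (\<Sum>i<n. \<xi> i om * (LBINT s:{\<tau> i<..\<tau> (Suc i)}. g s))"
    unfolding set_lebesgue_integral_def
  proof (subst Bochner_Integration.integral_sum)
    fix i assume "i \<in> {..<n}"
    hence "set_integrable lborel {\<tau> i<..\<tau> (Suc i)} g" using r[of i] by (intro set_integrable_subset[OF gi]) auto
    thus "integrable lborel (\<lambda>s. \<xi> i om * (indicator {\<tau> i<..\<tau> (Suc i)} s *\<^sub>R g s))" unfolding set_integrable_def by (rule integrable_mult_right)
  qed simp
  finally have D: "(LBINT s:{0..T}. simple_process n \<tau> \<xi> s om * g s) = (\<Sum>i<n. \<xi> i om * (LBINT s:{\<tau> i<..\<tau> (Suc i)}. g s))" .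
  show ?thesis unfolding D simple_ito_integral_def sum.distrib[symmetric]
    by (intro sum.cong refl) (simp add: inc[symmetric] algebra_simps)
qed

end

text \<open>
  Convergence in probability is preserved by an absolutely continuous change of measure (hypothesis
  \<open>ac\<close>), so the same simple processes approximate under both measures. The drift contributes the pairing of
  the simple process with \<open>g\<close>, which converges pathwise by Cauchy-Schwarz. No stochastic calculus under
  \<open>N'\<close> is involved.
\<close>

lemma has_ito_integral_change:
  assumes N: "filtered_space N F u" and N': "filtered_space N' F u" and sets: "sets N' = sets N"
    and ac: "\<And>A. (\<And>k::nat. A k \<in> sets N) ==> (\<lambda>k. measure N (A k)) \<longlonglongrightarrow> 0 ==> (\<lambda>k. measure N' (A k)) \<longlonglongrightarrow> 0"
    and a: "L2_process N F u a" "L2_process N' F u a" and g: "L2_process N F u g" and u: "0 <= u"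
    and Z: "\<And>t. t \<in> {0..u} ==> Z t \<in> borel_measurable N"
    and I: "has_ito_integral N F Z u a I"
  shows "has_ito_integral N' F (\<lambda>t om. Z t om + (LBINT s:{0..t}. g s om)) u a (\<lambda>om. I om + (LBINT s:{0..u}. a s om * g s om))"
proof -
  interpret N: filtered_space N F u by fact
  interpret N': filtered_space N' F u by fact
  note mc = measurable_cong_sets[OF sets refl, of borel] and sp = sets_eq_imp_space_eq[OF sets]
  have pa: "progressively_measurable F u a" and pg: "progressively_measurable F u g" using a g by (auto simp: L2_process_def)
  have trans: "tends_prob N' X Y" if "tends_prob N X Y" "\<And>n. X n \<in> borel_measurable N" "Y \<in> borel_measurable N" for X Y
    unfolding tends_prob_def sp
  proof (intro allI impI ac)
    fix \<epsilon> :: real and k assume e: "\<epsilon> > 0"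
    note [measurable] = that(2,3)
    show "{om \<in> space N. \<bar>X k om - Y om\<bar> > \<epsilon>} \<in> sets N" by measurable
    show "(\<lambda>k. measure N {om \<in> space N. \<bar>X k om - Y om\<bar> > \<epsilon>}) \<longlonglongrightarrow> 0" using that(1) e by (simp add: tends_prob_def)
  qed
  obtain n \<tau> \<xi> where \<xi>: "\<And>k. simple_integrand F u (n k) (\<tau> k) (\<xi> k)" and d: "tends_prob N (\<lambda>k. N.sq_dist (n k) (\<tau> k) (\<xi> k) a) (\<lambda>_. 0)"
    and S: "tends_prob N (\<lambda>k. simple_ito_integral Z (n k) (\<tau> k) (\<xi> k)) I" and Im: "I \<in> borel_measurable N"
    using I unfolding N.has_ito_integral_iff[OF a(1) u] by blast
  have dm: "N.sq_dist (n k) (\<tau> k) (\<xi> k) a \<in> borel_measurable N" for k by (rule N.sq_dist_measurable[OF \<xi> pa u])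
  let ?D = "\<lambda>om. LBINT s:{0..u}. a s om * g s om" and ?Dk = "\<lambda>k om. LBINT s:{0..u}. simple_process (n k) (\<tau> k) (\<xi> k) s om * g s om"
  let ?Z = "\<lambda>t om. Z t om + (LBINT s:{0..t}. g s om)"
  have Dm [measurable]: "?D \<in> borel_measurable N" by (rule N.time_pairing_measurable[OF N.progressive_joint_M[OF pa u] N.progressive_joint_M[OF pg u]])
  have Dkm [measurable]: "?Dk k \<in> borel_measurable N" for k by (rule N.time_pairing_measurable[OF N.simple_process_joint_measurable[OF \<xi>] N.progressive_joint_M[OF pg u]])
  have gm [measurable]: "(\<lambda>om. sq_norm u (\<lambda>t. g t om)) \<in> borel_measurable N"
    unfolding sq_norm_def power2_eq_square by (rule N.time_pairing_measurable[OF N.progressive_joint_M[OF pg u] N.progressive_joint_M[OF pg u]])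
  have Dt: "tends_prob N ?Dk ?D" unfolding tends_prob_def
  proof (intro allI impI LIMSEQ_I)
    fix \<epsilon> h :: real assume e: "\<epsilon> > 0" and h: "h > 0"
    have "tends_prob N (\<lambda>j om. sq_norm u (\<lambda>t. g t om) / real (Suc j)) (\<lambda>_. 0)"
    proof (rule N.AE_tendsto_imp_tends_prob)
      show "AE om in N. (\<lambda>j. sq_norm u (\<lambda>t. g t om) / real (Suc j)) \<longlonglongrightarrow> 0"
        by (intro AE_I2 LIMSEQ_Suc[OF lim_const_over_n])
    qed measurable
    hence "(\<lambda>j. measure N {om \<in> space N. \<bar>sq_norm u (\<lambda>t. g t om) / real (Suc j) - 0\<bar> > \<epsilon>}) \<longlonglongrightarrow> 0" using e by (simp only: tends_prob_def)
    from order_tendstoD(2)[OF this, of "h / 2"] h obtain j where j: "measure N {om \<in> space N. \<bar>sq_norm u (\<lambda>t. g t om) / real (Suc j) - 0\<bar> > \<epsilon>} < h / 2"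
      unfolding eventually_sequentially by auto
    define c where "c = real (Suc j)"
    have c: "c > 0" by (simp add: c_def)
    have "\<epsilon> / c > 0" using e c by simp
    from order_tendstoD(2)[OF d[unfolded tends_prob_def, rule_format, OF this], of "h / 2"] h
    obtain k0 where k0: "\<And>k. k >= k0 ==> measure N {om \<in> space N. \<bar>N.sq_dist (n k) (\<tau> k) (\<xi> k) a om - 0\<bar> > \<epsilon> / c} < h / 2"
      unfolding eventually_sequentially by auto
    have "norm (measure N {om \<in> space N. \<bar>?Dk k om - ?D om\<bar> > \<epsilon>} - 0) < h" if k: "k >= k0" for k
    proof -
      note [measurable] = dm[of k]
      let ?A = "{om \<in> space N. \<bar>N.sq_dist (n k) (\<tau> k) (\<xi> k) a om - 0\<bar> > \<epsilon> / c}" and ?B = "{om \<in> space N. \<bar>sq_norm u (\<lambda>t. g t om) / real (Suc j) - 0\<bar> > \<epsilon>}"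
      have "measure N {om \<in> space N. \<bar>?Dk k om - ?D om\<bar> > \<epsilon>} <= measure N (?A \<union> ?B)"
      proof (rule N.finite_measure_mono_AE)
        show "AE om in N. om \<in> {om \<in> space N. \<bar>?Dk k om - ?D om\<bar> > \<epsilon>} \<longrightarrow> om \<in> ?A \<union> ?B"
          using N.L2_process_sq_int[OF a(1) u] N.L2_process_sq_int[OF g u]
        proof eventually_elim
          case (elim om)
          note si = N.sq_int_simple[OF \<xi>, of k om]
          have "?Dk k om - ?D om = (LBINT s:{0..u}. (simple_process (n k) (\<tau> k) (\<xi> k) s om - a s om) * g s om)"
            unfolding left_diff_distrib by (rule set_integral_diff(2)[OF sq_int_mult[OF si elim(2)] sq_int_mult[OF elim], symmetric])
          hence "\<bar>?Dk k om - ?D om\<bar> <= (c * N.sq_dist (n k) (\<tau> k) (\<xi> k) a om + sq_norm u (\<lambda>t. g t om) / c) / 2"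
            unfolding N.sq_dist_def using pairing_abs_le[OF sq_int_diff[OF si elim(1)] elim(2) c] by simp
          moreover have "c * x > \<epsilon> ==> \<bar>x - 0\<bar> > \<epsilon> / c" for x
          proof -
            assume "c * x > \<epsilon>"
            hence "\<epsilon> / c < x" using c by (simp add: pos_divide_less_eq mult.commute)
            thus "\<bar>x - 0\<bar> > \<epsilon> / c" by linarith
          qed
          moreover have "sq_norm u (\<lambda>t. g t om) / c > \<epsilon> ==> \<bar>sq_norm u (\<lambda>t. g t om) / real (Suc j) - 0\<bar> > \<epsilon>"
            by (simp add: c_def)
          ultimately show ?case by (cases "c * N.sq_dist (n k) (\<tau> k) (\<xi> k) a om > \<epsilon>") auto
        qed
      qed measurable
      also have "\<dots> <= measure N ?A + measure N ?B" by (rule measure_Un_le) measurable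
      also have "\<dots> < h" using k0[OF k] j by simp
      finally show ?thesis by simp
    qed
    thus "\<exists>no. \<forall>k\<ge>no. norm (measure N {om \<in> space N. \<bar>?Dk k om - ?D om\<bar> > \<epsilon>} - 0) < h" by blast
  qed
  have Zt: "?Z t \<in> borel_measurable N" if t: "t \<in> {0..u}" for t
  proof -
    have "(\<lambda>om. LBINT s:{0..t}. (\<lambda>x. x) (g s om)) \<in> borel_measurable (F t)"
      using t by (intro N.progressive_time_integral_measurable[OF pg]) auto
    from N.F_measurable_M[OF this t] have "(\<lambda>om. LBINT s:{0..t}. g s om) \<in> borel_measurable N" .
    thus ?thesis using Z[OF t] by simp
  qed
  have sm: "simple_ito_integral Z' (n k) (\<tau> k) (\<xi> k) \<in> borel_measurable N" if Z': "\<And>t. t \<in> {0..u} ==> Z' t \<in> borel_measurable N" for Z' k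
  proof -
    have "\<xi> k i \<in> borel_measurable N" "Z' (\<tau> k i) \<in> borel_measurable N" "Z' (\<tau> k (Suc i)) \<in> borel_measurable N" if "i < n k" for i
      using N.simple_integrand_measurable_M[OF \<xi> that] Z'[of "\<tau> k i"] Z'[of "\<tau> k (Suc i)"] simple_integrand_range[OF \<xi>, of i k] simple_integrand_range[OF \<xi>, of "Suc i" k] that by auto
    thus ?thesis unfolding simple_ito_integral_def[abs_def] by (intro borel_measurable_sum) auto
  qed
  have ID: "(\<lambda>om. I om + ?D om) \<in> borel_measurable N" using Im by simp
  have S': "tends_prob N (\<lambda>k. simple_ito_integral ?Z (n k) (\<tau> k) (\<xi> k)) (\<lambda>om. I om + ?D om)"
  proof (rule N.tends_prob_of_sum_bound[OF sm[OF Z] Im Dkm Dm sm[OF Zt] ID S Dt])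
    fix k
    show "AE om in N. \<bar>simple_ito_integral ?Z (n k) (\<tau> k) (\<xi> k) om - (I om + ?D om)\<bar> <= \<bar>simple_ito_integral Z (n k) (\<tau> k) (\<xi> k) om - I om\<bar> + \<bar>?Dk k om - ?D om\<bar>"
      using N.L2_process_sq_int[OF g u]
    proof eventually_elim
      case (elim om)
      have "simple_ito_integral ?Z (n k) (\<tau> k) (\<xi> k) om = simple_ito_integral (\<lambda>t om'. Z t om' + (LBINT s:{0..t}. g s om)) (n k) (\<tau> k) (\<xi> k) om"
        by (simp add: simple_ito_integral_def)
      also have "\<dots> = simple_ito_integral Z (n k) (\<tau> k) (\<xi> k) om + ?Dk k om" by (rule N.simple_ito_integral_drift[OF \<xi> elim])
      finally show ?case by simp
    qed
  qed
  show ?thesis unfolding N'.has_ito_integral_iff[OF a(2) u] mc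
    using ID \<xi> trans[OF d dm] trans[OF S' sm[OF Zt] ID] by (intro conjI exI[of _ n] exI[of _ \<tau>] exI[of _ \<xi>] allI) auto
qed

section \<open>Girsanov's theorem\<close>

lemma measure_density_real:
  assumes d: "integrable M d" "\<And>x. 0 <= d x" and A: "A \<in> sets M"
  shows "measure (density M (\<lambda>x. ennreal (d x))) A = (LINT x|M. d x * indicator A x)"
proof -
  have [measurable]: "d \<in> borel_measurable M" using d by auto
  have "emeasure (density M (\<lambda>x. ennreal (d x))) A = (\<integral>\<^sup>+x. ennreal (d x * indicator A x) \<partial>M)"
    using A by (subst emeasure_density) (auto intro!: nn_integral_cong simp: indicator_def)
  also have "\<dots> = ennreal (LINT x|M. d x * indicator A x)"
    by (rule nn_integral_eq_integral[OF integrable_real_mult_indicator[OF A d(1)]]) (auto simp: d)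
  finally show ?thesis by (simp add: measure_def integral_nonneg d)
qed

text \<open>
  Uniform absolute continuity of the integral: split the density at a high level \<open>n\<close>.
\<close>

lemma (in prob_space) density_measure_tendsto_0:
  assumes d: "integrable M d" "\<And>x. 0 <= d x" and A: "\<And>k::nat. A k \<in> sets M" and lim: "(\<lambda>k. measure M (A k)) \<longlonglongrightarrow> 0"
  shows "(\<lambda>k. measure (density M (\<lambda>x. ennreal (d x))) (A k)) \<longlonglongrightarrow> 0"
proof (rule LIMSEQ_I)
  fix e :: real assume e: "e > 0"
  have [measurable]: "d \<in> borel_measurable M" using d by auto
  have "(\<lambda>n::nat. LINT x|M. max (d x - real n) 0) \<longlonglongrightarrow> (LINT x|M. 0)"
  proof (rule integral_dominated_convergence[where w=d])
    show "AE x in M. (\<lambda>n. max (d x - real n) 0) \<longlonglongrightarrow> 0"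
    proof (rule AE_I2)
      fix x
      obtain N where "d x <= real N" using real_arch_simple by blast
      hence "\<forall>\<^sub>F n in sequentially. max (d x - real n) 0 = 0"
        unfolding eventually_sequentially by (intro exI[of _ N]) (auto simp: max_def)
      thus "(\<lambda>n. max (d x - real n) 0) \<longlonglongrightarrow> 0" by (rule tendsto_eventually)
    qed
    show "AE x in M. norm (max (d x - real n) 0) <= d x" for n using d(2) by auto
  qed (use d in auto)
  from order_tendstoD(2)[OF this, of "e / 2"] e obtain n where n: "(LINT x|M. max (d x - real n) 0) < e / 2"
    unfolding eventually_sequentially by auto
  have "e / (2 * (real n + 1)) > 0" using e by simp
  from order_tendstoD(2)[OF lim this] obtain k0 where k0: "\<And>k. k >= k0 ==> measure M (A k) < e / (2 * (real n + 1))"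
    unfolding eventually_sequentially by auto
  have im: "integrable M (\<lambda>x. max (d x - real n) 0)" using d by (intro Bochner_Integration.integrable_bound[OF d(1)]) auto
  have "norm (measure (density M (\<lambda>x. ennreal (d x))) (A k) - 0) < e" if k: "k >= k0" for k
  proof -
    have ii: "integrable M (\<lambda>x. real n * indicator (A k) x)"
      by (intro integrable_mult_right integrable_real_indicator A) (simp add: emeasure_eq_measure)
    have "measure (density M (\<lambda>x. ennreal (d x))) (A k) = (LINT x|M. d x * indicator (A k) x)"
      by (rule measure_density_real[OF d A])
    also have "\<dots> <= (LINT x|M. max (d x - real n) 0 + real n * indicator (A k) x)"
      by (rule integral_mono[OF integrable_real_mult_indicator[OF A d(1)] Bochner_Integration.integrable_add[OF im ii]])
        (auto simp: indicator_def)
    also have "\<dots> = (LINT x|M. max (d x - real n) 0) + real n * measure M (A k)"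
      using Bochner_Integration.integral_add[OF im ii] A by simp
    also have "\<dots> < e / 2 + e / 2"
    proof (rule add_less_le_mono[OF n])
      have "real n * measure M (A k) <= (real n + 1) * (e / (2 * (real n + 1)))"
        using k0[OF k] by (intro mult_mono) auto
      also have "\<dots> = e / 2" by (simp add: field_simps)
      finally show "real n * measure M (A k) <= e / 2" .
    qed
    finally show ?thesis by simp
  qed
  thus "\<exists>no. \<forall>k\<ge>no. norm (measure (density M (\<lambda>x. ennreal (d x))) (A k) - 0) < e" by blast
qed

lemma set_lebesgue_integral_singleton: "(LBINT s:{0..0::real}. (h s :: real)) = 0"
  unfolding set_lebesgue_integral_def
  by (rule integral_eq_zero_AE) (use AE_lborel_singleton[of "0::real"] in eventually_elim, auto simp: indicator_def)

lemma (in filtered_space) filtered_space_restrict: "u <= T ==> filtered_space M F u"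
  by unfold_locales (use sub F_mono in auto)

lemma L2_process_restrict:
  assumes "L2_process M F T h" "u <= T" shows "L2_process M F u h"
  using assms unfolding L2_process_def progressively_measurable_def
  by (auto elim!: eventually_mono intro: set_integrable_subset)

lemma indicator_pairing:
  assumes h: "sq_int T h" and st: "0 <= s" "s < t" "t <= T"
  shows "(LBINT u:{0..T}. (c * indicator {s<..t} u) * h u) = c * ((LBINT u:{0..t}. h u) - (LBINT u:{0..s}. h u))"
proof -
  note hi = sq_int_integrable[OF h]
  have e: "{0..t} = {0..s} \<union> {s<..t}" using st by auto
  have "(LBINT u:{0..t}. h u) = (LBINT u:{0..s}. h u) + (LBINT u:{s<..t}. h u)"
    unfolding e using st by (intro set_integral_Un set_integrable_subset[OF hi]) auto
  moreover have "(LBINT u:{0..T}. (c * indicator {s<..t} u) * h u) = c * (LBINT u:{s<..t}. h u)"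
  proof -
    have "(LBINT u:{0..T}. (c * indicator {s<..t} u) * h u) = (LBINT u:{0..T}. c * (indicator {s<..t} u * h u))" by (simp only: mult.assoc)
    also have "\<dots> = c * (LBINT u:{0..T}. indicator {s<..t} u * h u)" by (rule set_integral_mult_right)
    also have "(LBINT u:{0..T}. indicator {s<..t} u * h u) = (LBINT u:{s<..t}. h u)"
      unfolding set_lebesgue_integral_def using st by (intro Bochner_Integration.integral_cong) (auto simp: indicator_def)
    finally show ?thesis .
  qed
  ultimately show ?thesis by simp
qed

lemma sq_norm_indicator:
  assumes st: "0 <= s" "s < t" "t <= T"
  shows "sq_norm T (\<lambda>u. c * indicator {s<..t} u) = c\<^sup>2 * (t - s)"
proof -
  have "sq_norm T (\<lambda>u. c * indicator {s<..t} u) = (LINT u|lborel. c\<^sup>2 * indicator {s<..t} u)"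
    unfolding sq_norm_def set_lebesgue_integral_def using st by (intro Bochner_Integration.integral_cong) (auto simp: indicator_def)
  also have "\<dots> = c\<^sup>2 * (t - s)" using st by simp
  finally show ?thesis .
qed

context girsanov
begin

definition Q :: "'a measure" where "Q = density M (\<lambda>om. ennreal (dens om))"

lemma dens_pos: "dens om > 0" by (simp add: dens_def)
lemma dens_nonneg: "dens om >= 0" by (simp add: dens_def)
lemma dens_measurable [measurable]: "dens \<in> borel_measurable M" using dens_integral(1) by auto

lemma sets_Q [simp, measurable_cong]: "sets Q = sets M" and space_Q [simp]: "space Q = space M"
  by (simp_all add: Q_def)

lemma borel_Q: "borel_measurable Q = borel_measurable M" by (rule measurable_cong_sets) simp_all

lemma AE_Q: "(AE om in Q. P om) \<longleftrightarrow> (AE om in M. P om)"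
  unfolding Q_def by (subst AE_density) (auto simp: dens_pos)

lemma measure_Q: "A \<in> sets M ==> measure Q A = (LINT om|M. dens om * indicator A om)"
  unfolding Q_def by (rule measure_density_real[OF dens_integral(1) dens_nonneg])

lemma prob_space_Q: "prob_space Q"
proof
  have "emeasure Q (space Q) = (\<integral>\<^sup>+om. ennreal (dens om) \<partial>M)"
    unfolding Q_def by (subst emeasure_density) (auto intro!: nn_integral_cong)
  also have "\<dots> = 1" using nn_integral_eq_integral[OF dens_integral(1)] dens_integral(2) by (simp add: dens_nonneg)
  finally show "emeasure Q (space Q) = 1" .
qed

lemma M_eq: "density Q (\<lambda>om. ennreal (1 / dens om)) = M"
proof -
  have "density Q (\<lambda>om. ennreal (1 / dens om)) = density M (\<lambda>om. ennreal (dens om) * ennreal (1 / dens om))"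
    unfolding Q_def by (rule density_density_eq) measurable
  also have "(\<lambda>om. ennreal (dens om) * ennreal (1 / dens om)) = (\<lambda>_. 1)"
    using dens_pos by (auto simp: ennreal_mult'[symmetric] dens_nonneg less_imp_neq[THEN not_sym])
  finally show ?thesis by (simp add: density_1)
qed

lemma integrable_inverse_dens: "integrable Q (\<lambda>om. 1 / dens om)"
proof -
  have "integrable M (\<lambda>om. dens om *\<^sub>R (1 / dens om))" using dens_pos by (simp add: less_imp_neq[THEN not_sym])
  thus ?thesis unfolding Q_def by (subst integrable_density) (auto simp: dens_nonneg)
qed

lemma tendsto_0_Q: "(\<And>k::nat. A k \<in> sets M) ==> (\<lambda>k. measure M (A k)) \<longlonglongrightarrow> 0 ==> (\<lambda>k. measure Q (A k)) \<longlonglongrightarrow> 0"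
  unfolding Q_def by (rule density_measure_tendsto_0[OF dens_integral(1) dens_nonneg])

lemma tendsto_0_M:
  assumes "\<And>k::nat. A k \<in> sets Q" "(\<lambda>k. measure Q (A k)) \<longlonglongrightarrow> 0" shows "(\<lambda>k. measure M (A k)) \<longlonglongrightarrow> 0"
proof -
  interpret Q: prob_space Q by (rule prob_space_Q)
  have "0 <= 1 / dens om" for om by (simp add: dens_nonneg)
  from Q.density_measure_tendsto_0[OF integrable_inverse_dens this assms] show ?thesis unfolding M_eq .
qed

lemma filtered_space_Q: "u <= T ==> filtered_space Q F u"
  using sub F_mono by (intro filtered_space.intro[OF prob_space_Q] filtered_space_axioms.intro) (auto simp: subalgebra_def)

lemma L2_process_Q: "L2_process Q F u a \<longleftrightarrow> L2_process M F u a"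
  by (simp add: L2_process_def AE_Q)

lemma drift_shift_measurable:
  assumes Z: "\<And>t. t \<in> {0..T} ==> Z t \<in> borel_measurable M" and h: "L2_process M F T h" and t: "t \<in> {0..T}"
  shows "drift_shift Z h t \<in> borel_measurable M"
proof -
  have "(\<lambda>om. LBINT s:{0..t}. (\<lambda>x. x) (h s om)) \<in> borel_measurable (F t)"
    using t h by (intro progressive_time_integral_measurable) (auto simp: L2_process_def)
  from F_measurable_M[OF this t] have "(\<lambda>om. LBINT s:{0..t}. h s om) \<in> borel_measurable M" .
  thus ?thesis using Z[OF t] unfolding drift_shift_def[abs_def] by simp
qed

text \<open>
  The choice of a version in \<open>ito_integral\<close> under \<open>Q\<close> is compared with the one under \<open>M\<close> by changing the
  measure forth (for existence) and back (with the drift \<open>- h\<close>), and using uniqueness under \<open>M\<close>.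
\<close>

lemma ito_integral_shift:
  assumes bm: "bm_pair M F u Z Z'" and h: "L2_process M F T h" and a: "L2_process M F u a" and u: "0 <= u" "u <= T"
    and Zm: "\<And>t. t \<in> {0..T} ==> Z t \<in> borel_measurable M"
  shows "AE om in M. ito_integral Q F (drift_shift Z h) u a om = ito_integral M F Z u a om + (LBINT s:{0..u}. a s om * h s om)"
    and "ito_integral Q F (drift_shift Z h) u a \<in> borel_measurable M"
proof -
  interpret u: bm_pair M F u Z Z' by (rule bm)
  note hu = L2_process_restrict[OF h u(2)] and aQ = a[unfolded L2_process_Q[symmetric]]
  have nh: "L2_process M F u (\<lambda>t om. - h t om)" using u.L2_process_linear[OF hu hu u(1), of "-1" 0] by simp
  note nhQ = nh[unfolded L2_process_Q[symmetric]]
  have Dm: "drift_shift Z h t \<in> borel_measurable Q" if "t \<in> {0..u}" for t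
    unfolding borel_Q using that u by (intro drift_shift_measurable[OF Zm h]) auto
  have Zm': "Z t \<in> borel_measurable M" if "t \<in> {0..u}" for t using that u Zm by auto
  note I = u.has_ito_integral_ito_integral[OF a u(1)]
  have shift: "drift_shift Z h = (\<lambda>t om. Z t om + (LBINT s:{0..t}. h s om))" by (simp add: drift_shift_def fun_eq_iff)
  have "has_ito_integral Q F (drift_shift Z h) u a (\<lambda>om. ito_integral M F Z u a om + (LBINT s:{0..u}. a s om * h s om))"
    unfolding shift by (rule has_ito_integral_change[OF u.filtered_space_axioms filtered_space_Q[OF u(2)] sets_Q tendsto_0_Q a aQ hu u(1) Zm' I])
  from exI[of "has_ito_integral Q F (drift_shift Z h) u a", OF this]
  have ex: "\<exists>I. has_ito_integral Q F (drift_shift Z h) u a I" .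
  have IQ: "has_ito_integral Q F (drift_shift Z h) u a (ito_integral Q F (drift_shift Z h) u a)"
    using someI_ex[OF ex] by (simp only: ito_integral_def)
  have "has_ito_integral M F (\<lambda>t om. drift_shift Z h t om + (LBINT s:{0..t}. - h s om)) u a
      (\<lambda>om. ito_integral Q F (drift_shift Z h) u a om + (LBINT s:{0..u}. a s om * - h s om))"
    by (rule has_ito_integral_change[OF filtered_space_Q[OF u(2)] u.filtered_space_axioms sets_Q[symmetric] tendsto_0_M aQ a nhQ u(1) Dm IQ])
  moreover have "(\<lambda>t om. drift_shift Z h t om + (LBINT s:{0..t}. - h s om)) = Z"
    by (simp add: drift_shift_def set_lebesgue_integral_def fun_eq_iff)
  moreover have "(LBINT s:{0..u}. a s om * - h s om) = - (LBINT s:{0..u}. a s om * h s om)" for om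
    by (simp add: set_lebesgue_integral_def)
  ultimately have "has_ito_integral M F Z u a (\<lambda>om. ito_integral Q F (drift_shift Z h) u a om - (LBINT s:{0..u}. a s om * h s om))" by simp
  from u.has_ito_integral_unique[OF a u(1) I this]
  show "AE om in M. ito_integral Q F (drift_shift Z h) u a om = ito_integral M F Z u a om + (LBINT s:{0..u}. a s om * h s om)" by eventually_elim simp
  show "ito_integral Q F (drift_shift Z h) u a \<in> borel_measurable M" using IQ unfolding has_ito_integral_def borel_Q by blast
qed

lemma increment_phase:
  assumes st: "0 <= s" "s < t" "t <= T"
  shows "AE om in M. phase (\<lambda>u. c * indicator {s<..t} u) (\<lambda>u. d * indicator {s<..t} u) om =
    c * (drift_shift W f t om - drift_shift W f s om) + d * (drift_shift B g t om - drift_shift B g s om)"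
proof -
  note L = deterministic_L2_process[of "indicator {s<..t}", OF _ sq_int_indicator, simplified]
  have lin: "AE om in M. IW (\<lambda>u _. c * indicator {s<..t} u) om = c * IW (\<lambda>u _. indicator {s<..t} u) om"
    "AE om in M. IB (\<lambda>u _. d * indicator {s<..t} u) om = d * IB (\<lambda>u _. indicator {s<..t} u) om"
    using ito_integral_linear[OF L L T, of c 0] swap.ito_integral_linear[OF L L T, of d 0] by auto
  show ?thesis
    using lin ito_integral_indicator[OF st] swap.ito_integral_indicator[OF st] sq_int_fg
  proof eventually_elim
    case (elim om)
    show ?case unfolding phase_def drift_shift_def elim(1-4) indicator_pairing[OF elim(5) st] indicator_pairing[OF elim(6) st]
      by (simp add: algebra_simps)
  qed
qed

text \<open>
  The master identity with multiples of the indicator of \<open>(s, t]\<close> computes the characteristic function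
  of the increment on each event of \<open>F s\<close>.
\<close>

lemma increment_law:
  assumes ab: "\<alpha>\<^sup>2 + \<beta>\<^sup>2 = 1" and st: "0 <= s" "s < t" "t <= T" and A: "A \<in> sets (F s)"
    and D: "D \<in> borel_measurable M" "AE om in M. D om = \<alpha> * (drift_shift W f t om - drift_shift W f s om) + \<beta> * (drift_shift B g t om - drift_shift B g s om)"
    and C: "C \<in> sets borel"
  shows "measure Q (A \<inter> {om \<in> space M. D om / sqrt (t - s) \<in> C}) = measure Q A * measure std_normal_distribution C"
proof -
  note [measurable] = D(1) C
  have AM [measurable]: "A \<in> sets M" using A F_sets[of s] st by auto
  define \<sigma> where "\<sigma> = sqrt (t - s)"
  have \<sigma>: "\<sigma> > 0" "\<sigma>\<^sup>2 = t - s" using st by (auto simp: \<sigma>_def)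
  define Y where "Y om = dens om * indicator A om" for om
  have Yi: "integrable M Y" unfolding Y_def by (rule integrable_real_mult_indicator[OF AM dens_integral(1)])
  have [measurable]: "Y \<in> borel_measurable M" using Yi by auto
  have weight: "indicator A om * complex_of_real (dens om) = complex_of_real (dens om * indicator A om)" for om
    by (simp add: indicator_def)
  have ch: "(CLINT x|M. Y x * iexp (\<theta> * (D x / \<sigma>))) = complex_of_real (measure Q A * exp (-(\<theta>\<^sup>2)/2))" for \<theta>
  proof -
    define k where "k = \<theta> / \<sigma>"
    have k2: "k\<^sup>2 * (t - s) = \<theta>\<^sup>2" unfolding \<sigma>(2)[symmetric] k_def using \<sigma>(1) by (simp add: power_divide)
    let ?a = "\<lambda>u. k * \<alpha> * indicator {s<..t} u" and ?b = "\<lambda>u. k * \<beta> * indicator {s<..t} u"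
    have m: "?a \<in> borel_measurable borel" "sq_int T ?a" "?b \<in> borel_measurable borel" "sq_int T ?b"
      by (measurable, rule sq_int_cmult[OF sq_int_indicator], measurable, rule sq_int_cmult[OF sq_int_indicator])
    have z: "?a u = 0" "?b u = 0" if "u < s" for u using that by auto
    have sT: "s <= T" using st by simp
    note mi = master_identity[OF m st(1) sT A z]
    have n: "sq_norm T ?a + sq_norm T ?b = \<theta>\<^sup>2"
    proof -
      have "sq_norm T ?a + sq_norm T ?b = (\<alpha>\<^sup>2 + \<beta>\<^sup>2) * (k\<^sup>2 * (t - s))"
        unfolding sq_norm_indicator[OF st] by (simp add: power_mult_distrib algebra_simps)
      thus ?thesis unfolding ab k2 by simp
    qed
    have [measurable]: "phase ?a ?b \<in> borel_measurable M" by (rule mi(2))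
    have char: "(CLINT om|M. indicator A om * (complex_of_real (dens om) * iexp (phase ?a ?b om))) =
      (CLINT om|M. indicator A om * complex_of_real (dens om)) * complex_of_real (exp (- (sq_norm T ?a + sq_norm T ?b) / 2))" by (rule mi(1))
    have "(CLINT x|M. Y x * iexp (\<theta> * (D x / \<sigma>))) = (CLINT om|M. indicator A om * (complex_of_real (dens om) * iexp (phase ?a ?b om)))"
    proof (rule integral_cong_AE)
      show "AE x in M. Y x * iexp (\<theta> * (D x / \<sigma>)) = indicator A x * (complex_of_real (dens x) * iexp (phase ?a ?b x))"
        using D(2) increment_phase[OF st, of "k * \<alpha>" "k * \<beta>"]
      proof eventually_elim
        case (elim x)
        have "\<theta> * (D x / \<sigma>) = k * D x" by (simp add: k_def)
        also have "\<dots> = phase ?a ?b x" unfolding elim(2) unfolding elim(1) by (simp add: algebra_simps)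
        finally have "\<theta> * (D x / \<sigma>) = phase ?a ?b x" .
        thus ?case by (simp add: Y_def indicator_def)
      qed
    qed measurable
    also have "\<dots> = (CLINT om|M. complex_of_real (dens om * indicator A om)) * complex_of_real (exp (- \<theta>\<^sup>2 / 2))"
      unfolding char n weight ..
    also have "\<dots> = complex_of_real (measure Q A * exp (-(\<theta>\<^sup>2)/2))" unfolding measure_Q[OF AM] integral_complex_of_real of_real_mult[symmetric] ..
    finally show ?thesis .
  qed
  have "measure Q (A \<inter> {om \<in> space M. D om / \<sigma> \<in> C}) = (LINT om|M. Y om * indicator C (D om / \<sigma>))"
    by (subst measure_Q) (auto intro!: Bochner_Integration.integral_cong simp: Y_def indicator_def)
  also have "\<dots> = measure Q A * measure std_normal_distribution C"
    by (rule weighted_char_determines_law[OF Yi _ _ ch C]) (auto simp: Y_def dens_nonneg)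
  finally show ?thesis by (simp add: \<sigma>_def)
qed

text \<open>
  Normality (\<open>A\<close> the whole space) and independence from \<open>F s\<close> are both contained in the increment law.
\<close>

lemma brownian_motion_Q:
  assumes ab: "\<alpha>\<^sup>2 + \<beta>\<^sup>2 = 1" and Z: "adapted F T Z" "continuous_paths M T Z"
    and eq: "AE om in M. \<forall>t\<in>{0..T}. Z t om = \<alpha> * drift_shift W f t om + \<beta> * drift_shift B g t om"
  shows "brownian_motion Q F T Z"
  unfolding brownian_motion_def
proof (intro conjI allI impI)
  interpret Q: prob_space Q by (rule prob_space_Q)
  show "adapted F T Z" by (rule Z)
  show "continuous_paths Q T Z" using Z(2) by (simp add: continuous_paths_def AE_Q)
  have "AE om in M. W 0 om = 0" "AE om in M. B 0 om = 0" using bW bB by (auto simp: brownian_motion_def)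
  with eq have "AE om in M. Z 0 om = 0"
    by eventually_elim (use T in \<open>simp add: drift_shift_def set_lebesgue_integral_singleton del: atLeastAtMost_singleton\<close>)
  thus "AE om in Q. Z 0 om = 0" by (simp add: AE_Q)
  fix s t assume "0 <= s \<and> s < t \<and> t <= T"
  hence st: "0 <= s" "s < t" "t <= T" by auto
  let ?D = "\<lambda>om. Z t om - Z s om"
  have D [measurable]: "?D \<in> borel_measurable M"
    using Z(1) F_measurable_M[of "Z t" t] F_measurable_M[of "Z s" s] st by (intro borel_measurable_diff) (auto simp: adapted_def)
  have De: "AE om in M. ?D om = \<alpha> * (drift_shift W f t om - drift_shift W f s om) + \<beta> * (drift_shift B g t om - drift_shift B g s om)"
    using eq by eventually_elim (use st in \<open>simp add: algebra_simps\<close>)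
  note law = increment_law[OF ab st _ D De]
  have \<sigma>: "sqrt (t - s) > 0" using st by simp
  have FM: "space M \<in> sets (F s)" using F_space[of s] sets.top[of "F s"] st by simp
  have Qs: "measure Q (space M) = 1" using Q.prob_space by simp
  have std: "measure Q {om \<in> space M. ?D om / sqrt (t - s) \<in> C} = measure std_normal_distribution C" if C: "C \<in> sets borel" for C
  proof -
    have "space M \<inter> {om \<in> space M. ?D om / sqrt (t - s) \<in> C} = {om \<in> space M. ?D om / sqrt (t - s) \<in> C}" by auto
    with law[OF FM C] show ?thesis by (simp add: Qs)
  qed
  have "distributed Q lborel (\<lambda>om. ?D om / sqrt (t - s)) std_normal_density"
    unfolding distributed_def
  proof (intro conjI measure_eqI)
    interpret N: prob_space std_normal_distribution using real_dist_normal_dist unfolding real_distribution_def by auto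
    fix C assume "C \<in> sets (distr Q lborel (\<lambda>om. ?D om / sqrt (t - s)))"
    hence C: "C \<in> sets borel" by simp
    have "emeasure (distr Q lborel (\<lambda>om. ?D om / sqrt (t - s))) C = emeasure Q {om \<in> space M. ?D om / sqrt (t - s) \<in> C}"
      using C by (subst emeasure_distr) (auto intro!: arg_cong[where f="emeasure Q"] simp: borel_Q)
    thus "emeasure (distr Q lborel (\<lambda>om. ?D om / sqrt (t - s))) C = emeasure std_normal_distribution C"
      by (simp add: Q.emeasure_eq_measure N.emeasure_eq_measure std[OF C])
  qed (auto simp: borel_Q)
  thus "distributed Q lborel ?D (normal_density 0 (sqrt (t - s)))"
    using Q.normal_standard_normal_convert[OF \<sigma>, of ?D 0] by simp
  show "Q.indep_set (sets (F s)) (sets (vimage_algebra (space Q) ?D borel))"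
    unfolding Q.indep_sets2_eq
  proof (intro conjI ballI)
    have sv: "sets (vimage_algebra (space Q) ?D borel) = {?D -` C \<inter> space M | C. C \<in> sets borel}"
      by (subst sets_vimage_algebra2) auto
    show "sets (F s) \<subseteq> sets Q" using F_sets[of s] st by auto
    show "sets (vimage_algebra (space Q) ?D borel) \<subseteq> sets Q" unfolding sv by (auto intro: measurable_sets[OF D])
    fix a b assume a: "a \<in> sets (F s)" and b: "b \<in> sets (vimage_algebra (space Q) ?D borel)"
    then obtain C where C: "C \<in> sets borel" "b = ?D -` C \<inter> space M" unfolding sv by auto
    have bo: "(\<lambda>x. sqrt (t - s) * x) \<in> borel_measurable borel" by measurable
    have C': "(\<lambda>x. sqrt (t - s) * x) -` C \<in> sets borel" using measurable_sets[OF bo C(1)] by simp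
    have b': "b = {om \<in> space M. ?D om / sqrt (t - s) \<in> (\<lambda>x. sqrt (t - s) * x) -` C}" using \<sigma> C(2) by auto
    show "measure Q (a \<inter> b) = measure Q a * measure Q b"
      unfolding b' law[OF a C'] std[OF C'] ..
  qed
qed

lemma continuous_drift_shift:
  assumes "continuous_paths M T Z" "L2_process M F T h"
  shows "continuous_paths M T (drift_shift Z h)"
  unfolding continuous_paths_def
  using assms(1)[unfolded continuous_paths_def] L2_process_sq_int[OF assms(2) T0]
proof eventually_elim
  case (elim om)
  note hi = sq_int_integrable[OF elim(2)]
  have c: "continuous_on {0..T} (\<lambda>t. integral {0..t} (\<lambda>s. h s om))"
    by (rule indefinite_integral_continuous_1) (rule set_borel_integral_eq_integral(1)[OF hi])
  have e: "(LBINT s:{0..t}. h s om) = integral {0..t} (\<lambda>s. h s om)" if "t \<in> {0..T}" for t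
    using that by (intro set_borel_integral_eq_integral(2) set_integrable_subset[OF hi]) auto
  have "continuous_on {0..T} (\<lambda>t. LBINT s:{0..t}. h s om)" by (rule continuous_on_eq[OF c]) (rule e[symmetric])
  thus ?case unfolding drift_shift_def by (intro continuous_on_add elim(1))
qed

lemma adapted_drift_shift:
  assumes "adapted F T Z" "L2_process M F T h" shows "adapted F T (drift_shift Z h)"
  unfolding adapted_def
proof
  fix t assume t: "t \<in> {0..T}"
  have "(\<lambda>om. LBINT s:{0..t}. (\<lambda>x. x) (h s om)) \<in> borel_measurable (F t)"
    using t assms by (intro progressive_time_integral_measurable) (auto simp: L2_process_def)
  moreover have "Z t \<in> borel_measurable (F t)" using assms(1) t by (simp add: adapted_def)
  ultimately show "drift_shift Z h t \<in> borel_measurable (F t)"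
    unfolding drift_shift_def[abs_def] by (intro borel_measurable_add)
qed

lemma brownian_motion_shifted_B: "brownian_motion Q F T (drift_shift B g)"
proof (rule brownian_motion_Q[of 0 1])
  show "adapted F T (drift_shift B g)" using bB gL2 by (intro adapted_drift_shift) (auto simp: brownian_motion_def)
  show "continuous_paths M T (drift_shift B g)" using bB gL2 by (intro continuous_drift_shift) (auto simp: brownian_motion_def)
qed auto

text \<open>
  The kernel \<open>k\<close> is that of the fractional Brownian motion at the terminal time. The two coordinates are
  first decorrelated, by subtracting \<open>\<rho> * \<kappa>\<close> times the first from the second; the resulting
  pair has the characteristic function of independent standard normal variables.
\<close>

lemma terminal_law:
  assumes k: "k \<in> borel_measurable borel" "sq_int T k" "\<And>t. t < 0 ==> k t = 0"
      "sq_norm T k = v\<^sup>2" "(LBINT t:{0..T}. k t) = \<kappa> * (v * sqrt T)"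
    and v: "0 < v" and \<rho>: "\<bar>\<rho>\<bar> <= 1" and r: "\<bar>\<rho> * \<kappa>\<bar> < 1" and w: "w = sqrt (1 - (\<rho> * \<kappa>)\<^sup>2)"
    and U: "U1 \<in> borel_measurable M" "U2 \<in> borel_measurable M"
    and U1: "AE om in M. U1 om = \<rho> * drift_shift B g T om + sqrt (1 - \<rho>\<^sup>2) * drift_shift W f T om"
    and U2: "AE om in M. U2 om = IB (\<lambda>t _. k t) om + (LBINT t:{0..T}. k t * g t om)"
  shows "distr Q (borel \<Otimes>\<^sub>M borel) (\<lambda>om. (U1 om / sqrt T, (U2 om / v - \<rho> * \<kappa> * (U1 om / sqrt T)) / w))
    = std_normal_distribution \<Otimes>\<^sub>M std_normal_distribution"
  unfolding Q_def
proof (rule joint_char_determines_law[OF dens_integral(1) dens_nonneg])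
  note [measurable] = U
  show "(\<lambda>om. U1 om / sqrt T) \<in> borel_measurable M" "(\<lambda>om. (U2 om / v - \<rho> * \<kappa> * (U1 om / sqrt T)) / w) \<in> borel_measurable M" by measurable
  fix p q :: real
  define R where "R = \<rho> * \<kappa>"
  have "R\<^sup>2 < 1" using r unfolding R_def by (simp add: abs_square_less_1)
  hence w0: "w > 0" and w2: "w\<^sup>2 = 1 - R\<^sup>2" by (auto simp: w R_def)
  define s where "s = sqrt T"
  have s: "s > 0" "s\<^sup>2 = T" using T by (auto simp: s_def)
  define \<eta> where "\<eta> = q / (w * v)"
  define \<theta> where "\<theta> = p / s - q * R / (w * s)"
  let ?J = "\<lambda>u::real. indicator {0<..T} u :: real"
  let ?a = "\<lambda>u. \<theta> * sqrt (1 - \<rho>\<^sup>2) * ?J u" and ?b = "\<lambda>u. \<theta> * \<rho> * ?J u + \<eta> * k u"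
  note J = sq_int_indicator[of 0 T]
  have m: "?a \<in> borel_measurable borel" "sq_int T ?a" "?b \<in> borel_measurable borel" "sq_int T ?b"
    using k(1) by (measurable, intro sq_int_cmult J, measurable, intro sq_int_add sq_int_cmult J k(2))
  have z: "?a u = 0" "?b u = 0" if "u < 0" for u using that k(3)[OF that] by auto
  have FM: "space M \<in> sets (F 0)" using F_space[of 0] sets.top[of "F 0"] T by simp
  note mi = master_identity[OF m order_refl T0 FM z]
  have t0: "(0::real) <= 0" "0 < T" "T <= T" using T by auto
  have \<rho>1: "(sqrt (1 - \<rho>\<^sup>2))\<^sup>2 = 1 - \<rho>\<^sup>2" using \<rho> by (simp add: abs_square_le_1)
  have nb: "sq_norm T ?b = (\<theta> * \<rho>)\<^sup>2 * T + 2 * (\<theta> * \<rho>) * \<eta> * (\<kappa> * (v * s)) + \<eta>\<^sup>2 * v\<^sup>2"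
  proof -
    have i: "set_integrable lborel {0..T} (\<lambda>u. (\<theta> * \<rho> * ?J u)\<^sup>2)" "set_integrable lborel {0..T} (\<lambda>u. 2 * (\<theta> * \<rho>) * \<eta> * (?J u * k u))" "set_integrable lborel {0..T} (\<lambda>u. \<eta>\<^sup>2 * (k u)\<^sup>2)"
    proof -
      show "set_integrable lborel {0..T} (\<lambda>u. (\<theta> * \<rho> * ?J u)\<^sup>2)" using sq_int_cmult[OF J] by (simp add: sq_int_def)
      show "set_integrable lborel {0..T} (\<lambda>u. 2 * (\<theta> * \<rho>) * \<eta> * (?J u * k u))" by (rule set_integrable_mult_right) (rule sq_int_mult[OF J k(2)])
      show "set_integrable lborel {0..T} (\<lambda>u. \<eta>\<^sup>2 * (k u)\<^sup>2)" using k(2) by (intro set_integrable_mult_right) (simp add: sq_int_def)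
    qed
    have "sq_norm T ?b = (LBINT u:{0..T}. (\<theta> * \<rho> * ?J u)\<^sup>2 + (2 * (\<theta> * \<rho>) * \<eta> * (?J u * k u) + \<eta>\<^sup>2 * (k u)\<^sup>2))"
      unfolding sq_norm_def by (rule set_lebesgue_integral_cong) (auto simp: power2_eq_square algebra_simps)
    also have "\<dots> = sq_norm T (\<lambda>u. \<theta> * \<rho> * ?J u) + ((LBINT u:{0..T}. 2 * (\<theta> * \<rho>) * \<eta> * (?J u * k u)) + (LBINT u:{0..T}. \<eta>\<^sup>2 * (k u)\<^sup>2))"
      unfolding set_integral_add(2)[OF i(1) set_integral_add(1)[OF i(2,3)]] set_integral_add(2)[OF i(2,3)] sq_norm_def ..
    also have "(LBINT u:{0..T}. \<eta>\<^sup>2 * (k u)\<^sup>2) = \<eta>\<^sup>2 * v\<^sup>2" unfolding k(4)[symmetric] sq_norm_def by (rule set_integral_mult_right)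
    also have "(LBINT u:{0..T}. 2 * (\<theta> * \<rho>) * \<eta> * (?J u * k u)) = 2 * (\<theta> * \<rho>) * \<eta> * (LBINT u:{0..T}. ?J u * k u)" by (rule set_integral_mult_right)
    also have "(LBINT u:{0..T}. ?J u * k u) = \<kappa> * (v * s)"
      using indicator_pairing[OF k(2) t0, of 1] k(5) set_lebesgue_integral_singleton[of k] by (simp add: s_def del: atLeastAtMost_singleton)
    finally show ?thesis unfolding sq_norm_indicator[OF t0] by simp
  qed
  have n: "sq_norm T ?a + sq_norm T ?b = p\<^sup>2 + q\<^sup>2"
  proof -
    define x where "x = q / w"
    have ts: "\<theta> * s = p - R * x" using s(1) w0 by (simp add: \<theta>_def x_def field_simps)
    have ev: "\<eta> * v = x" using v by (simp add: \<eta>_def x_def)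
    have "sq_norm T ?a + sq_norm T ?b = \<theta>\<^sup>2 * (1 - \<rho>\<^sup>2) * s\<^sup>2 + ((\<theta> * \<rho>)\<^sup>2 * s\<^sup>2 + 2 * (\<theta> * \<rho>) * \<eta> * (\<kappa> * (v * s)) + \<eta>\<^sup>2 * v\<^sup>2)"
      unfolding nb sq_norm_indicator[OF t0] by (simp add: power_mult_distrib \<rho>1 s(2))
    also have "\<dots> = (\<theta> * s)\<^sup>2 + 2 * (\<theta> * s) * (\<eta> * v) * R + (\<eta> * v)\<^sup>2"
      by (simp add: R_def power2_eq_square algebra_simps)
    also have "\<dots> = p\<^sup>2 + (1 - R\<^sup>2) * x\<^sup>2" unfolding ts ev by (simp add: power2_eq_square algebra_simps)
    also have "\<dots> = p\<^sup>2 + q\<^sup>2" unfolding w2[symmetric] x_def using w0 by (simp add: power_divide)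
    finally show ?thesis .
  qed
  have [measurable]: "phase ?a ?b \<in> borel_measurable M" by (rule mi(2))
  have char: "(CLINT om|M. indicator (space M) om * (complex_of_real (dens om) * iexp (phase ?a ?b om))) =
    (CLINT om|M. indicator (space M) om * complex_of_real (dens om)) * complex_of_real (exp (- (sq_norm T ?a + sq_norm T ?b) / 2))" by (rule mi(1))
  have linb: "AE om in M. IB (\<lambda>u _. ?b u) om = \<theta> * \<rho> * IB (\<lambda>u _. ?J u) om + \<eta> * IB (\<lambda>u _. k u) om"
    using swap.ito_integral_linear[OF deterministic_L2_process[of ?J, OF _ J] deterministic_L2_process[OF k(1,2)] T, of "\<theta> * \<rho>" \<eta>] by simp
  have lina: "AE om in M. phase ?a (\<lambda>u. \<theta> * \<rho> * ?J u) om =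
    \<theta> * sqrt (1 - \<rho>\<^sup>2) * (drift_shift W f T om - drift_shift W f 0 om) + \<theta> * \<rho> * (drift_shift B g T om - drift_shift B g 0 om)"
    by (rule increment_phase[OF t0])
  have linJ: "AE om in M. IB (\<lambda>u _. \<theta> * \<rho> * ?J u) om = \<theta> * \<rho> * IB (\<lambda>u _. ?J u) om"
    using swap.ito_integral_linear[OF deterministic_L2_process[of ?J, OF _ J] deterministic_L2_process[OF k(1,2)] T, of "\<theta> * \<rho>" 0] by simp
  have z0: "AE om in M. W 0 om = 0" "AE om in M. B 0 om = 0" using bW bB by (auto simp: brownian_motion_def)
  have ph: "AE om in M. phase ?a ?b om = \<theta> * U1 om + \<eta> * U2 om"
    using linb lina linJ z0 U1 U2 sq_int_fg(2)
  proof eventually_elim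
    case (elim om)
    have z: "drift_shift W f 0 om = 0" "drift_shift B g 0 om = 0"
      unfolding drift_shift_def set_lebesgue_integral_singleton elim by simp_all
    have i: "set_integrable lborel {0..T} (\<lambda>u. \<theta> * \<rho> * ?J u * g u om)" "set_integrable lborel {0..T} (\<lambda>u. \<eta> * (k u * g u om))"
      by (rule sq_int_mult[OF sq_int_cmult[OF J] elim(8)], rule set_integrable_mult_right, rule sq_int_mult[OF k(2) elim(8)])
    have "(LBINT u:{0..T}. ?b u * g u om) = (LBINT u:{0..T}. \<theta> * \<rho> * ?J u * g u om + \<eta> * (k u * g u om))"
      by (simp add: algebra_simps)
    also have "\<dots> = (LBINT u:{0..T}. \<theta> * \<rho> * ?J u * g u om) + \<eta> * (LBINT u:{0..T}. k u * g u om)"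
      unfolding set_integral_add(2)[OF i] by (simp only: set_integral_mult_right)
    finally have "phase ?a ?b om = phase ?a (\<lambda>u. \<theta> * \<rho> * ?J u) om + \<eta> * (IB (\<lambda>u _. k u) om + (LBINT u:{0..T}. k u * g u om))"
      unfolding phase_def elim(1) elim(3) by (simp add: algebra_simps)
    also have "\<dots> = \<theta> * U1 om + \<eta> * U2 om" unfolding elim(2) z unfolding elim(6,7) by (simp add: algebra_simps)
    finally show ?case .
  qed
  have "(CLINT x|M. dens x * iexp (p * (U1 x / sqrt T) + q * ((U2 x / v - \<rho> * \<kappa> * (U1 x / sqrt T)) / w)))
    = (CLINT x|M. indicator (space M) x * (complex_of_real (dens x) * iexp (phase ?a ?b x)))"
  proof (rule integral_cong_AE)
    show "AE x in M. dens x * iexp (p * (U1 x / sqrt T) + q * ((U2 x / v - \<rho> * \<kappa> * (U1 x / sqrt T)) / w))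
      = indicator (space M) x * (complex_of_real (dens x) * iexp (phase ?a ?b x))"
      using ph AE_space
    proof eventually_elim
      case (elim x)
      have "p * (U1 x / s) + q * ((U2 x / v - R * (U1 x / s)) / w) = phase ?a ?b x"
        unfolding elim(1) unfolding \<theta>_def \<eta>_def using w0 v s(1) by (simp add: field_simps)
      thus ?case using elim(2) by (simp add: s_def R_def)
    qed
  qed (use w0 in measurable)
  also have "\<dots> = (CLINT x|M. complex_of_real (dens x)) * complex_of_real (exp (- (p\<^sup>2 + q\<^sup>2) / 2))"
  proof -
    have "(CLINT x|M. indicator (space M) x * complex_of_real (dens x)) = (CLINT x|M. complex_of_real (dens x))"
      by (rule Bochner_Integration.integral_cong) auto
    thus ?thesis unfolding char n by simp
  qed
  also have "\<dots> = complex_of_real (exp (- (p\<^sup>2 + q\<^sup>2) / 2))" using dens_integral(2) by simp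
  finally show "(CLINT x|M. dens x * iexp (p * (U1 x / sqrt T) + q * ((U2 x / v - \<rho> * \<kappa> * (U1 x / sqrt T)) / w)))
    = complex_of_real (exp (- (p\<^sup>2 + q\<^sup>2) / 2))" .
qed

end

section \<open>Densities of affine images and conditional expectations\<close>

text \<open>
  Linear change of variables, one coordinate at a time. The identity \<open>split\<close> factorises the
  bivariate density in the decorrelated coordinates.
\<close>

lemma distr_affine_normal_pair:
  fixes X Y :: "'a => real"
  assumes H: "T > 0" and r: "\<bar>\<rho> * kappa_const H\<bar> < 1"
    and m: "X \<in> borel_measurable N" "Y \<in> borel_measurable N"
    and law: "distr N (borel \<Otimes>\<^sub>M borel) (\<lambda>om. ((X om - x0) / sqrt T,
        ((Y om - y0) / T powr H - \<rho> * kappa_const H * ((X om - x0) / sqrt T)) / sqrt (1 - (\<rho> * kappa_const H)\<^sup>2)))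
      = std_normal_distribution \<Otimes>\<^sub>M std_normal_distribution"
  shows "distr N lborel (\<lambda>om. (X om, Y om)) = density lborel (\<lambda>z. ennreal (phi_density H \<rho> T (fst z - x0) (snd z - y0)))"
proof (rule measure_eqI)
  note [measurable] = m
  interpret std: prob_space std_normal_distribution using real_dist_normal_dist unfolding real_distribution_def by auto
  define R where "R = \<rho> * kappa_const H"
  define w where "w = sqrt (1 - R\<^sup>2)"
  define s where "s = sqrt T"
  define v where "v = T powr H"
  have "R\<^sup>2 < 1" using r unfolding R_def by (simp add: abs_square_less_1)
  hence w: "w > 0" "w\<^sup>2 = 1 - R\<^sup>2" by (auto simp: w_def)
  have s: "s > 0" and v: "v > 0" using H by (auto simp: s_def v_def)
  have sv: "T powr (H + 1/2) = s * v" using H by (simp add: s_def v_def powr_add powr_half_sqrt)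
  let ?\<phi> = "\<lambda>x y. phi_density H \<rho> T (x - x0) (y - y0)"
  have \<phi>m [measurable]: "(\<lambda>z. phi_density H \<rho> T (fst z - x0) (snd z - y0)) \<in> borel_measurable (lborel \<Otimes>\<^sub>M lborel)"
    "(\<lambda>z. phi_density H \<rho> T (fst z - x0) (snd z - y0)) \<in> borel_measurable borel"
    unfolding phi_density_def borel_prod[symmetric] by measurable
  have split: "s * (w * v) * ?\<phi> (x0 + s * a) (y0 + v * R * a + (v * w) * b) = std_normal_density a * std_normal_density b" for a b
  proof -
    have e: "\<rho>\<^sup>2 * (kappa_const H)\<^sup>2 = R\<^sup>2" "2 * \<rho> * kappa_const H = 2 * R" by (simp_all add: R_def power_mult_distrib)
    have q: "(v * R * a + v * w * b) / v = R * a + w * b" using v by (simp add: field_simps)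
    have sq: "a\<^sup>2 - 2 * R * a * (R * a + w * b) + (R * a + w * b)\<^sup>2 = w\<^sup>2 * (a\<^sup>2 + b\<^sup>2)"
    proof -
      have "a\<^sup>2 - 2 * R * a * (R * a + w * b) + (R * a + w * b)\<^sup>2 = (1 - R\<^sup>2) * a\<^sup>2 + w\<^sup>2 * b\<^sup>2"
        by (simp add: power2_eq_square algebra_simps)
      thus ?thesis by (simp add: w(2) algebra_simps)
    qed
    have "?\<phi> (x0 + s * a) (y0 + v * R * a + (v * w) * b) = 1 / (2 * pi * (s * v) * w) * exp (- 1 / (2 * w\<^sup>2) * (w\<^sup>2 * (a\<^sup>2 + b\<^sup>2)))"
    proof -
      have "(x0 + s * a - x0) / s = a" "(y0 + v * R * a + (v * w) * b - y0) / v = R * a + w * b" using s q by simp_all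
      thus ?thesis unfolding phi_density_def e sv s_def[symmetric] v_def[symmetric] w_def[symmetric] w(2)[symmetric] sq[symmetric] using w(1) by simp
    qed
    also have "- 1 / (2 * w\<^sup>2) * (w\<^sup>2 * (a\<^sup>2 + b\<^sup>2)) = - a\<^sup>2 / 2 + - b\<^sup>2 / 2" using w(1) by (simp add: field_simps)
    finally have "s * (w * v) * ?\<phi> (x0 + s * a) (y0 + v * R * a + (v * w) * b) = 1 / (2 * pi) * (exp (- a\<^sup>2 / 2) * exp (- b\<^sup>2 / 2))"
      unfolding exp_add using s v w(1) by simp
    moreover have "(1 / l * e) * (1 / l * f) = 1 / (l * l) * (e * f)" for l e f :: real by simp
    ultimately show ?thesis unfolding std_normal_density_def by simp
  qed
  fix A assume "A \<in> sets (distr N lborel (\<lambda>om. (X om, Y om)))"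
  hence A: "A \<in> sets borel" by simp
  have A2 [measurable]: "A \<in> sets (borel \<Otimes>\<^sub>M borel)" unfolding borel_prod by (rule A)
  let ?\<Psi> = "\<lambda>z. (x0 + s * fst z, y0 + v * R * fst z + (v * w) * snd z)"
  have \<Psi>m [measurable]: "?\<Psi> \<in> borel \<Otimes>\<^sub>M borel \<rightarrow>\<^sub>M borel \<Otimes>\<^sub>M borel" by measurable
  let ?V = "\<lambda>om. ((X om - x0) / s, ((Y om - y0) / v - R * ((X om - x0) / s)) / w)"
  have Vm [measurable]: "?V \<in> N \<rightarrow>\<^sub>M borel \<Otimes>\<^sub>M borel" using s v w by measurable
  have inv: "?\<Psi> (?V om) = (X om, Y om)" for om using s v w(1) by (simp add: field_simps)
  have "emeasure (distr N lborel (\<lambda>om. (X om, Y om))) A = (\<integral>\<^sup>+z. indicator A z \<partial>distr N (borel \<Otimes>\<^sub>M borel) (\<lambda>om. (X om, Y om)))"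
    using A A2 by (simp add: emeasure_distr borel_prod[symmetric])
  also have "\<dots> = (\<integral>\<^sup>+om. indicator A (?\<Psi> (?V om)) \<partial>N)"
    unfolding inv using A2 by (intro nn_integral_distr) measurable
  also have "\<dots> = (\<integral>\<^sup>+z. indicator A (?\<Psi> z) \<partial>distr N (borel \<Otimes>\<^sub>M borel) ?V)"
    using A2 by (intro nn_integral_distr[symmetric]) measurable
  also have "\<dots> = (\<integral>\<^sup>+z. indicator A (?\<Psi> z) \<partial>(std_normal_distribution \<Otimes>\<^sub>M std_normal_distribution))"
    using law unfolding s_def v_def w_def R_def by simp
  also have "\<dots> = (\<integral>\<^sup>+a. \<integral>\<^sup>+b. indicator A (?\<Psi> (a, b)) \<partial>std_normal_distribution \<partial>std_normal_distribution)"
    using A2 by (intro std.nn_integral_fst[symmetric]) measurable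
  also have "\<dots> = (\<integral>\<^sup>+a. ennreal (std_normal_density a) * (\<integral>\<^sup>+b. ennreal (std_normal_density b) * indicator A (?\<Psi> (a, b)) \<partial>lborel) \<partial>lborel)"
    using A2 by (simp add: nn_integral_density)
  also have "\<dots> = (\<integral>\<^sup>+a. ennreal s * (ennreal (v * w) * (\<integral>\<^sup>+b. ennreal (?\<phi> (x0 + s * a) (y0 + v * R * a + (v * w) * b)) * indicator A (x0 + s * a, y0 + v * R * a + (v * w) * b) \<partial>lborel)) \<partial>lborel)"
  proof (intro nn_integral_cong)
    fix a
    have "ennreal (std_normal_density a) * (\<integral>\<^sup>+b. ennreal (std_normal_density b) * indicator A (?\<Psi> (a, b)) \<partial>lborel)
      = (\<integral>\<^sup>+b. ennreal (std_normal_density a) * (ennreal (std_normal_density b) * indicator A (?\<Psi> (a, b))) \<partial>lborel)"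
      using A2 by (intro nn_integral_cmult[symmetric]) measurable
    also have "\<dots> = (\<integral>\<^sup>+b. (ennreal s * ennreal (v * w)) * (ennreal (?\<phi> (x0 + s * a) (y0 + v * R * a + (v * w) * b)) * indicator A (x0 + s * a, y0 + v * R * a + (v * w) * b)) \<partial>lborel)"
    proof (intro nn_integral_cong)
      fix b
      have "ennreal (std_normal_density a) * ennreal (std_normal_density b) = ennreal (s * (v * w) * ?\<phi> (x0 + s * a) (y0 + v * R * a + (v * w) * b))"
        using split[of a b] by (simp add: ennreal_mult'[symmetric] mult.commute[of v w])
      also have "\<dots> = (ennreal s * ennreal (v * w)) * ennreal (?\<phi> (x0 + s * a) (y0 + v * R * a + (v * w) * b))"
        using s v w by (simp add: ennreal_mult')
      finally have key: "ennreal (std_normal_density a) * ennreal (std_normal_density b) = (ennreal s * ennreal (v * w)) * ennreal (?\<phi> (x0 + s * a) (y0 + v * R * a + (v * w) * b))" .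
      show "ennreal (std_normal_density a) * (ennreal (std_normal_density b) * indicator A (?\<Psi> (a, b))) =
        (ennreal s * ennreal (v * w)) * (ennreal (?\<phi> (x0 + s * a) (y0 + v * R * a + (v * w) * b)) * indicator A (x0 + s * a, y0 + v * R * a + (v * w) * b))"
        unfolding mult.assoc[symmetric] fst_conv snd_conv key[unfolded mult.assoc[symmetric]] ..
    qed
    also have "\<dots> = (ennreal s * ennreal (v * w)) * (\<integral>\<^sup>+b. ennreal (?\<phi> (x0 + s * a) (y0 + v * R * a + (v * w) * b)) * indicator A (x0 + s * a, y0 + v * R * a + (v * w) * b) \<partial>lborel)"
      using A2 by (intro nn_integral_cmult) (unfold phi_density_def, measurable)
    finally show "ennreal (std_normal_density a) * (\<integral>\<^sup>+b. ennreal (std_normal_density b) * indicator A (?\<Psi> (a, b)) \<partial>lborel)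
      = ennreal s * (ennreal (v * w) * (\<integral>\<^sup>+b. ennreal (?\<phi> (x0 + s * a) (y0 + v * R * a + (v * w) * b)) * indicator A (x0 + s * a, y0 + v * R * a + (v * w) * b) \<partial>lborel))"
      by (simp only: mult.assoc)
  qed
  also have "\<dots> = (\<integral>\<^sup>+a. ennreal s * (\<integral>\<^sup>+y. ennreal (?\<phi> (x0 + s * a) y) * indicator A (x0 + s * a, y) \<partial>lborel) \<partial>lborel)"
  proof (intro nn_integral_cong arg_cong[where f="\<lambda>x. ennreal s * x"])
    fix a
    have fm: "(\<lambda>y. ennreal (?\<phi> (x0 + s * a) y) * indicator A (x0 + s * a, y)) \<in> borel_measurable borel"
      using A2 unfolding phi_density_def by measurable
    have "v * w \<noteq> 0" "\<bar>v * w\<bar> = v * w" using v w by auto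
    with nn_integral_real_affine[OF fm, of "v * w" "y0 + v * R * a"]
    show "ennreal (v * w) * (\<integral>\<^sup>+b. ennreal (?\<phi> (x0 + s * a) (y0 + v * R * a + (v * w) * b)) * indicator A (x0 + s * a, y0 + v * R * a + (v * w) * b) \<partial>lborel)
      = (\<integral>\<^sup>+y. ennreal (?\<phi> (x0 + s * a) y) * indicator A (x0 + s * a, y) \<partial>lborel)" by simp
  qed
  also have "\<dots> = (\<integral>\<^sup>+x. \<integral>\<^sup>+y. ennreal (?\<phi> x y) * indicator A (x, y) \<partial>lborel \<partial>lborel)"
  proof -
    have fm: "(\<lambda>x. \<integral>\<^sup>+y. ennreal (?\<phi> x y) * indicator A (x, y) \<partial>lborel) \<in> borel_measurable borel"
      using A2 unfolding phi_density_def by measurable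
    have fm': "(\<lambda>a. \<integral>\<^sup>+y. ennreal (?\<phi> (x0 + s * a) y) * indicator A (x0 + s * a, y) \<partial>lborel) \<in> borel_measurable lborel"
      using A2 unfolding phi_density_def by measurable
    have "s \<noteq> 0" "\<bar>s\<bar> = s" using s by auto
    with nn_integral_real_affine[OF fm, of s x0] show ?thesis unfolding nn_integral_cmult[OF fm'] by simp
  qed
  also have "\<dots> = (\<integral>\<^sup>+z. ennreal (phi_density H \<rho> T (fst z - x0) (snd z - y0)) * indicator A z \<partial>(lborel \<Otimes>\<^sub>M lborel))"
  proof -
    have [measurable]: "A \<in> sets (lborel \<Otimes>\<^sub>M lborel)"
      using A2 sets_pair_measure_cong[OF sets_lborel sets_lborel] by simp
    have fm: "(\<lambda>z. ennreal (phi_density H \<rho> T (fst z - x0) (snd z - y0)) * indicator A z) \<in> borel_measurable (lborel \<Otimes>\<^sub>M lborel)"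
      by measurable
    show ?thesis using lborel.nn_integral_fst[OF fm] by simp
  qed
  also have "\<dots> = emeasure (density lborel (\<lambda>z. ennreal (phi_density H \<rho> T (fst z - x0) (snd z - y0)))) A"
    using A by (simp add: emeasure_density lborel_prod)
  finally show "emeasure (distr N lborel (\<lambda>om. (X om, Y om))) A = emeasure (density lborel (\<lambda>z. ennreal (phi_density H \<rho> T (fst z - x0) (snd z - y0)))) A" .
qed simp

text \<open>
  The Radon-Nikodym derivative \<open>D\<close> of the law of \<open>V\<close> under \<open>M\<close> with respect to its law under \<open>Q\<close>
  satisfies the defining property of \<open>E\<^sub>Q[Z | V]\<close> after composition with \<open>V\<close>. Positivity of \<open>\<phi>\<close> turns
  null sets of the law of \<open>V\<close> into Lebesgue null sets, so that any version of the conditional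
  expectation may be inserted.
\<close>

lemma density_given_terminal_value:
  fixes V :: "'a => 'b::euclidean_space" and \<phi> :: "'b => real"
  assumes M: "prob_space M" and Q: "prob_space Q" and sets: "sets Q = sets M"
    and V: "V \<in> borel_measurable M" and Z: "integrable Q Z" and Z0: "AE om in Q. 0 <= Z om"
    and MZ: "\<And>A. A \<in> sets M ==> measure M A = (LINT om|Q. Z om * indicator A om)"
    and \<phi>: "\<phi> \<in> borel_measurable borel" "\<And>z. \<phi> z > 0" and law: "distr Q lborel V = density lborel (\<lambda>z. ennreal (\<phi> z))"
  shows "\<exists>p. (\<forall>z. 0 <= p z) \<and> distributed M lborel V (\<lambda>z. ennreal (p z)) \<and>
    (AE z in lborel. p z = \<phi> z * cond_exp_given Q borel V Z z)"
proof -
  interpret M: prob_space M by (rule M)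
  interpret Q: prob_space Q by (rule Q)
  have sp: "space Q = space M" by (rule sets_eq_imp_space_eq[OF sets])
  have VQ: "V \<in> borel_measurable Q" using V measurable_cong_sets[OF sets refl, of "borel :: 'b measure"] by simp
  have VQl: "V \<in> Q \<rightarrow>\<^sub>M lborel" and VMl: "V \<in> M \<rightarrow>\<^sub>M lborel" using V VQ by simp_all
  define \<nu> where "\<nu> = distr Q lborel V"
  define \<mu> where "\<mu> = distr M lborel V"
  interpret \<nu>: prob_space \<nu> unfolding \<nu>_def by (rule Q.prob_space_distr[OF VQl])
  interpret \<mu>: prob_space \<mu> unfolding \<mu>_def by (rule M.prob_space_distr[OF VMl])
  have s\<nu> [simp, measurable_cong]: "sets \<nu> = sets borel" and s\<mu> [simp, measurable_cong]: "sets \<mu> = sets borel" by (simp_all add: \<nu>_def \<mu>_def)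
  have ac: "absolutely_continuous \<nu> \<mu>" unfolding absolutely_continuous_def
  proof
    fix C assume "C \<in> null_sets \<nu>"
    hence C: "C \<in> sets borel" "emeasure Q (V -` C \<inter> space Q) = 0"
      using VQl by (auto simp: null_sets_def \<nu>_def emeasure_distr)
    have VC: "V -` C \<inter> space M \<in> sets M" by (rule measurable_sets[OF V C(1)])
    have "AE om in Q. om \<notin> V -` C \<inter> space M"
      by (rule AE_not_in) (use C VC in \<open>auto simp: null_sets_def sets sp\<close>)
    hence "measure M (V -` C \<inter> space M) = 0" unfolding MZ[OF VC]
      by (intro integral_eq_zero_AE) (auto elim!: eventually_mono)
    hence "emeasure \<mu> C = 0" using C(1) VMl by (simp add: \<mu>_def emeasure_distr M.emeasure_eq_measure)
    thus "C \<in> null_sets \<mu>" using C(1) by (simp add: null_sets_def)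
  qed
  obtain D where D: "D \<in> borel_measurable \<nu>" "AE z in \<nu>. RN_deriv \<nu> \<mu> z = ennreal (D z)" "\<And>z. 0 <= D z"
    by (rule \<nu>.real_RN_deriv[OF \<mu>.finite_measure_axioms ac]) (auto intro: that)
  have [measurable]: "D \<in> borel_measurable borel" using D(1) by simp
  have \<mu>D: "\<mu> = density \<nu> (\<lambda>z. ennreal (D z))"
  proof -
    have "\<mu> = density \<nu> (RN_deriv \<nu> \<mu>)" using \<nu>.density_RN_deriv[OF ac] by simp
    also have "\<dots> = density \<nu> (\<lambda>z. ennreal (D z))" by (rule density_cong) (use D in auto)
    finally show ?thesis .
  qed
  have Di: "integrable \<nu> D"
  proof (rule integrableI_nonneg)
    have "(\<integral>\<^sup>+z. ennreal (D z) \<partial>\<nu>) = emeasure \<mu> (space \<mu>)"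
      unfolding \<mu>D by (subst emeasure_density) (auto intro!: nn_integral_cong simp: \<nu>_def)
    thus "(\<integral>\<^sup>+z. ennreal (D z) \<partial>\<nu>) < \<infinity>" using \<mu>.emeasure_space_1 by simp
  qed (use D in auto)
  let ?G = "vimage_algebra (space Q) V borel"
  have sG: "sets ?G = {V -` C \<inter> space Q | C. C \<in> sets borel}" by (subst sets_vimage_algebra2) auto
  have sub: "subalgebra Q ?G" unfolding subalgebra_def sG using measurable_sets[OF VQ] by auto
  interpret G: finite_measure_subalgebra Q ?G by unfold_locales (rule sub)
  have VG: "V \<in> ?G \<rightarrow>\<^sub>M borel" by (rule measurable_vimage_algebra1) auto
  have DV: "AE om in Q. real_cond_exp Q ?G Z om = D (V om)"
  proof (rule G.real_cond_exp_charact)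
    show "integrable Q (\<lambda>om. D (V om))" using Di VQl unfolding \<nu>_def by (subst (asm) integrable_distr_eq) auto
    show "(\<lambda>om. D (V om)) \<in> borel_measurable ?G" by (rule measurable_compose[OF VG]) simp
    fix A assume "A \<in> sets ?G"
    then obtain C where C: "C \<in> sets borel" "A = V -` C \<inter> space Q" unfolding sG by auto
    have AM: "A \<in> sets M" using measurable_sets[OF V C(1)] C(2) sp by simp
    have "(LINT om:A|Q. Z om) = measure M A" unfolding MZ[OF AM] set_lebesgue_integral_def by (simp add: mult.commute)
    also have "\<dots> = measure \<mu> C" using C VMl by (simp add: \<mu>_def measure_distr sp)
    also have "\<dots> = (LINT z|\<nu>. D z * indicator C z)" unfolding \<mu>D by (rule measure_density_real[OF Di D(3)]) (simp add: C)
    also have "\<dots> = (LINT om|Q. D (V om) * indicator C (V om))" unfolding \<nu>_def using VQl C(1) by (intro integral_distr) auto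
    also have "\<dots> = (LINT om:A|Q. D (V om))" unfolding set_lebesgue_integral_def C(2) by (auto intro!: Bochner_Integration.integral_cong simp: indicator_def)
    finally show "(LINT om:A|Q. Z om) = (LINT om:A|Q. D (V om))" .
  qed (rule Z)
  let ?E = "cond_exp_given Q borel V Z"
  have E: "?E \<in> borel_measurable borel \<and> (AE om in Q. real_cond_exp Q ?G Z om = ?E (V om))"
    unfolding cond_exp_given_def by (rule someI[of _ D]) (use DV in auto)
  hence [measurable]: "?E \<in> borel_measurable borel" by simp
  from E DV have "AE om in Q. D (V om) = ?E (V om)" by (auto elim: eventually_elim2)
  hence "AE z in \<nu>. D z = ?E z" unfolding \<nu>_def using VQl by (subst AE_distr_iff) auto
  hence "AE z in density lborel (\<lambda>z. ennreal (\<phi> z)). D z = ?E z" unfolding \<nu>_def law .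
  hence AEl: "AE z in lborel. D z = ?E z" using \<phi> by (subst (asm) AE_density) auto
  have "distr M lborel V = density lborel (\<lambda>z. ennreal (\<phi> z * D z))"
  proof -
    have "distr M lborel V = density (density lborel (\<lambda>z. ennreal (\<phi> z))) (\<lambda>z. ennreal (D z))"
      using \<mu>D unfolding \<mu>_def \<nu>_def law .
    also have "\<dots> = density lborel (\<lambda>z. ennreal (\<phi> z) * ennreal (D z))" using \<phi> by (intro density_density_eq) auto
    finally show ?thesis using \<phi>(2) by (simp add: ennreal_mult' less_imp_le)
  qed
  hence "distributed M lborel V (\<lambda>z. ennreal (\<phi> z * D z))" using VMl \<phi>(1) by (simp add: distributed_def)
  moreover have "AE z in lborel. \<phi> z * D z = \<phi> z * ?E z" using AEl by eventually_elim simp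
  moreover have "0 <= \<phi> z * D z" for z using \<phi>(2)[of z] D(3)[of z] by simp
  ultimately show ?thesis by (intro exI[of _ "\<lambda>z. \<phi> z * D z"]) auto
qed

section \<open>The representation of the joint density\<close>

lemma drift_along_path_measurable:
  fixes h :: "real => real => real => real"
  assumes h: "(\<lambda>(t, x, y). h t x y) \<in> borel_measurable (restrict_space borel ({0..T} \<times> UNIV))"
    and x: "continuous_on {0..T} x" and y: "continuous_on {0..T} y"
  shows "(\<lambda>s. indicator {0..T} s *\<^sub>R h s (x s) (y s)) \<in> borel_measurable borel"
proof -
  let ?R = "restrict_space (borel :: real measure) {0..T}"
  have p: "(\<lambda>s. (s, x s, y s)) \<in> ?R \<rightarrow>\<^sub>M restrict_space borel ({0..T} \<times> UNIV)"
  proof (rule measurable_restrict_space2)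
    show "(\<lambda>s. (s, x s, y s)) \<in> space ?R \<rightarrow> {0..T} \<times> UNIV" by (auto simp: space_restrict_space)
    show "(\<lambda>s. (s, x s, y s)) \<in> borel_measurable ?R"
      by (intro borel_measurable_Pair measurable_restrict_space1[OF measurable_ident_sets] borel_measurable_continuous_on_restrict x y) simp
  qed
  have "(\<lambda>s. h s (x s) (y s)) \<in> borel_measurable ?R" using measurable_compose[OF p h] by simp
  thus ?thesis by (subst (asm) borel_measurable_restrict_space_iff) auto
qed

lemma set_integral_linear_AE:
  assumes e: "AE s in lborel. s \<in> {0..T} \<longrightarrow> c * b s + d * a s = h s"
    and h: "(\<lambda>s. indicator {0..T} s *\<^sub>R h s) \<in> borel_measurable borel"
    and ab: "sq_int T a" "sq_int T b" and t: "t <= T"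
  shows "(LBINT s:{0..t}. (h s :: real)) = c * (LBINT s:{0..t}. b s) + d * (LBINT s:{0..t}. a s)"
proof -
  have sub: "{0..t} \<subseteq> {0..T}" using t by auto
  have i: "set_integrable lborel {0..t} (\<lambda>s. c * b s)" "set_integrable lborel {0..t} (\<lambda>s. d * a s)"
    by (rule set_integrable_subset[OF sq_int_integrable[OF sq_int_cmult[OF ab(2)]] _ sub], simp)
      (rule set_integrable_subset[OF sq_int_integrable[OF sq_int_cmult[OF ab(1)]] _ sub], simp)
  have "(LBINT s:{0..t}. h s) = (LBINT s:{0..t}. c * b s + d * a s)"
    unfolding set_lebesgue_integral_def
  proof (rule integral_cong_AE)
    have "(\<lambda>s. indicator {0..t} s *\<^sub>R h s) = (\<lambda>s. indicator {0..t} s * (indicator {0..T} s *\<^sub>R h s))"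
      using sub by (auto simp: indicator_def fun_eq_iff)
    thus "(\<lambda>s. indicator {0..t} s *\<^sub>R h s) \<in> borel_measurable lborel" using h by simp
    show "(\<lambda>s. indicator {0..t} s *\<^sub>R (c * b s + d * a s)) \<in> borel_measurable lborel"
      using set_integral_add(1)[OF i] by (simp add: set_integrable_def)
    show "AE s in lborel. indicator {0..t} s *\<^sub>R h s = indicator {0..t} s *\<^sub>R (c * b s + d * a s)"
      using e by eventually_elim (use sub in \<open>auto simp: indicator_def\<close>)
  qed
  also have "\<dots> = c * (LBINT s:{0..t}. b s) + d * (LBINT s:{0..t}. a s)"
    unfolding set_integral_add(2)[OF i] by simp
  finally show ?thesis .
qed

lemma K_kernel_sq_int:
  assumes "0 < H" "H < 1" "0 <= u" shows "sq_int u (K_kernel H u)"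
proof (cases "u = 0")
  case True
  have "K_kernel H 0 = (\<lambda>_. 0)" by (auto simp: K_kernel_def)
  thus ?thesis using True by simp
next
  case False
  thus ?thesis using assms by (intro K_kernel_integrals(1)) auto
qed

theorem theorem2p2:
  fixes M :: "'a measure" and F :: "real \<Rightarrow> 'a measure"
    and H \<rho> T x0 y0 :: real
    and h1 h2 :: "real \<Rightarrow> real \<Rightarrow> real \<Rightarrow> real"
    and B W BH X Y ht1 ht2 Wt Bt :: "real \<Rightarrow> 'a \<Rightarrow> real"
    and Pt :: "'a measure" and V :: "'a \<Rightarrow> real \<times> real" and Z :: "'a \<Rightarrow> real"
  assumes "0 < H" "H < 1" and "- 1 < \<rho>" "\<rho> < 1" and "0 < T" "T < 1"
    and "prob_space M" and "complete_measure M" and "usual_filtration M F T"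
    and "brownian_motion M F T B" and "brownian_motion M F T W"
    and "independent_processes M T B W"
    and "fbm_generated_by M F H T B BH"
    and "drift_assumption H T h1 h2"
    and "unique_sde_solution M F T \<rho> x0 y0 h1 h2 B W BH X Y"
    and "tilde_drifts M F H T \<rho> h1 h2 X Y ht1 ht2"
    and "novikov M T ht1 ht2"
  defines "Pt \<equiv> tilde_measure M F T B W ht1 ht2"
    and "Wt \<equiv> drift_shift W ht1" and "Bt \<equiv> drift_shift B ht2"
    and "V \<equiv> \<lambda>\<omega>. (X T \<omega>, Y T \<omega>)"
    and "Z \<equiv> \<lambda>\<omega>. exp
          (ito_integral Pt F Wt T ht1 \<omega> - 1/2 * (LBINT t:{0..T}. (ht1 t \<omega>)\<^sup>2)
           + ito_integral Pt F Bt T ht2 \<omega> - 1/2 * (LBINT t:{0..T}. (ht2 t \<omega>)\<^sup>2))"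
  shows "(\<exists>p. (\<forall>z. 0 \<le> p z) \<and> distributed M lborel V (\<lambda>z. ennreal (p z)) \<and>
            (AE (x, y) in lborel.
               p (x, y) = phi_density H \<rho> T (x - x0) (y - y0) * cond_exp_given Pt borel V Z (x, y)))
         \<and> prob_space Pt
         \<and> brownian_motion Pt F T (\<lambda>t \<omega>. X t \<omega> - x0)
         \<and> fractional_brownian_motion Pt F H T (\<lambda>t \<omega>. Y t \<omega> - y0)"
proof -
  note H = \<open>0 < H\<close> \<open>H < 1\<close> and T = \<open>0 < T\<close>
  note sys = \<open>unique_sde_solution M F T \<rho> x0 y0 h1 h2 B W BH X Y\<close>[unfolded unique_sde_solution_def sde_solution_def, THEN conjunct1]
  note sol = sys[THEN conjunct1] sys[THEN conjunct2, THEN conjunct1] sys[THEN conjunct2, THEN conjunct2, THEN conjunct1]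
    sys[THEN conjunct2, THEN conjunct2, THEN conjunct2, THEN conjunct1]
  note sde = sys[THEN conjunct2, THEN conjunct2, THEN conjunct2, THEN conjunct2]
  note tilde = \<open>tilde_drifts M F H T \<rho> h1 h2 X Y ht1 ht2\<close>[unfolded tilde_drifts_def]
  note L2 = tilde[THEN conjunct1] tilde[THEN conjunct2, THEN conjunct1]
  note tilde2 = tilde[THEN conjunct2, THEN conjunct2, THEN conjunct1] and tilde1 = tilde[THEN conjunct2, THEN conjunct2, THEN conjunct2]
  have h1: "(\<lambda>(t, x, y). h1 t x y) \<in> borel_measurable (restrict_space borel ({0..T} \<times> UNIV))"
    by (rule bspec[OF \<open>drift_assumption H T h1 h2\<close>[unfolded drift_assumption_def, THEN conjunct1]]) simp
  have BH: "AE om in M. BH u om = ito_integral M F B u (\<lambda>s _. K_kernel H u s) om" if "u \<in> {0..T}" for u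
    by (rule bspec[OF \<open>fbm_generated_by M F H T B BH\<close>[unfolded fbm_generated_by_def, THEN conjunct2] that])
  note uf = \<open>usual_filtration M F T\<close>[unfolded usual_filtration_def]
  have fs: "filtered_space M F T"
  proof (intro filtered_space.intro[OF \<open>prob_space M\<close>] filtered_space_axioms.intro)
    show "subalgebra M (F t)" if "t \<in> {0..T}" for t by (rule bspec[OF uf[THEN conjunct1] that])
    show "sets (F s) \<subseteq> sets (F t)" if "0 <= s" "s <= t" "t <= T" for s t
      by (rule uf[THEN conjunct2, THEN conjunct1, rule_format]) (simp add: that)
  qed
  have bm: "bm_pair M F T W B" by (intro bm_pair.intro[OF fs] bm_pair_axioms.intro) fact+
  interpret G: girsanov M F T W B ht1 ht2
    by (intro girsanov.intro[OF bm] girsanov_axioms.intro T L2) (use \<open>novikov M T ht1 ht2\<close> in \<open>simp add: novikov_def\<close>)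
  have Pt: "Pt = G.Q" by (simp add: Pt_def tilde_measure_def G.Q_def G.dens_def)
  have Bm: "B t \<in> borel_measurable M" and Wm: "W t \<in> borel_measurable M" if "t \<in> {0..T}" for t
    using that G.bm_measurable(2)[OF G.bB, of t T] G.bm_measurable(2)[OF G.bW, of t T] by auto
  have Xm: "X T \<in> borel_measurable M" and Ym: "Y T \<in> borel_measurable M"
    using sol(1,2) T G.F_measurable_M[of "X T" T] G.F_measurable_M[of "Y T" T] by (auto simp: adapted_def)
  have \<rho>: "\<bar>\<rho>\<bar> < 1" using \<open>- 1 < \<rho>\<close> \<open>\<rho> < 1\<close> by simp
  have \<rho>2: "(sqrt (1 - \<rho>\<^sup>2))\<^sup>2 + \<rho>\<^sup>2 = 1" using \<rho> abs_square_le_1[of \<rho>] by simp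
  have r: "\<bar>\<rho> * kappa_const H\<bar> < 1"
  proof -
    have "\<bar>\<rho> * kappa_const H\<bar> <= \<bar>\<rho>\<bar> * 1" unfolding abs_mult using kappa_const_bounds[OF H] by (intro mult_left_mono) auto
    thus ?thesis using \<rho> by simp
  qed
  have X: "AE om in M. \<forall>t\<in>{0..T}. X t om - x0 = sqrt (1 - \<rho>\<^sup>2) * drift_shift W ht1 t om + \<rho> * drift_shift B ht2 t om"
    using sde tilde1 G.sq_int_fg sol(3,4)[unfolded continuous_paths_def]
  proof eventually_elim
    case (elim om)
    show ?case
    proof
      fix t assume t: "t \<in> {0..T}"
      hence "(LBINT s:{0..t}. h1 s (X s om) (Y s om)) = \<rho> * (LBINT s:{0..t}. ht2 s om) + sqrt (1 - \<rho>\<^sup>2) * (LBINT s:{0..t}. ht1 s om)"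
        by (intro set_integral_linear_AE[OF elim(2) drift_along_path_measurable[OF h1 elim(5,6)] elim(3,4)]) auto
      thus "X t om - x0 = sqrt (1 - \<rho>\<^sup>2) * drift_shift W ht1 t om + \<rho> * drift_shift B ht2 t om"
        using elim(1) t by (simp add: drift_shift_def algebra_simps)
    qed
  qed
  have bmX: "brownian_motion Pt F T (\<lambda>t om. X t om - x0)"
    unfolding Pt
  proof (rule G.brownian_motion_Q[OF \<rho>2 _ _ X])
    show "adapted F T (\<lambda>t om. X t om - x0)" using sol(1) by (auto simp: adapted_def)
    show "continuous_paths M T (\<lambda>t om. X t om - x0)"
      using sol(3) unfolding continuous_paths_def by eventually_elim (intro continuous_intros)
  qed
  have Y: "AE om in M. Y u om - y0 = ito_integral M F B u (\<lambda>s _. K_kernel H u s) om + (LBINT s:{0..u}. K_kernel H u s * ht2 s om)" if u: "u \<in> {0..T}" for u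
    using sde tilde2 BH[OF u] by eventually_elim (use u in auto)
  have fbmY: "fractional_brownian_motion Pt F H T (\<lambda>t om. Y t om - y0)"
    unfolding Pt fractional_brownian_motion_def
  proof (intro exI[of _ "drift_shift B ht2"] conjI)
    show "brownian_motion G.Q F T (drift_shift B ht2)" by (rule G.brownian_motion_shifted_B)
    show "fbm_generated_by G.Q F H T (drift_shift B ht2) (\<lambda>t om. Y t om - y0)"
      unfolding fbm_generated_by_def
    proof (intro conjI ballI)
      show "continuous_paths G.Q T (\<lambda>t om. Y t om - y0)"
        using sol(4) unfolding continuous_paths_def G.AE_Q by eventually_elim (intro continuous_intros)
      fix u assume u: "u \<in> {0..T}"
      hence u': "0 <= u" "u <= T" by auto
      have a: "L2_process M F u (\<lambda>s _. K_kernel H u s)"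
        by (rule filtered_space.deterministic_L2_process[OF G.filtered_space_restrict[OF u'(2)] K_kernel_measurable K_kernel_sq_int[OF H u'(1)]])
      have shift: "AE om in M. ito_integral G.Q F (drift_shift B ht2) u (\<lambda>s _. K_kernel H u s) om =
          ito_integral M F B u (\<lambda>s _. K_kernel H u s) om + (LBINT s:{0..u}. K_kernel H u s * ht2 s om)"
        by (rule G.ito_integral_shift(1)[OF G.swap.bm_pair_restrict[OF u'] L2(2) a u' Bm])
      show "AE om in G.Q. Y u om - y0 = ito_integral G.Q F (drift_shift B ht2) u (\<lambda>s _. K_kernel H u s) om"
        unfolding G.AE_Q using Y[OF u] shift by eventually_elim simp
    qed
  qed
  have TT: "T \<in> {0..T}" using T by simp
  have "distr G.Q (borel \<Otimes>\<^sub>M borel) (\<lambda>om. ((X T om - x0) / sqrt T,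
        ((Y T om - y0) / T powr H - \<rho> * kappa_const H * ((X T om - x0) / sqrt T)) / sqrt (1 - (\<rho> * kappa_const H)\<^sup>2)))
      = std_normal_distribution \<Otimes>\<^sub>M std_normal_distribution"
  proof (rule G.terminal_law[OF K_kernel_measurable[of H T] K_kernel_integrals(1)[OF H T]])
    show "sq_norm T (K_kernel H T) = (T powr H)\<^sup>2" by (rule K_kernel_integrals(2)[OF H T])
    show "(LBINT t:{0..T}. K_kernel H T t) = kappa_const H * (T powr H * sqrt T)"
      using T by (simp add: K_kernel_integrals(3)[OF H T] powr_add powr_half_sqrt)
    show "AE om in M. X T om - x0 = \<rho> * drift_shift B ht2 T om + sqrt (1 - \<rho>\<^sup>2) * drift_shift W ht1 T om"
      using X by eventually_elim (use TT in auto)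
    show "AE om in M. Y T om - y0 = ito_integral M F B T (\<lambda>t _. K_kernel H T t) om + (LBINT t:{0..T}. K_kernel H T t * ht2 t om)" by (rule Y[OF TT])
  qed (use T \<rho> r Xm Ym in \<open>auto simp: K_kernel_def\<close>)
  from distr_affine_normal_pair[OF T r _ _ this]
  have law: "distr G.Q lborel V = density lborel (\<lambda>z. ennreal (phi_density H \<rho> T (fst z - x0) (snd z - y0)))"
    using Xm Ym unfolding V_def by (simp add: G.borel_Q)
  have bT: "bm_pair M F T B W" by (rule G.bm_pair_swap)
  note shW = G.ito_integral_shift[OF bm L2(1,1) less_imp_le[OF T] order_refl Wm]
  note shB = G.ito_integral_shift[OF bT L2(2,2) less_imp_le[OF T] order_refl Bm]
  have shW1: "AE om in M. ito_integral G.Q F (drift_shift W ht1) T ht1 om = ito_integral M F W T ht1 om + (LBINT s:{0..T}. ht1 s om * ht1 s om)"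
    by (rule shW(1))
  have shB1: "AE om in M. ito_integral G.Q F (drift_shift B ht2) T ht2 om = ito_integral M F B T ht2 om + (LBINT s:{0..T}. ht2 s om * ht2 s om)"
    by (rule shB(1))
  have Zdens: "AE om in G.Q. Z om = 1 / G.dens om"
    unfolding G.AE_Q using shW1 shB1
  proof eventually_elim
    case (elim om)
    have inv: "exp ((a + p) - 1/2 * p + (b + q) - 1/2 * q) = 1 / exp (- a - 1/2 * p - b - 1/2 * q)" for a b p q :: real
    proof -
      have "1 / exp (- a - 1/2 * p - b - 1/2 * q) = exp (- (- a - 1/2 * p - b - 1/2 * q))" by (simp only: exp_minus inverse_eq_divide)
      also have "- (- a - 1/2 * p - b - 1/2 * q) = (a + p) - 1/2 * p + (b + q) - 1/2 * q" by linarith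
      finally show ?thesis ..
    qed
    show ?case unfolding Z_def Pt Wt_def Bt_def elim G.dens_def power2_eq_square by (rule inv)
  qed
  have [measurable]: "Z \<in> borel_measurable G.Q"
  proof -
    have [measurable]: "ito_integral G.Q F Wt T ht1 \<in> borel_measurable M" "ito_integral G.Q F Bt T ht2 \<in> borel_measurable M"
      unfolding Wt_def Bt_def by (rule shW(2), assumption) (rule shB(2), assumption)
    have [measurable]: "(\<lambda>om. LBINT t:{0..T}. (ht1 t om)\<^sup>2) \<in> borel_measurable M" "(\<lambda>om. LBINT t:{0..T}. (ht2 t om)\<^sup>2) \<in> borel_measurable M"
      using G.sq_norm_process_measurable[OF L2(1)] G.sq_norm_process_measurable[OF L2(2)] by (simp_all add: sq_norm_def)
    show ?thesis unfolding G.borel_Q Z_def Pt by measurable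
  qed
  have [measurable]: "G.dens \<in> borel_measurable G.Q" unfolding G.borel_Q by measurable
  have Zi: "integrable G.Q Z"
    using G.integrable_inverse_dens Zdens by (subst integrable_cong_AE[OF _ _ Zdens]) auto
  have MZ: "measure M A = (LINT om|G.Q. Z om * indicator A om)" if A: "A \<in> sets M" for A
  proof -
    have "measure M A = (LINT om|G.Q. 1 / G.dens om * indicator A om)"
      using measure_density_real[OF G.integrable_inverse_dens, of A] A unfolding G.M_eq by (simp add: G.dens_nonneg)
    also have "\<dots> = (LINT om|G.Q. Z om * indicator A om)"
    proof (rule integral_cong_AE)
      show "AE om in G.Q. 1 / G.dens om * indicator A om = Z om * indicator A om" using Zdens by eventually_elim simp
    qed (use A in measurable)
    finally show ?thesis .
  qed
  have "(\<rho> * kappa_const H)\<^sup>2 < 1" using r by (simp add: abs_square_less_1)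
  hence \<phi>: "phi_density H \<rho> T a b > 0" for a b
    using T unfolding phi_density_def by (intro mult_pos_pos divide_pos_pos) (auto simp: power_mult_distrib)
  have \<phi>m: "(\<lambda>z. phi_density H \<rho> T (fst z - x0) (snd z - y0)) \<in> borel_measurable borel"
    unfolding phi_density_def borel_prod[symmetric] by measurable
  have Vm: "V \<in> borel_measurable M" unfolding V_def using Xm Ym by (intro borel_measurable_Pair)
  obtain p where p: "\<And>z. 0 <= p z" "distributed M lborel V (\<lambda>z. ennreal (p z))"
      "AE z in lborel. p z = phi_density H \<rho> T (fst z - x0) (snd z - y0) * cond_exp_given G.Q borel V Z z"
    using density_given_terminal_value[OF \<open>prob_space M\<close> G.prob_space_Q G.sets_Q Vm Zi _ MZ \<phi>m \<phi> law] by (auto simp: Z_def)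
  have "AE (x, y) in lborel. p (x, y) = phi_density H \<rho> T (x - x0) (y - y0) * cond_exp_given Pt borel V Z (x, y)"
    using p(3) unfolding Pt by eventually_elim auto
  with p(1,2) have "\<exists>p. (\<forall>z. 0 <= p z) \<and> distributed M lborel V (\<lambda>z. ennreal (p z)) \<and>
            (AE (x, y) in lborel.
               p (x, y) = phi_density H \<rho> T (x - x0) (y - y0) * cond_exp_given Pt borel V Z (x, y))" by blast
  moreover have "prob_space Pt" unfolding Pt by (rule G.prob_space_Q)
  ultimately show ?thesis using bmX fbmY by blast
qed

end
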